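(* Let $K$ be a local field of residue characteristic $p$ with residue field of cardinality $p^{f_K}$, and let $\rho_K=\rho_{e,p}$ with $e=v_K(p)$. Suppose that $\mu_p(K)=\{1\}$. Then $\mathcal{J}_K=\mathrm{Jump}_{\rho_K}$. Suppose that $\mu_p(K)\neq\{1\}$. Then $\mathcal{J}_K$ consists precisely of the elements of $\mathrm{Jump}_{\rho_K}^*$ that are $((I_K,\beta_K),f_K,p)$-compatible.
   Context: Local fields: non-archimedean, non-discrete, locally compact; $v_K$ normalized valuation ($v_K(p)=\infty$ in characteristic $p$), $\mu_p(K)=\{\alpha\in K:\alpha^p=1\}$, $U_i(K)=1+m_K^i$, $U_\bullet(K)$ the $\mathbb{Z}_p$-module $U_1(K)$ with filtration $(U_i(K))_{i\ge1}$. A character of $U_1(K)$ is a continuous homomorphism $\chi:U_1(K)\to\mathbb{Q}_p/\mathbb{Z}_p$, $J_\chi=\{i\ge1:\chi(U_i(K))\neq\chi(U_{i+1}(K))\}$, and $\mathcal{J}_K$ is the set of all $J_\chi$. (Equivalently, via local class field theory, $\mathcal{J}_K$ is the collection of sets of upper ramification jumps of cyclic totally ramified extensions of $K$ of $p$-power degree.) Shifts and jump sets: a shift is a strictly increasing $\rho:\mathbb{Z}_{\ge1}\to\mathbb{Z}_{\ge1}$ with $\rho(1)>1$; $T_\rho=\mathbb{Z}_{\ge1}\setminus\rho(\mathbb{Z}_{\ge1})$; if $T_\rho$ is finite, $e^*_\rho=\max(T_\rho)+1$ and $T_\rho^*=T_\rho\cup\{e_\rho^*\}$. $\rho_{e,p}(i)=\min\{i+e,pi\}$.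 $\mathrm{Jump}_\rho$ (resp. $\mathrm{Jump}_\rho^*$) is the set of finite $A\subseteq\mathbb{Z}_{\ge1}$ such that $a<b$ in $A$ implies $\rho(a)\le b$, and $A\setminus\rho(A)\subseteq T_\rho$ (resp. $T_\rho^*$). The assignment $A\mapsto(I_A,\beta_A)$, $I_A=A\setminus\rho(A)$, $\beta_A(i)=|[i,\infty)\cap A|$, is a bijection onto the pairs $(I,\beta)$ with $I$ a finite subset of $T_\rho$ (resp. $T_\rho^*$), $\beta:I\to\mathbb{Z}_{\ge1}$ strictly decreasing, and $i\mapsto\rho^{\beta(i)}(i)$ strictly increasing on $I$; jump sets $A$ and pairs $(I,\beta)$ are identified. Let $(a_1,b_1)\le_\rho(a_2,b_2)$ on $\mathbb{Z}_{\ge1}^2$ iff $b_2\ge b_1$ and $\rho^{b_2}(a_2)\ge\rho^{b_1}(a_1)$. Compatibility: let $\rho$ be a shift with $T_\rho$ finite, $f\ge1$, $p$ prime, $(I,\beta),(I',\beta')\in\mathrm{Jump}_\rho^*$. $(I,\beta)$ is $((I',\beta'),f,p)$-incompatible if: (1) $I\cap I'$ is non-empty, and the subset $\mathrm{Max}((I,\beta),(I',\beta'))$ of those $i\in I\cap I'$ for which $\beta(i)-\beta'(i)$ is strictly positive and takes its maximal possible value on $I\cap I'$ (denoted $c$) has precisely one element if $p>2$, and an odd number of elements if $p=2$; (2) if $f>1$ then $\mathrm{Max}((I,\beta),(I',\beta'))=\{e_\rho^*\}$; (3) given any $i\in I'\setminus I$, there is no $j\in I$ such that $(j,\beta(j))\ge_\rho(i,c+\beta'(i))$.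 $(I,\beta)$ is $((I',\beta'),f,p)$-compatible if it is not $((I',\beta'),f,p)$-incompatible. Definition of $(I_K,\beta_K)$: a filtered $\mathbb{Z}_p$-module is a sequence $M_1\supseteq M_2\supseteq\cdots$ of $\mathbb{Z}_p$-modules with $\bigcap_iM_i=\{0\}$; its weight map $w(x)=\sup\{i:x\in M_i\}$ determines the filtration; morphisms are $\mathbb{Z}_p$-linear maps with $\phi(M_i)\subseteq N_i$. Products and sums carry the termwise filtration, quotients by closed submodules the image filtration. $S_i$ is $\mathbb{Z}_p$ with weight $w(x)=\rho^{\mathrm{ord}_p(x)}(i)$ ($w(0)=\infty$); $M_\rho=\prod_{i\in T_\rho}S_i$, $M_\rho^*=\prod_{i\in T_\rho^*}S_i$; $v_{(I,\beta)}=(x_j)_{j\in T_\rho^*}\in M_\rho^*$ has $x_j=0$ for $j\notin I$, $x_j=p^{\beta(j)}$ for $j\in I$. If $\mu_p(K)\ne\{1\}$, $(I_K,\beta_K)$ is the unique element of $\mathrm{Jump}_{\rho_K}^*$ with $U_\bullet(K)\simeq M_{\rho_K}^{f_K-1}\oplus(M_{\rho_K}^*/\mathbb{Z}_pv_{(I_K,\beta_K)})$ as filtered modules. *)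

theory Defs
  imports
    "HOL-Analysis.Analysis"
    "HOL-Algebra.Ideal_Product"
    "HOL-Algebra.QuotRing"
    "HOL-Algebra.Module"
    "HOL-Library.Extended_Nat"
    "HOL-Computational_Algebra.Primes"
begin

section \<open>Local fields\<close>

text \<open>
  The field is the whole type \<open>'a\<close>; its topology is the one induced by an absolute value.
  Everything below depends only on that topology, not on the absolute value inducing it.
\<close>

definition field_topology :: "('a::field \<Rightarrow> real) \<Rightarrow> 'a topology" where
  "field_topology absv = Metric_space.mtopology UNIV (\<lambda>x y. absv (x - y))"

locale local_field =
  fixes absv :: "'a::field \<Rightarrow> real"
  assumes absv_nonneg: "0 \<le> absv x"
    and absv_eq_0_iff: "absv x = 0 \<longleftrightarrow> x = 0"
    and absv_mult: "absv (x * y) = absv x * absv y"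
    and absv_nonarchimedean: "absv (x + y) \<le> max (absv x) (absv y)"
    and non_discrete: "field_topology absv \<noteq> discrete_topology UNIV"
    and locally_compact: "locally_compact_space (field_topology absv)"

definition valuation_ring :: "('a::field \<Rightarrow> real) \<Rightarrow> 'a ring" where
  "valuation_ring absv =
     \<lparr>carrier = {x. absv x \<le> 1}, mult = (*), one = 1, zero = 0, add = (+)\<rparr>"

definition maximal_ideal :: "('a::field \<Rightarrow> real) \<Rightarrow> 'a set" where
  "maximal_ideal absv = {x. absv x < 1}"

definition residue_field :: "('a::field \<Rightarrow> real) \<Rightarrow> 'a set ring" where
  "residue_field absv = valuation_ring absv Quot maximal_ideal absv"

definition uniformizer :: "('a::field \<Rightarrow> real) \<Rightarrow> 'a \<Rightarrow> bool" where
  "uniformizer absv \<pi> \<longleftrightarrow>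
     \<pi> \<noteq> 0 \<and> \<pi> \<in> maximal_ideal absv \<and> (\<forall>x\<in>maximal_ideal absv. absv x \<le> absv \<pi>)"

text \<open>The normalized valuation, meaningful on nonzero elements only.\<close>

definition val :: "('a::field \<Rightarrow> real) \<Rightarrow> 'a \<Rightarrow> int" where
  "val absv x = (THE n. \<exists>\<pi>. uniformizer absv \<pi> \<and> absv x = absv \<pi> powi n)"

definition val_p :: "('a::field \<Rightarrow> real) \<Rightarrow> nat \<Rightarrow> enat" where
  "val_p absv p = (if (of_nat p :: 'a) = 0 then \<infinity> else enat (nat (val absv (of_nat p))))"

text \<open>The exponent is a power in the monoid of ideals, i.e. an iterated ideal product.\<close>

definition U :: "('a::field \<Rightarrow> real) \<Rightarrow> nat \<Rightarrow> 'a set" where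
  "U absv i = (\<lambda>y. 1 + y) ` (maximal_ideal absv [^]\<^bsub>ideals_set (valuation_ring absv)\<^esub> i)"

definition mu :: "nat \<Rightarrow> 'a::field set" where
  "mu p = {\<alpha>. \<alpha> ^ p = 1}"


section \<open>p-adic numbers\<close>

text \<open>
  A p-adic integer is the coherent sequence of its residues: \<open>x n\<close> in \<open>{0..<p^n}\<close>
  is its residue modulo \<open>p^n\<close>.
\<close>

type_synonym padic = "nat \<Rightarrow> int"

definition Zp :: "nat \<Rightarrow> padic ring" where
  "Zp p = \<lparr>carrier = {x. \<forall>n. x n \<in> {0..<int p ^ n} \<and> x (Suc n) mod int p ^ n = x n},
           mult = (\<lambda>x y n. (x n * y n) mod int p ^ n),
           one = (\<lambda>n. 1 mod int p ^ n),
           zero = (\<lambda>n. 0),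
           add = (\<lambda>x y n. (x n + y n) mod int p ^ n)\<rparr>"

text \<open>For \<open>x \<noteq> 0\<close>; note that \<open>p^n\<close> divides \<open>x\<close> iff \<open>x n = 0\<close>.\<close>

definition ord_p :: "padic \<Rightarrow> nat" where
  "ord_p x = (LEAST n. x (Suc n) \<noteq> 0)"

text \<open>
  The additive group of the field of fractions \<open>Q\<^sub>p\<close> of \<open>Z\<^sub>p\<close>: classes of pairs
  (numerator, denominator).
\<close>

definition frac_rel :: "nat \<Rightarrow> ((padic \<times> padic) \<times> (padic \<times> padic)) set" where
  "frac_rel p =
     {((a, b), (c, d)).
        a \<in> carrier (Zp p) \<and> b \<in> carrier (Zp p) - {\<zero>\<^bsub>Zp p\<^esub>} \<and>
        c \<in> carrier (Zp p) \<and> d \<in> carrier (Zp p) - {\<zero>\<^bsub>Zp p\<^esub>} \<and>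
        a \<otimes>\<^bsub>Zp p\<^esub> d = c \<otimes>\<^bsub>Zp p\<^esub> b}"

definition Qp_add :: "nat \<Rightarrow> (padic \<times> padic) set monoid" where
  "Qp_add p =
     \<lparr>carrier = (carrier (Zp p) \<times> (carrier (Zp p) - {\<zero>\<^bsub>Zp p\<^esub>})) // frac_rel p,
      mult = (\<lambda>X Y. \<Union>(a, b)\<in>X. \<Union>(c, d)\<in>Y.
                frac_rel p `` {(a \<otimes>\<^bsub>Zp p\<^esub> d \<oplus>\<^bsub>Zp p\<^esub> c \<otimes>\<^bsub>Zp p\<^esub> b, b \<otimes>\<^bsub>Zp p\<^esub> d)}),
      one = frac_rel p `` {(\<zero>\<^bsub>Zp p\<^esub>, \<one>\<^bsub>Zp p\<^esub>)}\<rparr>"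

definition Qp_mod_Zp :: "nat \<Rightarrow> (padic \<times> padic) set set monoid" where
  "Qp_mod_Zp p = Qp_add p Mod ((\<lambda>a. frac_rel p `` {(a, \<one>\<^bsub>Zp p\<^esub>)}) ` carrier (Zp p))"


section \<open>Characters of the principal units\<close>

definition U1_group :: "('a::field \<Rightarrow> real) \<Rightarrow> 'a monoid" where
  "U1_group absv = \<lparr>carrier = U absv 1, mult = (*), one = 1\<rparr>"

text \<open>
  The quotient topology on \<open>Q\<^sub>p/Z\<^sub>p\<close> is discrete, since \<open>Z\<^sub>p\<close> is open in \<open>Q\<^sub>p\<close>.
\<close>

definition characters :: "('a::field \<Rightarrow> real) \<Rightarrow> nat \<Rightarrow> ('a \<Rightarrow> (padic \<times> padic) set set) set" where
  "characters absv p =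
     {\<theta>. \<theta> \<in> hom (U1_group absv) (Qp_mod_Zp p) \<and>
         continuous_map (subtopology (field_topology absv) (U absv 1))
           (discrete_topology (carrier (Qp_mod_Zp p))) \<theta>}"

definition char_jumps :: "('a::field \<Rightarrow> real) \<Rightarrow> ('a \<Rightarrow> 'b) \<Rightarrow> nat set" where
  "char_jumps absv \<theta> = {i. 1 \<le> i \<and> \<theta> ` U absv i \<noteq> \<theta> ` U absv (i + 1)}"

definition jump_sets_of_field :: "('a::field \<Rightarrow> real) \<Rightarrow> nat \<Rightarrow> nat set set" where
  "jump_sets_of_field absv p = char_jumps absv ` characters absv p"


section \<open>Shifts and jump sets\<close>

text \<open>A shift is a function on the positive integers; its value at \<open>0\<close> is irrelevant.\<close>

definition rho :: "enat \<Rightarrow> nat \<Rightarrow> nat \<Rightarrow> nat" where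
  "rho e p i = (case e of enat n \<Rightarrow> min (i + n) (p * i) | \<infinity> \<Rightarrow> p * i)"

definition rho_K :: "('a::field \<Rightarrow> real) \<Rightarrow> nat \<Rightarrow> nat \<Rightarrow> nat" where
  "rho_K absv p = rho (val_p absv p) p"

definition T :: "(nat \<Rightarrow> nat) \<Rightarrow> nat set" where
  "T \<rho> = {1..} - \<rho> ` {1..}"

text \<open>The starred notions are meaningful only if \<open>T \<rho>\<close> is finite.\<close>

definition e_star :: "(nat \<Rightarrow> nat) \<Rightarrow> nat" where
  "e_star \<rho> = Max (T \<rho>) + 1"

definition T_star :: "(nat \<Rightarrow> nat) \<Rightarrow> nat set" where
  "T_star \<rho> = T \<rho> \<union> {e_star \<rho>}"

definition jump_sets_within :: "nat set \<Rightarrow> (nat \<Rightarrow> nat) \<Rightarrow> nat set set" where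
  "jump_sets_within S \<rho> =
     {A. finite A \<and> A \<subseteq> {1..} \<and> (\<forall>a\<in>A. \<forall>b\<in>A. a < b \<longrightarrow> \<rho> a \<le> b) \<and> A - \<rho> ` A \<subseteq> S}"

definition Jump :: "(nat \<Rightarrow> nat) \<Rightarrow> nat set set" where
  "Jump \<rho> = jump_sets_within (T \<rho>) \<rho>"

definition Jump_star :: "(nat \<Rightarrow> nat) \<Rightarrow> nat set set" where
  "Jump_star \<rho> = jump_sets_within (T_star \<rho>) \<rho>"

text \<open>The pair \<open>(I, \<beta>)\<close> identified with a jump set.\<close>

definition jump_I :: "(nat \<Rightarrow> nat) \<Rightarrow> nat set \<Rightarrow> nat set" where
  "jump_I \<rho> A = A - \<rho> ` A"

definition jump_beta :: "nat set \<Rightarrow> nat \<Rightarrow> nat" where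
  "jump_beta A i = card ({i..} \<inter> A)"

definition le_rho :: "(nat \<Rightarrow> nat) \<Rightarrow> nat \<times> nat \<Rightarrow> nat \<times> nat \<Rightarrow> bool" where
  "le_rho \<rho> x y \<longleftrightarrow>
     (case (x, y) of ((a\<^sub>1, b\<^sub>1), (a\<^sub>2, b\<^sub>2)) \<Rightarrow>
        b\<^sub>2 \<ge> b\<^sub>1 \<and> (\<rho> ^^ b\<^sub>2) a\<^sub>2 \<ge> (\<rho> ^^ b\<^sub>1) a\<^sub>1)"

definition beta_diff :: "(nat \<Rightarrow> nat) \<Rightarrow> (nat \<Rightarrow> nat) \<Rightarrow> nat \<Rightarrow> int" where
  "beta_diff \<beta> \<beta>' i = int (\<beta> i) - int (\<beta>' i)"

definition max_diff :: "nat set \<times> (nat \<Rightarrow> nat) \<Rightarrow> nat set \<times> (nat \<Rightarrow> nat) \<Rightarrow> int" where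
  "max_diff J J' = Max (beta_diff (snd J) (snd J') ` (fst J \<inter> fst J'))"

definition Max_set :: "nat set \<times> (nat \<Rightarrow> nat) \<Rightarrow> nat set \<times> (nat \<Rightarrow> nat) \<Rightarrow> nat set" where
  "Max_set J J' =
     {i \<in> fst J \<inter> fst J'. beta_diff (snd J) (snd J') i > 0 \<and>
        beta_diff (snd J) (snd J') i = max_diff J J'}"

text \<open>In the third condition \<open>max_diff J J'\<close> is positive whenever the first condition holds.\<close>

definition incompatible ::
  "(nat \<Rightarrow> nat) \<Rightarrow> nat \<Rightarrow> nat \<Rightarrow> nat set \<times> (nat \<Rightarrow> nat) \<Rightarrow> nat set \<times> (nat \<Rightarrow> nat) \<Rightarrow> bool" where
  "incompatible \<rho> f p J J' \<longleftrightarrow>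
     (fst J \<inter> fst J' \<noteq> {} \<and>
        (if p > 2 then card (Max_set J J') = 1 else odd (card (Max_set J J')))) \<and>
     (f > 1 \<longrightarrow> Max_set J J' = {e_star \<rho>}) \<and>
     (\<forall>i \<in> fst J' - fst J.
        \<not> (\<exists>j \<in> fst J. le_rho \<rho> (i, nat (max_diff J J') + snd J' i) (j, snd J j)))"

text \<open>Jump sets as sets; \<open>compatible \<rho> f p A A'\<close>: \<open>A\<close> is \<open>(A', f, p)\<close>-compatible.\<close>

definition compatible :: "(nat \<Rightarrow> nat) \<Rightarrow> nat \<Rightarrow> nat \<Rightarrow> nat set \<Rightarrow> nat set \<Rightarrow> bool" where
  "compatible \<rho> f p A A' \<longleftrightarrow>
     \<not> incompatible \<rho> f p (jump_I \<rho> A, jump_beta A) (jump_I \<rho> A', jump_beta A')"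


section \<open>Filtered modules\<close>

text \<open>
  \<open>Fil M i\<close> for \<open>i \<ge> 1\<close> is the filtration, with \<open>Fil M 1 = carrier M\<close>. The ring fields
  \<open>mult\<close> and \<open>one\<close> inherited from the record of modules play no role.
\<close>

record ('r, 'b) filt_module = "('r, 'b) module" +
  Fil :: "nat \<Rightarrow> 'b set"

definition filt_hom ::
  "'r ring \<Rightarrow> ('r, 'b) filt_module \<Rightarrow> ('r, 'c) filt_module \<Rightarrow> ('b \<Rightarrow> 'c) set" where
  "filt_hom R M N =
     {\<phi>. \<phi> \<in> carrier M \<rightarrow> carrier N \<and>
         (\<forall>x\<in>carrier M. \<forall>y\<in>carrier M. \<phi> (x \<oplus>\<^bsub>M\<^esub> y) = \<phi> x \<oplus>\<^bsub>N\<^esub> \<phi> y) \<and>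
         (\<forall>a\<in>carrier R. \<forall>x\<in>carrier M. \<phi> (a \<odot>\<^bsub>M\<^esub> x) = a \<odot>\<^bsub>N\<^esub> \<phi> x) \<and>
         (\<forall>i\<ge>1. \<phi> ` Fil M i \<subseteq> Fil N i)}"

definition filt_isomorphic ::
  "'r ring \<Rightarrow> ('r, 'b) filt_module \<Rightarrow> ('r, 'c) filt_module \<Rightarrow> bool" where
  "filt_isomorphic R M N \<longleftrightarrow>
     (\<exists>\<phi>\<in>filt_hom R M N. \<exists>\<psi>\<in>filt_hom R N M.
        (\<forall>x\<in>carrier M. \<psi> (\<phi> x) = x) \<and> (\<forall>y\<in>carrier N. \<phi> (\<psi> y) = y))"

definition filt_prod :: "'i set \<Rightarrow> ('i \<Rightarrow> ('r, 'b) filt_module) \<Rightarrow> ('r, 'i \<Rightarrow> 'b) filt_module" where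
  "filt_prod S M =
     \<lparr>carrier = (\<Pi>\<^sub>E i\<in>S. carrier (M i)),
      mult = undefined, one = undefined,
      zero = (\<lambda>i\<in>S. \<zero>\<^bsub>M i\<^esub>),
      add = (\<lambda>x y. \<lambda>i\<in>S. x i \<oplus>\<^bsub>M i\<^esub> y i),
      smult = (\<lambda>a x. \<lambda>i\<in>S. a \<odot>\<^bsub>M i\<^esub> x i),
      Fil = (\<lambda>k. \<Pi>\<^sub>E i\<in>S. Fil (M i) k)\<rparr>"

definition filt_sum ::
  "('r, 'b) filt_module \<Rightarrow> ('r, 'c) filt_module \<Rightarrow> ('r, 'b \<times> 'c) filt_module" where
  "filt_sum M N =
     \<lparr>carrier = carrier M \<times> carrier N,
      mult = undefined, one = undefined,
      zero = (\<zero>\<^bsub>M\<^esub>, \<zero>\<^bsub>N\<^esub>),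
      add = (\<lambda>(x, y) (x', y'). (x \<oplus>\<^bsub>M\<^esub> x', y \<oplus>\<^bsub>N\<^esub> y')),
      smult = (\<lambda>a (x, y). (a \<odot>\<^bsub>M\<^esub> x, a \<odot>\<^bsub>N\<^esub> y)),
      Fil = (\<lambda>k. Fil M k \<times> Fil N k)\<rparr>"

definition filt_quot :: "('r, 'b) filt_module \<Rightarrow> 'b set \<Rightarrow> ('r, 'b set) filt_module" where
  "filt_quot M N =
     \<lparr>carrier = a_rcosets\<^bsub>M\<^esub> N,
      mult = undefined, one = undefined,
      zero = N,
      add = (\<lambda>X Y. X <+>\<^bsub>M\<^esub> Y),
      smult = (\<lambda>a X. N <+>\<^bsub>M\<^esub> ((\<lambda>x. a \<odot>\<^bsub>M\<^esub> x) ` X)),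
      Fil = (\<lambda>k. (\<lambda>x. N +>\<^bsub>M\<^esub> x) ` Fil M k)\<rparr>"

definition weight :: "(nat \<Rightarrow> nat) \<Rightarrow> nat \<Rightarrow> padic \<Rightarrow> enat" where
  "weight \<rho> i x = (if x = (\<lambda>n. 0) then \<infinity> else enat ((\<rho> ^^ ord_p x) i))"

definition S_mod :: "nat \<Rightarrow> (nat \<Rightarrow> nat) \<Rightarrow> nat \<Rightarrow> (padic, padic) filt_module" where
  "S_mod p \<rho> i =
     \<lparr>carrier = carrier (Zp p),
      mult = undefined, one = undefined,
      zero = \<zero>\<^bsub>Zp p\<^esub>,
      add = (\<lambda>x y. x \<oplus>\<^bsub>Zp p\<^esub> y),
      smult = (\<lambda>a x. a \<otimes>\<^bsub>Zp p\<^esub> x),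
      Fil = (\<lambda>k. {x \<in> carrier (Zp p). enat k \<le> weight \<rho> i x})\<rparr>"

definition M_rho :: "nat \<Rightarrow> (nat \<Rightarrow> nat) \<Rightarrow> (padic, nat \<Rightarrow> padic) filt_module" where
  "M_rho p \<rho> = filt_prod (T \<rho>) (S_mod p \<rho>)"

definition M_rho_star :: "nat \<Rightarrow> (nat \<Rightarrow> nat) \<Rightarrow> (padic, nat \<Rightarrow> padic) filt_module" where
  "M_rho_star p \<rho> = filt_prod (T_star \<rho>) (S_mod p \<rho>)"

definition v_vec :: "nat \<Rightarrow> (nat \<Rightarrow> nat) \<Rightarrow> nat set \<Rightarrow> nat \<Rightarrow> padic" where
  "v_vec p \<rho> A =
     (\<lambda>j\<in>T_star \<rho>. if j \<in> jump_I \<rho> A then add_pow (Zp p) (p ^ jump_beta A j) \<one>\<^bsub>Zp p\<^esub> else \<zero>\<^bsub>Zp p\<^esub>)"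

text \<open>\<open>u\<^sup>a\<close> for a p-adic integer \<open>a\<close> and a principal unit \<open>u\<close>.\<close>

definition unit_pow :: "('a::field \<Rightarrow> real) \<Rightarrow> padic \<Rightarrow> 'a \<Rightarrow> 'a" where
  "unit_pow absv a u =
     (THE y. limitin (field_topology absv) (\<lambda>n. u ^ nat (a n)) y sequentially)"

definition U_mod :: "('a::field \<Rightarrow> real) \<Rightarrow> (padic, 'a) filt_module" where
  "U_mod absv =
     \<lparr>carrier = U absv 1,
      mult = undefined, one = undefined,
      zero = 1,
      add = (*),
      smult = unit_pow absv,
      Fil = U absv\<rparr>"

text \<open>The jump set corresponding to \<open>(I\<^sub>K, \<beta>\<^sub>K)\<close>, for \<open>K\<close> containing nontrivial p-th roots of unity.\<close>

definition jump_set_K :: "('a::field \<Rightarrow> real) \<Rightarrow> nat \<Rightarrow> nat \<Rightarrow> nat set" where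
  "jump_set_K absv p f =
     (THE A. A \<in> Jump_star (rho_K absv p) \<and>
        filt_isomorphic (Zp p) (U_mod absv)
          (filt_sum
            (filt_prod {..<f - 1} (\<lambda>_. M_rho p (rho_K absv p)))
            (filt_quot (M_rho_star p (rho_K absv p))
              ((\<lambda>a. a \<odot>\<^bsub>M_rho_star p (rho_K absv p)\<^esub> v_vec p (rho_K absv p) A) ` carrier (Zp p)))))"

end

theory Submission
  imports Defs "HOL-Computational_Algebra.Polynomial"
begin

text \<open>
  The group \<open>U\<^sub>1(K)\<close> is generated topologically by units of weights \<open>i \<in> T \<rho>\<close>, one for each element of a basis
  of the residue field, and, if \<open>K\<close> contains a primitive \<open>p\<close>-th root of unity \<open>\<zeta>\<close>, by one more unit of weight
  \<open>e_star \<rho>\<close>; in the latter case there is exactly one relation, coming from \<open>\<zeta>\<^sup>p = 1\<close>. A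
  character is thus a choice of values \<open>y g\<close> on the generators subject to that relation, and the number of jumps
  \<open>\<ge> k\<close> of a character is the exponent of \<open>p\<close> that kills its restriction to \<open>U\<^sub>k\<close>. Prescribing the jump set \<open>A\<close>
  therefore prescribes the orders of the values at the generators of weight in \<open>jump_I \<rho> A\<close> and bounds the others.
  Without a relation every jump set can be realized. With the relation \<open>\<Sum> p\<^bsup>\<beta>'(i)\<^esup> y\<^sub>i = 0\<close> the only
  obstruction is a lowest-order part that cannot cancel: either a single nonzero term, or for \<open>p = 2\<close> an odd number of
  them; this is what incompatibility expresses. A good choice of generators, adapted to an expansion of \<open>\<zeta>\<close> in
  terms of arbitrary ones, gives the relation the shape of a jump set, and this jump set is unique since it
  is determined by the levels that \<open>\<zeta>\<close> reaches modulo \<open>p\<^sup>n\<close>-th powers.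
\<close>

section \<open>Jump sets of a shift\<close>

text \<open>For \<open>u = 1 + x\<close> of level \<open>i\<close> the two leading terms of
  \<open>u^p - 1\<close>, namely \<open>x^p\<close> and \<open>p x\<close>, have levels
  \<open>p * i\<close> and \<open>i + e\<close>; this is the origin of the minimum in
  \<open>\<rho>\<close>. They can cancel only if \<open>p * i = i + e\<close>, so
  \<open>e1 = e / (p - 1)\<close> is the only level at which the \<open>p\<close>-th power map from
  \<open>U i / U (i + 1)\<close> to \<open>U (\<rho> i) / U (\<rho> i + 1)\<close> can have a
  kernel. All graded quotients have order \<open>p^f\<close>. Hence injectivity forces surjectivity,
  and at \<open>e1\<close> a kernel of order \<open>p\<close>, generated by \<zeta>, forces a
  cokernel of order \<open>p\<close> at level \<open>\<rho> e1\<close>: one extra generator and one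
  relation.

  The obstacle is that the group is a module over the \<open>p\<close>-adic integers, possibly with
  infinitely many generators, and that characters take values in a divisible group. A continuous
  character kills some \<open>U n\<close>, so its values are killed by \<open>p^n\<close>. It is
  therefore an integer function modulo a power of \<open>p\<close>, and integer exponents modulo
  \<open>U n\<close> suffice. The \<open>p\<close>-adic modules return only where a presentation
  with integer exponents is matched with the isomorphism that defines
  \<open>jump_set_K\<close>.\<close>

locale shift =
  fixes \<rho> :: "nat \<Rightarrow> nat"
  assumes rho_mono: "strict_mono \<rho>" and rho_0 [simp]: "\<rho> 0 = 0" and rho_gt: "1 \<le> i \<Longrightarrow> i < \<rho> i"
begin

lemma rho_less_iff [simp]: "\<rho> a < \<rho> b \<longleftrightarrow> a < b"
  using rho_mono by (simp add: strict_mono_less)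

lemma rho_le_iff [simp]: "\<rho> a \<le> \<rho> b \<longleftrightarrow> a \<le> b"
  using rho_mono by (simp add: strict_mono_less_eq)

lemma rho_eq_iff [simp]: "\<rho> a = \<rho> b \<longleftrightarrow> a = b"
  using rho_mono by (simp add: strict_mono_eq)

lemma rho_ge: "i \<le> \<rho> i"
  using rho_gt[of i] by (cases i) auto

lemma pow_less_iff [simp]: "(\<rho> ^^ c) a < (\<rho> ^^ c) b \<longleftrightarrow> a < b"
  by (induction c) auto

lemma pow_le_iff [simp]: "(\<rho> ^^ c) a \<le> (\<rho> ^^ c) b \<longleftrightarrow> a \<le> b"
  by (induction c) auto

lemma pow_eq_iff [simp]: "(\<rho> ^^ c) a = (\<rho> ^^ c) b \<longleftrightarrow> a = b"
  by (induction c) auto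

lemma pow_ge_add: "1 \<le> i \<Longrightarrow> i + c \<le> (\<rho> ^^ c) i"
proof (induction c)
  case (Suc c)
  then have "1 \<le> (\<rho> ^^ c) i" by linarith
  from rho_gt[OF this] Suc show ?case by simp
qed simp

lemma pow_ge: "i \<le> (\<rho> ^^ c) i"
  using pow_ge_add[of i c] by (cases i) auto

lemma pow_comp: "(\<rho> ^^ c) ((\<rho> ^^ d) i) = (\<rho> ^^ (c + d)) i"
  by (simp add: funpow_add)

lemma pow_mono_exp: "c \<le> d \<Longrightarrow> (\<rho> ^^ c) i \<le> (\<rho> ^^ d) i"
  using pow_ge[of "(\<rho> ^^ c) i" "d - c"] by (simp add: pow_comp)

lemma pow_split: "c \<le> d \<Longrightarrow> (\<rho> ^^ d) i = (\<rho> ^^ c) ((\<rho> ^^ (d - c)) i)"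
  using fun_cong[OF funpow_add[of c "d - c" \<rho>], of i] by simp

text \<open>The common \<open>n\<close> iterations of \<open>\<rho>\<close> cancel, so that only the
  position of the chain of \<open>j\<close> after \<open>b - n\<close> steps matters.\<close>

lemma le_rho_iff: "le_rho \<rho> (i, n) (j, b) \<longleftrightarrow> n \<le> b \<and> i \<le> (\<rho> ^^ (b - n)) j"
  using pow_split[of n b j] by (auto simp: le_rho_def)

section \<open>Jump sets and their counting functions\<close>

definition spaced :: "nat set \<Rightarrow> bool" where
  "spaced A \<longleftrightarrow> finite A \<and> A \<subseteq> {1..} \<and> (\<forall>a\<in>A. \<forall>b\<in>A. a < b \<longrightarrow> \<rho> a \<le> b)"

text \<open>Only the bound on \<open>jump_I\<close> distinguishes \<open>Jump\<close> from
  \<open>Jump_star\<close>; everything about gaps can be stated for \<open>spaced\<close>.\<close>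

lemma jump_sets_within_iff: "A \<in> jump_sets_within S \<rho> \<longleftrightarrow> spaced A \<and> jump_I \<rho> A \<subseteq> S"
  by (auto simp: jump_sets_within_def spaced_def jump_I_def)

lemma jump_beta_antimono: "finite A \<Longrightarrow> i \<le> k \<Longrightarrow> jump_beta A k \<le> jump_beta A i"
  unfolding jump_beta_def by (rule card_mono) auto

lemma jump_beta_step: "finite A \<Longrightarrow> jump_beta A k = jump_beta A (Suc k) + (if k \<in> A then 1 else 0)"
proof -
  assume "finite A"
  have "{k..} \<inter> A = ({Suc k..} \<inter> A) \<union> (if k \<in> A then {k} else {})"
    by (auto simp: Suc_le_eq order_le_less)
  then show ?thesis using \<open>finite A\<close> unfolding jump_beta_def by (auto simp: card_insert_if)
qed

lemma jump_beta_pos: "finite A \<Longrightarrow> 1 \<le> jump_beta A i \<longleftrightarrow> (\<exists>a\<in>A. i \<le> a)"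
  unfolding jump_beta_def by (auto simp: Suc_le_eq card_gt_0_iff)

lemma in_iff_jump_beta: "finite A \<Longrightarrow> k \<in> A \<longleftrightarrow> jump_beta A k \<noteq> jump_beta A (Suc k)"
  using jump_beta_step[of A k] by simp

text \<open>A spaced set meets the half-open interval from \<open>i\<close> to
  \<open>\<rho> i\<close> in at most one point.\<close>

lemma jump_beta_rho:
  assumes "spaced A"
  shows "jump_beta A i \<le> jump_beta A (\<rho> i) + 1"
proof -
  have fin: "finite A" using assms by (simp add: spaced_def)
  have one: "card ({i..<\<rho> i} \<inter> A) \<le> 1"
  proof (rule ccontr)
    assume "\<not> ?thesis"
    then obtain a b where ab: "a \<in> {i..<\<rho> i} \<inter> A" "b \<in> {i..<\<rho> i} \<inter> A" "a \<noteq> b"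
      by (metis Int_lower1 card_le_Suc0_iff_eq finite_atLeastLessThan finite_subset One_nat_def)
    have *: False if "a \<in> {i..<\<rho> i} \<inter> A" "b \<in> {i..<\<rho> i} \<inter> A" "a < b" for a b
    proof -
      from that assms have "\<rho> a \<le> b" by (auto simp: spaced_def)
      moreover have "\<rho> i \<le> \<rho> a" using that by simp
      ultimately have "\<rho> i \<le> b" by (rule order_trans[rotated])
      then show False using that by auto
    qed
    show False using ab * by (metis linorder_neqE_nat)
  qed
  have "{i..} \<inter> A = ({i..<\<rho> i} \<inter> A) \<union> ({\<rho> i..} \<inter> A)" using rho_ge[of i] by auto
  then have "jump_beta A i \<le> card ({i..<\<rho> i} \<inter> A) + card ({\<rho> i..} \<inter> A)"
    unfolding jump_beta_def by (metis card_Un_le)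
  with one show ?thesis unfolding jump_beta_def by linarith
qed

lemma jump_beta_pow:
  assumes "spaced A"
  shows "jump_beta A i \<le> jump_beta A ((\<rho> ^^ c) i) + c"
proof (induction c)
  case (Suc c)
  with jump_beta_rho[OF assms, of "(\<rho> ^^ c) i"] show ?case by simp
qed simp

text \<open>Going back along \<open>\<rho>\<close> inside \<open>A\<close> ends at an element of
  \<open>jump_I\<close>. Each step back raises the count by exactly one: at least one because the
  predecessor itself is counted, at most one by \<open>jump_beta_rho\<close>.\<close>

lemma chain_start:
  assumes "spaced A" "k \<in> A"
  shows "\<exists>j\<in>jump_I \<rho> A. \<exists>c. k = (\<rho> ^^ c) j \<and> jump_beta A j = jump_beta A k + c"
  using assms(2)
proof (induction k rule: less_induct)
  case (less k)
  have fin: "finite A" using assms(1) by (simp add: spaced_def)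
  show ?case
  proof (cases "k \<in> jump_I \<rho> A")
    case True
    then show ?thesis by (intro bexI[of _ k] exI[of _ 0]) auto
  next
    case False
    with less.prems obtain a where a: "a \<in> A" "k = \<rho> a" by (auto simp: jump_I_def)
    have "a \<ge> 1" using a assms(1) by (auto simp: spaced_def)
    then have lt: "a < k" using rho_gt a by simp
    from less.IH[OF lt a(1)] obtain j c where jc: "j \<in> jump_I \<rho> A" "a = (\<rho> ^^ c) j"
      "jump_beta A j = jump_beta A a + c" by blast
    have "jump_beta A a \<ge> jump_beta A k + 1"
      using jump_beta_step[OF fin, of a] a(1) jump_beta_antimono[OF fin, of "Suc a" k] lt by simp
    then have "jump_beta A a = jump_beta A k + 1" using jump_beta_rho[OF assms(1), of a] a by simp
    then show ?thesis using jc a by (intro bexI[of _ j] exI[of _ "Suc c"]) auto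
  qed
qed

text \<open>A discrete intermediate value argument: the count falls to 0 in steps of at most one,
  and each step occurs at an element of \<open>A\<close>.\<close>

lemma jump_beta_attained:
  assumes "finite A" "1 \<le> n" "n \<le> jump_beta A i"
  shows "\<exists>k\<in>A. i \<le> k \<and> jump_beta A k = n"
proof -
  have ex: "\<exists>m. jump_beta A (i + m) = 0"
  proof -
    obtain M where M: "\<forall>a\<in>A. a < M" using \<open>finite A\<close> finite_nat_set_iff_bounded by blast
    have "\<not> 1 \<le> jump_beta A (i + M)" unfolding jump_beta_pos[OF assms(1)] using M by fastforce
    then have "jump_beta A (i + M) = 0" by simp
    then show ?thesis by blast
  qed
  have ex2: "\<exists>m. jump_beta A (i + m) < n" using ex assms(2) by (metis less_le_trans zero_less_one)
  define m where "m = (LEAST m. jump_beta A (i + m) < n)"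
  have m: "jump_beta A (i + m) < n" unfolding m_def by (rule LeastI_ex[OF ex2])
  have "m \<noteq> 0" using m assms(3) by (intro notI) simp
  then obtain m' where m': "m = Suc m'" by (cases m) auto
  have ge: "jump_beta A (i + m') \<ge> n" using not_less_Least[of m' "\<lambda>m. jump_beta A (i + m) < n"] m' m_def by simp
  have st: "jump_beta A (i + m') = jump_beta A (i + m) + (if i + m' \<in> A then 1 else 0)"
    using jump_beta_step[OF assms(1), of "i + m'"] m' by simp
  show ?thesis using st ge m by (intro bexI[of _ "i + m'"]) (auto split: if_splits)
qed

text \<open>This turns the third condition of incompatibility into a plain inequality between
  counts. One direction is \<open>jump_beta_pow\<close>; for the other, an element of count
  \<open>n\<close> at or above \<open>i\<close> is traced back to the start of its chain.\<close>

lemma dominated_iff: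
  assumes "spaced A" "1 \<le> n"
  shows "(\<exists>j\<in>jump_I \<rho> A. le_rho \<rho> (i, n) (j, jump_beta A j)) \<longleftrightarrow> n \<le> jump_beta A i"
proof
  assume "\<exists>j\<in>jump_I \<rho> A. le_rho \<rho> (i, n) (j, jump_beta A j)"
  then obtain j where j: "n \<le> jump_beta A j" "i \<le> (\<rho> ^^ (jump_beta A j - n)) j"
    by (auto simp: le_rho_iff)
  have "jump_beta A j \<le> jump_beta A ((\<rho> ^^ (jump_beta A j - n)) j) + (jump_beta A j - n)"
    by (rule jump_beta_pow[OF assms(1)])
  also have "jump_beta A ((\<rho> ^^ (jump_beta A j - n)) j) \<le> jump_beta A i"
    using assms(1) j(2) by (intro jump_beta_antimono) (auto simp: spaced_def)
  finally show "n \<le> jump_beta A i" using j(1) by linarith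
next
  assume "n \<le> jump_beta A i"
  then obtain k where k: "k \<in> A" "i \<le> k" "jump_beta A k = n"
    using jump_beta_attained[of A n i] assms by (auto simp: spaced_def)
  obtain j c where "j \<in> jump_I \<rho> A" "k = (\<rho> ^^ c) j" "jump_beta A j = jump_beta A k + c"
    using chain_start[OF assms(1) k(1)] by blast
  then show "\<exists>j\<in>jump_I \<rho> A. le_rho \<rho> (i, n) (j, jump_beta A j)"
    using k by (intro bexI[of _ j]) (auto simp: le_rho_iff)
qed

text \<open>These are the inequalities that make \<open>(jump_I \<rho> A, jump_beta A)\<close> an
  admissible pair. The chain from \<open>i\<close>, continued until the remaining count is that of
  \<open>i'\<close>, is still below \<open>i'\<close>.\<close>

lemma jump_I_strict:
  assumes "spaced A" "i \<in> jump_I \<rho> A" "i' \<in> jump_I \<rho> A" "i < i'"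
  shows "jump_beta A i' < jump_beta A i" "(\<rho> ^^ jump_beta A i) i < (\<rho> ^^ jump_beta A i') i'"
proof -
  have fin: "finite A" using assms(1) by (simp add: spaced_def)
  have iA: "i \<in> A" "i' \<in> A" using assms by (auto simp: jump_I_def)
  have "jump_beta A i' \<le> jump_beta A (Suc i)" using assms(4) by (intro jump_beta_antimono[OF fin]) auto
  then show lt: "jump_beta A i' < jump_beta A i" using jump_beta_step[OF fin, of i] iA by simp
  \<comment> \<open>\<open>a\<close> is the element of \<open>A\<close> just before
    \<open>i'\<close>; spacing gives \<open>\<rho> a \<le> i'\<close>, and equality is excluded
    because \<open>i'\<close> starts a chain.\<close>
  obtain a where a: "a \<in> A" "i \<le> a" "jump_beta A a = jump_beta A i' + 1"
    using jump_beta_attained[OF fin, of "jump_beta A i' + 1" i] lt by auto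
  have "a < i'"
  proof (rule ccontr)
    assume "\<not> a < i'"
    then have "jump_beta A a \<le> jump_beta A i'" by (intro jump_beta_antimono[OF fin]) auto
    with a show False by simp
  qed
  then have "\<rho> a \<le> i'" using assms(1) a(1) iA by (auto simp: spaced_def)
  moreover have "\<rho> a \<noteq> i'" using assms(3) a(1) by (auto simp: jump_I_def)
  ultimately have ai': "\<rho> a < i'" by simp
  define c where "c = jump_beta A i - jump_beta A a"
  have c: "jump_beta A i = jump_beta A a + c" using a lt by (simp add: c_def)
  have "(\<rho> ^^ c) i \<le> a"
  proof (rule ccontr)
    assume "\<not> ?thesis"
    then have "jump_beta A ((\<rho> ^^ c) i) \<le> jump_beta A (Suc a)" by (intro jump_beta_antimono[OF fin]) auto
    with jump_beta_pow[OF assms(1), of i c] jump_beta_step[OF fin, of a] a(1) c show False by simp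
  qed
  then have "(\<rho> ^^ (c + 1)) i \<le> \<rho> a" by simp
  then have "(\<rho> ^^ (c + 1)) i < i'" using ai' by linarith
  then have "(\<rho> ^^ jump_beta A i') ((\<rho> ^^ (c + 1)) i) < (\<rho> ^^ jump_beta A i') i'" by (simp del: funpow.simps)
  moreover have "jump_beta A i = jump_beta A i' + (c + 1)" using c a by simp
  ultimately show "(\<rho> ^^ jump_beta A i) i < (\<rho> ^^ jump_beta A i') i'" by (simp only: funpow_add o_apply)
qed

lemma jump_beta_I_pos: "spaced A \<Longrightarrow> i \<in> jump_I \<rho> A \<Longrightarrow> 1 \<le> jump_beta A i"
  by (subst jump_beta_pos) (auto simp: spaced_def jump_I_def)

lemma spaced_eqI:
  assumes "spaced A" "spaced B"
    and "\<And>i n. 1 \<le> n \<Longrightarrow> n \<le> jump_beta A i \<longleftrightarrow> n \<le> jump_beta B i"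
  shows "A = B"
proof -
  have le: "jump_beta A i \<le> jump_beta B i" if "\<And>n. 1 \<le> n \<Longrightarrow> n \<le> jump_beta A i \<Longrightarrow> n \<le> jump_beta B i" for A B i
    using that[of "jump_beta A i"] by (cases "jump_beta A i = 0") auto
  have "jump_beta A i = jump_beta B i" for i
    using le[of A i B] le[of B i A] assms(3) by (meson order_antisym)
  then show ?thesis using assms(1,2) in_iff_jump_beta by (auto simp: spaced_def)
qed

text \<open>The level reached by a root of unity modulo \<open>p^n\<close>-th powers: its factor at
  \<open>i\<close> has exponent \<open>p^(jump_beta A i - 1)\<close> and hence weight
  \<open>(\<rho> ^^ (jump_beta A i - 1)) i\<close>, and factors with
  \<open>jump_beta A i > n\<close> are themselves \<open>p^n\<close>-th powers. By
  \<open>presented_torsion\<close> it depends on the filtered group alone.\<close>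

definition tail_bound :: "nat set \<Rightarrow> nat \<Rightarrow> nat \<Rightarrow> bool" where
  "tail_bound A n l \<longleftrightarrow> (\<forall>i\<in>jump_I \<rho> A. jump_beta A i \<le> n \<longrightarrow> l \<le> (\<rho> ^^ (jump_beta A i - 1)) i)"

lemma jump_I_pow_pred_less:
  assumes "spaced A" "i \<in> jump_I \<rho> A" "i' \<in> jump_I \<rho> A" "i < i'"
  shows "(\<rho> ^^ (jump_beta A i - 1)) i < (\<rho> ^^ (jump_beta A i' - 1)) i'"
proof -
  have "Suc (jump_beta A i - 1) = jump_beta A i" "Suc (jump_beta A i' - 1) = jump_beta A i'"
    using jump_beta_I_pos assms by fastforce+
  then have "(\<rho> ^^ Suc (jump_beta A i - 1)) i < (\<rho> ^^ Suc (jump_beta A i' - 1)) i'"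
    using jump_I_strict(2)[OF assms] by (simp del: funpow.simps)
  then show ?thesis by simp
qed

lemma jump_I_beta_le:
  assumes "spaced A" "i \<in> jump_I \<rho> A" "i' \<in> jump_I \<rho> A" "jump_beta A i' \<le> jump_beta A i"
  shows "i \<le> i'"
  using jump_I_strict(1)[OF assms(1,3,2)] assms(4) by (meson leD not_le_imp_less)

text \<open>Along \<open>jump_I\<close> the weights rise as the counts fall, so a term of count
  \<open>n\<close> is the lowest one among the counts up to \<open>n\<close> and shows as a strict
  change of the bound between \<open>n\<close> and \<open>n - 1\<close>.\<close>

lemma tail_bound_pairs:
  assumes "spaced A" "1 \<le> n"
  shows "(tail_bound A n w \<and> \<not> tail_bound A n (Suc w) \<and> tail_bound A (n - 1) (Suc w)) \<longleftrightarrow>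
         (\<exists>i\<in>jump_I \<rho> A. jump_beta A i = n \<and> (\<rho> ^^ (n - 1)) i = w)"
proof
  assume "\<exists>i\<in>jump_I \<rho> A. jump_beta A i = n \<and> (\<rho> ^^ (n - 1)) i = w"
  then obtain i where i: "i \<in> jump_I \<rho> A" "jump_beta A i = n" "(\<rho> ^^ (n - 1)) i = w" by blast
  have "w \<le> (\<rho> ^^ (jump_beta A i' - 1)) i'" if i': "i' \<in> jump_I \<rho> A" "jump_beta A i' \<le> n" for i'
  proof -
    have "i \<le> i'" using jump_I_beta_le[OF assms(1) i(1) i'(1)] i(2) i'(2) by simp
    then show ?thesis using jump_I_pow_pred_less[OF assms(1) i(1) i'(1)] i by (cases "i = i'") auto
  qed
  moreover have "Suc w \<le> (\<rho> ^^ (jump_beta A i' - 1)) i'" if i': "i' \<in> jump_I \<rho> A" "jump_beta A i' \<le> n - 1" for i'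
  proof -
    have "jump_beta A i' < jump_beta A i" using i(2) i'(2) assms(2) by linarith
    then have "i \<le> i'" "i \<noteq> i'" using jump_I_beta_le[OF assms(1) i(1) i'(1)] by auto
    then show ?thesis using jump_I_pow_pred_less[OF assms(1) i(1) i'(1)] i by simp
  qed
  ultimately show "tail_bound A n w \<and> \<not> tail_bound A n (Suc w) \<and> tail_bound A (n - 1) (Suc w)"
    using i unfolding tail_bound_def by fastforce
next
  assume *: "tail_bound A n w \<and> \<not> tail_bound A n (Suc w) \<and> tail_bound A (n - 1) (Suc w)"
  then obtain i where i: "i \<in> jump_I \<rho> A" "jump_beta A i \<le> n" "\<not> Suc w \<le> (\<rho> ^^ (jump_beta A i - 1)) i"
    unfolding tail_bound_def by blast
  have "\<not> jump_beta A i \<le> n - 1" using * i unfolding tail_bound_def by blast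
  then have "jump_beta A i = n" using i(2) by linarith
  moreover have "w \<le> (\<rho> ^^ (jump_beta A i - 1)) i" using * i unfolding tail_bound_def by blast
  ultimately show "\<exists>i\<in>jump_I \<rho> A. jump_beta A i = n \<and> (\<rho> ^^ (n - 1)) i = w" using i by auto
qed

text \<open>Iterates of \<open>\<rho>\<close> are injective, so the weight
  \<open>(\<rho> ^^ (n - 1)) i\<close> gives back \<open>i\<close>. Thus the bounds determine all
  pairs, and \<open>dominated_iff\<close> recovers the counts from the pairs.\<close>

lemma spaced_eq_tail_bound:
  assumes A: "spaced A" and B: "spaced B" and eq: "\<And>n l. tail_bound A n l \<longleftrightarrow> tail_bound B n l"
  shows "A = B"
proof -
  have *: "\<exists>i\<in>jump_I \<rho> B. i = j \<and> jump_beta B i = jump_beta A j"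
    if A: "spaced A" and B: "spaced B" and eq: "\<And>n l. tail_bound A n l \<longleftrightarrow> tail_bound B n l"
      and j: "j \<in> jump_I \<rho> A" for A B j
  proof -
    have pos: "1 \<le> jump_beta A j" by (rule jump_beta_I_pos[OF A j])
    from tail_bound_pairs[OF A pos, of "(\<rho> ^^ (jump_beta A j - 1)) j"]
      tail_bound_pairs[OF B pos, of "(\<rho> ^^ (jump_beta A j - 1)) j"] eq j
    obtain i where "i \<in> jump_I \<rho> B" "jump_beta B i = jump_beta A j"
      "(\<rho> ^^ (jump_beta A j - 1)) i = (\<rho> ^^ (jump_beta A j - 1)) j" by auto
    then show ?thesis by auto
  qed
  have dom: "(\<exists>j\<in>jump_I \<rho> B. le_rho \<rho> (i, n) (j, jump_beta B j))"
    if A: "spaced A" and B: "spaced B" and eq: "\<And>n l. tail_bound A n l \<longleftrightarrow> tail_bound B n l"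
      and ex: "(\<exists>j\<in>jump_I \<rho> A. le_rho \<rho> (i, n) (j, jump_beta A j))" for A B i n
    using ex *[OF A B eq] by metis
  show ?thesis
  proof (rule spaced_eqI[OF A B])
    fix i n :: nat assume n: "1 \<le> n"
    show "n \<le> jump_beta A i \<longleftrightarrow> n \<le> jump_beta B i"
      using dominated_iff[OF A n, of i] dominated_iff[OF B n, of i] dom[OF A B eq, of i n] dom[OF B A eq[symmetric], of i n]
      by blast
  qed
qed

section \<open>Jump sets from abstract counting functions\<close>

context
  fixes nn :: "nat \<Rightarrow> nat" and M :: nat
  assumes anti: "\<And>k l. k \<le> l \<Longrightarrow> nn l \<le> nn k" and sub: "\<And>k. 1 \<le> k \<Longrightarrow> nn k \<le> nn (\<rho> k) + 1" and zero: "nn M = 0"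
begin

text \<open>Between \<open>k\<close> and \<open>\<rho> k\<close> the function can fall by one only;
  a fall at \<open>k\<close> uses this up and leaves it constant from \<open>k + 1\<close> to
  \<open>\<rho> k\<close>.\<close>

lemma rank_step: "1 \<le> k \<Longrightarrow> nn k \<noteq> nn (k + 1) \<Longrightarrow> nn k = nn (k + 1) + 1 \<and> nn (\<rho> k) = nn (k + 1)"
  using sub[of k] anti[of k "k+1"] anti[of "k+1" "\<rho> k"] rho_gt[of k] by fastforce

lemma rank_set_finite: "finite {k. 1 \<le> k \<and> nn k \<noteq> nn (k + 1)}"
proof (rule finite_subset)
  show "{k. 1 \<le> k \<and> nn k \<noteq> nn (k + 1)} \<subseteq> {..M}"
  proof
    fix k assume k: "k \<in> {k. 1 \<le> k \<and> nn k \<noteq> nn (k + 1)}"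
    show "k \<in> {..M}"
    proof (rule ccontr)
      assume "k \<notin> {..M}"
      then have "nn k = 0" "nn (k+1) = 0" using anti[of M k] anti[of M "k+1"] zero by auto
      with k show False by simp
    qed
  qed
qed simp

lemma rank_set_spaced: "spaced {k. 1 \<le> k \<and> nn k \<noteq> nn (k + 1)}"
  unfolding spaced_def
proof (intro conjI ballI impI)
  fix a b assume ab: "a \<in> {k. 1 \<le> k \<and> nn k \<noteq> nn (k + 1)}" "b \<in> {k. 1 \<le> k \<and> nn k \<noteq> nn (k + 1)}" "a < b"
  show "\<rho> a \<le> b"
  proof (rule ccontr)
    assume "\<not> \<rho> a \<le> b"
    then have "nn (\<rho> a) \<le> nn (b + 1)" "nn b \<le> nn (a + 1)" "nn (b + 1) \<le> nn b" using ab by (auto intro!: anti)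
    then show False using rank_step[of a] ab by simp
  qed
qed (use rank_set_finite in auto)

text \<open>Beyond \<open>M\<close> both sides vanish; going down from there they grow together, by
  one at each element of the set.\<close>

lemma rank_set_beta:
  assumes "1 \<le> k" shows "jump_beta {k. 1 \<le> k \<and> nn k \<noteq> nn (k + 1)} k = nn k"
proof -
  let ?J = "{k. 1 \<le> k \<and> nn k \<noteq> nn (k + 1)}"
  have "jump_beta ?J (M + m) = nn (M + m)" for m
  proof -
    have z: "nn k = 0" if "k \<ge> M" for k using anti[OF that] zero by simp
    have "{M + m..} \<inter> ?J = {}" using z by auto
    then show ?thesis using z[of "M+m"] by (simp add: jump_beta_def)
  qed
  then have big: "jump_beta ?J k = nn k" if "M \<le> k" for k using le_Suc_ex[OF that] by (elim exE) simp
  show ?thesis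
  proof (cases "k \<le> M")
    case True
    then show ?thesis using assms
    proof (induction k rule: inc_induct)
      case base
      show ?case by (rule big) simp
    next
      case (step k)
      have "jump_beta ?J k = jump_beta ?J (Suc k) + (if k \<in> ?J then 1 else 0)"
        by (rule jump_beta_step[OF rank_set_finite])
      moreover have "k \<in> ?J \<longleftrightarrow> nn k \<noteq> nn (k + 1)" using step by simp
      moreover have "jump_beta ?J (Suc k) = nn (k + 1)" using step by simp
      ultimately show ?case using rank_step[of k] step.prems by (cases "nn k = nn (k + 1)") auto
    qed
  qed (rule big, simp)
qed

end

text \<open>The jump set \<open>A\<close> is built from the function \<open>k \<mapsto> |A \<inter> [k, \<infinity>)|\<close>, which has to be the maximum over
  \<open>i \<in> I\<close> of the number of \<open>c < \<beta> i\<close> with \<open>\<rho>\<^sup>c i \<ge> k\<close>.\<close>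

lemma jump_set_of_pairs:
  assumes fin: "finite I" and I1: "I \<subseteq> {1..}" and pos: "\<And>i. i \<in> I \<Longrightarrow> 1 \<le> \<beta> i"
    and dec: "\<And>i i'. i \<in> I \<Longrightarrow> i' \<in> I \<Longrightarrow> i < i' \<Longrightarrow> \<beta> i' < \<beta> i"
    and inc: "\<And>i i'. i \<in> I \<Longrightarrow> i' \<in> I \<Longrightarrow> i < i' \<Longrightarrow> (\<rho> ^^ \<beta> i) i < (\<rho> ^^ \<beta> i') i'"
  shows "\<exists>A. spaced A \<and> jump_I \<rho> A = I \<and> (\<forall>i\<in>I. jump_beta A i = \<beta> i)"
proof -
  \<comment> \<open>The chain of \<open>i\<close> consists of the \<open>\<beta> i\<close> numbers
    \<open>(\<rho> ^^ c) i\<close> with \<open>c < \<beta> i\<close>. \<open>P k n\<close> says that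
    no chain has more than \<open>n\<close> members at or above \<open>k\<close>, by looking at the
    member that is number \<open>n + 1\<close> from the top.\<close>
  define P where "P k n \<longleftrightarrow> (\<forall>i\<in>I. \<beta> i \<le> n \<or> (\<rho> ^^ (\<beta> i - n - 1)) i < k)" for k n
  define nn where "nn k = (LEAST n. P k n)" for k
  have P_mono: "P k n'" if "P k n" "n \<le> n'" for k n n'
    unfolding P_def
  proof
    fix i assume i: "i \<in> I"
    have "\<beta> i - n' - 1 \<le> \<beta> i - n - 1" using that by simp
    from pow_mono_exp[OF this, of i] that i show "\<beta> i \<le> n' \<or> (\<rho> ^^ (\<beta> i - n' - 1)) i < k"
      unfolding P_def by fastforce
  qed
  have P_ex: "\<exists>n. P k n" for k
  proof -
    have "P k (Max (\<beta> ` I))" unfolding P_def using fin by auto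
    then show ?thesis by blast
  qed
  have le_iff: "nn k \<le> n \<longleftrightarrow> P k n" for k n
    unfolding nn_def using P_mono[OF LeastI_ex[OF P_ex]] Least_le[of "P k"] by blast
  have anti: "nn l \<le> nn k" if "k \<le> l" for k l
  proof -
    have "P k (nn k)" by (rule iffD1[OF le_iff order_refl])
    then have "P l (nn k)" using that unfolding P_def by (meson order_less_le_trans)
    then show ?thesis using le_iff by simp
  qed
  have sub: "nn k \<le> nn (\<rho> k) + 1" for k
  proof -
    have *: "P (\<rho> k) (nn (\<rho> k))" by (rule iffD1[OF le_iff order_refl])
    have "\<beta> i \<le> nn (\<rho> k) + 1 \<or> (\<rho> ^^ (\<beta> i - (nn (\<rho> k) + 1) - 1)) i < k" if "i \<in> I" for i
    proof (rule disjCI)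
      assume n: "\<not> (\<rho> ^^ (\<beta> i - (nn (\<rho> k) + 1) - 1)) i < k"
      show "\<beta> i \<le> nn (\<rho> k) + 1"
      proof (rule ccontr)
        assume b: "\<not> ?thesis"
        then have "(\<rho> ^^ Suc (\<beta> i - (nn (\<rho> k) + 1) - 1)) i < \<rho> k"
          using * that unfolding P_def by (auto simp del: funpow.simps simp: Suc_diff_Suc)
        then show False using n by simp
      qed
    qed
    then show ?thesis unfolding le_iff P_def by blast
  qed
  define M where "M = Suc (Max (insert 0 ((\<lambda>i. (\<rho> ^^ \<beta> i) i) ` I)))"
  have "P M 0" unfolding P_def
  proof
    fix i assume "i \<in> I"
    then have "(\<rho> ^^ \<beta> i) i < M" unfolding M_def using fin by (auto intro!: le_imp_less_Suc Max_ge)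
    moreover have "(\<rho> ^^ (\<beta> i - 0 - 1)) i \<le> (\<rho> ^^ \<beta> i) i" by (intro pow_mono_exp) simp
    ultimately show "\<beta> i \<le> 0 \<or> (\<rho> ^^ (\<beta> i - 0 - 1)) i < M" by linarith
  qed
  then have zero: "nn M = 0" using le_iff by (metis le_zero_eq)
  let ?J = "{k. 1 \<le> k \<and> nn k \<noteq> nn (k + 1)}"
  have sp: "spaced ?J" by (rule rank_set_spaced[of nn M], erule anti, rule sub, rule zero)
  have bt: "jump_beta ?J k = nn k" if "1 \<le> k" for k
    by (rule rank_set_beta[of nn M], erule anti, rule sub, rule zero, rule that)
  have rs: "nn k = nn (k + 1) + 1 \<and> nn (\<rho> k) = nn (k + 1)" if "1 \<le> k" "nn k \<noteq> nn (k + 1)" for k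
    by (rule rank_step[of nn M], erule anti, rule sub, rule zero) (fact that)+
  \<comment> \<open>A longer chain starts lower and, by \<open>inc\<close>, also ends lower;
    cancelling \<open>\<beta> i\<close> iterations shows that at most \<open>\<beta> i\<close> of
    its members lie at or above \<open>i\<close>.\<close>
  have other: "(\<rho> ^^ (\<beta> i' - \<beta> i)) i' < i" if "i \<in> I" "i' \<in> I" "\<not> \<beta> i' \<le> \<beta> i" for i i'
  proof -
    have "\<not> i < i'" "i \<noteq> i'" using dec[OF that(1,2)] that(3) by auto
    then have "i' < i" by simp
    from inc[OF that(2,1) this] show ?thesis using pow_split[of "\<beta> i" "\<beta> i'" i'] that(3) by simp
  qed
  have nnI: "nn i = \<beta> i" if i: "i \<in> I" for i
  proof (rule order_antisym)
    show "nn i \<le> \<beta> i" unfolding le_iff P_def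
    proof
      fix i' assume "i' \<in> I"
      then show "\<beta> i' \<le> \<beta> i \<or> (\<rho> ^^ (\<beta> i' - \<beta> i - 1)) i' < i"
        using other[OF i, of i'] pow_mono_exp[of "\<beta> i' - \<beta> i - 1" "\<beta> i' - \<beta> i" i'] by fastforce
    qed
    have "\<not> P i (\<beta> i - 1)" unfolding P_def using i pos[OF i] by force
    then have "\<not> nn i \<le> \<beta> i - 1" using le_iff by blast
    then show "\<beta> i \<le> nn i" by linarith
  qed
  have nnS: "nn (i + 1) \<le> \<beta> i - 1" if i: "i \<in> I" for i
    unfolding le_iff P_def
  proof
    fix i' assume i': "i' \<in> I"
    show "\<beta> i' \<le> \<beta> i - 1 \<or> (\<rho> ^^ (\<beta> i' - (\<beta> i - 1) - 1)) i' < i + 1"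
    proof (cases "\<beta> i' \<le> \<beta> i")
      case True
      consider "i = i'" | "i < i'" | "i' < i" by linarith
      then show ?thesis
      proof cases
        case 1
        then show ?thesis using pos[OF i] by simp
      next
        case 2
        then show ?thesis using dec[OF i i' 2] by linarith
      next
        case 3
        then show ?thesis using dec[OF i' i 3] True by linarith
      qed
    next
      case False
      then have "\<beta> i' - (\<beta> i - 1) - 1 = \<beta> i' - \<beta> i" using pos[OF i] by linarith
      then show ?thesis using other[OF i i' False] by simp
    qed
  qed
  have "jump_I \<rho> ?J = I"
  proof
    show "I \<subseteq> jump_I \<rho> ?J"
    proof
      fix i assume i: "i \<in> I"
      have "i \<in> ?J" using nnI[OF i] nnS[OF i] pos[OF i] I1 i by auto
      \<comment> \<open>If \<open>i = \<rho> a\<close> with a fall at \<open>a\<close>, the count at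
        \<open>a\<close> is \<open>\<beta> i + 1\<close>. But a chain with more than
        \<open>\<beta> i\<close> members at or above \<open>a\<close> would, after one more
        application of \<open>\<rho>\<close>, contradict \<open>other\<close>.\<close>
      moreover have "i \<notin> \<rho> ` ?J"
      proof
        assume "i \<in> \<rho> ` ?J"
        then obtain a where a: "i = \<rho> a" "1 \<le> a" "nn a \<noteq> nn (a + 1)" by auto
        have "nn a = \<beta> i + 1" using rs[OF a(2,3)] nnI[OF i] a(1) by simp
        moreover have "P a (\<beta> i)" unfolding P_def
        proof
          fix i' assume i': "i' \<in> I"
          show "\<beta> i' \<le> \<beta> i \<or> (\<rho> ^^ (\<beta> i' - \<beta> i - 1)) i' < a"
          proof (rule disjCI, rule ccontr)
            assume n: "\<not> (\<rho> ^^ (\<beta> i' - \<beta> i - 1)) i' < a" "\<not> \<beta> i' \<le> \<beta> i"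
            have "(\<rho> ^^ Suc (\<beta> i' - \<beta> i - 1)) i' < \<rho> a"
              using other[OF i i' n(2)] n(2) a(1) by (simp del: funpow.simps add: Suc_diff_Suc)
            with n show False by simp
          qed
        qed
        ultimately show False using le_iff[of a "\<beta> i"] by simp
      qed
      ultimately show "i \<in> jump_I \<rho> ?J" by (simp add: jump_I_def)
    qed
    show "jump_I \<rho> ?J \<subseteq> I"
    proof
      fix b assume "b \<in> jump_I \<rho> ?J"
      then have b: "1 \<le> b" "nn b \<noteq> nn (b + 1)" "b \<notin> \<rho> ` ?J" by (auto simp: jump_I_def)
      from rs[OF b(1,2)] have b2: "nn b = nn (b + 1) + 1" by simp
      show "b \<in> I"
      proof (rule ccontr)
        assume bI: "b \<notin> I"
        define q where "q = nn (b + 1)"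
        have "\<not> P b q" using le_iff[of b q] b2 q_def by simp
        then obtain i where i: "i \<in> I" "q < \<beta> i" "b \<le> (\<rho> ^^ (\<beta> i - q - 1)) i"
          unfolding P_def by (auto simp: not_le not_less)
        have "P (b + 1) q" unfolding q_def by (rule iffD1[OF le_iff order_refl])
        then have "b = (\<rho> ^^ (\<beta> i - q - 1)) i" using i unfolding P_def by fastforce
        moreover have "\<beta> i - q - 1 \<noteq> 0" using bI i \<open>b = _\<close> by (intro notI) simp
        then obtain d where d: "\<beta> i - q - 1 = Suc d" by (cases "\<beta> i - q - 1") auto
        \<comment> \<open>A fall at \<open>b\<close> outside \<open>I\<close> happens at a later
          member of some chain; the member \<open>a\<close> just before it is a fall as well, so
          \<open>b\<close> is the image of a jump.\<close>
        define a where "a = (\<rho> ^^ d) i"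
        have ba: "b = \<rho> a" using \<open>b = _\<close> d a_def by simp
        have a1: "1 \<le> a" using ba b(1) by (cases a) auto
        have "\<not> P a (q + 1)"
        proof
          assume "P a (q + 1)"
          then have "\<beta> i \<le> q + 1 \<or> (\<rho> ^^ (\<beta> i - (q + 1) - 1)) i < a" using i(1) unfolding P_def by blast
          moreover have "\<beta> i - (q + 1) - 1 = d" using d by linarith
          ultimately show False using d a_def by auto
        qed
        then have "nn a > q + 1" using le_iff[of a "q+1"] by simp
        moreover have "nn (a + 1) \<le> q + 1"
        proof -
          have "nn (a + 1) \<le> nn (\<rho> (a + 1)) + 1" by (rule sub)
          also have "nn (\<rho> (a + 1)) \<le> nn (b + 1)"
          proof (rule anti)
            have "\<rho> a < \<rho> (a + 1)" by (subst rho_less_iff) simp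
            then show "b + 1 \<le> \<rho> (a + 1)" unfolding ba by linarith
          qed
          finally show ?thesis by (simp add: q_def)
        qed
        ultimately have "a \<in> ?J" using a1 by simp
        then show False using b(3) ba by blast
      qed
    qed
  qed
  moreover have "\<forall>i\<in>I. jump_beta ?J i = \<beta> i" using bt nnI I1 by auto
  ultimately show ?thesis using sp by blast
qed

end

section \<open>Filtered groups of units and their characters\<close>

text \<open>The groups consist of nonzero elements of a field, so that group operations are field
  operations. By the convention \<open>U 0 = U 1\<close> the index 0 denotes the whole
  group.\<close>

locale unit_filt = shift \<rho> for \<rho> +
  fixes U :: "nat \<Rightarrow> 'a::field set" and p :: nat
  assumes prime_p: "prime p"
    and U_nonzero: "x \<in> U k \<Longrightarrow> x \<noteq> 0"
    and U_one: "1 \<in> U k"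
    and U_mult: "x \<in> U k \<Longrightarrow> y \<in> U k \<Longrightarrow> x * y \<in> U k"
    and U_inverse: "x \<in> U k \<Longrightarrow> inverse x \<in> U k"
    and U_antimono: "k \<le> l \<Longrightarrow> U l \<subseteq> U k"
    and U_0: "U 0 = U 1"
    and U_pow_p: "x \<in> U k \<Longrightarrow> x ^ p \<in> U (\<rho> k)"
begin

lemma p_gt_1: "1 < int p" "0 < int p" "int p \<noteq> 0"
  using prime_gt_1_nat[OF prime_p] by auto

lemma U_in_0: "x \<in> U k \<Longrightarrow> x \<in> U 0"
  using U_antimono[of 0 k] by auto

lemma U_divide: "x \<in> U k \<Longrightarrow> y \<in> U k \<Longrightarrow> x / y \<in> U k"
  using U_mult[OF _ U_inverse] by (simp add: divide_inverse)

lemma U_power: "x \<in> U k \<Longrightarrow> x ^ n \<in> U k"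
  by (induction n) (auto intro: U_one U_mult)

lemma U_powi: "x \<in> U k \<Longrightarrow> x powi n \<in> U k"
  by (auto simp: power_int_def intro: U_power U_inverse)

lemma U_prod: "(\<And>g. g \<in> S \<Longrightarrow> w g \<in> U k) \<Longrightarrow> prod w S \<in> U k"
  by (induction S rule: infinite_finite_induct) (auto intro: U_one U_mult)

lemma U_divide_cancel: "x / y \<in> U k \<Longrightarrow> y \<in> U k \<Longrightarrow> x \<in> U k"
  using U_mult[of "x / y" k y] U_nonzero[of y k] by auto

lemma U_divide_cancel2: "x / y \<in> U k \<Longrightarrow> x \<in> U k \<Longrightarrow> y \<in> U k"
  using U_divide[of x k "x / y"] U_nonzero[of "x / y" k] U_nonzero[of x k] by auto

lemma U_divide_trans: "x / y \<in> U k \<Longrightarrow> y / z \<in> U k \<Longrightarrow> x / z \<in> U k"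
  using U_mult[of "x / y" k "y / z"] U_nonzero[of "x / y" k] by auto

lemma U_divide_sym: "x / y \<in> U k \<Longrightarrow> y / x \<in> U k"
  using U_inverse[of "x / y" k] by (simp add: field_simps)

lemma U_pow_pow: "x \<in> U k \<Longrightarrow> x ^ (p ^ c) \<in> U ((\<rho> ^^ c) k)"
proof (induction c)
  case (Suc c)
  then have "(x ^ (p ^ c)) ^ p \<in> U (\<rho> ((\<rho> ^^ c) k))" by (intro U_pow_p) auto
  then show ?case by (simp add: power_mult[symmetric] mult.commute)
qed simp

text \<open>For \<open>i \<ge> 1\<close> this says that \<open>a\<close> has weight at least
  \<open>k\<close> in the cyclic module with generator of weight \<open>i\<close>, that is
  \<open>(\<rho> ^^ ord a) i \<ge> k\<close>. Divisibility avoids a separate case for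
  \<open>a = 0\<close>.\<close>

definition dv :: "nat \<Rightarrow> nat \<Rightarrow> int \<Rightarrow> bool" where
  "dv i k a \<longleftrightarrow> (\<forall>c. (\<rho> ^^ c) i < k \<longrightarrow> int p ^ (c + 1) dvd a)"

lemma dv_add: "dv i k a \<Longrightarrow> dv i k b \<Longrightarrow> dv i k (a + b)"
  and dv_diff: "dv i k a \<Longrightarrow> dv i k b \<Longrightarrow> dv i k (a - b)"
  and dv_mult: "dv i k b \<Longrightarrow> dv i k (a * b)"
  and dv_zero: "dv i k 0"
  and dv_antimono: "k \<le> l \<Longrightarrow> dv i l a \<Longrightarrow> dv i k a"
  and dv_trivial: "k \<le> i \<Longrightarrow> dv i k a"
  using pow_ge[of i] by (auto simp: dv_def intro: le_less_trans) (metis dual_order.trans leD)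

text \<open>Multiplication by \<open>p\<close> is one step along the chain of \<open>i\<close>: the
  condition at \<open>c\<close> for \<open>a\<close> is the one at \<open>c + 1\<close> for
  \<open>p * a\<close>, and for \<open>p * a\<close> the condition at 0 is automatic.\<close>

lemma dv_p_iff: "dv i (\<rho> k) (int p * a) \<longleftrightarrow> dv i k a"
proof
  assume a: "dv i k a"
  show "dv i (\<rho> k) (int p * a)"
    unfolding dv_def
  proof (intro allI impI)
    fix c assume "(\<rho> ^^ c) i < \<rho> k"
    then show "int p ^ (c + 1) dvd int p * a" using a by (cases c) (auto simp: dv_def)
  qed
next
  assume a: "dv i (\<rho> k) (int p * a)"
  show "dv i k a"
    unfolding dv_def
  proof (intro allI impI)
    fix c assume "(\<rho> ^^ c) i < k"
    then have "(\<rho> ^^ Suc c) i < \<rho> k" by simp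
    then have "int p ^ (Suc c + 1) dvd int p * a" using a unfolding dv_def by blast
    then show "int p ^ (c + 1) dvd a" using p_gt_1 by simp
  qed
qed

lemma dv_pow: "int p ^ c dvd a \<Longrightarrow> dv i ((\<rho> ^^ c) i) a"
  unfolding dv_def
proof (intro allI impI)
  fix d assume "int p ^ c dvd a" "(\<rho> ^^ d) i < (\<rho> ^^ c) i"
  then have "d < c" using pow_mono_exp[of c d i] by (metis leD not_le_imp_less)
  then have "int p ^ (d + 1) dvd int p ^ c" by (intro le_imp_power_dvd) simp
  then show "int p ^ (d + 1) dvd a" using \<open>int p ^ c dvd a\<close> by (rule dvd_trans)
qed

text \<open>The least \<open>c\<close> at which the chain of \<open>i\<close> reaches
  \<open>k\<close> condenses the family of conditions into one divisibility.\<close>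

lemma dv_witness:
  assumes "dv i k a" "1 \<le> i"
  obtains c where "k \<le> (\<rho> ^^ c) i" "int p ^ c dvd a" "\<And>d. d < c \<Longrightarrow> (\<rho> ^^ d) i < k"
proof -
  have ex: "\<exists>c. k \<le> (\<rho> ^^ c) i" using pow_ge_add[OF assms(2), of k] by (intro exI[of _ k]) linarith
  define c where "c = (LEAST c. k \<le> (\<rho> ^^ c) i)"
  have 1: "k \<le> (\<rho> ^^ c) i" unfolding c_def by (rule LeastI_ex[OF ex])
  have 2: "(\<rho> ^^ d) i < k" if "d < c" for d using not_less_Least[OF that[unfolded c_def]] by simp
  have "int p ^ c dvd a"
  proof (cases c)
    case (Suc d)
    then show ?thesis using 2[of d] assms(1) by (auto simp: dv_def)
  qed simp
  with 1 2 that show ?thesis by blast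
qed

lemma U_powi_dv:
  assumes "x \<in> U i" "1 \<le> i" "dv i k a"
  shows "x powi a \<in> U k"
proof -
  obtain c where c: "k \<le> (\<rho> ^^ c) i" "int p ^ c dvd a" using dv_witness[OF assms(3,2)] by blast
  then obtain b where b: "a = int (p ^ c) * b" by auto
  have "x powi a = (x ^ (p ^ c)) powi b" unfolding b power_int_mult power_int_of_nat by (rule refl)
  also have "\<dots> \<in> U ((\<rho> ^^ c) i)" by (intro U_powi U_pow_pow assms)
  finally show ?thesis using U_antimono[OF c(1)] by blast
qed

text \<open>An integer representative of a character with values killed by \<open>p^N\<close>:
  \<open>h x\<close> stands for the class of \<open>h x / p^N\<close>, and the second clause is
  continuity.\<close>

definition ichar :: "nat \<Rightarrow> ('a \<Rightarrow> int) \<Rightarrow> bool" where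
  "ichar N h \<longleftrightarrow> (\<forall>x\<in>U 0. \<forall>y\<in>U 0. int p ^ N dvd h (x * y) - h x - h y) \<and>
     (\<exists>n. \<forall>x\<in>U n. int p ^ N dvd h x)"

definition rank :: "nat \<Rightarrow> ('a \<Rightarrow> int) \<Rightarrow> nat \<Rightarrow> nat" where
  "rank N h k = (LEAST n. \<forall>x\<in>U k. int p ^ N dvd int p ^ n * h x)"

definition ijumps :: "nat \<Rightarrow> ('a \<Rightarrow> int) \<Rightarrow> nat set" where
  "ijumps N h = {k. 1 \<le> k \<and> rank N h k \<noteq> rank N h (k + 1)}"

lemma rank_le_iff: "rank N h k \<le> n \<longleftrightarrow> (\<forall>x\<in>U k. int p ^ N dvd int p ^ n * h x)"
proof
  have *: "\<forall>x\<in>U k. int p ^ N dvd int p ^ rank N h k * h x"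
    unfolding rank_def by (rule LeastI[of _ N]) simp
  assume "rank N h k \<le> n"
  then have "int p ^ rank N h k dvd int p ^ n" by (rule le_imp_power_dvd)
  then show "\<forall>x\<in>U k. int p ^ N dvd int p ^ n * h x" using * by (meson dvd_trans mult_dvd_mono dvd_refl)
qed (simp add: rank_def Least_le)

lemma rank_antimono: "k \<le> l \<Longrightarrow> rank N h l \<le> rank N h k"
  using rank_le_iff[of N h k "rank N h k"] U_antimono[of k l] by (subst rank_le_iff) auto

lemma dvd_cong: "q dvd a - b \<Longrightarrow> q dvd c * a \<longleftrightarrow> q dvd c * b" for a b c q :: int
proof -
  assume "q dvd a - b"
  then have "q dvd c * (a - b)" by simp
  then show ?thesis using dvd_add_right_iff[of q "c * (a - b)" "c * b"] by (simp add: algebra_simps)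
qed

context
  fixes N h assumes h: "ichar N h"
begin

lemma ichar_mult: "x \<in> U 0 \<Longrightarrow> y \<in> U 0 \<Longrightarrow> int p ^ N dvd h (x * y) - h x - h y"
  using h by (simp add: ichar_def)

lemma ichar_one: "int p ^ N dvd h 1"
  using h U_one by (auto simp: ichar_def)

lemma ichar_power: "x \<in> U 0 \<Longrightarrow> int p ^ N dvd h (x ^ n) - int n * h x"
proof (induction n)
  case 0
  then show ?case using ichar_one by simp
next
  case (Suc n)
  have "int p ^ N dvd (h (x * x ^ n) - h x - h (x ^ n)) + (h (x ^ n) - int n * h x)"
    using ichar_mult[of x "x ^ n"] Suc U_power[of x 0 n] by (intro dvd_add) auto
  then show ?case by (simp add: algebra_simps)
qed

lemma ichar_divide: "x \<in> U 0 \<Longrightarrow> y \<in> U 0 \<Longrightarrow> int p ^ N dvd h (x / y) - (h x - h y)"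
proof -
  assume xy: "x \<in> U 0" "y \<in> U 0"
  then have "int p ^ N dvd h x - h (x / y) - h y"
    using ichar_mult[of "x / y" y] U_divide[of x 0 y] U_nonzero[of y 0] by simp
  then have "int p ^ N dvd - (h x - h (x / y) - h y)" by (simp only: dvd_minus_iff)
  then show ?thesis by (simp add: algebra_simps)
qed

text \<open>Since \<open>p\<close>-th powers of \<open>U k\<close> lie in
  \<open>U (\<rho> k)\<close>, one more factor \<open>p\<close> than is needed there kills
  \<open>U k\<close>. This makes \<open>rank N h\<close> a counting function in the abstract sense
  above.\<close>

lemma ichar_rank_rho: "rank N h k \<le> rank N h (\<rho> k) + 1"
  unfolding rank_le_iff
proof
  fix x assume x: "x \<in> U k"
  have "int p ^ N dvd int p ^ rank N h (\<rho> k) * h (x ^ p)"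
    using rank_le_iff[of N h "\<rho> k" "rank N h (\<rho> k)"] U_pow_p[OF x] by simp
  then have "int p ^ N dvd int p ^ rank N h (\<rho> k) * (int p * h x)"
    using dvd_cong[OF ichar_power[OF U_in_0[OF x], of p]] by blast
  then show "int p ^ N dvd int p ^ (rank N h (\<rho> k) + 1) * h x" by (simp add: mult_ac)
qed

lemma ichar_rank_zero: "\<exists>M. rank N h M = 0"
proof -
  obtain M where "\<forall>x\<in>U M. int p ^ N dvd h x" using h by (auto simp: ichar_def)
  then have "rank N h M \<le> 0" by (subst rank_le_iff) simp
  then show ?thesis by auto
qed

lemma ijumps_spaced: "spaced (ijumps N h)"
proof -
  obtain M where "rank N h M = 0" using ichar_rank_zero by blast
  then show ?thesis unfolding ijumps_def
    by (intro rank_set_spaced[of "rank N h" M] rank_antimono ichar_rank_rho)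
qed

lemma ijumps_beta: "1 \<le> k \<Longrightarrow> jump_beta (ijumps N h) k = rank N h k"
proof -
  assume k: "1 \<le> k"
  obtain M where "rank N h M = 0" using ichar_rank_zero by blast
  then show ?thesis unfolding ijumps_def
    by (intro rank_set_beta[of "rank N h" M] rank_antimono ichar_rank_rho k)
qed

lemma ijumps_step: "k \<in> ijumps N h \<Longrightarrow> rank N h k = rank N h (k + 1) + 1"
proof -
  assume k: "k \<in> ijumps N h"
  obtain M where M: "rank N h M = 0" using ichar_rank_zero by blast
  have "rank N h k = rank N h (k + 1) + 1 \<and> rank N h (\<rho> k) = rank N h (k + 1)"
    by (rule rank_step[of "rank N h" M]) (use k M in \<open>auto intro: rank_antimono ichar_rank_rho simp: ijumps_def simp del: One_nat_def\<close>)
  then show ?thesis by simp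
qed

text \<open>If \<open>U (\<rho> i)\<close> consists of \<open>p\<close>-th powers modulo the next
  level, a jump at \<open>\<rho> i\<close> is inherited from a jump at \<open>i\<close> and does not
  start a chain.\<close>

lemma ijumps_I_subset:
  assumes surj: "\<And>i x. 1 \<le> i \<Longrightarrow> \<rho> i \<notin> X \<Longrightarrow> x \<in> U (\<rho> i) \<Longrightarrow> \<exists>y\<in>U i. x / y ^ p \<in> U (\<rho> i + 1)"
  shows "jump_I \<rho> (ijumps N h) \<subseteq> T \<rho> \<union> X"
proof
  fix b assume b: "b \<in> jump_I \<rho> (ijumps N h)"
  then have bJ: "b \<in> ijumps N h" and bI: "b \<notin> \<rho> ` ijumps N h" by (auto simp: jump_I_def)
  show "b \<in> T \<rho> \<union> X"
  proof (rule ccontr)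
    assume nb: "b \<notin> T \<rho> \<union> X"
    have b1: "1 \<le> b" using bJ by (simp add: ijumps_def)
    with nb obtain i where i: "1 \<le> i" "b = \<rho> i" by (auto simp: T_def)
    define q where "q = rank N h (b + 1)"
    have rb: "rank N h b = q + 1" using ijumps_step[OF bJ] q_def by simp
    then have "\<not> rank N h b \<le> q" by simp
    then obtain x where x: "x \<in> U b" "\<not> int p ^ N dvd int p ^ q * h x" unfolding rank_le_iff by blast
    obtain y where y: "y \<in> U i" "x / y ^ p \<in> U (b + 1)" using surj[of i x] i nb x by auto
    have yp: "y ^ p \<in> U 0" "x \<in> U 0" "y \<in> U 0" using y(1) x(1) U_power U_in_0 by blast+
    have "int p ^ N dvd int p ^ q * h (x / y ^ p)" using rank_le_iff[of N h "b+1" q] y(2) q_def by simp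
    then have "int p ^ N dvd int p ^ q * (h x - h (y ^ p))" using dvd_cong[OF ichar_divide[OF yp(2,1)]] by simp
    then have "int p ^ N dvd int p ^ q * h x - int p ^ q * h (y ^ p)" by (simp add: algebra_simps)
    then have "\<not> int p ^ N dvd int p ^ q * h (y ^ p)" using x(2) dvd_add[of "int p ^ N" "int p ^ q * h x - int p ^ q * h (y ^ p)" "int p ^ q * h (y ^ p)"] by auto
    then have "\<not> int p ^ N dvd int p ^ q * (int p * h y)" using dvd_cong[OF ichar_power[OF yp(3), of p]] by simp
    then have "\<not> int p ^ N dvd int p ^ (q + 1) * h y" by (simp add: mult_ac)
    then have "\<not> rank N h i \<le> q + 1" using y(1) rank_le_iff by blast
    \<comment> \<open>The \<open>p\<close>-th powers of \<open>U (i + 1)\<close> lie beyond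
      \<open>\<rho> i\<close>, where \<open>p^q\<close> already kills the character; so the fall
      found at \<open>i\<close> is not delayed.\<close>
    moreover have "rank N h (i + 1) \<le> q + 1"
    proof -
      have "\<rho> i < \<rho> (i + 1)" by (subst rho_less_iff) simp
      then have "rank N h (\<rho> (i + 1)) \<le> q" unfolding q_def i(2) by (intro rank_antimono) linarith
      then show ?thesis using ichar_rank_rho[of "i + 1"] by linarith
    qed
    ultimately have "i \<in> ijumps N h" using i(1) by (simp add: ijumps_def)
    then show False using bI i(2) by blast
  qed
qed

end

definition unitv :: "'g \<Rightarrow> 'g \<Rightarrow> int" where
  "unitv g = (\<lambda>x. if x = g then 1 else 0)"

lemma additive_mod_scale:
  fixes H :: "('g \<Rightarrow> int) \<Rightarrow> int"
  assumes "\<And>a b. q dvd H (\<lambda>x. a x + b x) - H a - H b"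
  shows "q dvd H (\<lambda>x. m * a x) - m * H a"
proof (induction m rule: int_induct[of _ 0])
  case base
  show ?case using assms[of "\<lambda>x. 0" "\<lambda>x. 0"] by (simp add: dvd_minus_iff)
next
  case (step1 i)
  have "q dvd (H (\<lambda>x. i * a x + a x) - H (\<lambda>x. i * a x) - H a) + (H (\<lambda>x. i * a x) - i * H a)"
    using step1 assms by (intro dvd_add) auto
  then show ?case by (simp add: algebra_simps)
next
  case (step2 i)
  have "q dvd (H (\<lambda>x. i * a x) - i * H a) - (H (\<lambda>x. (i - 1) * a x + a x) - H (\<lambda>x. (i - 1) * a x) - H a)"
    by (rule dvd_diff[OF step2(2) assms])
  then show ?case by (simp add: algebra_simps)
qed

lemma additive_mod_expand:
  fixes H :: "('g \<Rightarrow> int) \<Rightarrow> int"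
  assumes add: "\<And>a b. q dvd H (\<lambda>x. a x + b x) - H a - H b" and "finite S"
  shows "q dvd H (\<lambda>x. if x \<in> S then a x else 0) - (\<Sum>g\<in>S. a g * H (unitv g))"
  using assms(2)
proof (induction S)
  case empty
  show ?case using add[of "\<lambda>x. 0" "\<lambda>x. 0"] by (simp add: dvd_minus_iff)
next
  case (insert s S)
  let ?r = "\<lambda>S x. if x \<in> S then a x else 0"
  have "?r (insert s S) = (\<lambda>x. ?r S x + a s * unitv s x)" using insert.hyps by (auto simp: unitv_def fun_eq_iff)
  then have "q dvd H (?r (insert s S)) - H (?r S) - H (\<lambda>x. a s * unitv s x)" using add[of "?r S" "\<lambda>x. a s * unitv s x"] by simp
  then have "q dvd (H (?r (insert s S)) - H (?r S) - H (\<lambda>x. a s * unitv s x))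
      + (H (\<lambda>x. a s * unitv s x) - a s * H (unitv s)) + (H (?r S) - (\<Sum>g\<in>S. a g * H (unitv g)))"
    using additive_mod_scale[of q H "a s" "unitv s"] add insert.IH by (intro dvd_add) auto
  then show ?case using insert.hyps by (simp add: algebra_simps)
qed

end

text \<open>\<open>F a\<close> stands for the product of the generators raised to the powers \<open>a\<close>. The exponents are
  integers, not p-adic integers; generation and relations are therefore only required modulo every \<open>U n\<close>.\<close>

locale gen_system = unit_filt \<rho> U p for \<rho> and U :: "nat \<Rightarrow> 'a::field set" and p +
  fixes G :: "'g set" and wt :: "'g \<Rightarrow> nat" and F :: "('g \<Rightarrow> int) \<Rightarrow> 'a"
  assumes fin_G: "finite G" and wt_pos: "g \<in> G \<Longrightarrow> 1 \<le> wt g"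
    and F_add: "F (\<lambda>g. a g + b g) = F a * F b"
    and F_fil: "(\<And>g. g \<in> G \<Longrightarrow> dv (wt g) k (a g)) \<Longrightarrow> F a \<in> U k"
begin

definition vFil :: "nat \<Rightarrow> ('g \<Rightarrow> int) \<Rightarrow> bool" where
  "vFil k a \<longleftrightarrow> (\<forall>g\<in>G. dv (wt g) k (a g))"

text \<open>Generation compatible with the filtration: an element of level \<open>k\<close> is
  approximated using exponents each of which has weight at least \<open>k\<close>.\<close>

definition spans :: "nat \<Rightarrow> bool" where
  "spans n \<longleftrightarrow> (\<forall>k. \<forall>x\<in>U k. \<exists>a. vFil k a \<and> x / F a \<in> U n)"

text \<open>Modulo \<open>U n\<close> all relations are multiples of \<open>v\<close>, up to vectors
  that are trivial modulo \<open>U n\<close> by weight. That \<open>v\<close> is a relation is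
  stated separately, as \<open>F v = 1\<close>.\<close>

definition relations :: "nat \<Rightarrow> ('g \<Rightarrow> int) \<Rightarrow> bool" where
  "relations n v \<longleftrightarrow> (\<forall>a. F a \<in> U n \<longrightarrow> (\<exists>l. vFil n (\<lambda>g. a g - l * v g)))"

lemma F_vFil: "vFil k a \<Longrightarrow> F a \<in> U k"
  using F_fil by (auto simp: vFil_def)

lemma F_U0: "F a \<in> U 0"
  by (rule F_fil) (simp add: dv_def)

lemma F_nz: "F a \<noteq> 0"
  using F_U0 U_nonzero by blast

lemma F_zero: "F (\<lambda>g. 0) = 1"
  using F_add[of "\<lambda>g. 0" "\<lambda>g. 0"] F_nz[of "\<lambda>g. 0"] by simp

lemma F_diff: "F (\<lambda>g. a g - b g) = F a / F b"
  using F_add[of "\<lambda>g. a g - b g" b] F_nz[of b] by simp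

lemma F_nat_scale: "F (\<lambda>g. int m * a g) = F a ^ m"
proof (induction m)
  case (Suc m)
  have "F (\<lambda>g. int (Suc m) * a g) = F (\<lambda>g. a g + int m * a g)" by (simp add: algebra_simps)
  then show ?case using Suc by (simp add: F_add)
qed (simp add: F_zero)

lemma F_scale: "F (\<lambda>g. m * a g) = F a powi m"
proof (cases m)
  case (nonneg n)
  then show ?thesis by (simp add: F_nat_scale)
next
  case (neg n)
  have "F (\<lambda>g. 0 - int (Suc n) * a g) = F (\<lambda>g. 0) / F a ^ Suc n" by (simp only: F_diff F_nat_scale)
  moreover have "(\<lambda>g. m * a g) = (\<lambda>g. 0 - int (Suc n) * a g)" unfolding neg by (simp only: diff_0 mult_minus_left)
  moreover have "F a powi m = inverse (F a ^ Suc n)" unfolding neg by (simp only: power_int_minus power_int_of_nat)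
  ultimately show ?thesis by (simp only: F_zero divide_inverse mult_1_left)
qed

lemma vFil_diff: "vFil k a \<Longrightarrow> vFil k b \<Longrightarrow> vFil k (\<lambda>g. a g - b g)"
  and vFil_add: "vFil k a \<Longrightarrow> vFil k b \<Longrightarrow> vFil k (\<lambda>g. a g + b g)"
  and vFil_scale: "vFil k a \<Longrightarrow> vFil k (\<lambda>g. m * a g)"
  and vFil_antimono: "k \<le> l \<Longrightarrow> vFil l a \<Longrightarrow> vFil k a"
  and vFil_0: "vFil 0 a"
  by (auto simp: vFil_def intro: dv_diff dv_add dv_mult dv_antimono) (simp add: dv_def)

lemma vFil_unitv: "g \<in> G \<Longrightarrow> vFil (wt g) (unitv g)"
  by (auto simp: vFil_def unitv_def intro: dv_trivial dv_zero)

text \<open>\<open>F\<close> takes vectors over the whole index type. The coordinates outside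
  \<open>G\<close> are split off: they meet every weight condition vacuously, so their product lies
  in all \<open>U n\<close>, in particular in one that the character kills.\<close>

lemma ichar_expand:
  assumes h: "ichar N h"
  shows "int p ^ N dvd h (F a) - (\<Sum>g\<in>G. a g * h (F (unitv g)))"
proof -
  have add: "int p ^ N dvd h (F (\<lambda>x. a x + b x)) - h (F a) - h (F b)" for a b
    unfolding F_add by (rule ichar_mult[OF h F_U0 F_U0])
  let ?r = "\<lambda>x. if x \<in> G then a x else 0" and ?s = "\<lambda>x. if x \<in> G then 0 else a x"
  obtain n where n: "\<forall>x\<in>U n. int p ^ N dvd h x" using h by (auto simp: ichar_def)
  have "F ?s \<in> U n" by (rule F_fil) (simp add: dv_zero)
  then have s: "int p ^ N dvd h (F ?s)" using n by blast
  have "a = (\<lambda>x. ?r x + ?s x)" by auto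
  then have "int p ^ N dvd h (F a) - h (F ?r) - h (F ?s)" using add[of ?r ?s] by simp
  then have "int p ^ N dvd (h (F a) - h (F ?r) - h (F ?s)) + h (F ?s) + (h (F ?r) - (\<Sum>g\<in>G. a g * h (F (unitv g))))"
    using additive_mod_expand[of "int p ^ N" "\<lambda>a. h (F a)" G a] add fin_G s by (intro dvd_add) auto
  then show ?thesis by (simp add: algebra_simps)
qed

text \<open>The values \<open>y g\<close> define an additive map \<open>Y\<close> on exponent
  vectors. It descends to the group modulo \<open>U n\<close>, because relations are multiples of
  \<open>v\<close> up to vectors of weight \<open>n\<close>, and \<open>Y\<close> kills those since
  \<open>A\<close> lies below \<open>n\<close>. The upper bounds on the orders of the
  \<open>y g\<close> keep the rank below the count; the lower bounds at the starts of chains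
  propagate along the chains.\<close>

lemma ichar_realization:
  assumes sp: "spans n" and rel: "relations n v" and A: "spaced A" and An: "\<And>a. a \<in> A \<Longrightarrow> a < n"
    and y1: "\<And>g. g \<in> G \<Longrightarrow> int p ^ N dvd int p ^ jump_beta A (wt g) * y g"
    and y2: "\<And>j. j \<in> jump_I \<rho> A \<Longrightarrow> \<exists>g\<in>G. wt g = j \<and> \<not> int p ^ N dvd int p ^ (jump_beta A j - 1) * y g"
    and y3: "int p ^ N dvd (\<Sum>g\<in>G. v g * y g)"
  shows "\<exists>h. ichar N h \<and> ijumps N h = A"
proof -
  have fin: "finite A" using A by (simp add: spaced_def)
  define Y where "Y a = (\<Sum>g\<in>G. a g * y g)" for a
  have Y_diff: "Y (\<lambda>g. a g - b g) = Y a - Y b" for a b by (simp add: Y_def algebra_simps sum_subtractf)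
  have Y_add: "Y (\<lambda>g. a g + b g) = Y a + Y b" for a b by (simp add: Y_def algebra_simps sum.distrib)
  have Y_scale: "Y (\<lambda>g. l * a g) = l * Y a" for l a by (simp add: Y_def sum_distrib_left mult.assoc)
  have Y_fil: "int p ^ N dvd int p ^ jump_beta A k * Y a" if a: "vFil k a" for k a
    unfolding Y_def sum_distrib_left
  proof (rule dvd_sum)
    fix g assume g: "g \<in> G"
    have "dv (wt g) k (a g)" using a g by (simp add: vFil_def)
    then obtain c where c: "k \<le> (\<rho> ^^ c) (wt g)" "int p ^ c dvd a g" "\<And>d. d < c \<Longrightarrow> (\<rho> ^^ d) (wt g) < k"
      using dv_witness wt_pos[OF g] by blast
    have "jump_beta A (wt g) \<le> jump_beta A k + c"
    proof (cases c)
      case 0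
      then show ?thesis using c(1) jump_beta_antimono[OF fin, of k "wt g"] by simp
    next
      case (Suc d)
      have "jump_beta A (wt g) \<le> jump_beta A ((\<rho> ^^ c) (wt g)) + c" by (rule jump_beta_pow[OF A])
      also have "jump_beta A ((\<rho> ^^ c) (wt g)) \<le> jump_beta A k" by (rule jump_beta_antimono[OF fin c(1)])
      finally show ?thesis by simp
    qed
    then have "int p ^ jump_beta A (wt g) dvd int p ^ (jump_beta A k + c)" by (rule le_imp_power_dvd)
    then have "int p ^ N dvd int p ^ (jump_beta A k + c) * y g" using y1[OF g] by (meson dvd_trans mult_dvd_mono dvd_refl)
    moreover have "int p ^ (jump_beta A k + c) * y g dvd int p ^ jump_beta A k * (a g * y g)"
      unfolding power_add mult.assoc using c(2) by (intro mult_dvd_mono) auto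
    ultimately show "int p ^ N dvd int p ^ jump_beta A k * (a g * y g)" by (rule dvd_trans)
  qed
  have betan: "jump_beta A n = 0"
  proof -
    have "\<not> 1 \<le> jump_beta A n" unfolding jump_beta_pos[OF fin] using An by fastforce
    then show ?thesis by simp
  qed
  have Y_rel: "int p ^ N dvd Y a" if Fa: "F a \<in> U n" for a
  proof -
    obtain l where l: "vFil n (\<lambda>g. a g - l * v g)" using rel Fa unfolding relations_def by blast
    have "int p ^ N dvd Y (\<lambda>g. a g - l * v g)" using Y_fil[OF l] betan by simp
    then have "int p ^ N dvd Y a - l * Y v" by (simp only: Y_diff Y_scale)
    moreover have "int p ^ N dvd l * Y v" using y3 by (simp add: Y_def)
    ultimately have "int p ^ N dvd (Y a - l * Y v) + l * Y v" by (rule dvd_add)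
    then show ?thesis by simp
  qed
  \<comment> \<open>An arbitrary approximation of \<open>x\<close> modulo \<open>U n\<close>; two
    choices differ by a relation, so \<open>h x\<close> is determined modulo
    \<open>p^N\<close>.\<close>
  define h where "h x = Y (SOME a. x / F a \<in> U n)" for x
  have h_eq: "int p ^ N dvd h x - Y a" if x: "x / F a \<in> U n" for x a
  proof -
    let ?b = "SOME a. x / F a \<in> U n"
    have b: "x / F ?b \<in> U n" by (rule someI[of "\<lambda>a. x / F a \<in> U n"]) (rule x)
    have "F ?b / F a \<in> U n" using U_divide_trans[OF U_divide_sym[OF b] x] .
    then have "F (\<lambda>g. ?b g - a g) \<in> U n" by (simp add: F_diff)
    from Y_rel[OF this] show ?thesis by (simp add: Y_diff h_def)
  qed
  have ex: "\<exists>a. vFil k a \<and> x / F a \<in> U n" if "x \<in> U k" for x k using sp that by (simp add: spans_def)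
  have char: "ichar N h"
    unfolding ichar_def
  proof (intro conjI ballI exI)
    fix x z assume "x \<in> U 0" "z \<in> U 0"
    then obtain a b where ab: "x / F a \<in> U n" "z / F b \<in> U n" using ex by blast
    have "(x * z) / F (\<lambda>g. a g + b g) \<in> U n" using U_mult[OF ab] by (simp add: F_add)
    note e = h_eq[OF this] h_eq[OF ab(1)] h_eq[OF ab(2)]
    have "int p ^ N dvd (h (x * z) - Y (\<lambda>g. a g + b g)) - (h x - Y a) - (h z - Y b)"
      by (intro dvd_diff[OF dvd_diff[OF e(1,2)] e(3)])
    then show "int p ^ N dvd h (x * z) - h x - h z" by (simp add: Y_add algebra_simps)
  next
    fix x assume "x \<in> U n"
    then have "x / F (\<lambda>g. 0) \<in> U n" by (simp add: F_zero)
    from h_eq[OF this] show "int p ^ N dvd h x" by (simp add: Y_def)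
  qed
  have up: "rank N h k \<le> jump_beta A k" for k
    unfolding rank_le_iff
  proof
    fix x assume "x \<in> U k"
    then obtain a where a: "vFil k a" "x / F a \<in> U n" using ex by blast
    show "int p ^ N dvd int p ^ jump_beta A k * h x"
      using dvd_cong[OF h_eq[OF a(2)]] Y_fil[OF a(1)] by blast
  qed
  \<comment> \<open>If \<open>k\<close> is reached from the start \<open>j\<close> after
    \<open>c\<close> steps, the \<open>p^c\<close>-th power of a generator of weight
    \<open>j\<close> is an element of \<open>U k\<close> on which the character has the required
    order.\<close>
  have low: "jump_beta A k \<le> rank N h k" if k: "k \<in> A" for k
  proof -
    obtain j c where j: "j \<in> jump_I \<rho> A" "k = (\<rho> ^^ c) j" "jump_beta A j = jump_beta A k + c"
      using chain_start[OF A k] by blast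
    obtain g where g: "g \<in> G" "wt g = j" "\<not> int p ^ N dvd int p ^ (jump_beta A j - 1) * y g" using y2[OF j(1)] by blast
    have kpos: "1 \<le> jump_beta A k" using jump_beta_pos[OF fin] k by blast
    define a where "a = (\<lambda>x. int p ^ c * unitv g x)"
    have "vFil k a" unfolding vFil_def a_def unitv_def using j g by (auto intro: dv_pow dv_zero)
    have "F a / F a \<in> U n" using F_nz U_one by simp
    from h_eq[OF this] have he: "int p ^ N dvd h (F a) - Y a" .
    have "Y a = int p ^ c * y g"
    proof -
      have "Y (unitv g) = (\<Sum>x\<in>G. if x = g then y g else 0)" unfolding Y_def by (rule sum.cong) (auto simp: unitv_def)
      also have "\<dots> = y g" using g(1) fin_G by simp
      finally show ?thesis by (simp add: a_def Y_scale)
    qed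
    moreover have "int p ^ (jump_beta A j - 1) = int p ^ (jump_beta A k - 1) * int p ^ c"
      using kpos j(3) by (simp flip: power_add)
    ultimately have "\<not> int p ^ N dvd int p ^ (jump_beta A k - 1) * Y a" using g(3) by (simp add: mult.assoc)
    then have "\<not> int p ^ N dvd int p ^ (jump_beta A k - 1) * h (F a)" using dvd_cong[OF he] by blast
    then have "\<not> rank N h k \<le> jump_beta A k - 1" unfolding rank_le_iff using F_vFil[OF \<open>vFil k a\<close>] by blast
    then show ?thesis by linarith
  qed
  have eq: "rank N h k = jump_beta A k" for k
  proof (rule order_antisym[OF up])
    show "jump_beta A k \<le> rank N h k"
    proof (cases "jump_beta A k = 0")
      case False
      then obtain a where a: "a \<in> A" "k \<le> a" "jump_beta A a = jump_beta A k"
        using jump_beta_attained[OF fin, of "jump_beta A k" k] by auto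
      then show ?thesis using low[OF a(1)] rank_antimono[OF a(2), of N h] by simp
    qed simp
  qed
  have "ijumps N h = A"
    unfolding ijumps_def eq using in_iff_jump_beta[OF fin] A by (auto simp: spaced_def)
  with char show ?thesis by blast
qed

text \<open>The converse of \<open>ichar_realization\<close>. For the second claim, an element of
  \<open>U j\<close> of maximal order under the character is expanded in generators. One term must
  survive, and if its generator had a weight other than \<open>j\<close>, then \<open>j\<close>
  would not start a chain.\<close>

lemma ichar_necessary:
  assumes sp: "\<And>n. spans n" and h: "ichar N h" and A: "A = ijumps N h"
  shows "g \<in> G \<Longrightarrow> int p ^ N dvd int p ^ jump_beta A (wt g) * h (F (unitv g))"
    and "j \<in> jump_I \<rho> A \<Longrightarrow> \<exists>g\<in>G. wt g = j \<and> \<not> int p ^ N dvd int p ^ (jump_beta A j - 1) * h (F (unitv g))"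
    and "F v = 1 \<Longrightarrow> int p ^ N dvd (\<Sum>g\<in>G. v g * h (F (unitv g)))"
proof -
  note bt = ijumps_beta[OF h, folded A]
  have spA: "spaced A" using ijumps_spaced[OF h] A by simp
  have fin: "finite A" using spA by (simp add: spaced_def)
  show n1: "int p ^ N dvd int p ^ jump_beta A (wt g) * h (F (unitv g))" if g: "g \<in> G" for g
    unfolding bt[OF wt_pos[OF g]] using rank_le_iff[of N h "wt g"] F_vFil[OF vFil_unitv[OF g]] by blast
  show "int p ^ N dvd (\<Sum>g\<in>G. v g * h (F (unitv g)))" if "F v = 1"
    using dvd_diff[OF ichar_one[OF h] ichar_expand[OF h, of v]] that by simp
  show "\<exists>g\<in>G. wt g = j \<and> \<not> int p ^ N dvd int p ^ (jump_beta A j - 1) * h (F (unitv g))" if j: "j \<in> jump_I \<rho> A"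
  proof -
    have jA: "j \<in> A" and jr: "j \<notin> \<rho> ` A" using j by (auto simp: jump_I_def)
    have j1: "1 \<le> j" using jA spA by (auto simp: spaced_def)
    have bpos: "1 \<le> jump_beta A j" by (rule jump_beta_I_pos[OF spA j])
    define q where "q = jump_beta A j - 1"
    have "\<not> rank N h j \<le> q" using bt[OF j1] bpos q_def by simp
    then obtain x where x: "x \<in> U j" "\<not> int p ^ N dvd int p ^ q * h x" unfolding rank_le_iff by blast
    obtain n where n: "\<forall>x\<in>U n. int p ^ N dvd h x" using h by (auto simp: ichar_def)
    obtain a where a: "vFil j a" "x / F a \<in> U n" using sp[of n] x(1) unfolding spans_def by blast
    have "int p ^ N dvd h (x / F a) - (h x - h (F a))" by (rule ichar_divide[OF h U_in_0[OF x(1)] F_U0])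
    moreover have "int p ^ N dvd h (x / F a)" using n a(2) by blast
    ultimately have "int p ^ N dvd h (x / F a) - (h (x / F a) - (h x - h (F a)))" by (rule dvd_diff[rotated])
    then have d1: "int p ^ N dvd h x - h (F a)" by simp
    have "int p ^ N dvd (h x - h (F a)) + (h (F a) - (\<Sum>g\<in>G. a g * h (F (unitv g))))"
      using d1 ichar_expand[OF h, of a] by (rule dvd_add)
    then have "int p ^ N dvd h x - (\<Sum>g\<in>G. a g * h (F (unitv g)))" by simp
    from dvd_cong[OF this] x(2) have "\<not> int p ^ N dvd int p ^ q * (\<Sum>g\<in>G. a g * h (F (unitv g)))" by blast
    moreover have "int p ^ N dvd int p ^ q * (\<Sum>g\<in>G. a g * h (F (unitv g)))"
      if "\<And>g. g \<in> G \<Longrightarrow> int p ^ N dvd int p ^ q * (a g * h (F (unitv g)))"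
      unfolding sum_distrib_left by (rule dvd_sum) (rule that)
    ultimately obtain g where g: "g \<in> G" "\<not> int p ^ N dvd int p ^ q * (a g * h (F (unitv g)))" by blast
    obtain c where c: "j \<le> (\<rho> ^^ c) (wt g)" "int p ^ c dvd a g" "\<And>d. d < c \<Longrightarrow> (\<rho> ^^ d) (wt g) < j"
      using dv_witness[of "wt g" j "a g"] a(1) g(1) wt_pos[OF g(1)] unfolding vFil_def by blast
    have gc: "\<not> int p ^ N dvd int p ^ (q + c) * h (F (unitv g))"
    proof
      assume "int p ^ N dvd int p ^ (q + c) * h (F (unitv g))"
      moreover have "int p ^ (q + c) * h (F (unitv g)) dvd int p ^ q * (a g * h (F (unitv g)))"
        unfolding power_add mult.assoc using c(2) by (intro mult_dvd_mono) auto
      ultimately show False using g(2) dvd_trans by blast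
    qed
    have big: "q + c < jump_beta A (wt g)"
    proof (rule ccontr)
      assume "\<not> ?thesis"
      then have "int p ^ jump_beta A (wt g) dvd int p ^ (q + c)" by (intro le_imp_power_dvd) simp
      then show False using n1[OF g(1)] gc by (meson dvd_trans mult_dvd_mono dvd_refl)
    qed
    have "wt g = j"
    proof (rule ccontr)
      assume ne: "wt g \<noteq> j"
      show False
      proof (cases "wt g < j")
        case False
        then have "jump_beta A (wt g) \<le> jump_beta A (Suc j)" using ne by (intro jump_beta_antimono[OF fin]) simp
        then show False using big jump_beta_step[OF fin, of j] jA q_def by simp
      next
        case True
        then have "c \<noteq> 0" using c(1) by (intro notI) simp
        have "jump_beta A j + 1 \<le> jump_beta A (wt g)" using big q_def bpos \<open>c \<noteq> 0\<close> by linarith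
        \<comment> \<open>\<open>b\<close> is the predecessor of \<open>j\<close> in
          \<open>A\<close>. The count at \<open>wt g\<close> is so large that the chain from
          \<open>wt g\<close> is still at or below \<open>b\<close> one step before it reaches
          \<open>j\<close>; hence \<open>j = \<rho> b\<close>, which is excluded.\<close>
        then obtain b where b: "b \<in> A" "wt g \<le> b" "jump_beta A b = jump_beta A j + 1"
          using jump_beta_attained[OF fin, of "jump_beta A j + 1" "wt g"] by auto
        have "b < j"
        proof (rule ccontr)
          assume "\<not> b < j"
          then have "jump_beta A b \<le> jump_beta A j" by (intro jump_beta_antimono[OF fin]) simp
          then show False using b(3) by simp
        qed
        have "(\<rho> ^^ (c - 1)) (wt g) \<le> b"
        proof (rule ccontr)
          assume "\<not> ?thesis"
          then have "jump_beta A ((\<rho> ^^ (c - 1)) (wt g)) \<le> jump_beta A (Suc b)" by (intro jump_beta_antimono[OF fin]) simp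
          then show False using jump_beta_pow[OF spA, of "wt g" "c - 1"] jump_beta_step[OF fin, of b] b big q_def bpos \<open>c \<noteq> 0\<close> by simp
        qed
        then have "(\<rho> ^^ Suc (c - 1)) (wt g) \<le> \<rho> b" by simp
        then have "j \<le> \<rho> b" using c(1) \<open>c \<noteq> 0\<close> by simp
        moreover have "\<rho> b \<le> j" using spA b(1) jA \<open>b < j\<close> by (auto simp: spaced_def)
        ultimately show False using jr b(1) by auto
      qed
    qed
    moreover have "\<not> int p ^ N dvd int p ^ q * h (F (unitv g))"
    proof
      assume "int p ^ N dvd int p ^ q * h (F (unitv g))"
      then have "int p ^ N dvd a g * (int p ^ q * h (F (unitv g)))" by simp
      then show False using g(2) by (simp add: mult.left_commute)
    qed
    ultimately show ?thesis using g(1) q_def by blast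
  qed
qed

end

section \<open>The congruence behind compatibility\<close>

text \<open>One index for each cyclic factor of the direct sum of \<open>f - 1\<close> copies of
  \<open>M_rho\<close> and one copy of \<open>M_rho_star\<close>. The last copy contains the extra
  weight and supports the relation.\<close>

definition gens :: "nat \<Rightarrow> (nat \<Rightarrow> nat) \<Rightarrow> (nat \<times> nat) set" where
  "gens f \<rho> = {..<f - 1} \<times> T \<rho> \<union> {f - 1} \<times> T_star \<rho>"

definition rel_vec :: "nat \<Rightarrow> nat \<Rightarrow> (nat \<Rightarrow> nat) \<Rightarrow> nat set \<Rightarrow> nat \<times> nat \<Rightarrow> int" where
  "rel_vec p f \<rho> A = (\<lambda>(s, i). if s = f - 1 \<and> i \<in> jump_I \<rho> A then int p ^ jump_beta A i else 0)"

lemma e_star_notin_T: "finite (T \<rho>) \<Longrightarrow> e_star \<rho> \<notin> T \<rho>"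
  unfolding e_star_def by (metis Max_ge Suc_eq_plus1 not_less_eq_eq order_refl)

lemma finite_gens: "finite (T \<rho>) \<Longrightarrow> finite (gens f \<rho>)"
  by (simp add: gens_def T_star_def)

lemma sum_rel_vec:
  assumes "finite (T \<rho>)" "jump_I \<rho> A \<subseteq> T_star \<rho>"
  shows "(\<Sum>g\<in>gens f \<rho>. rel_vec p f \<rho> A g * y g) = (\<Sum>i\<in>jump_I \<rho> A. int p ^ jump_beta A i * y (f - 1, i))"
proof -
  have "(\<Sum>g\<in>gens f \<rho>. rel_vec p f \<rho> A g * y g) = (\<Sum>g\<in>Pair (f - 1) ` jump_I \<rho> A. rel_vec p f \<rho> A g * y g)"
    using assms by (intro sum.mono_neutral_right finite_gens) (auto simp: gens_def rel_vec_def)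
  also have "\<dots> = (\<Sum>i\<in>jump_I \<rho> A. rel_vec p f \<rho> A (f - 1, i) * y (f - 1, i))"
    by (subst sum.reindex) (auto simp: inj_on_def)
  also have "\<dots> = (\<Sum>i\<in>jump_I \<rho> A. int p ^ jump_beta A i * y (f - 1, i))"
    by (intro sum.cong) (auto simp: rel_vec_def)
  finally show ?thesis .
qed

text \<open>Two terms of lowest order can cancel any remainder \<open>S\<close> while both stay
  prime to \<open>p\<close>: for odd \<open>p\<close> one of 1 and -1 is an admissible first
  summand, for \<open>p = 2\<close> the parity of \<open>S\<close> decides.\<close>

lemma two_units_sum:
  assumes p: "prime p" and S: "2 < p \<or> (p = 2 \<and> even S)"
  shows "\<exists>x y :: int. x + y = - S \<and> \<not> int p dvd x \<and> \<not> int p dvd y"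
proof -
  have p1: "1 < int p" using prime_gt_1_nat[OF p] by simp
  have n1: "\<not> int p dvd 1" using p1 by (simp add: zdvd_not_zless)
  show ?thesis
  proof (cases "int p dvd S + 1")
    case False
    then have "\<not> int p dvd - (S + 1)" unfolding dvd_minus_iff by simp
    then show ?thesis using n1 by (intro exI[of _ 1] exI[of _ "- (S + 1)"]) auto
  next
    case True
    have "2 < p"
    proof (rule ccontr)
      assume "\<not> 2 < p"
      then have "p = 2" "even S" using S by auto
      then show False using True by simp
    qed
    have "\<not> int p dvd 1 - S"
    proof
      assume "int p dvd 1 - S"
      then have "int p dvd (S + 1) + (1 - S)" by (rule dvd_add[OF True])
      then show False using \<open>2 < p\<close> by (simp add: zdvd_not_zless)
    qed
    then show ?thesis using n1 by (intro exI[of _ "-1"] exI[of _ "1 - S"]) auto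
  qed
qed

context shift
begin

context
  fixes p f :: nat and A B :: "nat set"
  assumes p: "prime p" and f: "1 \<le> f" and finT: "finite (T \<rho>)"
    and A: "spaced A" "jump_I \<rho> A \<subseteq> T_star \<rho>"
    and B: "spaced B" "jump_I \<rho> B \<subseteq> T_star \<rho>"
begin

private abbreviation (input) "\<alpha> \<equiv> jump_beta A"
private abbreviation (input) "\<beta> \<equiv> jump_beta B"
private abbreviation (input) "I \<equiv> jump_I \<rho> A"
private abbreviation (input) "I' \<equiv> jump_I \<rho> B"
private abbreviation (input) "c \<equiv> max_diff (I, \<alpha>) (I', \<beta>)"
private abbreviation (input) "MM \<equiv> Max_set (I, \<alpha>) (I', \<beta>)"

private lemma finI: "finite I" "finite I'"
  using A(1) B(1) by (auto simp: spaced_def jump_I_def)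

private lemma diff_le: "i \<in> I \<Longrightarrow> i \<in> I' \<Longrightarrow> int (\<alpha> i) - int (\<beta> i) \<le> c"
  unfolding max_diff_def by (intro Max_ge) (use finI in \<open>auto simp: beta_diff_def\<close>)

private lemma mem_MM: "i \<in> MM \<longleftrightarrow> i \<in> I \<and> i \<in> I' \<and> int (\<alpha> i) - int (\<beta> i) = c \<and> 0 < c"
  by (auto simp: Max_set_def beta_diff_def)

private lemma c_attained: "I \<inter> I' \<noteq> {} \<Longrightarrow> \<exists>i\<in>I \<inter> I'. int (\<alpha> i) - int (\<beta> i) = c"
proof -
  assume "I \<inter> I' \<noteq> {}"
  then have "c \<in> beta_diff \<alpha> \<beta> ` (I \<inter> I')" 
    unfolding max_diff_def fst_conv snd_conv by (intro Max_in) (use finI in auto)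
  then show ?thesis by (auto simp: beta_diff_def)
qed

private lemma beta_pos: "i \<in> I' \<Longrightarrow> 1 \<le> \<beta> i" "i \<in> I \<Longrightarrow> 1 \<le> \<alpha> i"
  using jump_beta_I_pos A(1) B(1) by auto

private lemma p_nz: "int p \<noteq> 0" "1 < int p"
  using prime_gt_1_nat[OF p] by auto

private lemma pow_not_dvd: "n < N \<Longrightarrow> \<not> int p ^ N dvd int p ^ n"
proof
  assume "n < N" "int p ^ N dvd int p ^ n"
  then have "int p ^ N \<le> int p ^ n" using p_nz by (intro zdvd_imp_le) auto
  then show False using \<open>n < N\<close> p_nz by simp
qed

text \<open>If \<open>A\<close> were incompatible, multiplying the relation by
  \<open>p^(C - 1)\<close>, where \<open>C\<close> is the maximal difference, would kill every term
  outside \<open>Max_set\<close> and turn each term inside it into an element of order exactly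
  \<open>p\<close>. One such element, or an odd number of them for \<open>p = 2\<close>, does not
  sum to zero.\<close>

lemma solvable_imp_compatible:
  assumes y1: "\<And>g. g \<in> gens f \<rho> \<Longrightarrow> int p ^ N dvd int p ^ \<alpha> (snd g) * y g"
    and y2: "\<And>j. j \<in> I \<Longrightarrow> \<exists>g\<in>gens f \<rho>. snd g = j \<and> \<not> int p ^ N dvd int p ^ (\<alpha> j - 1) * y g"
    and y3: "int p ^ N dvd (\<Sum>g\<in>gens f \<rho>. rel_vec p f \<rho> B g * y g)"
  shows "compatible \<rho> f p A B"
  unfolding compatible_def
proof
  assume inc: "incompatible \<rho> f p (I, \<alpha>) (I', \<beta>)"
  define z where "z i = y (f - 1, i)" for i
  have sub: "MM \<subseteq> I'" "finite MM" using finI by (auto simp: mem_MM intro: finite_subset[of _ I])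
  have z1: "int p ^ N dvd int p ^ \<alpha> i * z i" if "i \<in> T_star \<rho>" for i
    using y1[of "(f - 1, i)"] that by (simp add: gens_def z_def)
  from inc have ne: "MM \<noteq> {}" by (auto simp: incompatible_def split: if_splits)
  then have cpos: "0 < c" using mem_MM by blast
  define C where "C = nat c"
  have C: "c = int C" "1 \<le> C" using cpos by (auto simp: C_def)
  have s: "int p ^ N dvd (\<Sum>i\<in>I'. int p ^ (\<beta> i + (C - 1)) * z i)"
  proof -
    have "int p ^ N dvd int p ^ (C - 1) * (\<Sum>i\<in>I'. int p ^ \<beta> i * z i)"
      using y3 unfolding sum_rel_vec[OF finT B(2)] z_def by simp
    then show ?thesis by (simp add: sum_distrib_left power_add mult_ac)
  qed
  \<comment> \<open>For \<open>i\<close> in \<open>jump_I \<rho> A\<close> the difference is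
    strictly below the maximum; for other \<open>i\<close> the third condition gives the same
    inequality through \<open>dominated_iff\<close>.\<close>
  have dead: "int p ^ N dvd int p ^ (\<beta> i + (C - 1)) * z i" if i: "i \<in> I' - MM" for i
  proof -
    have "\<alpha> i \<le> \<beta> i + (C - 1)"
    proof (cases "i \<in> I")
      case True
      then have "int (\<alpha> i) - int (\<beta> i) \<le> c" "int (\<alpha> i) - int (\<beta> i) \<noteq> c" using i diff_le mem_MM cpos by auto
      then show ?thesis using C by linarith
    next
      case False
      then have "\<not> (\<exists>j\<in>I. le_rho \<rho> (i, C + \<beta> i) (j, \<alpha> j))" using inc i by (auto simp: incompatible_def C_def)
      then have "\<not> C + \<beta> i \<le> \<alpha> i" using dominated_iff[OF A(1), of "C + \<beta> i" i] C by simp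
      then show ?thesis by linarith
    qed
    then have "int p ^ \<alpha> i dvd int p ^ (\<beta> i + (C - 1))" by (rule le_imp_power_dvd)
    then show ?thesis using z1[of i] i B(2) by (meson DiffD1 dvd_trans mult_dvd_mono dvd_refl subsetD)
  qed
  have "int p ^ N dvd (\<Sum>i\<in>I'. int p ^ (\<beta> i + (C - 1)) * z i) - (\<Sum>i\<in>I' - MM. int p ^ (\<beta> i + (C - 1)) * z i)"
    by (intro dvd_diff s dvd_sum dead)
  then have "int p ^ N dvd (\<Sum>i\<in>MM. int p ^ (\<beta> i + (C - 1)) * z i)"
    using sum.subset_diff[OF sub(1), of "\<lambda>i. int p ^ (\<beta> i + (C - 1)) * z i"] finI by simp
  moreover have "(\<Sum>i\<in>MM. int p ^ (\<beta> i + (C - 1)) * z i) = (\<Sum>i\<in>MM. int p ^ (\<alpha> i - 1) * z i)"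
  proof (rule sum.cong)
    fix i assume "i \<in> MM"
    then have "\<beta> i + (C - 1) = \<alpha> i - 1" using mem_MM[of i] C by linarith
    then show "int p ^ (\<beta> i + (C - 1)) * z i = int p ^ (\<alpha> i - 1) * z i" by simp
  qed simp
  ultimately have sM: "int p ^ N dvd (\<Sum>i\<in>MM. int p ^ (\<alpha> i - 1) * z i)" by simp
  \<comment> \<open>A generator of the right order might lie in another copy. For
    \<open>f > 1\<close> this is impossible, because \<open>Max_set\<close> is then
    \<open>{e_star \<rho>}\<close> and this weight occurs in the last copy only.\<close>
  have nz: "\<not> int p ^ N dvd int p ^ (\<alpha> i - 1) * z i" if i: "i \<in> MM" for i
  proof -
    obtain g where g: "g \<in> gens f \<rho>" "snd g = i" "\<not> int p ^ N dvd int p ^ (\<alpha> i - 1) * y g"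
      using y2[of i] i mem_MM by blast
    have "fst g = f - 1"
    proof (cases "f = 1")
      case False
      then have "MM = {e_star \<rho>}" using inc f by (auto simp: incompatible_def)
      then have "snd g \<notin> T \<rho>" using i g(2) e_star_notin_T[OF finT] by auto
      then show ?thesis using g(1) by (auto simp: gens_def)
    qed (use g(1) in \<open>auto simp: gens_def\<close>)
    then have "g = (f - 1, i)" using g(2) by (metis prod.collapse)
    then show ?thesis using g(3) by (simp add: z_def)
  qed
  have ptimes: "int p ^ N dvd int p * (int p ^ (\<alpha> i - 1) * z i)" if i: "i \<in> MM" for i
  proof -
    have iI: "i \<in> I" using i mem_MM by blast
    have "int p * (int p ^ (\<alpha> i - 1) * z i) = int p ^ Suc (\<alpha> i - 1) * z i" by simp
    also have "Suc (\<alpha> i - 1) = \<alpha> i" using beta_pos(2)[OF iI] by simp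
    finally have "int p * (int p ^ (\<alpha> i - 1) * z i) = int p ^ \<alpha> i * z i" .
    moreover have "int p ^ N dvd int p ^ \<alpha> i * z i" using z1[of i] iI A(2) by blast
    ultimately show ?thesis by (simp only:)
  qed
  have "card MM = 1 \<or> (p = 2 \<and> odd (card MM))"
    using inc prime_ge_2_nat[OF p] by (auto simp: incompatible_def split: if_splits)
  then show False
  proof
    assume "card MM = 1"
    then obtain i where "MM = {i}" by (auto simp: card_1_singleton_iff)
    then show False using sM nz[of i] by simp
  next
    \<comment> \<open>Modulo \<open>2^N\<close> there is a single element of order 2, so a sum of
      such elements vanishes according to the parity of their number.\<close>
    assume "p = 2 \<and> odd (card MM)"
    then have p2: "int p = 2" and od: "odd (card MM)" by auto
    obtain i0 where "i0 \<in> MM" using ne by blast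
    then have "N \<noteq> 0" using nz[of i0] by (intro notI) simp
    then obtain N' where N': "N = Suc N'" by (cases N) auto
    have "\<exists>u. int p ^ (\<alpha> i - 1) * z i = 2 ^ N' * u \<and> odd u" if i: "i \<in> MM" for i
    proof -
      have "2 ^ N' dvd int p ^ (\<alpha> i - 1) * z i" using ptimes[OF i] unfolding p2 N' by simp
      then obtain u where u: "int p ^ (\<alpha> i - 1) * z i = 2 ^ N' * u" by (elim dvdE)
      have "\<not> 2 dvd u" using nz[OF i] unfolding u unfolding p2 N' by auto
      with u show ?thesis by blast
    qed
    then obtain u where u: "\<And>i. i \<in> MM \<Longrightarrow> int p ^ (\<alpha> i - 1) * z i = 2 ^ N' * u i \<and> odd (u i)" by metis
    have "(\<Sum>i\<in>MM. int p ^ (\<alpha> i - 1) * z i) = 2 ^ N' * (\<Sum>i\<in>MM. u i)"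
      unfolding sum_distrib_left by (rule sum.cong) (use u in auto)
    then have "even (\<Sum>i\<in>MM. u i)" using sM unfolding p2 N' by simp
    moreover have "even (\<Sum>i\<in>MM. u i) \<longleftrightarrow> even (card MM)"
    proof -
      have "even (\<Sum>i\<in>MM. u i) \<longleftrightarrow> even (card {i \<in> MM. odd (u i)})"
        using even_sum_iff[OF sub(2), of u] by simp
      moreover have "{i \<in> MM. odd (u i)} = MM" using u by blast
      ultimately show ?thesis by simp
    qed
    ultimately show False using od by simp
  qed
qed

text \<open>It suffices to choose the special components \<open>z\<close>: the other copies of a generator of weight in
  \<open>T \<rho>\<close> can realize the required order whenever the residue degree exceeds 1.\<close>

private lemma solvable_from_special:
  assumes N: "\<And>i. \<alpha> i < N"
    and z1: "\<And>i. int p ^ N dvd int p ^ \<alpha> i * z i"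
    and z2: "\<And>j. j \<in> I \<Longrightarrow> f = 1 \<or> j = e_star \<rho> \<Longrightarrow> \<not> int p ^ N dvd int p ^ (\<alpha> j - 1) * z j"
    and z3: "int p ^ N dvd (\<Sum>i\<in>I'. int p ^ \<beta> i * z i)"
  shows "\<exists>N y. (\<forall>g\<in>gens f \<rho>. int p ^ N dvd int p ^ \<alpha> (snd g) * y g) \<and>
    (\<forall>j\<in>I. \<exists>g\<in>gens f \<rho>. snd g = j \<and> \<not> int p ^ N dvd int p ^ (\<alpha> j - 1) * y g) \<and>
    int p ^ N dvd (\<Sum>g\<in>gens f \<rho>. rel_vec p f \<rho> B g * y g)"
proof -
  define y where "y = (\<lambda>(s, i). if s = f - 1 then z i else int p ^ (N - \<alpha> i))"
  have e: "int p ^ \<alpha> i * int p ^ (N - \<alpha> i) = int p ^ N" for i using N[of i] by (simp flip: power_add)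
  have "\<forall>g\<in>gens f \<rho>. int p ^ N dvd int p ^ \<alpha> (snd g) * y g"
    using z1 e by (auto simp: y_def)
  moreover have "\<exists>g\<in>gens f \<rho>. snd g = j \<and> \<not> int p ^ N dvd int p ^ (\<alpha> j - 1) * y g" if j: "j \<in> I" for j
  proof (cases "f = 1 \<or> j = e_star \<rho>")
    case True
    then show ?thesis using z2[OF j] A(2) j by (intro bexI[of _ "(f - 1, j)"]) (auto simp: y_def gens_def)
  next
    case False
    then have "j \<in> T \<rho>" using A(2) j by (auto simp: T_star_def)
    moreover have "\<not> int p ^ N dvd int p ^ (\<alpha> j - 1) * int p ^ (N - \<alpha> j)"
      unfolding power_add[symmetric] using N[of j] beta_pos(2)[OF j] by (intro pow_not_dvd) simp
    ultimately show ?thesis using False f by (intro bexI[of _ "(0, j)"]) (auto simp: y_def gens_def)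
  qed
  moreover have "int p ^ N dvd (\<Sum>g\<in>gens f \<rho>. rel_vec p f \<rho> B g * y g)"
    unfolding sum_rel_vec[OF finT B(2)] using z3 by (simp add: y_def)
  ultimately show ?thesis by blast
qed

text \<open>The trial solution \<open>z0\<close> has the exact order wherever the special component
  must have it and is 0 elsewhere. Three cases arise: all its terms vanish; a component that is not
  forced can absorb the total; or conditions two and three of incompatibility hold. In the last case
  the first condition fails, and two members of \<open>Max_set\<close> can be adjusted by factors
  prime to \<open>p\<close>.\<close>

lemma compatible_imp_solvable:
  assumes comp: "compatible \<rho> f p A B"
  shows "\<exists>N y. (\<forall>g\<in>gens f \<rho>. int p ^ N dvd int p ^ \<alpha> (snd g) * y g) \<and>
    (\<forall>j\<in>I. \<exists>g\<in>gens f \<rho>. snd g = j \<and> \<not> int p ^ N dvd int p ^ (\<alpha> j - 1) * y g) \<and>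
    int p ^ N dvd (\<Sum>g\<in>gens f \<rho>. rel_vec p f \<rho> B g * y g)"
proof -
  \<comment> \<open>\<open>\<alpha> 0\<close> is the size of \<open>A\<close> and bounds all
    counts.\<close>
  define N where "N = \<alpha> 0 + 1"
  have N: "\<alpha> i < N" for i using jump_beta_antimono[of A 0 i] A(1) by (simp add: N_def spaced_def less_Suc_eq_le)
  \<comment> \<open>Weights at which the special component itself has to realize the order: there is
    no other copy if \<open>f = 1\<close>, and none for \<open>e_star \<rho>\<close> in any
    case.\<close>
  define forced where "forced i \<longleftrightarrow> i \<in> I \<and> (f = 1 \<or> i = e_star \<rho>)" for i
  define z0 where "z0 i = (if forced i then int p ^ (N - \<alpha> i) else 0)" for i
  have forced_nd: "\<not> int p ^ N dvd int p ^ (\<alpha> j - 1) * int p ^ (N - \<alpha> j)" if "j \<in> I" for j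
    unfolding power_add[symmetric] using N[of j] beta_pos(2)[OF that] by (intro pow_not_dvd) simp
  have e: "int p ^ \<alpha> i * int p ^ (N - \<alpha> i) = int p ^ N" for i using N[of i] by (simp flip: power_add)
  have z01: "int p ^ N dvd int p ^ \<alpha> i * z0 i" for i using e by (simp add: z0_def)
  have z02: "\<not> int p ^ N dvd int p ^ (\<alpha> j - 1) * z0 j" if "j \<in> I" "f = 1 \<or> j = e_star \<rho>" for j
    using forced_nd[OF that(1)] that by (simp add: z0_def forced_def)
  show ?thesis
  proof (cases "\<forall>i. forced i \<longrightarrow> i \<in> I' \<longrightarrow> \<alpha> i \<le> \<beta> i")
    case True
    have "int p ^ N dvd (\<Sum>i\<in>I'. int p ^ \<beta> i * z0 i)"
    proof (rule dvd_sum)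
      fix i assume i: "i \<in> I'"
      show "int p ^ N dvd int p ^ \<beta> i * z0 i"
      proof (cases "forced i")
        case fo: True
        then have "\<alpha> i \<le> \<beta> i" using True i by blast
        then have "int p ^ \<alpha> i dvd int p ^ \<beta> i" by (rule le_imp_power_dvd)
        then show ?thesis using z01[of i] by (meson dvd_trans mult_dvd_mono dvd_refl)
      qed (simp add: z0_def)
    qed
    then show ?thesis by (intro solvable_from_special[of N z0] N z01 z02)
  next
    case False
    then obtain i1 where i1: "forced i1" "i1 \<in> I'" "\<beta> i1 < \<alpha> i1" by (auto simp: not_le)
    then have i1I: "i1 \<in> I" by (simp add: forced_def)
    have cpos: "0 < c" using diff_le[OF i1I i1(2)] i1(3) by linarith
    define C where "C = nat c"
    have C: "c = int C" "1 \<le> C" using cpos by (auto simp: C_def)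
    have le_C: "\<alpha> i \<le> \<beta> i + C" if "i \<in> I" "i \<in> I'" for i using diff_le[OF that] C by linarith
    obtain i2 where i2: "i2 \<in> I" "i2 \<in> I'" "int (\<alpha> i2) - int (\<beta> i2) = c" using c_attained i1I i1(2) by blast
    have i2M: "i2 \<in> MM" using i2 cpos mem_MM by blast
    show ?thesis
    proof (cases "\<exists>i0\<in>I'. \<not> forced i0 \<and> C + \<beta> i0 \<le> \<alpha> i0")
      case True
      then obtain i0 where i0: "i0 \<in> I'" "\<not> forced i0" "C + \<beta> i0 \<le> \<alpha> i0" by blast
      have C_N: "C + \<beta> i0 \<le> N" using i0(3) N[of i0] by linarith
      \<comment> \<open>No difference exceeds \<open>C\<close>, so the total is a multiple of
        \<open>p^(N - C)\<close>; the values allowed at \<open>i0\<close> yield every such multiple,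
        since \<open>C + \<beta> i0 \<le> \<alpha> i0\<close>.\<close>
      have "int p ^ (N - C) dvd (\<Sum>i\<in>I'. int p ^ \<beta> i * z0 i)"
      proof (rule dvd_sum)
        fix i assume i: "i \<in> I'"
        show "int p ^ (N - C) dvd int p ^ \<beta> i * z0 i"
        proof (cases "forced i")
          case fo: True
          then have "N - C \<le> \<beta> i + (N - \<alpha> i)" using le_C[of i] i N[of i] by (simp add: forced_def)
          then have "int p ^ (N - C) dvd int p ^ (\<beta> i + (N - \<alpha> i))" by (rule le_imp_power_dvd)
          then show ?thesis using fo by (simp add: z0_def power_add)
        qed (simp add: z0_def)
      qed
      then obtain S where S: "(\<Sum>i\<in>I'. int p ^ \<beta> i * z0 i) = int p ^ (N - C) * S" by (elim dvdE)
      define z where "z = z0(i0 := - S * int p ^ (N - C - \<beta> i0))"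
      have e0: "int p ^ \<beta> i0 * int p ^ (N - C - \<beta> i0) = int p ^ (N - C)" using C_N by (simp flip: power_add)
      have "(\<Sum>i\<in>I'. int p ^ \<beta> i * z i) = (\<Sum>i\<in>I'. int p ^ \<beta> i * z0 i) + int p ^ \<beta> i0 * z i0"
      proof -
        have "z0 i0 = 0" using i0(2) by (simp add: z0_def)
        moreover have "(\<Sum>i\<in>I' - {i0}. int p ^ \<beta> i * z i) = (\<Sum>i\<in>I' - {i0}. int p ^ \<beta> i * z0 i)"
          by (rule sum.cong) (auto simp: z_def)
        ultimately show ?thesis using sum.remove[OF finI(2) i0(1), of "\<lambda>i. int p ^ \<beta> i * z i"]
            sum.remove[OF finI(2) i0(1), of "\<lambda>i. int p ^ \<beta> i * z0 i"] by simp
      qed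
      also have "\<dots> = int p ^ (N - C) * S - S * (int p ^ \<beta> i0 * int p ^ (N - C - \<beta> i0))" by (simp add: S z_def)
      also have "\<dots> = 0" unfolding e0 by simp
      finally have z3: "int p ^ N dvd (\<Sum>i\<in>I'. int p ^ \<beta> i * z i)" by simp
      have z1: "int p ^ N dvd int p ^ \<alpha> i * z i" for i
      proof (cases "i = i0")
        case True
        have "N \<le> \<alpha> i0 + (N - C - \<beta> i0)" using i0(3) by linarith
        then have "int p ^ N dvd int p ^ (\<alpha> i0 + (N - C - \<beta> i0))" by (rule le_imp_power_dvd)
        then have "int p ^ N dvd int p ^ (\<alpha> i0 + (N - C - \<beta> i0)) * (- S)" by (rule dvd_mult2)
        then show ?thesis unfolding True by (simp add: z_def power_add mult_ac)
      qed (use z01[of i] in \<open>simp add: z_def\<close>)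
      have z2: "\<not> int p ^ N dvd int p ^ (\<alpha> j - 1) * z j" if "j \<in> I" "f = 1 \<or> j = e_star \<rho>" for j
        using z02[OF that] i0(2) that by (auto simp: z_def forced_def)
      show ?thesis by (intro solvable_from_special[of N z] N z1 z2 z3)
    next
      \<comment> \<open>No unforced component can absorb the total. For weights outside
        \<open>jump_I \<rho> A\<close> this is the third condition, and for weights inside it makes
        all members of \<open>Max_set\<close> forced, which yields the second.\<close>
      case no: False
      have c3: "\<forall>i\<in>I' - I. \<not> (\<exists>j\<in>I. le_rho \<rho> (i, nat c + \<beta> i) (j, \<alpha> j))"
      proof
        fix i assume i: "i \<in> I' - I"
        then have "\<not> C + \<beta> i \<le> \<alpha> i" using no by (auto simp: forced_def)
        then show "\<not> (\<exists>j\<in>I. le_rho \<rho> (i, nat c + \<beta> i) (j, \<alpha> j))"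
          using dominated_iff[OF A(1), of "C + \<beta> i" i] C(2) unfolding C_def[symmetric] by simp
      qed
      have MMf: "forced i" if "i \<in> MM" for i
      proof (rule ccontr)
        assume "\<not> forced i"
        moreover have "i \<in> I'" "C + \<beta> i \<le> \<alpha> i" using that mem_MM[of i] C by auto
        ultimately show False using no by blast
      qed
      have c2: "f > 1 \<longrightarrow> MM = {e_star \<rho>}" 
      proof
        assume "1 < f"
        then have "i = e_star \<rho>" if "i \<in> MM" for i using MMf[OF that] by (simp add: forced_def)
        then show "MM = {e_star \<rho>}" using i2M by blast
      qed
      have n1: "\<not> (if p > 2 then card MM = 1 else odd (card MM))"
        using comp c2 c3 i1I i1(2) by (auto simp: compatible_def incompatible_def)
      \<comment> \<open>For \<open>f > 1\<close> the set \<open>Max_set\<close> would be a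
        singleton, hence of odd size, and all three conditions of incompatibility would
        hold.\<close>
      have f1: "f = 1"
      proof (rule ccontr)
        assume "f \<noteq> 1"
        then have "card MM = 1" using c2 f by simp
        with n1 show False by (cases "2 < p") auto
      qed
      have fo: "forced i \<longleftrightarrow> i \<in> I" for i using f1 by (simp add: forced_def)
      have finM: "finite MM" using finI by (auto simp: mem_MM intro: finite_subset[of _ I])
      have "card MM \<noteq> 1" using n1 by (auto split: if_splits)
      then obtain i3 where i3: "i3 \<in> MM" "i3 \<noteq> i2" using i2M finM
        by (metis card_1_singleton_iff is_singletonI' is_singleton_def empty_iff One_nat_def)
      have i3': "i3 \<in> I" "i3 \<in> I'" using i3 mem_MM by auto
      let ?R = "(I \<inter> I') - {i2, i3}"
      define S where "S = (\<Sum>i\<in>?R. int p ^ (\<beta> i + C - \<alpha> i))"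
      have "2 < p \<or> (p = 2 \<and> even S)"
      proof (rule disjCI)
        assume "\<not> (p = 2 \<and> even S)"
        then show "2 < p"
        proof (rule contrapos_np)
          assume "\<not> 2 < p"
          then have p2: "p = 2" using prime_ge_2_nat[OF p] by simp
          then have ev: "even (card MM)" using n1 by simp
          have "even S \<longleftrightarrow> even (card {i \<in> ?R. odd (int p ^ (\<beta> i + C - \<alpha> i))})"
            unfolding S_def using finI by (intro even_sum_iff) auto
          also have "{i \<in> ?R. odd (int p ^ (\<beta> i + C - \<alpha> i))} = MM - {i2, i3}"
          proof -
            \<comment> \<open>The exponent is 0 exactly on \<open>Max_set\<close>, so modulo 2 the
              sum \<open>S\<close> counts its members other than \<open>i2\<close> and
              \<open>i3\<close>.\<close>
            have "odd (int p ^ (\<beta> i + C - \<alpha> i)) \<longleftrightarrow> i \<in> MM" if "i \<in> I \<inter> I'" for i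
              using le_C[of i] that mem_MM[of i] C p2 by auto
            then show ?thesis using mem_MM by blast
          qed
          also have "card (MM - {i2, i3}) = card MM - 2" using i2M i3 finM by (subst card_Diff_subset) auto
          finally show "p = 2 \<and> even S" using p2 ev by simp
        qed
      qed
      then obtain x2 x3 where x: "x2 + x3 = - S" "\<not> int p dvd x2" "\<not> int p dvd x3" using two_units_sum[OF p] by blast
      define \<epsilon> where "\<epsilon> i = (if i = i2 then x2 else if i = i3 then x3 else (1::int))" for i
      have \<epsilon>: "\<not> int p dvd \<epsilon> i" for i using x p_nz(2) by (simp add: \<epsilon>_def zdvd_not_zless)
      define z where "z i = (if i \<in> I then \<epsilon> i * int p ^ (N - \<alpha> i) else 0)" for i
      have z1: "int p ^ N dvd int p ^ \<alpha> i * z i" for i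
        using e[of i] by (auto simp: z_def mult.left_commute)
      have z2: "\<not> int p ^ N dvd int p ^ (\<alpha> j - 1) * z j" if j: "j \<in> I" for j
      proof
        assume "int p ^ N dvd int p ^ (\<alpha> j - 1) * z j"
        moreover have "int p ^ (\<alpha> j - 1) * z j = int p ^ (N - 1) * \<epsilon> j"
        proof -
          have "int p ^ (\<alpha> j - 1) * int p ^ (N - \<alpha> j) = int p ^ (N - 1)"
            unfolding power_add[symmetric] using N[of j] beta_pos(2)[OF j] by simp
          then show ?thesis using j by (simp add: z_def mult_ac)
        qed
        moreover have "int p ^ N = int p ^ (N - 1) * int p" by (simp add: N_def)
        ultimately show False using \<epsilon>[of j] p_nz by simp
      qed
      have CN: "C \<le> N" using i2 C N[of i2] by linarith
      have "(\<Sum>i\<in>I'. int p ^ \<beta> i * z i) = (\<Sum>i\<in>I \<inter> I'. int p ^ \<beta> i * z i)"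
        using finI by (intro sum.mono_neutral_right) (auto simp: z_def)
      also have "\<dots> = (\<Sum>i\<in>I \<inter> I'. int p ^ (N - C) * (\<epsilon> i * int p ^ (\<beta> i + C - \<alpha> i)))"
      proof (rule sum.cong)
        fix i assume i: "i \<in> I \<inter> I'"
        then have "\<beta> i + (N - \<alpha> i) = (N - C) + (\<beta> i + C - \<alpha> i)" using le_C[of i] N[of i] CN by auto
        then have "int p ^ \<beta> i * int p ^ (N - \<alpha> i) = int p ^ (N - C) * int p ^ (\<beta> i + C - \<alpha> i)" by (simp flip: power_add)
        then show "int p ^ \<beta> i * z i = int p ^ (N - C) * (\<epsilon> i * int p ^ (\<beta> i + C - \<alpha> i))"
          using i by (simp add: z_def mult_ac)
      qed simp
      also have "\<dots> = int p ^ (N - C) * (\<Sum>i\<in>I \<inter> I'. \<epsilon> i * int p ^ (\<beta> i + C - \<alpha> i))" by (simp add: sum_distrib_left)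
      also have "(\<Sum>i\<in>I \<inter> I'. \<epsilon> i * int p ^ (\<beta> i + C - \<alpha> i)) = 0"
      proof -
        have ez: "\<beta> i + C - \<alpha> i = 0" if "i \<in> MM" for i using that mem_MM[of i] C by linarith
        have split: "I \<inter> I' = insert i2 (insert i3 ?R)" using i2 i3' by auto
        have "(\<Sum>i\<in>I \<inter> I'. \<epsilon> i * int p ^ (\<beta> i + C - \<alpha> i)) = x2 + (x3 + (\<Sum>i\<in>?R. \<epsilon> i * int p ^ (\<beta> i + C - \<alpha> i)))"
          using ez[OF i2M] ez[OF i3(1)] i3(2) finI by (subst split) (simp add: \<epsilon>_def)
        also have "(\<Sum>i\<in>?R. \<epsilon> i * int p ^ (\<beta> i + C - \<alpha> i)) = S"
          unfolding S_def by (rule sum.cong) (auto simp: \<epsilon>_def)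
        finally show ?thesis using x(1) by simp
      qed
      finally have z3: "int p ^ N dvd (\<Sum>i\<in>I'. int p ^ \<beta> i * z i)" by simp
      show ?thesis by (intro solvable_from_special[of N z] N z1 z2 z3)
    qed
  qed
qed

end

end

section \<open>Generators of a filtered group of units\<close>

definition mgroup :: "'a::field set \<Rightarrow> bool" where
  "mgroup A \<longleftrightarrow> 1 \<in> A \<and> 0 \<notin> A \<and> (\<forall>x\<in>A. \<forall>y\<in>A. x * y \<in> A \<and> x / y \<in> A)"

definition mcoset :: "'a::field set \<Rightarrow> 'a \<Rightarrow> 'a set" where
  "mcoset K x = (\<lambda>k. x * k) ` K"

definition mindex :: "'a::field set \<Rightarrow> 'a set \<Rightarrow> nat" where
  "mindex A K = card (mcoset K ` A)"

lemma mgroup_nonzero: "mgroup A \<Longrightarrow> x \<in> A \<Longrightarrow> x \<noteq> 0"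
  by (auto simp: mgroup_def)

lemma mgroup_one: "mgroup A \<Longrightarrow> 1 \<in> A"
  by (simp add: mgroup_def)

lemma mgroup_mult: "mgroup A \<Longrightarrow> x \<in> A \<Longrightarrow> y \<in> A \<Longrightarrow> x * y \<in> A"
  by (simp add: mgroup_def)

lemma mgroup_divide: "mgroup A \<Longrightarrow> x \<in> A \<Longrightarrow> y \<in> A \<Longrightarrow> x / y \<in> A"
  by (simp add: mgroup_def)

lemma mgroup_inverse: "mgroup A \<Longrightarrow> x \<in> A \<Longrightarrow> inverse x \<in> A"
  using mgroup_divide[of A 1 x] mgroup_one[of A] by (simp add: divide_inverse)

lemma mgroup_power: "mgroup A \<Longrightarrow> x \<in> A \<Longrightarrow> x ^ n \<in> A"
  by (induction n) (auto intro: mgroup_one mgroup_mult)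

lemma mgroup_powi: "mgroup A \<Longrightarrow> x \<in> A \<Longrightarrow> x powi n \<in> A"
  by (auto simp: power_int_def intro: mgroup_power mgroup_inverse)

lemma mgroup_prod: "mgroup A \<Longrightarrow> (\<And>s. s \<in> S \<Longrightarrow> y s \<in> A) \<Longrightarrow> prod y S \<in> A"
  by (induction S rule: infinite_finite_induct) (auto intro: mgroup_one mgroup_mult)

lemma mgroup_divide_trans: "mgroup A \<Longrightarrow> x / y \<in> A \<Longrightarrow> y / z \<in> A \<Longrightarrow> x / z \<in> A"
  using mgroup_mult[of A "x / y" "y / z"] mgroup_nonzero[of A "x / y"] by auto

lemma mgroup_divide_sym: "mgroup A \<Longrightarrow> x / y \<in> A \<Longrightarrow> y / x \<in> A"
  using mgroup_inverse[of A "x / y"] by (simp add: field_simps)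

lemma mcoset_eq:
  assumes K: "mgroup K" and "x \<noteq> 0" "y \<noteq> 0"
  shows "mcoset K x = mcoset K y \<longleftrightarrow> x / y \<in> K"
proof
  assume "mcoset K x = mcoset K y"
  moreover have "x * 1 \<in> mcoset K x" unfolding mcoset_def using mgroup_one[OF K] by blast
  ultimately obtain k where "k \<in> K" "x * 1 = y * k" unfolding mcoset_def by blast
  then show "x / y \<in> K" using assms by (simp add: field_simps)
next
  have *: "mcoset K x \<subseteq> mcoset K y" if "x / y \<in> K" "y \<noteq> 0" for x y
  proof
    fix w assume "w \<in> mcoset K x"
    then obtain k where k: "k \<in> K" "w = x * k" by (auto simp: mcoset_def)
    then have "w = y * (x / y * k)" using that by simp
    then show "w \<in> mcoset K y" unfolding mcoset_def using mgroup_mult[OF K that(1) k(1)] by blast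
  qed
  assume "x / y \<in> K"
  then show "mcoset K x = mcoset K y" using * assms mgroup_divide_sym[OF K] by blast
qed

text \<open>\<open>\<phi>\<close> induces a bijection of coset spaces. It only has to respect the
  coset relations and to meet every coset.\<close>

lemma mindex_bij:
  assumes "mgroup K" "mgroup L" "0 \<notin> A" "0 \<notin> B"
    and \<phi>: "\<And>x. x \<in> A \<Longrightarrow> \<phi> x \<in> B"
    and eq: "\<And>x y. x \<in> A \<Longrightarrow> y \<in> A \<Longrightarrow> \<phi> x / \<phi> y \<in> L \<longleftrightarrow> x / y \<in> K"
    and sur: "\<And>w. w \<in> B \<Longrightarrow> \<exists>x\<in>A. w / \<phi> x \<in> L"
  shows "mindex A K = mindex B L"
proof -
  have nz: "x \<in> A \<Longrightarrow> x \<noteq> 0" "w \<in> B \<Longrightarrow> w \<noteq> 0" for x w using assms by auto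
  have "bij_betw (\<lambda>C. mcoset L (\<phi> (SOME x. x \<in> A \<and> mcoset K x = C))) (mcoset K ` A) (mcoset L ` B)"
  proof (rule bij_betw_imageI)
    have rep: "(SOME y. y \<in> A \<and> mcoset K y = mcoset K x) \<in> A \<and> mcoset K (SOME y. y \<in> A \<and> mcoset K y = mcoset K x) = mcoset K x" if "x \<in> A" for x
      by (rule someI[of "\<lambda>y. y \<in> A \<and> mcoset K y = mcoset K x" x]) (use that in simp)
    have val: "mcoset L (\<phi> (SOME y. y \<in> A \<and> mcoset K y = mcoset K x)) = mcoset L (\<phi> x)" if x: "x \<in> A" for x
    proof -
      let ?y = "SOME y. y \<in> A \<and> mcoset K y = mcoset K x"
      have "?y / x \<in> K" using rep[OF x] mcoset_eq[OF assms(1), of ?y x] nz x by blast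
      then have "\<phi> ?y / \<phi> x \<in> L" using eq rep[OF x] x by blast
      then show ?thesis using mcoset_eq[OF assms(2)] nz \<phi> rep[OF x] x by blast
    qed
    show "inj_on (\<lambda>C. mcoset L (\<phi> (SOME x. x \<in> A \<and> mcoset K x = C))) (mcoset K ` A)"
    proof (rule inj_onI)
      fix C D assume "C \<in> mcoset K ` A" "D \<in> mcoset K ` A" and
        e: "mcoset L (\<phi> (SOME x. x \<in> A \<and> mcoset K x = C)) = mcoset L (\<phi> (SOME x. x \<in> A \<and> mcoset K x = D))"
      then obtain x y where xy: "x \<in> A" "y \<in> A" "C = mcoset K x" "D = mcoset K y" by blast
      then have "mcoset L (\<phi> x) = mcoset L (\<phi> y)" using e val by simp
      then have "\<phi> x / \<phi> y \<in> L" using mcoset_eq[OF assms(2)] nz \<phi> xy by blast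
      then show "C = D" using eq mcoset_eq[OF assms(1)] nz xy by blast
    qed
    show "(\<lambda>C. mcoset L (\<phi> (SOME x. x \<in> A \<and> mcoset K x = C))) ` mcoset K ` A = mcoset L ` B"
    proof -
      have "(\<lambda>C. mcoset L (\<phi> (SOME x. x \<in> A \<and> mcoset K x = C))) ` mcoset K ` A = (\<lambda>x. mcoset L (\<phi> x)) ` A"
        unfolding image_image by (rule image_cong) (use val in auto)
      also have "\<dots> = mcoset L ` B"
      proof
        show "(\<lambda>x. mcoset L (\<phi> x)) ` A \<subseteq> mcoset L ` B" using \<phi> by blast
        show "mcoset L ` B \<subseteq> (\<lambda>x. mcoset L (\<phi> x)) ` A"
        proof
          fix C assume "C \<in> mcoset L ` B"
          then obtain w where w: "w \<in> B" "C = mcoset L w" by blast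
          obtain x where "x \<in> A" "w / \<phi> x \<in> L" using sur[OF w(1)] by blast
          then have "mcoset L w = mcoset L (\<phi> x)" using mcoset_eq[OF assms(2)] nz \<phi> w by blast
          then show "C \<in> (\<lambda>x. mcoset L (\<phi> x)) ` A" using w(2) \<open>x \<in> A\<close> by blast
        qed
      qed
      finally show ?thesis .
    qed
  qed
  then show ?thesis unfolding mindex_def by (rule bij_betw_same_card)
qed

lemma mindex_mult:
  assumes A: "mgroup A" and W: "mgroup W" and K: "mgroup K" and "K \<subseteq> W" "W \<subseteq> A"
  shows "mindex A K = mindex A W * mindex W K"
proof -
  define r where "r C = (SOME y. y \<in> A \<and> mcoset W y = C)" for C
  have rep: "r (mcoset W x) \<in> A \<and> mcoset W (r (mcoset W x)) = mcoset W x" if "x \<in> A" for x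
    unfolding r_def by (rule someI[of "\<lambda>y. y \<in> A \<and> mcoset W y = mcoset W x" x]) (use that in simp)
  have nz: "x \<in> A \<Longrightarrow> x \<noteq> 0" for x using mgroup_nonzero[OF A] .
  have q: "x / r (mcoset W x) \<in> W" if "x \<in> A" for x
    using rep[OF that] mcoset_eq[OF W, of x "r (mcoset W x)"] nz that by metis
  have "mcoset K ` A = (\<lambda>(C, D). (\<lambda>d. r C * d) ` D) ` (mcoset W ` A \<times> mcoset K ` W)"
  proof
    show "mcoset K ` A \<subseteq> (\<lambda>(C, D). (\<lambda>d. r C * d) ` D) ` (mcoset W ` A \<times> mcoset K ` W)"
    proof
      fix C assume "C \<in> mcoset K ` A"
      then obtain x where x: "x \<in> A" "C = mcoset K x" by blast
      have "r (mcoset W x) \<noteq> 0" using rep[OF x(1)] nz by blast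
      then have "C = (\<lambda>d. r (mcoset W x) * d) ` mcoset K (x / r (mcoset W x))"
        unfolding x(2) mcoset_def image_image by simp
      then show "C \<in> (\<lambda>(C, D). (\<lambda>d. r C * d) ` D) ` (mcoset W ` A \<times> mcoset K ` W)"
        using q[OF x(1)] x(1) by (intro image_eqI[of _ _ "(mcoset W x, mcoset K (x / r (mcoset W x)))"]) auto
    qed
    show "(\<lambda>(C, D). (\<lambda>d. r C * d) ` D) ` (mcoset W ` A \<times> mcoset K ` W) \<subseteq> mcoset K ` A"
    proof
      fix C assume "C \<in> (\<lambda>(C, D). (\<lambda>d. r C * d) ` D) ` (mcoset W ` A \<times> mcoset K ` W)"
      then obtain x w where xw: "x \<in> A" "w \<in> W" "C = (\<lambda>d. r (mcoset W x) * d) ` mcoset K w" by auto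
      then have "C = mcoset K (r (mcoset W x) * w)" by (simp add: mcoset_def image_image mult.assoc)
      moreover have "r (mcoset W x) * w \<in> A" using rep[OF xw(1)] xw(2) assms(5) mgroup_mult[OF A] by blast
      ultimately show "C \<in> mcoset K ` A" by blast
    qed
  qed
  moreover have "inj_on (\<lambda>(C, D). (\<lambda>d. r C * d) ` D) (mcoset W ` A \<times> mcoset K ` W)"
  proof (rule inj_onI)
    fix X Y assume X: "X \<in> mcoset W ` A \<times> mcoset K ` W" and Y: "Y \<in> mcoset W ` A \<times> mcoset K ` W"
      and e: "(case X of (C, D) \<Rightarrow> (\<lambda>d. r C * d) ` D) = (case Y of (C, D) \<Rightarrow> (\<lambda>d. r C * d) ` D)"
    obtain x w where xw: "x \<in> A" "w \<in> W" "X = (mcoset W x, mcoset K w)" using X by blast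
    obtain y v where yv: "y \<in> A" "v \<in> W" "Y = (mcoset W y, mcoset K v)" using Y by blast
    let ?a = "r (mcoset W x)" and ?b = "r (mcoset W y)"
    have ab: "?a \<noteq> 0" "?b \<noteq> 0" "?a \<in> A" "?b \<in> A" using rep xw(1) yv(1) nz by blast+
    have wv: "w \<noteq> 0" "v \<noteq> 0" using mgroup_nonzero[OF W] xw yv by auto
    have "mcoset K (?a * w) = mcoset K (?b * v)"
      using e unfolding xw(3) yv(3) by (simp add: mcoset_def image_image mult.assoc)
    then have k: "(?a * w) / (?b * v) \<in> K" using mcoset_eq[OF K] ab wv by simp
    then have "(?a * w) / (?b * v) * (v / w) \<in> W"
      using assms(4) mgroup_divide[OF W yv(2) xw(2)] mgroup_mult[OF W] by blast
    then have "?a / ?b \<in> W" using ab wv by simp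
    then have "mcoset W ?a = mcoset W ?b" using mcoset_eq[OF W] ab by simp
    then have s: "mcoset W x = mcoset W y" using rep xw(1) yv(1) by simp
    then have "w / v \<in> K" using k ab wv by simp
    then have "mcoset K w = mcoset K v" using mcoset_eq[OF K] wv by simp
    then show "X = Y" using s xw(3) yv(3) by simp
  qed
  ultimately show ?thesis unfolding mindex_def by (simp add: card_image card_cartesian_product)
qed

section \<open>Linear algebra over the field with \<open>p\<close> elements, in multiplicative
  notation\<close>

definition indep :: "nat \<Rightarrow> 'a::field set \<Rightarrow> 's set \<Rightarrow> ('s \<Rightarrow> 'a) \<Rightarrow> bool" where
  "indep p K S y \<longleftrightarrow> (\<forall>a. (\<Prod>s\<in>S. y s powi a s) \<in> K \<longrightarrow> (\<forall>s\<in>S. int p dvd a s))"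

lemma prod_powi_diff:
  "(\<And>s. s \<in> S \<Longrightarrow> y s \<noteq> 0) \<Longrightarrow>
    (\<Prod>s\<in>S. y s powi (a s - b s)) = (\<Prod>s\<in>S. y s powi a s) / (\<Prod>s\<in>S. y s powi b s :: 'a::field)"
  by (simp add: power_int_diff prod_dividef)

lemma prod_powi_add:
  "(\<And>s. s \<in> S \<Longrightarrow> y s \<noteq> 0) \<Longrightarrow>
    (\<Prod>s\<in>S. y s powi (a s + b s)) = (\<Prod>s\<in>S. y s powi a s) * (\<Prod>s\<in>S. y s powi b s :: 'a::field)"
  by (simp add: power_int_add prod.distrib)

lemma prod_powi_scale:
  "(\<Prod>s\<in>S. y s powi (m * a s)) = (\<Prod>s\<in>S. y s powi a s :: 'a::field) powi m"
  by (induction S rule: infinite_finite_induct)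
    (simp_all add: power_int_mult_distrib mult.commute[of m] power_int_mult)

locale elementary_level =
  fixes A K :: "'a::field set" and p :: nat
  assumes A: "mgroup A" and K: "mgroup K" and sub: "K \<subseteq> A" and prime: "prime p"
    and exp: "x \<in> A \<Longrightarrow> x ^ p \<in> K"
begin

lemma powi_p: "x \<in> A \<Longrightarrow> int p dvd m \<Longrightarrow> x powi m \<in> K"
  using mgroup_powi[OF K exp[of x]] by (auto simp: power_int_mult elim!: dvdE)

lemma reduce_mod:
  assumes "\<And>s. s \<in> S \<Longrightarrow> y s \<in> A"
  shows "(\<Prod>s\<in>S. y s powi a s) / (\<Prod>s\<in>S. y s powi (a s mod int p)) \<in> K"
proof -
  have "(\<Prod>s\<in>S. y s powi (a s - a s mod int p)) \<in> K"
    by (intro mgroup_prod[OF K] powi_p assms) (simp_all add: minus_mod_eq_mult_div)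
  then show ?thesis using prod_powi_diff[where S=S and y=y and a=a and b="\<lambda>s. a s mod int p"] mgroup_nonzero[OF A assms] by simp
qed

lemma indep_inj:
  assumes ind: "indep p K S y" and y: "\<And>s. s \<in> S \<Longrightarrow> y s \<in> A"
  shows "inj_on (\<lambda>a. mcoset K (\<Prod>s\<in>S. y s powi a s)) (PiE S (\<lambda>_. {0..<int p}))"
proof (rule inj_onI)
  fix a b assume a: "a \<in> PiE S (\<lambda>_. {0..<int p})" and b: "b \<in> PiE S (\<lambda>_. {0..<int p})"
    and e: "mcoset K (\<Prod>s\<in>S. y s powi a s) = mcoset K (\<Prod>s\<in>S. y s powi b s)"
  have nz: "\<And>s. s \<in> S \<Longrightarrow> y s \<noteq> 0" using mgroup_nonzero[OF A y] .
  have inA: "(\<Prod>s\<in>S. y s powi c s) \<in> A" for c by (intro mgroup_prod[OF A] mgroup_powi[OF A] y)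
  have "(\<Prod>s\<in>S. y s powi (a s - b s)) \<in> K"
    using e mcoset_eq[OF K mgroup_nonzero[OF A inA] mgroup_nonzero[OF A inA]] prod_powi_diff[where S=S and y=y, OF nz, where a=a and b=b] by simp
  then have d: "\<And>s. s \<in> S \<Longrightarrow> int p dvd a s - b s" using ind by (auto simp: indep_def)
  show "a = b"
  proof (rule PiE_ext[OF a b])
    fix s assume s: "s \<in> S"
    have "a s mod int p = b s mod int p" using d[OF s] by (simp add: mod_eq_dvd_iff)
    moreover have "a s \<in> {0..<int p}" "b s \<in> {0..<int p}" using a b s by auto
    ultimately show "a s = b s" by simp
  qed
qed

lemma card_PiE_p: "finite S \<Longrightarrow> card (PiE S (\<lambda>_. {0..<int p})) = p ^ card S"
  by (simp add: card_PiE)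

text \<open>The \<open>p^(card S)\<close> products with exponents below \<open>p\<close> lie in
  distinct cosets, and there are no more cosets than that.\<close>

lemma indep_spans:
  assumes "finite S" and ind: "indep p K S y" and y: "\<And>s. s \<in> S \<Longrightarrow> y s \<in> A"
    and idx: "mindex A K = p ^ card S" and x: "x \<in> A"
  shows "\<exists>a. x / (\<Prod>s\<in>S. y s powi a s) \<in> K"
proof -
  let ?\<phi> = "\<lambda>a. mcoset K (\<Prod>s\<in>S. y s powi a s)" and ?P = "PiE S (\<lambda>_. {0..<int p})"
  have inA: "(\<Prod>s\<in>S. y s powi c s) \<in> A" for c by (intro mgroup_prod[OF A] mgroup_powi[OF A] y)
  have "finite (mcoset K ` A)" using idx prime_gt_0_nat[OF prime] unfolding mindex_def
    by (intro card_ge_0_finite) simp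
  moreover have "?\<phi> ` ?P \<subseteq> mcoset K ` A" using inA by blast
  moreover have "card (?\<phi> ` ?P) = card (mcoset K ` A)"
    using card_image[OF indep_inj[OF ind y]] card_PiE_p[OF assms(1)] idx by (simp add: mindex_def)
  ultimately have "?\<phi> ` ?P = mcoset K ` A" by (rule card_subset_eq)
  then obtain a where "mcoset K x = ?\<phi> a" using x by (metis (no_types, lifting) imageE image_eqI)
  then show ?thesis using mcoset_eq[OF K mgroup_nonzero[OF A x] mgroup_nonzero[OF A inA]] by blast
qed

text \<open>Products of \<open>m < d\<close> elements fill at most \<open>p^m\<close> of the
  \<open>p^d\<close> cosets, so an element of a new coset can be adjoined.\<close>

lemma basis_exists:
  assumes idx: "mindex A K = p ^ d" and "m \<le> d"
  shows "\<exists>y :: nat \<Rightarrow> 'a. (\<forall>s<m. y s \<in> A) \<and> indep p K {..<m} y"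
  using assms(2)
proof (induction m)
  case 0
  show ?case by (auto simp: indep_def)
next
  case (Suc m)
  then obtain y :: "nat \<Rightarrow> 'a" where y: "\<forall>s<m. y s \<in> A" and ind: "indep p K {..<m} y" by auto
  let ?\<phi> = "\<lambda>a. mcoset K (\<Prod>s<m. y s powi a s)" and ?P = "PiE {..<m} (\<lambda>_. {0..<int p})"
  have inA: "(\<Prod>s<m. y s powi c s) \<in> A" for c using y by (intro mgroup_prod[OF A] mgroup_powi[OF A]) auto
  have nz: "\<And>s. s \<in> {..<m} \<Longrightarrow> y s \<noteq> 0" using mgroup_nonzero[OF A] y by auto
  have "\<not> mcoset K ` A \<subseteq> ?\<phi> ` ?P"
  proof
    assume "mcoset K ` A \<subseteq> ?\<phi> ` ?P"
    then have "mindex A K \<le> card (?\<phi> ` ?P)" unfolding mindex_def by (intro card_mono) (auto simp: finite_PiE)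
    also have "\<dots> \<le> card ?P" by (intro card_image_le) (auto simp: finite_PiE)
    also have "\<dots> = p ^ m" by (simp add: card_PiE)
    finally show False using idx Suc.prems prime_gt_1_nat[OF prime] by simp
  qed
  then obtain u where u: "u \<in> A" "mcoset K u \<notin> ?\<phi> ` ?P" by blast
  define y' where "y' = y(m := u)"
  have "\<forall>s<Suc m. y' s \<in> A" using y u by (auto simp: y'_def less_Suc_eq)
  moreover have "indep p K {..<Suc m} y'"
    unfolding indep_def
  proof (intro allI impI)
    fix a assume "(\<Prod>s<Suc m. y' s powi a s) \<in> K"
    then have k: "(\<Prod>s<m. y s powi a s) * u powi a m \<in> K" by (simp add: y'_def)
    \<comment> \<open>Otherwise a Bezout multiple of the relation has exponent 1 at \<open>u\<close>
      modulo \<open>p\<close>, and \<open>u\<close> would lie in the span of the earlier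
      elements.\<close>
    have pam: "int p dvd a m"
    proof (rule ccontr)
      assume "\<not> int p dvd a m"
      then have "coprime (a m) (int p)" using prime prime_imp_coprime[of "int p" "a m"] by (simp add: coprime_commute)
      moreover obtain b c where "b * a m + c * int p = gcd (a m) (int p)" using bezout_int by blast
      ultimately have "a m * b - 1 = - c * int p" by (simp add: algebra_simps)
      then have b: "int p dvd a m * b - 1" by simp
      have "((\<Prod>s<m. y s powi a s) * u powi a m) powi b \<in> K" by (rule mgroup_powi[OF K k])
      then have k2: "(\<Prod>s<m. y s powi (b * a s)) * u powi (a m * b) \<in> K"
        unfolding power_int_mult_distrib prod_powi_scale by (simp only: power_int_mult)
      have "u powi (a m * b - 1) \<in> K" by (rule powi_p[OF u(1) b])
      then have "(\<Prod>s<m. y s powi (b * a s)) * u powi (a m * b) / u powi (a m * b - 1) \<in> K" using k2 mgroup_divide[OF K] by blast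
      then have k3: "(\<Prod>s<m. y s powi (b * a s)) * u \<in> K"
        using mgroup_nonzero[OF A u(1)] by (simp add: power_int_diff)
      have inv: "(\<Prod>s<m. y s powi (- b * a s)) = inverse (\<Prod>s<m. y s powi (b * a s))"
        using prod_powi_scale[of y "-1" "\<lambda>s. b * a s" "{..<m}"] by (simp add: power_int_minus)
      have k4: "u / (\<Prod>s<m. y s powi (- b * a s)) \<in> K" unfolding inv using k3 by (simp add: mult.commute divide_inverse)
      let ?c = "\<lambda>s. - b * a s mod int p"
      have "u / (\<Prod>s<m. y s powi ?c s) \<in> K"
        using mgroup_divide_trans[OF K k4 reduce_mod[of "{..<m}" y "\<lambda>s. - b * a s"]] y by simp
      then have "mcoset K u = mcoset K (\<Prod>s<m. y s powi ?c s)"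
        using mcoset_eq[OF K mgroup_nonzero[OF A u(1)] mgroup_nonzero[OF A inA[of ?c]]] by blast
      also have "(\<Prod>s<m. y s powi ?c s) = (\<Prod>s<m. y s powi (restrict ?c {..<m}) s)" by simp
      finally have "mcoset K u \<in> ?\<phi> ` ?P" using prime_gt_0_nat[OF prime]
        by (intro image_eqI[of _ _ "restrict ?c {..<m}"]) auto
      then show False using u(2) by blast
    qed
    then have "u powi a m \<in> K" by (rule powi_p[OF u(1)])
    then have "(\<Prod>s<m. y s powi a s) \<in> K"
      using mgroup_divide[OF K k] mgroup_nonzero[OF A u(1)] by (metis nonzero_mult_div_cancel_right power_int_eq_0_iff)
    then show "\<forall>s\<in>{..<Suc m}. int p dvd a s" using ind pam by (auto simp: indep_def less_Suc_eq)
  qed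
  ultimately show ?case by blast
qed

text \<open>Steinitz exchange: \<open>x\<close> involves \<open>y s0\<close> with an exponent prime
  to \<open>p\<close> and may replace it. The transposition moves \<open>y t\<close> to the slot
  \<open>s0\<close>, so that \<open>x\<close> can take the prescribed slot \<open>t\<close>.\<close>

lemma indep_exchange:
  assumes "finite S" and ind: "indep p K S y" and y: "\<And>s. s \<in> S \<Longrightarrow> y s \<in> A"
    and S: "s0 \<in> S" "t \<in> S" and x: "x \<in> A" "x / (\<Prod>s\<in>S. y s powi m s) \<in> K" and m: "\<not> int p dvd m s0"
  shows "indep p K S (\<lambda>s. if s = t then x else y (Transposition.transpose s0 t s))"
  unfolding indep_def
proof (intro allI impI)
  fix a assume a: "(\<Prod>s\<in>S. (if s = t then x else y (Transposition.transpose s0 t s)) powi a s) \<in> K"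
  have nz: "\<And>s. s \<in> S \<Longrightarrow> y s \<noteq> 0" using mgroup_nonzero[OF A y] .
  have inA: "(\<Prod>s\<in>S. y s powi c s) \<in> A" for c by (intro mgroup_prod[OF A] mgroup_powi[OF A] y)
  \<comment> \<open>The exponents on the old family; \<open>y s0\<close> has left it and gets
    exponent 0.\<close>
  define b where "b s = (if s = s0 then 0 else a (Transposition.transpose s0 t s))" for s
  have "(\<Prod>s\<in>S. (if s = t then x else y (Transposition.transpose s0 t s)) powi a s)
      = x powi a t * (\<Prod>s\<in>S - {t}. y (Transposition.transpose s0 t s) powi a s)"
    by (subst prod.remove[OF assms(1) S(2)]) (auto intro!: prod.cong)
  also have "(\<Prod>s\<in>S - {t}. y (Transposition.transpose s0 t s) powi a s) = (\<Prod>s\<in>S - {s0}. y s powi b s)"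
    by (rule prod.reindex_bij_witness[of _ "Transposition.transpose s0 t" "Transposition.transpose s0 t"])
      (use S in \<open>auto simp: b_def Transposition.transpose_def split: if_splits\<close>)
  also have "\<dots> = (\<Prod>s\<in>S. y s powi b s)"
    by (subst prod.remove[OF assms(1) S(1)]) (simp add: b_def)
  finally have 1: "x powi a t * (\<Prod>s\<in>S. y s powi b s) \<in> K" using a by simp
  have "(x / (\<Prod>s\<in>S. y s powi m s)) powi a t \<in> K" by (rule mgroup_powi[OF K x(2)])
  then have 2: "x powi a t / (\<Prod>s\<in>S. y s powi (a t * m s)) \<in> K"
    by (simp add: power_int_divide_distrib prod_powi_scale)
  have "x powi a t * (\<Prod>s\<in>S. y s powi b s) / (x powi a t / (\<Prod>s\<in>S. y s powi (a t * m s))) \<in> K"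
    by (rule mgroup_divide[OF K 1 2])
  then have "(\<Prod>s\<in>S. y s powi b s) * (\<Prod>s\<in>S. y s powi (a t * m s)) \<in> K"
    using mgroup_nonzero[OF A x(1)] by simp
  then have "(\<Prod>s\<in>S. y s powi (b s + a t * m s)) \<in> K" using prod_powi_add[where S=S and y=y, OF nz] by simp
  then have d: "\<And>s. s \<in> S \<Longrightarrow> int p dvd b s + a t * m s" using ind by (auto simp: indep_def)
  have "int p dvd a t * m s0" using d[OF S(1)] by (simp add: b_def)
  then have at: "int p dvd a t" using m prime prime_dvd_mult_iff[of "int p"] by auto
  have b: "int p dvd b s" if "s \<in> S" for s using d[OF that] at by (simp add: dvd_add_left_iff)
  show "\<forall>s\<in>S. int p dvd a s"
  proof
    fix s assume s: "s \<in> S"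
    show "int p dvd a s"
    proof (cases "s = t")
      case False
      then have "Transposition.transpose s0 t s \<noteq> s0" "Transposition.transpose s0 t s \<in> S" using S s by (auto simp: Transposition.transpose_def)
      then show ?thesis using b[of "Transposition.transpose s0 t s"] by (simp add: b_def)
    qed (use at in simp)
  qed
qed

end

context unit_filt
begin

lemma U_mgroup: "mgroup (U k)"
  using U_nonzero by (auto simp: mgroup_def intro: U_one U_mult U_divide)

definition Wk :: "nat \<Rightarrow> 'a set" where
  "Wk k = {w \<in> U k. w \<in> U (k + 1) \<or> (\<exists>i\<ge>1. k = \<rho> i \<and> (\<exists>u\<in>U i. w / u ^ p \<in> U (k + 1)))}"

lemma Wk_T: "k \<in> T \<rho> \<Longrightarrow> Wk k = U (k + 1)"
  using U_antimono[of k "k + 1"] by (auto simp: Wk_def T_def)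

lemma Wk_rho: "1 \<le> i \<Longrightarrow> Wk (\<rho> i) = {w \<in> U (\<rho> i). \<exists>u\<in>U i. w / u ^ p \<in> U (\<rho> i + 1)}"
  unfolding Wk_def using U_one[of i] by (auto intro: bexI[of _ 1])

lemma Wk_mgroup: "1 \<le> k \<Longrightarrow> mgroup (Wk k)"
proof -
  assume "1 \<le> k"
  then consider "k \<in> T \<rho>" | i where "1 \<le> i" "k = \<rho> i" by (auto simp: T_def)
  then show ?thesis
  proof cases
    case 1
    then show ?thesis using U_mgroup Wk_T by simp
  next
    case 2
    have "mgroup {w \<in> U k. \<exists>u\<in>U i. w / u ^ p \<in> U (k + 1)}"
      unfolding mgroup_def
    proof (intro conjI ballI)
      fix x y assume "x \<in> {w \<in> U k. \<exists>u\<in>U i. w / u ^ p \<in> U (k + 1)}" "y \<in> {w \<in> U k. \<exists>u\<in>U i. w / u ^ p \<in> U (k + 1)}"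
      then obtain u v where uv: "x \<in> U k" "y \<in> U k" "u \<in> U i" "v \<in> U i" "x / u ^ p \<in> U (k + 1)" "y / v ^ p \<in> U (k + 1)" by blast
      have "x * y / (u * v) ^ p \<in> U (k + 1)" using U_mult[OF uv(5,6)] by (simp add: power_mult_distrib)
      then show "x * y \<in> {w \<in> U k. \<exists>u\<in>U i. w / u ^ p \<in> U (k + 1)}" using U_mult uv(1-4) by blast
      have "x / y / (u / v) ^ p = x / u ^ p / (y / v ^ p)" by (simp add: power_divide mult.commute)
      then have "x / y / (u / v) ^ p \<in> U (k + 1)" using U_divide[OF uv(5,6)] by simp
      then show "x / y \<in> {w \<in> U k. \<exists>u\<in>U i. w / u ^ p \<in> U (k + 1)}" using U_divide uv(1-4) by blast
    next
      show "1 \<in> {w \<in> U k. \<exists>u\<in>U i. w / u ^ p \<in> U (k + 1)}" using U_one by (auto intro!: bexI[of _ 1])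
      show "0 \<notin> {w \<in> U k. \<exists>u\<in>U i. w / u ^ p \<in> U (k + 1)}" using U_nonzero by blast
    qed
    then show ?thesis using Wk_rho[OF 2(1)] 2(2) by simp
  qed
qed

lemma Wk_bounds: "U (k + 1) \<subseteq> Wk k" "Wk k \<subseteq> U k"
  using U_antimono[of k "k + 1"] by (auto simp: Wk_def)

lemma U_pow_Suc: "1 \<le> k \<Longrightarrow> x \<in> U k \<Longrightarrow> x ^ p \<in> U (k + 1)"
  using U_pow_p[of x k] U_antimono[of "k + 1" "\<rho> k"] rho_gt[of k] by auto

lemma Wk_level: "1 \<le> k \<Longrightarrow> elementary_level (U k) (Wk k) p"
  by unfold_locales (use U_mgroup Wk_mgroup Wk_bounds(2) prime_p subsetD[OF Wk_bounds(1) U_pow_Suc] in auto)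

lemma U_level: "1 \<le> k \<Longrightarrow> elementary_level (U k) (U (k + 1)) p"
  using U_mgroup U_antimono[of k "k + 1"] prime_p U_pow_Suc by unfold_locales auto

end

text \<open>\<open>Wk k\<close> is the part of \<open>U k\<close> that is supplied by \<open>p\<close>-th powers of lower levels modulo \<open>U (k + 1)\<close>,
  so generators are only needed for the quotients \<open>U k / Wk k\<close>.\<close>

locale level_system = unit_filt \<rho> U p for \<rho> and U :: "nat \<Rightarrow> 'a::field set" and p +
  fixes G :: "'g set" and wt :: "'g \<Rightarrow> nat" and b :: "'g \<Rightarrow> 'a" and n :: nat
  assumes fin_G: "finite G" and wt_pos: "g \<in> G \<Longrightarrow> 1 \<le> wt g" and b: "g \<in> G \<Longrightarrow> b g \<in> U (wt g)"
    and level_span: "1 \<le> k \<Longrightarrow> k < n \<Longrightarrow> x \<in> U k \<Longrightarrow> \<exists>a. x / (\<Prod>g\<in>{g \<in> G. wt g = k}. b g powi a g) \<in> Wk k"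
begin

definition F :: "('g \<Rightarrow> int) \<Rightarrow> 'a" where
  "F a = (\<Prod>g\<in>G. b g powi a g)"

lemma b_nz: "g \<in> G \<Longrightarrow> b g \<noteq> 0"
  using b U_nonzero by blast

sublocale gen_system \<rho> U p G wt F
proof
  show "finite G" by (rule fin_G)
  show "1 \<le> wt g" if "g \<in> G" for g by (rule wt_pos[OF that])
  show "F (\<lambda>g. a g + c g) = F a * F c" for a c unfolding F_def by (rule prod_powi_add) (rule b_nz)
  show "F a \<in> U k" if "\<And>g. g \<in> G \<Longrightarrow> dv (wt g) k (a g)" for a k
    unfolding F_def
  proof (rule U_prod)
    fix g assume g: "g \<in> G"
    show "b g powi a g \<in> U k" by (rule U_powi_dv[OF b[OF g] wt_pos[OF g] that[OF g]])
  qed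
qed

text \<open>Generators of weight \<open>k\<close> remove everything outside \<open>Wk k\<close>.
  What is left is \<open>u^p\<close> modulo the next level with \<open>u\<close> of a smaller level
  \<open>i\<close>; an expansion of \<open>u\<close>, multiplied by \<open>p\<close>, moves from
  weight \<open>i\<close> to weight \<open>\<rho> i = k\<close>.\<close>

lemma step_span:
  assumes "1 \<le> k" "k < n" "x \<in> U k"
  shows "\<exists>a. vFil k a \<and> x / F a \<in> U (k + 1)"
  using assms
proof (induction k arbitrary: x rule: less_induct)
  case (less k)
  obtain a0 where a0: "x / (\<Prod>g\<in>{g \<in> G. wt g = k}. b g powi a0 g) \<in> Wk k" using level_span less.prems by blast
  define a where "a g = (if wt g = k then a0 g else 0)" for g
  have fa: "vFil k a" by (auto simp: vFil_def a_def intro: dv_trivial dv_zero)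
  have "F a = (\<Prod>g\<in>{g \<in> G. wt g = k}. b g powi a0 g)"
    unfolding F_def by (rule prod.mono_neutral_cong_right) (use fin_G in \<open>auto simp: a_def\<close>)
  then have w: "x / F a \<in> Wk k" using a0 by simp
  show ?case
  proof (cases "x / F a \<in> U (k + 1)")
    case True
    then show ?thesis using fa by blast
  next
    case False
    then obtain i u where i: "1 \<le> i" "k = \<rho> i" "u \<in> U i" "x / F a / u ^ p \<in> U (k + 1)"
      using w by (auto simp: Wk_def)
    have ik: "i < k" using rho_gt i by simp
    obtain c where c: "vFil i c" "u / F c \<in> U (i + 1)" using less.IH[OF ik i(1) _ i(3)] ik less.prems by auto
    have "(u / F c) ^ p \<in> U (\<rho> (i + 1))" by (rule U_pow_p[OF c(2)])
    \<comment> \<open>The error in the expansion of \<open>u\<close> has level \<open>i + 1\<close>,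
      so its \<open>p\<close>-th power is already beyond level \<open>k\<close>.\<close>
    moreover have "k + 1 \<le> \<rho> (i + 1)" using i(2) rho_less_iff[of i "i + 1"] by linarith
    ultimately have "(u / F c) ^ p \<in> U (k + 1)" using U_antimono by blast
    then have "u ^ p / F (\<lambda>g. int p * c g) \<in> U (k + 1)" by (simp add: F_scale power_divide)
    from U_mult[OF i(4) this] have "x / F (\<lambda>g. a g + int p * c g) \<in> U (k + 1)"
      using U_nonzero[OF i(3)] by (simp add: F_add)
    moreover have "vFil k (\<lambda>g. int p * c g)" using c(1) dv_p_iff unfolding i(2) by (auto simp: vFil_def)
    ultimately show ?thesis using vFil_add[OF fa] by blast
  qed
qed

lemma spans_upto:
  assumes "m \<le> n" shows "spans m"
proof -
  have "\<exists>a. vFil k a \<and> x / F a \<in> U (k + d)" if "k + d \<le> n" "1 \<le> k" "x \<in> U k" for k d x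
    using that
  proof (induction d)
    case 0
    then show ?case using vFil_0 by (intro exI[of _ "\<lambda>_. 0"]) (auto simp: F_zero vFil_def dv_zero)
  next
    case (Suc d)
    then obtain a where a: "vFil k a" "x / F a \<in> U (k + d)" by auto
    obtain c where c: "vFil (k + d) c" "x / F a / F c \<in> U (k + d + 1)"
      using step_span[of "k + d" "x / F a"] a(2) Suc.prems by auto
    have "vFil k c" using vFil_antimono[OF _ c(1)] by simp
    then show ?case using c(2) vFil_add[OF a(1), of c] by (intro exI[of _ "\<lambda>g. a g + c g"]) (auto simp: F_add)
  qed
  note main = this
  show ?thesis
    unfolding spans_def
  proof (intro allI ballI)
    fix k x assume x: "x \<in> U k"
    show "\<exists>a. vFil k a \<and> x / F a \<in> U m"
    proof (cases "m \<le> k")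
      case True
      then show ?thesis using x U_antimono[OF True] by (intro exI[of _ "\<lambda>_. 0"]) (auto simp: F_zero vFil_def dv_zero)
    next
      case False
      show ?thesis
      proof (cases "k = 0")
        case False
        then show ?thesis using main[of k "m - k" x] x assms \<open>\<not> m \<le> k\<close> by auto
      next
        case True
        then have "x \<in> U 1" using x U_0 by simp
        then show ?thesis using main[of 1 "m - 1" x] assms \<open>\<not> m \<le> k\<close> vFil_0 True by auto
      qed
    qed
  qed
qed

text \<open>By independence modulo \<open>Wk k\<close> the exponents at weight \<open>k\<close> are
  divisible by \<open>p\<close>. If \<open>k = \<rho> i\<close>, the exponents at lower weights are
  so too and give a \<open>p\<close>-th power of some \<open>F a'\<close>. This \<open>F a'\<close>
  lies in the kernel of the \<open>p\<close>-th power map at level \<open>i\<close> and agrees there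
  with a multiple of \<open>z\<close>; the rest is handled by induction. The vector \<open>z\<close>
  stands for a root of unity and \<open>p * z\<close> for the relation.\<close>

lemma step_relation:
  assumes ind: "\<And>k. 1 \<le> k \<Longrightarrow> k < n \<Longrightarrow> indep p (Wk k) {g \<in> G. wt g = k} b"
    and ker: "\<And>i u. 1 \<le> i \<Longrightarrow> i < n \<Longrightarrow> u \<in> U i \<Longrightarrow> u ^ p \<in> U (\<rho> i + 1) \<Longrightarrow>
      \<exists>l. vFil i (\<lambda>g. l * z g) \<and> u / F (\<lambda>g. l * z g) \<in> U (i + 1)"
    and "1 \<le> k" "k < n" "vFil k a" "F a \<in> U (k + 1)"
  shows "\<exists>l. vFil (k + 1) (\<lambda>g. a g - l * (int p * z g))"
  using assms(3-6)
proof (induction k arbitrary: a rule: less_induct)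
  case (less k)
  let ?E = "{g \<in> G. wt g = k}"
  have ind_k: "indep p (Wk k) ?E b" using ind less.prems by blast
  have Wg: "mgroup (Wk k)" using Wk_mgroup less.prems by blast
  have split: "F c = (\<Prod>g\<in>{g \<in> G. wt g < k}. b g powi c g) * (\<Prod>g\<in>?E. b g powi c g) * (\<Prod>g\<in>{g \<in> G. k < wt g}. b g powi c g)" for c
  proof -
    have "G = ({g \<in> G. wt g < k} \<union> ?E) \<union> {g \<in> G. k < wt g}" by auto
    then have "F c = (\<Prod>g\<in>({g \<in> G. wt g < k} \<union> ?E) \<union> {g \<in> G. k < wt g}. b g powi c g)" unfolding F_def by simp
    also have "\<dots> = (\<Prod>g\<in>{g \<in> G. wt g < k} \<union> ?E. b g powi c g) * (\<Prod>g\<in>{g \<in> G. k < wt g}. b g powi c g)"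
      using fin_G by (intro prod.union_disjoint) auto
    also have "(\<Prod>g\<in>{g \<in> G. wt g < k} \<union> ?E. b g powi c g) = (\<Prod>g\<in>{g \<in> G. wt g < k}. b g powi c g) * (\<Prod>g\<in>?E. b g powi c g)"
      using fin_G by (intro prod.union_disjoint) auto
    finally show ?thesis .
  qed
  have high: "(\<Prod>g\<in>{g \<in> G. k < wt g}. b g powi c g) \<in> U (k + 1)" for c
  proof (intro U_prod U_powi)
    fix g assume "g \<in> {g \<in> G. k < wt g}"
    then show "b g \<in> U (k + 1)" using b[of g] U_antimono[of "k + 1" "wt g"] by auto
  qed
  have EU: "(\<Prod>g\<in>?E. b g powi c g) \<in> U k" for c using b by (intro U_prod U_powi) auto
  show ?case
  proof (cases "k \<in> T \<rho>")
    case True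
    \<comment> \<open>No chain of a different weight passes through an element \<open>k\<close> of
      \<open>T \<rho>\<close>, so weight at least \<open>k\<close> already means at least
      \<open>k + 1\<close>.\<close>
    have up: "dv i (k + 1) c" if "dv i k c" "i \<noteq> k" "1 \<le> i" for i c
      unfolding dv_def
    proof (intro allI impI)
      fix d assume d: "(\<rho> ^^ d) i < k + 1"
      have "(\<rho> ^^ d) i \<noteq> k"
      proof (cases d)
        case (Suc d')
        have "1 \<le> (\<rho> ^^ d') i" using pow_ge_add[OF that(3), of d'] that(3) by linarith
        then show ?thesis using True Suc by (auto simp: T_def)
      qed (use that in simp)
      then show "int p ^ (d + 1) dvd c" using that(1) d by (simp add: dv_def)
    qed
    have low: "(\<Prod>g\<in>{g \<in> G. wt g < k}. b g powi a g) \<in> U (k + 1)"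
    proof (intro U_prod)
      fix g assume g: "g \<in> {g \<in> G. wt g < k}"
      then have "dv (wt g) (k + 1) (a g)" using less.prems(3) wt_pos by (intro up) (auto simp: vFil_def)
      then show "b g powi a g \<in> U (k + 1)" using g by (intro U_powi_dv[OF b wt_pos]) auto
    qed
    have "(\<Prod>g\<in>?E. b g powi a g) \<in> U (k + 1)"
      using split[of a] U_divide[OF U_divide[OF less.prems(4) high[of a]] low] U_nonzero[OF high[of a]] U_nonzero[OF low] by simp
    then have pd: "int p dvd a g" if "g \<in> ?E" for g
      using ind_k Wk_bounds(1)[of k] that unfolding indep_def by blast
    have "vFil (k + 1) (\<lambda>g. a g - 0 * (int p * z g))"
      unfolding vFil_def
    proof
      fix g assume g: "g \<in> G"
      have "dv k (k + 1) (a g)" if "wt g = k"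
        using dv_antimono[of "k + 1" "(\<rho> ^^ 1) k" k "a g"] dv_pow[of 1 "a g" k] pd[of g] g that rho_gt[of k] less.prems(1) by simp
      then show "dv (wt g) (k + 1) (a g - 0 * (int p * z g))"
        using up[of "wt g" "a g"] less.prems(3) g wt_pos[OF g] by (cases "wt g = k") (auto simp: vFil_def)
    qed
    then show ?thesis by blast
  next
    case False
    then obtain i where i: "1 \<le> i" "k = \<rho> i" using less.prems by (auto simp: T_def)
    have ik: "i < k" using rho_gt i by simp
    \<comment> \<open>Below weight \<open>k\<close> the weight condition at \<open>c = 0\<close>
      makes the exponents divisible by \<open>p\<close>, so the division is exact; other coordinates
      are set to 0.\<close>
    define a' where "a' g = (if g \<in> G \<and> wt g < k then a g div int p else 0)" for g
    have a': "a g = int p * a' g" if "g \<in> G" "wt g < k" for g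
    proof -
      have "dv (wt g) k (a g)" using less.prems(3) that by (simp add: vFil_def)
      then have "int p ^ (0 + 1) dvd a g" using that(2) unfolding dv_def by (metis funpow_0)
      then show ?thesis using that by (simp add: a'_def)
    qed
    have fa': "vFil i a'"
      unfolding vFil_def
    proof
      fix g assume g: "g \<in> G"
      show "dv (wt g) i (a' g)"
      proof (cases "wt g < k")
        case True
        then have "dv (wt g) (\<rho> i) (int p * a' g)"
          using less.prems(3) g unfolding a'[OF g True, symmetric] i(2)[symmetric] vFil_def by blast
        then show ?thesis using dv_p_iff by blast
      qed (simp add: a'_def dv_zero)
    qed
    have Fa': "F a' ^ p = (\<Prod>g\<in>{g \<in> G. wt g < k}. b g powi a g)"
    proof -
      have "F a' ^ p = F (\<lambda>g. int p * a' g)" by (simp add: F_nat_scale)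
      also have "\<dots> = (\<Prod>g\<in>{g \<in> G. wt g < k}. b g powi (int p * a' g))"
        unfolding F_def by (rule prod.mono_neutral_right) (use fin_G in \<open>auto simp: a'_def\<close>)
      also have "\<dots> = (\<Prod>g\<in>{g \<in> G. wt g < k}. b g powi a g)" by (rule prod.cong) (use a' in auto)
      finally show ?thesis .
    qed
    let ?e = "\<Prod>g\<in>?E. b g powi a g"
    have prod: "F a' ^ p * ?e \<in> U (k + 1)"
      using U_divide[OF less.prems(4) high[of a]] U_nonzero[OF high[of a]] split[of a] Fa' by simp
    have "?e / (inverse (F a')) ^ p \<in> U (k + 1)" using prod by (simp add: power_inverse divide_inverse mult.commute)
    then have "?e \<in> Wk k" unfolding i(2) using Wk_rho[OF i(1)] EU U_inverse[OF F_vFil[OF fa']] i(2) by auto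
    then have pd: "int p dvd a g" if "g \<in> ?E" for g using ind_k that unfolding indep_def by blast
    have "?e \<in> U (k + 1)"
    proof (intro U_prod)
      fix g assume g: "g \<in> ?E"
      then show "b g powi a g \<in> U (k + 1)"
        using elementary_level.powi_p[OF U_level[OF less.prems(1)], of "b g" "a g"] b pd by auto
    qed
    then have "F a' ^ p \<in> U (\<rho> i + 1)" using U_divide[OF prod] U_nonzero i(2) by fastforce
    then obtain l where l: "vFil i (\<lambda>g. l * z g)" "F a' / F (\<lambda>g. l * z g) \<in> U (i + 1)"
      using ker[of i "F a'"] i(1) ik less.prems F_vFil[OF fa'] by auto
    have "vFil i (\<lambda>g. a' g - l * z g)" "F (\<lambda>g. a' g - l * z g) \<in> U (i + 1)"
      using vFil_diff[OF fa' l(1)] l(2) by (auto simp: F_diff)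
    \<comment> \<open>After removal of \<open>l * z\<close> the vector \<open>a'\<close> is a
      relation at the lower level \<open>i\<close>. Multiplication by \<open>p\<close> combines both
      multipliers to \<open>l + p * m\<close>.\<close>
    then obtain m where m: "vFil (i + 1) (\<lambda>g. a' g - l * z g - m * (int p * z g))"
      using less.IH[OF ik i(1)] ik less.prems by (meson less_trans)
    have "vFil (k + 1) (\<lambda>g. a g - (l + int p * m) * (int p * z g))"
      unfolding vFil_def
    proof
      fix g assume g: "g \<in> G"
      have e: "int p * (a' g - l * z g - m * (int p * z g)) = int p * a' g - (l + int p * m) * (int p * z g)"
        by (simp add: algebra_simps)
      have d: "dv (wt g) (\<rho> (i + 1)) (int p * a' g - (l + int p * m) * (int p * z g))"
        using m g dv_p_iff[of "wt g" "i + 1"] unfolding vFil_def e[symmetric] by blast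
      have le: "k + 1 \<le> \<rho> (i + 1)" using i(2) rho_less_iff[of i "i + 1"] by linarith
      consider "wt g < k" | "wt g = k" | "k < wt g" by linarith
      then show "dv (wt g) (k + 1) (a g - (l + int p * m) * (int p * z g))"
      proof cases
        case 1
        then show ?thesis using dv_antimono[OF le d] a'[OF g] by simp
      next
        case 2
        then have "int p dvd a g - (l + int p * m) * (int p * z g)" using pd[of g] g by simp
        then show ?thesis using dv_antimono[of "k + 1" "(\<rho> ^^ 1) k" k] dv_pow[of 1 _ k] 2 rho_gt[of k] less.prems(1) by simp
      next
        case 3
        then show ?thesis by (intro dv_trivial) simp
      qed
    qed
    then show ?thesis by blast
  qed
qed

lemma relations_upto:
  assumes ind: "\<And>k. 1 \<le> k \<Longrightarrow> k < n \<Longrightarrow> indep p (Wk k) {g \<in> G. wt g = k} b"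
    and ker: "\<And>i u. 1 \<le> i \<Longrightarrow> i < n \<Longrightarrow> u \<in> U i \<Longrightarrow> u ^ p \<in> U (\<rho> i + 1) \<Longrightarrow>
      \<exists>l. vFil i (\<lambda>g. l * z g) \<and> u / F (\<lambda>g. l * z g) \<in> U (i + 1)"
    and Fz: "F (\<lambda>g. int p * z g) = 1" and m: "m \<le> n"
  shows "relations m (\<lambda>g. int p * z g)"
  unfolding relations_def
proof (intro allI impI)
  fix a assume a: "F a \<in> U m"
  have "\<exists>l. vFil k (\<lambda>g. a g - l * (int p * z g))" if "k \<le> m" for k
    using that
  proof (induction k)
    case 0
    show ?case using vFil_0 by blast
  next
    case (Suc k)
    then obtain l where l: "vFil k (\<lambda>g. a g - l * (int p * z g))" by auto
    show ?case
    proof (cases "k = 0")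
      case True
      then show ?thesis using wt_pos by (intro exI[of _ 0]) (auto simp: vFil_def intro!: dv_trivial)
    next
      case False
      have "F (\<lambda>g. a g - l * (int p * z g)) = F a" by (simp only: F_diff F_scale[of l] Fz power_int_1_left div_by_1)
      moreover have "F a \<in> U (k + 1)" using a U_antimono[of "k + 1" m] Suc.prems by auto
      ultimately obtain l' where "vFil (k + 1) (\<lambda>g. a g - l * (int p * z g) - l' * (int p * z g))"
        using step_relation[OF ind ker, of k "\<lambda>g. a g - l * (int p * z g)"] l False Suc.prems m by auto
      then show ?thesis by (intro exI[of _ "l + l'"]) (simp add: algebra_simps)
    qed
  qed
  then show "\<exists>l. vFil m (\<lambda>g. a g - l * (int p * z g))" by blast
qed

end

context elementary_level
begin

lemma mindex_basis:
  assumes "finite S" and ind: "indep p K S y" and y: "\<And>s. s \<in> S \<Longrightarrow> y s \<in> A"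
    and span: "\<And>x. x \<in> A \<Longrightarrow> \<exists>a. x / (\<Prod>s\<in>S. y s powi a s) \<in> K"
  shows "mindex A K = p ^ card S"
proof -
  let ?\<phi> = "\<lambda>a. mcoset K (\<Prod>s\<in>S. y s powi a s)" and ?P = "PiE S (\<lambda>_. {0..<int p})"
  have inA: "(\<Prod>s\<in>S. y s powi c s) \<in> A" for c by (intro mgroup_prod[OF A] mgroup_powi[OF A] y)
  have "mcoset K ` A = ?\<phi> ` ?P"
  proof
    show "?\<phi> ` ?P \<subseteq> mcoset K ` A" using inA by blast
    show "mcoset K ` A \<subseteq> ?\<phi> ` ?P"
    proof
      fix C assume "C \<in> mcoset K ` A"
      then obtain x where x: "x \<in> A" "C = mcoset K x" by blast
      obtain a where a: "x / (\<Prod>s\<in>S. y s powi a s) \<in> K" using span[OF x(1)] by blast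
      let ?c = "\<lambda>s. a s mod int p"
      have "x / (\<Prod>s\<in>S. y s powi ?c s) \<in> K"
        using mgroup_divide_trans[OF K a reduce_mod[where S=S and y=y and a=a, OF y]] by simp
      then have "C = mcoset K (\<Prod>s\<in>S. y s powi ?c s)"
        using mcoset_eq[OF K mgroup_nonzero[OF A x(1)] mgroup_nonzero[OF A inA[of ?c]]] x(2) by simp
      also have "(\<Prod>s\<in>S. y s powi ?c s) = (\<Prod>s\<in>S. y s powi (restrict ?c S) s)" by simp
      finally show "C \<in> ?\<phi> ` ?P" using prime_gt_0_nat[OF prime]
        by (intro image_eqI[of _ _ "restrict ?c S"]) auto
    qed
  qed
  then show ?thesis using card_image[OF indep_inj[where S=S and y=y, OF ind y]] card_PiE_p[OF assms(1)] by (simp add: mindex_def)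
qed

lemma basis_exists_on:
  assumes "finite S" and idx: "mindex A K = p ^ card S"
  shows "\<exists>y. (\<forall>s\<in>S. y s \<in> A) \<and> indep p K S y"
proof -
  obtain y :: "nat \<Rightarrow> 'a" where y: "\<forall>s<card S. y s \<in> A" "indep p K {..<card S} y"
    using basis_exists[OF idx order_refl] by blast
  obtain h where h: "bij_betw h S {0..<card S}" using ex_bij_betw_finite_nat[OF assms(1)] by blast
  have "indep p K S (y \<circ> h)"
    unfolding indep_def
  proof (intro allI impI)
    fix a assume a: "(\<Prod>s\<in>S. (y \<circ> h) s powi a s) \<in> K"
    let ?g = "inv_into S h"
    have "(\<Prod>s\<in>S. (y \<circ> h) s powi a s) = (\<Prod>s\<in>S. y (h s) powi a (?g (h s)))"
      using h by (intro prod.cong) (auto simp: bij_betw_def inv_into_f_f)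
    also have "\<dots> = (\<Prod>t\<in>{0..<card S}. y t powi a (?g t))"
      by (rule prod.reindex_bij_betw[OF h, of "\<lambda>t. y t powi a (?g t)"])
    finally have "\<forall>t<card S. int p dvd a (?g t)" using a y(2) by (auto simp: indep_def atLeast0LessThan)
    moreover have "a s = a (?g (h s))" "h s < card S" if "s \<in> S" for s
      using h that by (auto simp: bij_betw_def inv_into_f_f)
    ultimately show "\<forall>s\<in>S. int p dvd a s" by metis
  qed
  moreover have "\<forall>s\<in>S. (y \<circ> h) s \<in> A"
  proof
    fix s assume "s \<in> S"
    then have "h s < card S" using h by (auto simp: bij_betw_def)
    then show "(y \<circ> h) s \<in> A" using y(1) by simp
  qed
  ultimately show ?thesis by blast
qed

end

lemma mindex_self: "mgroup A \<Longrightarrow> mindex A A = 1"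
proof -
  assume A: "mgroup A"
  have "mcoset A x = mcoset A 1" if "x \<in> A" for x
    using mcoset_eq[OF A, of x 1] that mgroup_nonzero[OF A] by auto
  then have "mcoset A ` A = (\<lambda>_. mcoset A 1) ` A" by (intro image_cong) auto
  also have "\<dots> = {mcoset A 1}" using mgroup_one[OF A] by blast
  finally have "mcoset A ` A = {mcoset A 1}" .
  then show ?thesis by (simp add: mindex_def)
qed

context unit_filt
begin

text \<open>The isomorphism in the definition of \<open>jump_set_K\<close>, with integer exponents
  and approximation modulo every \<open>U n\<close> in place of \<open>p\<close>-adic exponents and
  equality. The two are matched by \<open>presented_of_iso\<close> and
  \<open>iso_of_presented\<close>.\<close>

definition presented :: "nat \<Rightarrow> nat set \<Rightarrow> bool" where
  "presented f A \<longleftrightarrow> (\<exists>F. gen_system \<rho> U p (gens f \<rho>) snd F \<and>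
     (\<forall>n. gen_system.spans \<rho> U p (gens f \<rho>) snd F n \<and>
          gen_system.relations \<rho> U p (gens f \<rho>) snd F n (rel_vec p f \<rho> A)) \<and>
     F (rel_vec p f \<rho> A) = 1)"

end

text \<open>\<open>X\<close> contains the levels at which the \<open>p\<close>-th power map on
  graded quotients may have a kernel; in the final applications it is empty or a singleton.
  Completeness is stated multiplicatively, with a prescribed rate of convergence.\<close>

locale unit_tower = unit_filt \<rho> U p for \<rho> and U :: "nat \<Rightarrow> 'a::field set" and p +
  fixes f :: nat and X :: "nat set"
  assumes f_pos: "1 \<le> f"
    and index: "1 \<le> k \<Longrightarrow> mindex (U k) (U (k + 1)) = p ^ f"
    and separated: "(\<And>k. x \<in> U k) \<Longrightarrow> x = 1"
    and complete: "(\<And>n. xs n \<in> U 0) \<Longrightarrow> (\<And>n. xs (Suc n) / xs n \<in> U n) \<Longrightarrow> \<exists>y. \<forall>n. y / xs n \<in> U n"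
    and inj_p: "1 \<le> i \<Longrightarrow> i \<notin> X \<Longrightarrow> u \<in> U i \<Longrightarrow> u ^ p \<in> U (\<rho> i + 1) \<Longrightarrow> u \<in> U (i + 1)"
begin

text \<open>An injective map between graded quotients of the same finite order \<open>p^f\<close> is
  onto.\<close>

lemma surj_p:
  assumes i: "1 \<le> i" "i \<notin> X" and w: "w \<in> U (\<rho> i)"
  shows "\<exists>u\<in>U i. w / u ^ p \<in> U (\<rho> i + 1)"
proof -
  let ?L = "U (\<rho> i + 1)" and ?B = "(\<lambda>u. u ^ p) ` U i"
  have sub: "?B \<subseteq> U (\<rho> i)" using U_pow_p by blast
  have nz: "x \<in> U k \<Longrightarrow> x \<noteq> 0" for x k using U_nonzero by blast
  have "mindex (U i) (U (i + 1)) = mindex ?B ?L"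
  proof (rule mindex_bij[OF U_mgroup U_mgroup, where \<phi> = "\<lambda>u. u ^ p"])
    show "0 \<notin> U i" "0 \<notin> ?B" using nz sub by blast+
    show "x ^ p \<in> ?B" if "x \<in> U i" for x using that by blast
    show "x ^ p / y ^ p \<in> ?L \<longleftrightarrow> x / y \<in> U (i + 1)" if "x \<in> U i" "y \<in> U i" for x y
    proof
      assume "x ^ p / y ^ p \<in> ?L"
      then have "(x / y) ^ p \<in> ?L" by (simp add: power_divide)
      then show "x / y \<in> U (i + 1)" using inj_p[OF i U_divide[OF that]] by blast
    next
      assume "x / y \<in> U (i + 1)"
      then have "(x / y) ^ p \<in> U (\<rho> (i + 1))" by (rule U_pow_p)
      moreover have "\<rho> i + 1 \<le> \<rho> (i + 1)" using rho_less_iff[of i "i + 1"] by linarith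
      ultimately show "x ^ p / y ^ p \<in> ?L" using U_antimono by (simp add: power_divide) blast
    qed
    show "\<exists>x\<in>U i. w / x ^ p \<in> ?L" if "w \<in> ?B" for w
    proof -
      obtain x where "x \<in> U i" "w = x ^ p" using \<open>w \<in> ?B\<close> by blast
      then show ?thesis using nz[of x i] U_one by (intro bexI[of _ x]) auto
    qed
  qed
  moreover have ri: "1 \<le> \<rho> i" using rho_ge[of i] i by linarith
  ultimately have "card (mcoset ?L ` ?B) = card (mcoset ?L ` U (\<rho> i))"
    using index[OF i(1)] index[OF ri] by (simp add: mindex_def)
  moreover have "finite (mcoset ?L ` U (\<rho> i))"
    using index[OF ri] prime_gt_0_nat[OF prime_p] unfolding mindex_def by (intro card_ge_0_finite) simp
  ultimately have "mcoset ?L ` ?B = mcoset ?L ` U (\<rho> i)" using sub by (intro card_subset_eq) auto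
  then obtain u where u: "u \<in> U i" "mcoset ?L w = mcoset ?L (u ^ p)" 
  proof -
    have "mcoset ?L w \<in> mcoset ?L ` ?B" using w unfolding \<open>mcoset ?L ` ?B = _\<close> by blast
    then show ?thesis using that by blast
  qed
  then have "w / u ^ p \<in> ?L" using mcoset_eq[OF U_mgroup, of w "u ^ p"] nz[OF w] nz[OF u(1)] by simp
  then show ?thesis using u(1) by blast
qed

lemma Wk_full: "1 \<le> i \<Longrightarrow> i \<notin> X \<Longrightarrow> Wk (\<rho> i) = U (\<rho> i)"
  using Wk_rho[of i] surj_p[of i] by auto

lemma ijumps_in_Jump:
  assumes h: "ichar N h"
  shows "ijumps N h \<in> jump_sets_within (T \<rho> \<union> \<rho> ` (X \<inter> {1..})) \<rho>"
  unfolding jump_sets_within_iff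
proof
  show "spaced (ijumps N h)" by (rule ijumps_spaced[OF h])
  show "jump_I \<rho> (ijumps N h) \<subseteq> T \<rho> \<union> \<rho> ` (X \<inter> {1..})"
    by (rule ijumps_I_subset[OF h]) (use surj_p in blast)
qed

text \<open>Only generators of weight below a bound \<open>n\<close> for \<open>A\<close> are
  chosen, so that \<open>G\<close> is finite even if \<open>T \<rho>\<close> is not. With no
  relation to respect, a generator of weight \<open>i\<close> may receive the value
  \<open>p^(N - jump_beta A i)\<close>, which has exact order \<open>p^(jump_beta A i)\<close>
  modulo \<open>p^N\<close>.\<close>

lemma realization_trivial:
  assumes X: "X = {}" and A: "A \<in> Jump \<rho>"
  shows "\<exists>N h. ichar N h \<and> ijumps N h = A"
proof -
  have sp: "spaced A" and IT: "jump_I \<rho> A \<subseteq> T \<rho>" using A by (auto simp: Jump_def jump_sets_within_iff)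
  have fin: "finite A" using sp by (simp add: spaced_def)
  define n where "n = Suc (Max (insert 0 A))"
  have An: "a < n" if "a \<in> A" for a using that fin by (auto simp: n_def less_Suc_eq_le)
  define G where "G = {..<f} \<times> {i \<in> T \<rho>. i < n}"
  have finG: "finite G" by (simp add: G_def)
  have wt1: "1 \<le> snd g" if "g \<in> G" for g using that by (auto simp: G_def T_def)
  have card_level: "mindex (U k) (Wk k) = p ^ card {g \<in> G. snd g = k}" if k: "1 \<le> k" "k < n" for k
  proof (cases "k \<in> T \<rho>")
    case True
    then have "{g \<in> G. snd g = k} = {..<f} \<times> {k}" using k by (auto simp: G_def)
    then show ?thesis using index[OF k(1)] Wk_T[OF True] by (simp add: card_cartesian_product)
  next
    case False
    then have "{g \<in> G. snd g = k} = {}" by (auto simp: G_def)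
    moreover obtain i where "1 \<le> i" "k = \<rho> i" using False k by (auto simp: T_def)
    then have "Wk k = U k" using Wk_full X by simp
    ultimately show ?thesis using mindex_self[OF U_mgroup] by (simp only: card.empty power_0)
  qed
  have ex: "\<exists>y. (\<forall>g\<in>{g \<in> G. snd g = k}. y g \<in> U k) \<and> indep p (Wk k) {g \<in> G. snd g = k} y" if "1 \<le> k" "k < n" for k
    using elementary_level.basis_exists_on[OF Wk_level[OF that(1)] _ card_level[OF that]] finG by simp
  define y where "y k = (SOME y. (\<forall>g\<in>{g \<in> G. snd g = k}. y g \<in> U k) \<and> indep p (Wk k) {g \<in> G. snd g = k} y)" for k
  have y: "(\<forall>g\<in>{g \<in> G. snd g = k}. y k g \<in> U k) \<and> indep p (Wk k) {g \<in> G. snd g = k} (y k)" if "1 \<le> k" "k < n" for k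
    unfolding y_def by (rule someI_ex[OF ex[OF that]])
  define b where "b g = y (snd g) g" for g
  have bU: "b g \<in> U (snd g)" if "g \<in> G" for g using y[of "snd g"] that wt1[OF that] by (auto simp: b_def G_def)
  have ind: "indep p (Wk k) {g \<in> G. snd g = k} b" if "1 \<le> k" "k < n" for k
  proof -
    have "(\<Prod>g\<in>{g \<in> G. snd g = k}. b g powi a g) = (\<Prod>g\<in>{g \<in> G. snd g = k}. y k g powi a g)" for a
      by (rule prod.cong) (auto simp: b_def)
    then show ?thesis using y[OF that] by (simp add: indep_def)
  qed
  interpret L: level_system \<rho> U p G snd b n
  proof
    show "finite G" by (rule finG)
    show "1 \<le> snd g" "b g \<in> U (snd g)" if "g \<in> G" for g using wt1 bU that by auto
    show "\<exists>a. x / (\<Prod>g\<in>{g \<in> G. snd g = k}. b g powi a g) \<in> Wk k" if k: "1 \<le> k" "k < n" "x \<in> U k" for k x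
      by (rule elementary_level.indep_spans[OF Wk_level[OF k(1)] _ ind[OF k(1,2)] _ card_level[OF k(1,2)] k(3)])
        (use finG bU in auto)
  qed
  have rel: "L.relations n (\<lambda>g. int p * 0)"
  proof (rule L.relations_upto[OF ind])
    show "\<exists>l. L.vFil i (\<lambda>g. l * 0) \<and> u / L.F (\<lambda>g. l * 0) \<in> U (i + 1)"
      if "1 \<le> i" "i < n" "u \<in> U i" "u ^ p \<in> U (\<rho> i + 1)" for i u
      using inj_p[OF that(1) _ that(3,4)] X by (simp add: L.F_zero L.vFil_def dv_zero)
  qed (use L.F_zero in simp_all)
  define N where "N = jump_beta A 0 + 1"
  have N: "jump_beta A i < N" for i using jump_beta_antimono[OF fin, of 0 i] by (simp add: N_def less_Suc_eq_le)
  have "\<exists>h. ichar N h \<and> ijumps N h = A"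
  proof (rule L.ichar_realization[OF L.spans_upto[OF order_refl] rel sp An, where y = "\<lambda>g. int p ^ (N - jump_beta A (snd g))"])
    show "int p ^ N dvd int p ^ jump_beta A (snd g) * int p ^ (N - jump_beta A (snd g))" for g :: "nat \<times> nat"
      unfolding power_add[symmetric] using N[of "snd g"] by (intro le_imp_power_dvd) simp
    show "\<exists>g\<in>G. snd g = j \<and> \<not> int p ^ N dvd int p ^ (jump_beta A j - 1) * int p ^ (N - jump_beta A (snd g))"
      if j: "j \<in> jump_I \<rho> A" for j
    proof (rule bexI[of _ "(0, j)"], intro conjI)
      show "(0, j) \<in> G" using j IT An f_pos by (auto simp: G_def jump_I_def)
      have "jump_beta A j - 1 + (N - jump_beta A j) < N" using N[of j] jump_beta_I_pos[OF sp j] by linarith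
      then have "\<not> int p ^ N dvd int p ^ (jump_beta A j - 1 + (N - jump_beta A j))"
        using p_gt_1 power_strict_increasing[of _ N "int p"] by (auto dest!: zdvd_imp_le)
      then show "\<not> int p ^ N dvd int p ^ (jump_beta A j - 1) * int p ^ (N - jump_beta A (snd (0, j)))" by (simp add: power_add)
    qed simp
  qed simp_all
  then show ?thesis by blast
qed

text \<open>Successive approximation: from \<open>i\<close> on, \<open>\<rho>\<close> is a
  translation and each graded \<open>p\<close>-th power map is onto, so an approximate root can be
  corrected by a unit of level \<open>i + n\<close> at step \<open>n\<close>. Completeness supplies
  the limit.\<close>

lemma p_th_root_tail:
  assumes i: "1 \<le> i" "\<And>n. i + n \<notin> X" and r: "\<And>n. \<rho> (i + n) = \<rho> i + n" and w: "w \<in> U (\<rho> i)"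
  shows "\<exists>y\<in>U i. w = y ^ p"
proof -
  have "\<exists>x. \<forall>n. (x n \<in> U i \<and> w / x n ^ p \<in> U (\<rho> i + n)) \<and> x (Suc n) / x n \<in> U (i + n)"
  proof (rule dependent_nat_choice)
    show "\<exists>x. x \<in> U i \<and> w / x ^ p \<in> U (\<rho> i + 0)" using w U_one by (intro exI[of _ 1]) simp
    fix x n assume x: "x \<in> U i \<and> w / x ^ p \<in> U (\<rho> i + n)"
    then obtain u where u: "u \<in> U (i + n)" "w / x ^ p / u ^ p \<in> U (\<rho> (i + n) + 1)"
      using surj_p[of "i + n" "w / x ^ p"] i r by auto
    have "u \<in> U i" using u(1) U_antimono[of i "i + n"] by auto
    then have "x * u \<in> U i" using x U_mult by blast
    moreover have "w / (x * u) ^ p \<in> U (\<rho> i + Suc n)" using u(2) r by (simp add: power_mult_distrib)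
    moreover have "x * u / x \<in> U (i + n)" using u(1) x U_nonzero by auto
    ultimately show "\<exists>y. (y \<in> U i \<and> w / y ^ p \<in> U (\<rho> i + Suc n)) \<and> y / x \<in> U (i + n)" by blast
  qed
  then obtain x where x: "\<And>n. x n \<in> U i" "\<And>n. w / x n ^ p \<in> U (\<rho> i + n)" "\<And>n. x (Suc n) / x n \<in> U (i + n)" by blast
  have "x n \<in> U 0" "x (Suc n) / x n \<in> U n" for n
    using x(1)[of n] x(3)[of n] U_antimono[of 0 i] U_antimono[of n "i + n"] by auto
  then obtain y where y: "\<And>n. y / x n \<in> U n" using complete[of x] by blast
  have yi: "y \<in> U i" using U_divide_cancel[OF y[of i] x(1)] .
  have "w / y ^ p \<in> U n" for n
  proof -
    have "w / x n ^ p \<in> U n" using x(2)[of n] U_antimono[of n "\<rho> i + n"] by auto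
    moreover have "(x n / y) ^ p \<in> U n" by (rule U_power[OF U_divide_sym[OF y]])
    ultimately have "w / x n ^ p * (x n / y) ^ p \<in> U n" by (rule U_mult)
    then show ?thesis using U_nonzero[OF x(1)[of n]] by (simp add: power_divide)
  qed
  then have "w / y ^ p = 1" by (rule separated)
  then show ?thesis using yi U_nonzero[OF yi] by auto
qed

theorem ijumps_trivial:
  assumes "X = {}"
  shows "{ijumps N h | N h. ichar N h} = Jump \<rho>"
  using realization_trivial[OF assms] ijumps_in_Jump assms by (fastforce simp: Jump_def)

end

section \<open>Presentations in the presence of roots of unity\<close>

text \<open>\<open>e1\<close> is the exact level of \<zeta>; for a local field it equals
  \<open>v(p) / (p - 1)\<close>, and \<open>tail\<close> records that \<open>\<rho>\<close> is a
  translation from there on.\<close>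

locale unit_tower_mu = unit_tower \<rho> U p f "{e1}" for \<rho> and U :: "nat \<Rightarrow> 'a::field set" and p f e1 +
  fixes \<zeta> :: 'a
  assumes e1: "1 \<le> e1" and zeta: "\<zeta> \<in> U e1" "\<zeta> \<notin> U (e1 + 1)" "\<zeta> ^ p = 1"
    and roots: "x ^ p = 1 \<Longrightarrow> \<exists>l::nat. x = \<zeta> ^ l"
    and tail: "e1 \<le> i \<Longrightarrow> \<rho> (i + 1) = \<rho> i + 1"
    and fin_T: "finite (T \<rho>)" and e_star: "e_star \<rho> = \<rho> e1"
begin

lemma tail_add: "e1 \<le> i \<Longrightarrow> \<rho> (i + n) = \<rho> i + n"
  by (induction n) (use tail in \<open>simp_all add: add.assoc[symmetric]\<close>)

lemma T_star_le: "i \<in> T_star \<rho> \<Longrightarrow> 1 \<le> i \<and> i \<le> \<rho> e1"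
proof -
  assume i: "i \<in> T_star \<rho>"
  have "1 \<le> \<rho> e1" using rho_ge[of e1] e1 by linarith
  moreover have "i < \<rho> e1" if "i \<in> T \<rho>"
  proof (rule ccontr)
    assume "\<not> i < \<rho> e1"
    then have "i = \<rho> (e1 + (i - \<rho> e1))" using tail_add[of e1 "i - \<rho> e1"] by simp
    then show False using that e1 unfolding T_def by (metis DiffE atLeast_iff image_eqI trans_le_add1)
  qed
  ultimately show ?thesis using i e_star by (auto simp: T_star_def T_def)
qed

lemma not_T_star: "1 \<le> k \<Longrightarrow> k \<notin> T_star \<rho> \<Longrightarrow> \<exists>i\<ge>1. i \<noteq> e1 \<and> k = \<rho> i"
  using e_star by (auto simp: T_star_def T_def)

lemma p_th_root: "e1 < i \<Longrightarrow> w \<in> U (\<rho> i) \<Longrightarrow> \<exists>y\<in>U i. w = y ^ p"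
  by (rule p_th_root_tail) (auto intro: tail_add)

lemma p_power_root:
  assumes "e1 < i" "w \<in> U ((\<rho> ^^ c) i)"
  shows "\<exists>y\<in>U i. w = y ^ (p ^ c)"
  using assms(2)
proof (induction c arbitrary: w)
  case (Suc c)
  have "e1 < (\<rho> ^^ c) i" using assms(1) pow_ge[of i c] by linarith
  then obtain v where v: "v \<in> U ((\<rho> ^^ c) i)" "w = v ^ p" using p_th_root[of "(\<rho> ^^ c) i" w] Suc.prems by auto
  obtain y where "y \<in> U i" "v = y ^ (p ^ c)" using Suc.IH[OF v(1)] by blast
  then show ?case using v(2) by (auto simp: power_mult[symmetric] mult.commute)
qed auto

text \<open>\<open>u^p\<close> lies in \<open>U (\<rho> (e1 + 1))\<close> and is thus the
  \<open>p\<close>-th power of some \<open>w\<close> of level \<open>e1 + 1\<close>; the quotient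
  \<open>u / w\<close> is a root of unity.\<close>

lemma kernel_p:
  assumes u: "u \<in> U e1" "u ^ p \<in> U (\<rho> e1 + 1)"
  shows "\<exists>l::nat. u / \<zeta> ^ l \<in> U (e1 + 1)"
proof -
  have "u ^ p \<in> U (\<rho> (e1 + 1))" using u(2) tail[of e1] by simp
  then obtain w where w: "w \<in> U (e1 + 1)" "u ^ p = w ^ p" using p_th_root[of "e1 + 1" "u ^ p"] by auto
  have "(u / w) ^ p = 1" using w U_nonzero[OF w(1)] by (simp add: power_divide)
  then obtain l where l: "u / w = \<zeta> ^ l" using roots by blast
  have "\<zeta> ^ l \<noteq> 0" using U_nonzero[OF zeta(1)] by simp
  then have "u / \<zeta> ^ l = w" using l U_nonzero[OF w(1)] by (simp add: field_simps)
  then show ?thesis using w(1) by auto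
qed

text \<open>The \<open>p\<close>-th power map from level \<open>e1\<close> to level
  \<open>\<rho> e1\<close> has a kernel of order \<open>p\<close> on graded quotients, generated by
  \<zeta>. Source and target both have order \<open>p^f\<close>, so the cokernel has order
  \<open>p\<close> too.\<close>

lemma index_star: "mindex (U (\<rho> e1)) (Wk (\<rho> e1)) = p"
proof -
  let ?es = "\<rho> e1" and ?K = "U (e1 + 1)"
  have es1: "1 \<le> ?es" using rho_ge[of e1] e1 by linarith
  \<comment> \<open>The preimage of the kernel in \<open>U e1\<close>; both sides of the count are
    indices relative to it.\<close>
  define L where "L = {u \<in> U e1. u ^ p \<in> U (?es + 1)}"
  have L: "mgroup L" unfolding mgroup_def
  proof (intro conjI ballI)
    show "1 \<in> L" "0 \<notin> L" using U_one U_nonzero by (auto simp: L_def)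
    fix x y assume "x \<in> L" "y \<in> L"
    then show "x * y \<in> L" "x / y \<in> L" using U_mult U_divide by (auto simp: L_def power_mult_distrib power_divide)
  qed
  have KL: "?K \<subseteq> L"
  proof
    fix u assume u: "u \<in> ?K"
    have "u ^ p \<in> U (?es + 1)" using U_pow_p[OF u] tail[of e1] by simp
    then show "u \<in> L" using u U_antimono[of e1 "e1 + 1"] by (auto simp: L_def)
  qed
  interpret E: elementary_level L ?K p
  proof
    show "mgroup L" "mgroup ?K" "?K \<subseteq> L" "prime p" using L U_mgroup KL prime_p by auto
    show "x ^ p \<in> ?K" if "x \<in> L" for x
      using that U_antimono[of "e1 + 1" "?es + 1"] rho_ge[of e1] unfolding L_def by auto
  qed
  have zL: "\<zeta> \<in> L" using zeta U_one by (simp add: L_def)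
  have "mindex L ?K = p ^ card {()}"
  proof (rule E.mindex_basis[where y = "\<lambda>_. \<zeta>"])
    show "indep p ?K {()} (\<lambda>_. \<zeta>)"
      unfolding indep_def
    proof (intro allI impI ballI)
      fix a :: "unit \<Rightarrow> int" and s assume "(\<Prod>s\<in>{()}. \<zeta> powi a s) \<in> ?K"
      then have z: "\<zeta> powi a () \<in> ?K" by simp
      show "int p dvd a s"
      proof (rule ccontr)
        assume "\<not> int p dvd a s"
        then have "coprime (a ()) (int p)" using prime_p prime_imp_coprime[of "int p" "a ()"] by (simp add: coprime_commute)
        moreover obtain b c where "b * a () + c * int p = gcd (a ()) (int p)" using bezout_int by blast
        ultimately have e: "b * a () + c * int p = 1" by simp
        have "\<zeta> powi (b * a () + c * int p) = (\<zeta> powi a ()) powi b * (\<zeta> ^ p) powi c"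
        proof -
          have "\<zeta> \<noteq> 0" using U_nonzero[OF zeta(1)] .
          then show ?thesis by (simp add: power_int_add power_int_mult mult.commute[of b] mult.commute[of c])
        qed
        then have "\<zeta> = (\<zeta> powi a ()) powi b" using e zeta(3) by simp
        then show False using U_powi[OF z, of b] zeta(2) by simp
      qed
    qed
    show "\<exists>a. x / (\<Prod>s\<in>{()}. \<zeta> powi a s) \<in> ?K" if "x \<in> L" for x
    proof -
      obtain l :: nat where "x / \<zeta> ^ l \<in> ?K" using kernel_p[of x] \<open>x \<in> L\<close> by (auto simp: L_def)
      then show ?thesis by (intro exI[of _ "\<lambda>_. int l"]) simp
    qed
  qed (use zL in auto)
  then have 1: "mindex L ?K = p" by simp
  have LU: "L \<subseteq> U e1" by (auto simp: L_def)
  have 2: "p ^ f = mindex (U e1) L * p" using mindex_mult[OF U_mgroup L U_mgroup KL LU] index[OF e1] 1 by simp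
  have 3: "mindex (U e1) L = mindex (Wk ?es) (U (?es + 1))"
  proof (rule mindex_bij[OF L U_mgroup, where \<phi> = "\<lambda>u. u ^ p"])
    show "0 \<notin> U e1" "0 \<notin> Wk ?es" using U_nonzero Wk_bounds(2) by blast+
    show "x ^ p \<in> Wk ?es" if "x \<in> U e1" for x
      unfolding Wk_rho[OF e1] using that U_pow_p[OF that] U_one U_nonzero[OF that] by (auto intro!: bexI[of _ x])
    show "x ^ p / y ^ p \<in> U (?es + 1) \<longleftrightarrow> x / y \<in> L" if "x \<in> U e1" "y \<in> U e1" for x y
      using U_divide[OF that] by (simp add: L_def power_divide)
    show "\<exists>x\<in>U e1. w / x ^ p \<in> U (?es + 1)" if "w \<in> Wk ?es" for w using that unfolding Wk_rho[OF e1] by blast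
  qed
  have 4: "p ^ f = mindex (U ?es) (Wk ?es) * mindex (U e1) L"
    using mindex_mult[OF U_mgroup Wk_mgroup[OF es1] U_mgroup Wk_bounds] index[OF es1] 3 by simp
  have "mindex (U e1) L \<noteq> 0" using 2 prime_gt_0_nat[OF prime_p] by (intro notI) simp
  then show ?thesis using 2 4 by (metis mult.commute mult_cancel_right)
qed

abbreviation lev :: "nat \<Rightarrow> (nat \<times> nat) set" where
  "lev k \<equiv> {g \<in> gens f \<rho>. snd g = k}"

lemma gens_wt: "g \<in> gens f \<rho> \<Longrightarrow> snd g \<in> T_star \<rho>"
  by (auto simp: gens_def T_star_def)

lemma special_gen: "i \<in> T_star \<rho> \<Longrightarrow> (f - 1, i) \<in> gens f \<rho>"
  by (simp add: gens_def)

text \<open>The number of generators of weight \<open>k\<close> is \<open>f\<close> on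
  \<open>T \<rho>\<close>, 1 at \<open>e_star \<rho>\<close> and 0 elsewhere, in agreement with the
  orders of the quotients \<open>U k / Wk k\<close>.\<close>

lemma index_level: "1 \<le> k \<Longrightarrow> mindex (U k) (Wk k) = p ^ card (lev k)"
proof -
  assume k: "1 \<le> k"
  have ns: "\<rho> e1 \<notin> T \<rho>" using e_star_notin_T[OF fin_T] e_star by simp
  consider "k \<in> T \<rho>" | "k = \<rho> e1" | "k \<notin> T_star \<rho>" using e_star by (auto simp: T_star_def)
  then show ?thesis
  proof cases
    case 1
    then have "lev k = {..<f} \<times> {k}" using f_pos by (auto simp: gens_def T_star_def)
    then show ?thesis using index[OF k] Wk_T[OF 1] by (simp add: card_cartesian_product)
  next
    case 2
    then have "lev k = {(f - 1, k)}" using ns e_star by (auto simp: gens_def T_star_def)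
    then show ?thesis using index_star 2 by simp
  next
    case 3
    then have "lev k = {}" using gens_wt by blast
    moreover have "Wk k = U k" using not_T_star[OF k 3] Wk_full by auto
    ultimately show ?thesis using mindex_self[OF U_mgroup] by (simp only: card.empty power_0)
  qed
qed

definition basis :: "(nat \<times> nat \<Rightarrow> 'a) \<Rightarrow> bool" where
  "basis b \<longleftrightarrow> (\<forall>g\<in>gens f \<rho>. b g \<in> U (snd g)) \<and> (\<forall>k\<ge>1. indep p (Wk k) (lev k) b)"

lemma basis_level_system: "basis b \<Longrightarrow> level_system \<rho> U p (gens f \<rho>) snd b n"
proof
  assume b: "basis b"
  show "finite (gens f \<rho>)" by (rule finite_gens[OF fin_T])
  show "1 \<le> snd g" "b g \<in> U (snd g)" if "g \<in> gens f \<rho>" for g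
    using b gens_wt[OF that] T_star_le that by (auto simp: basis_def)
  show "\<exists>a. x / (\<Prod>g\<in>lev k. b g powi a g) \<in> Wk k" if k: "1 \<le> k" "k < n" "x \<in> U k" for k x
    by (rule elementary_level.indep_spans[OF Wk_level[OF k(1)] _ _ _ index_level[OF k(1)] k(3)])
      (use finite_gens[OF fin_T] b k(1) in \<open>auto simp: basis_def\<close>)
qed

lemma basis_exists: "\<exists>b. basis b"
proof -
  have ex: "\<exists>y. (\<forall>g\<in>lev k. y g \<in> U k) \<and> indep p (Wk k) (lev k) y" if "1 \<le> k" for k
    using elementary_level.basis_exists_on[OF Wk_level[OF that] _ index_level[OF that]] finite_gens[OF fin_T] by simp
  define y where "y k = (SOME y. (\<forall>g\<in>lev k. y g \<in> U k) \<and> indep p (Wk k) (lev k) y)" for k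
  have y: "(\<forall>g\<in>lev k. y k g \<in> U k) \<and> indep p (Wk k) (lev k) (y k)" if "1 \<le> k" for k
    unfolding y_def by (rule someI_ex[OF ex[OF that]])
  define b where "b g = y (snd g) g" for g
  have "indep p (Wk k) (lev k) b" if "1 \<le> k" for k
  proof -
    have "(\<Prod>g\<in>lev k. b g powi a g) = (\<Prod>g\<in>lev k. y k g powi a g)" for a by (rule prod.cong) (auto simp: b_def)
    then show ?thesis using y[OF that] by (simp add: indep_def)
  qed
  moreover have "b g \<in> U (snd g)" if g: "g \<in> gens f \<rho>" for g
  proof -
    have "1 \<le> snd g" using T_star_le[OF gens_wt[OF g]] by blast
    from y[OF this] g have "y (snd g) g \<in> U (snd g)" by blast
    then show ?thesis by (simp add: b_def)
  qed
  ultimately show ?thesis unfolding basis_def by blast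
qed

end

context unit_tower_mu
begin

text \<open>The relation expresses \<open>\<zeta>^p = 1\<close>; dividing its exponents by
  \<open>p\<close> leaves those of a root of unity.\<close>

definition half_rel :: "nat set \<Rightarrow> nat \<times> nat \<Rightarrow> int" where
  "half_rel A = (\<lambda>(s, i). if s = f - 1 \<and> i \<in> jump_I \<rho> A then int p ^ (jump_beta A i - 1) else 0)"

lemma rel_half: "spaced A \<Longrightarrow> rel_vec p f \<rho> A = (\<lambda>g. int p * half_rel A g)"
proof
  fix g :: "nat \<times> nat" assume "spaced A"
  moreover obtain s i where "g = (s, i)" by (cases g)
  ultimately show "rel_vec p f \<rho> A g = int p * half_rel A g"
    using jump_beta_I_pos[of A i] by (cases "jump_beta A i") (auto simp: rel_vec_def half_rel_def)
qed

lemma ex_p_adic_split: "z \<noteq> 0 \<Longrightarrow> \<exists>c u. z = int p ^ c * u \<and> \<not> int p dvd u"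
  using multiplicity_decompose'[of z "int p"] p_gt_1 by (metis zdvd1_eq abs_of_pos less_irrefl)

lemma zeta_not_power: "\<zeta> \<noteq> 1"
  using zeta(2) U_one by blast

text \<open>Write \<open>\<zeta>\<close> as the product of the \<open>b g powi z g\<close> up to a tail that is a high $p$-power, and group the factors by the
  minimal pairs (weight, order of \<open>z g\<close>) for the dominance order; each minimal pair yields one new
  generator, which replaces the special generator of its weight.\<close>

lemma adapted_basis:
  "\<exists>A b. A \<in> Jump_star \<rho> \<and> basis b \<and> (\<Prod>g\<in>gens f \<rho>. b g powi half_rel A g) = \<zeta> \<and>
     (\<forall>i\<in>jump_I \<rho> A. e1 \<le> (\<rho> ^^ (jump_beta A i - 1)) i)"
proof -
  let ?G = "gens f \<rho>" and ?es = "\<rho> e1"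
  have finG: "finite ?G" by (rule finite_gens[OF fin_T])
  obtain b0 where b0: "basis b0" using basis_exists by blast
  have b0U: "b0 g \<in> U (snd g)" if "g \<in> ?G" for g using b0 that by (simp add: basis_def)
  have wt1: "1 \<le> snd g" "snd g \<le> ?es" if "g \<in> ?G" for g using T_star_le[OF gens_wt[OF that]] by auto
  \<comment> \<open>Chosen so that every unit of level \<open>n0\<close> is a \<open>p^e1\<close>-th
    power of a unit of level above \<open>\<rho> e1\<close>, and can therefore be absorbed into a
    generator later.\<close>
  define n0 where "n0 = (\<rho> ^^ e1) (?es + 1)"
  have n0: "?es + 1 \<le> n0" unfolding n0_def by (rule pow_ge)
  have es1: "e1 + 1 \<le> ?es + 1" using rho_ge[of e1] by simp
  interpret L0: level_system \<rho> U p ?G snd b0 n0 by (rule basis_level_system[OF b0])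
  obtain z where z: "L0.vFil e1 z" "\<zeta> / L0.F z \<in> U n0"
    using L0.spans_upto[OF order_refl] zeta(1) unfolding L0.spans_def by blast
  have "\<exists>y\<in>U (?es + 1). \<zeta> / L0.F z = y ^ (p ^ e1)"
    using p_power_root[of "?es + 1" "\<zeta> / L0.F z" e1] z(2) rho_ge[of e1] by (simp add: n0_def)
  then obtain y where y: "y \<in> U (?es + 1)" "\<zeta> / L0.F z = y ^ (p ^ e1)" by blast
  have "\<forall>g. \<exists>c u. z g \<noteq> 0 \<longrightarrow> z g = int p ^ c * u \<and> \<not> int p dvd u" using ex_p_adic_split by blast
  then obtain c u where cu: "\<And>g. z g \<noteq> 0 \<Longrightarrow> z g = int p ^ c g * u g \<and> \<not> int p dvd u g" by metis
  define S where "S = {g \<in> ?G. z g \<noteq> 0}"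
  have finS: "finite S" using finG by (simp add: S_def)
  have SG: "g \<in> ?G" if "g \<in> S" for g using that by (simp add: S_def)
  have zS: "z g = int p ^ c g * u g" "\<not> int p dvd u g" if "g \<in> S" for g using cu that by (auto simp: S_def)
  define h where "h g = (\<rho> ^^ c g) (snd g)" for g
  \<comment> \<open>If \<open>dom r g\<close> holds, the factor at \<open>g\<close> is the
    \<open>p^(c r)\<close>-th power of a unit whose level is at least the weight of
    \<open>r\<close>; it can be moved into the generator made from \<open>r\<close>.\<close>
  define dom where "dom r g \<longleftrightarrow> c r \<le> c g \<and> h r \<le> h g" for r g
  define mn where "mn r \<longleftrightarrow> r \<in> S \<and> (\<forall>g\<in>S. dom g r \<longrightarrow> dom r g)" for r
  have dom_refl: "dom g g" for g by (simp add: dom_def)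
  have dom_trans: "dom g k" if "dom g r" "dom r k" for g r k using that by (auto simp: dom_def)
  have ex_mn: "\<exists>r. mn r \<and> dom r g" if "g \<in> S" for g
    using that
  proof (induction "c g + h g" arbitrary: g rule: less_induct)
    case less
    show ?case
    proof (cases "mn g")
      case True
      then show ?thesis using dom_refl by blast
    next
      case False
      then obtain g' where g': "g' \<in> S" "dom g' g" "\<not> dom g g'" using less.prems by (auto simp: mn_def)
      then have "c g' + h g' < c g + h g" by (auto simp: dom_def)
      then obtain r where "mn r" "dom r g'" using less.hyps[of g'] g'(1) by blast
      then show ?thesis using dom_trans g'(2) by blast
    qed
  qed
  define I where "I = snd ` {r. mn r}"
  define R where "R i = (SOME r. mn r \<and> snd r = i)" for i
  have R: "mn (R i)" "snd (R i) = i" "R i \<in> S" if "i \<in> I" for i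
  proof -
    have "\<exists>r. mn r \<and> snd r = i" using that by (auto simp: I_def)
    from someI_ex[OF this] show "mn (R i)" "snd (R i) = i" unfolding R_def by auto
    then show "R i \<in> S" by (simp add: mn_def)
  qed
  define \<gamma> where "\<gamma> i = c (R i)" for i
  have hR: "h (R i) = (\<rho> ^^ \<gamma> i) i" if "i \<in> I" for i using R[OF that] by (simp add: h_def \<gamma>_def)
  have finI: "finite I"
  proof -
    have "{r. mn r} \<subseteq> S" by (auto simp: mn_def)
    then show ?thesis unfolding I_def using finS finite_subset by blast
  qed
  have IT: "i \<in> T_star \<rho>" if "i \<in> I" for i using gens_wt[OF SG[OF R(3)[OF that]]] R(2)[OF that] by simp
  have cover: "\<exists>i\<in>I. dom (R i) g" if g: "g \<in> S" for g
  proof -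
    obtain r where r: "mn r" "dom r g" using ex_mn[OF g] by blast
    define i where "i = snd r"
    have i: "i \<in> I" using r(1) by (auto simp: I_def i_def)
    have rS: "r \<in> S" using r(1) by (simp add: mn_def)
    have "dom (R i) r"
    proof (cases "c (R i) \<le> c r")
      case True
      then show ?thesis using R(2)[OF i] pow_mono_exp[OF True, of i] by (simp add: dom_def h_def i_def)
    next
      case False
      then have "dom r (R i)" using R(2)[OF i] pow_mono_exp[of "c r" "c (R i)" i] by (simp add: dom_def h_def i_def)
      then show ?thesis using R(1)[OF i] rS by (auto simp: mn_def)
    qed
    then show ?thesis using i dom_trans r(2) by blast
  qed
  \<comment> \<open>\<open>R i\<close> is assigned to its own weight, so that it enters the new
    generator with an exponent prime to \<open>p\<close>; any other factor goes to some minimal one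
    below it.\<close>
  define asg where "asg g = (if snd g \<in> I \<and> g = R (snd g) then snd g else SOME i. i \<in> I \<and> dom (R i) g)" for g
  have asg: "asg g \<in> I" "dom (R (asg g)) g" if g: "g \<in> S" for g
  proof -
    have "asg g \<in> I \<and> dom (R (asg g)) g"
    proof (cases "snd g \<in> I \<and> g = R (snd g)")
      case True
      then have "asg g = snd g" by (simp add: asg_def)
      then show ?thesis using True dom_refl by metis
    next
      case False
      then have "asg g = (SOME i. i \<in> I \<and> dom (R i) g)" by (simp only: asg_def if_False)
      moreover have "(SOME i. i \<in> I \<and> dom (R i) g) \<in> I \<and> dom (R (SOME i. i \<in> I \<and> dom (R i) g)) g"
        by (rule someI_ex[of "\<lambda>i. i \<in> I \<and> dom (R i) g"]) (use cover[OF g] in blast)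
      ultimately show ?thesis by simp
    qed
    then show "asg g \<in> I" "dom (R (asg g)) g" by auto
  qed
  have asgR: "asg (R i) = i" if "i \<in> I" for i
  proof -
    have "snd (R i) \<in> I \<and> R i = R (snd (R i))" using R(2)[OF that] that by simp
    then have "asg (R i) = snd (R i)" unfolding asg_def by (rule if_P)
    then show ?thesis using R(2)[OF that] by simp
  qed
  have \<gamma>_le: "\<gamma> (asg g) \<le> c g" "(\<rho> ^^ \<gamma> (asg g)) (asg g) \<le> (\<rho> ^^ c g) (snd g)" if g: "g \<in> S" for g
    using asg[OF g] hR[OF asg(1)[OF g]] by (auto simp: dom_def \<gamma>_def h_def)
  have dec: "\<gamma> i' < \<gamma> i" and inc: "(\<rho> ^^ \<gamma> i) i < (\<rho> ^^ \<gamma> i') i'" if i: "i \<in> I" "i' \<in> I" "i < i'" for i i'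
  proof -
    \<comment> \<open>Comparable minimal factors have equal order and equal weight, so distinct
      weights in \<open>I\<close> are incomparable; this yields both strict inequalities.\<close>
    have eqv: "\<gamma> j = \<gamma> j' \<and> h (R j) = h (R j')" if j: "j \<in> I" "j' \<in> I" and d: "dom (R j) (R j')" for j j'
    proof -
      have "dom (R j') (R j)" using R(1)[OF j(2)] R(3)[OF j(1)] d unfolding mn_def by blast
      then show ?thesis using d unfolding dom_def \<gamma>_def by linarith
    qed
    show l: "\<gamma> i' < \<gamma> i"
    proof (rule ccontr)
      assume n: "\<not> ?thesis"
      then have "(\<rho> ^^ \<gamma> i) i \<le> (\<rho> ^^ \<gamma> i') i" by (intro pow_mono_exp) simp
      also have "\<dots> \<le> (\<rho> ^^ \<gamma> i') i'" using i(3) by simp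
      finally have "dom (R i) (R i')" using n hR i by (simp add: dom_def \<gamma>_def)
      from eqv[OF i(1,2) this] have "\<gamma> i = \<gamma> i'" "(\<rho> ^^ \<gamma> i) i = (\<rho> ^^ \<gamma> i') i'"
        unfolding hR[OF i(1)] hR[OF i(2)] by auto
      then have "(\<rho> ^^ \<gamma> i') i = (\<rho> ^^ \<gamma> i') i'" by (simp only:)
      then show False using i(3) by simp
    qed
    show "(\<rho> ^^ \<gamma> i) i < (\<rho> ^^ \<gamma> i') i'"
    proof (rule ccontr)
      assume "\<not> ?thesis"
      then have "dom (R i') (R i)" using l hR i by (simp add: dom_def \<gamma>_def)
      from eqv[OF i(2,1) this] show False using l by simp
    qed
  qed
  obtain A where A: "spaced A" "jump_I \<rho> A = I" "\<And>i. i \<in> I \<Longrightarrow> jump_beta A i = \<gamma> i + 1"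
  proof -
    have "\<exists>A. spaced A \<and> jump_I \<rho> A = I \<and> (\<forall>i\<in>I. jump_beta A i = \<gamma> i + 1)"
    proof (rule jump_set_of_pairs[OF finI])
      show "I \<subseteq> {1..}" using IT T_star_le by auto
      show "\<gamma> i' + 1 < \<gamma> i + 1" if "i \<in> I" "i' \<in> I" "i < i'" for i i' using dec[OF that] by simp
      show "(\<rho> ^^ (\<gamma> i + 1)) i < (\<rho> ^^ (\<gamma> i' + 1)) i'" if "i \<in> I" "i' \<in> I" "i < i'" for i i' using inc[OF that] by simp
    qed simp
    then show ?thesis using that by blast
  qed
  \<comment> \<open>Were all exponents divisible by \<open>p^e1\<close>, then \<zeta> would have
    level \<open>e1 + 1\<close>. The factor found here leads to an \<open>i0\<close> with
    \<open>\<gamma> i0 \<le> e1\<close>, able to absorb the tail.\<close>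
  have low: "\<exists>g\<in>S. c g < e1"
  proof (rule ccontr)
    assume n: "\<not> ?thesis"
    have "dv (snd g) (e1 + 1) (z g)" if g: "g \<in> ?G" for g
    proof (cases "g \<in> S")
      case True
      then have "int p ^ e1 dvd z g" using n zS(1)[OF True] by (auto simp: not_less intro: le_imp_power_dvd dvd_mult2)
      then have "dv (snd g) ((\<rho> ^^ e1) (snd g)) (z g)" by (rule dv_pow)
      moreover have "e1 + 1 \<le> (\<rho> ^^ e1) (snd g)" using pow_ge_add[OF wt1(1)[OF g], of e1] wt1(1)[OF g] by linarith
      ultimately show ?thesis by (rule dv_antimono[rotated])
    qed (use g in \<open>simp add: S_def dv_zero\<close>)
    then have "L0.F z \<in> U (e1 + 1)" by (intro L0.F_fil)
    moreover have "\<zeta> / L0.F z \<in> U (e1 + 1)" using z(2) U_antimono[of "e1 + 1" n0] n0 es1 by auto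
    ultimately show False using U_divide_cancel zeta(2) by blast
  qed
  then obtain g1 where g1: "g1 \<in> S" "c g1 < e1" by blast
  define i0 where "i0 = asg g1"
  have i0: "i0 \<in> I" "\<gamma> i0 \<le> e1" using asg(1)[OF g1(1)] \<gamma>_le(1)[OF g1(1)] g1(2) by (auto simp: i0_def)
  \<comment> \<open>The tail goes into the single generator \<open>i0\<close>. Its level exceeds
    \<open>\<rho> e1\<close>, hence all weights, so the class of that generator is not
    affected.\<close>
  define yy where "yy i = (if i = i0 then y ^ (p ^ (e1 - \<gamma> i)) else 1)" for i
  define e where "e k g = (if g \<in> S \<and> asg g = k then int p ^ (c g - \<gamma> k) * u g else 0)" for k g
  define x where "x i = (\<Prod>g\<in>?G. b0 g powi e i g) * yy i" for i
  have yyU: "yy i \<in> U (?es + 1)" for i using y(1) U_power U_one by (simp add: yy_def)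
  have zeta_x: "\<zeta> = (\<Prod>i\<in>I. x i ^ (p ^ \<gamma> i))"
  proof -
    have 1: "(\<Prod>g\<in>?G. b0 g powi e i g) ^ (p ^ \<gamma> i) = (\<Prod>g\<in>{g \<in> S. asg g = i}. b0 g powi z g)" if "i \<in> I" for i
    proof -
      have "(\<Prod>g\<in>?G. b0 g powi e i g) = (\<Prod>g\<in>{g \<in> S. asg g = i}. b0 g powi e i g)"
        by (rule prod.mono_neutral_right[OF finG]) (auto simp: S_def e_def)
      then have "(\<Prod>g\<in>?G. b0 g powi e i g) ^ (p ^ \<gamma> i) = (\<Prod>g\<in>{g \<in> S. asg g = i}. (b0 g powi e i g) ^ (p ^ \<gamma> i))"
        by (simp add: prod_power_distrib)
      also have "\<dots> = (\<Prod>g\<in>{g \<in> S. asg g = i}. b0 g powi z g)"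
      proof (rule prod.cong)
        fix g assume g: "g \<in> {g \<in> S. asg g = i}"
        have "(b0 g powi e i g) ^ (p ^ \<gamma> i) = b0 g powi (e i g * int (p ^ \<gamma> i))"
          unfolding power_int_mult power_int_of_nat by (rule refl)
        also have "e i g * int (p ^ \<gamma> i) = z g"
        proof -
          have "int p ^ (c g - \<gamma> i) * int p ^ \<gamma> i = int p ^ c g" using \<gamma>_le(1)[of g] g by (simp flip: power_add)
          then show ?thesis using g zS(1)[of g] by (simp add: e_def mult_ac)
        qed
        finally show "(b0 g powi e i g) ^ (p ^ \<gamma> i) = b0 g powi z g" .
      qed simp
      finally show ?thesis .
    qed
    have 2: "(\<Prod>i\<in>I. yy i ^ (p ^ \<gamma> i)) = y ^ (p ^ e1)"
    proof -
      have "(\<Prod>i\<in>I. yy i ^ (p ^ \<gamma> i)) = (\<Prod>i\<in>I. if i = i0 then y ^ (p ^ e1) else 1)"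
        by (rule prod.cong) (use i0(2) in \<open>auto simp: yy_def simp flip: power_mult power_add\<close>)
      then show ?thesis using i0(1) finI by simp
    qed
    have "(\<Prod>i\<in>I. x i ^ (p ^ \<gamma> i)) = (\<Prod>i\<in>I. \<Prod>g\<in>{g \<in> S. asg g = i}. b0 g powi z g) * y ^ (p ^ e1)"
      unfolding x_def power_mult_distrib prod.distrib 2 using 1 by simp
    also have "(\<Prod>i\<in>I. \<Prod>g\<in>{g \<in> S. asg g = i}. b0 g powi z g) = (\<Prod>g\<in>S. b0 g powi z g)"
      by (rule prod.group[OF finS finI]) (use asg(1) in blast)
    also have "(\<Prod>g\<in>S. b0 g powi z g) = L0.F z"
      unfolding L0.F_def by (rule prod.mono_neutral_left[OF finG]) (auto simp: S_def)
    also have "L0.F z * y ^ (p ^ e1) = \<zeta>" using y(2) L0.F_nz[of z] by (simp add: field_simps)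
    finally show ?thesis by simp
  qed
  \<comment> \<open>A factor of another weight either has level above \<open>k\<close>, or reaches
    \<open>k\<close> after at least one step of its chain and is then a \<open>p\<close>-th
    power.\<close>
  have elt: "b0 g powi e k g \<in> Wk k" if k: "k \<in> I" and g: "g \<in> ?G" "snd g \<noteq> k" for k g
  proof (cases "g \<in> S \<and> asg g = k")
    case False
    then have "e k g = 0" by (simp only: e_def if_False)
    then show ?thesis using U_one Wk_bounds(1)[of k] by auto
  next
    case True
    define d where "d = c g - \<gamma> k"
    have cg: "c g = \<gamma> k + d" using \<gamma>_le(1)[of g] True by (auto simp: d_def)
    have "(\<rho> ^^ \<gamma> k) k \<le> (\<rho> ^^ \<gamma> k) ((\<rho> ^^ d) (snd g))" using \<gamma>_le(2)[of g] True by (simp add: cg funpow_add)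
    then have kd: "k \<le> (\<rho> ^^ d) (snd g)" by simp
    have eg: "e k g = int p ^ d * u g" using True by (simp add: e_def d_def)
    have eU: "b0 g powi e k g \<in> U ((\<rho> ^^ d) (snd g))"
      by (rule U_powi_dv[OF b0U[OF g(1)] wt1(1)[OF g(1)]]) (simp add: eg dv_pow)
    show ?thesis
    proof (cases "(\<rho> ^^ d) (snd g) = k")
      case False
      then show ?thesis using eU kd U_antimono[of "k + 1" "(\<rho> ^^ d) (snd g)"] Wk_bounds(1)[of k] by auto
    next
      case eq: True
      then have "d \<noteq> 0" using g(2) by (intro notI) simp
      then obtain d' where d': "d = Suc d'" by (cases d) auto
      define i where "i = (\<rho> ^^ d') (snd g)"
      have i1: "1 \<le> i" using pow_ge_add[OF wt1(1)[OF g(1)], of d'] wt1(1)[OF g(1)] by (simp add: i_def)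
      have ki: "k = \<rho> i" using eq by (simp add: i_def d')
      define v where "v = b0 g powi (int p ^ d' * u g)"
      have v: "v \<in> U i" unfolding v_def i_def by (rule U_powi_dv[OF b0U[OF g(1)] wt1(1)[OF g(1)]]) (simp add: dv_pow)
      have "b0 g powi e k g = b0 g powi (int p ^ d' * u g * int p)" by (simp add: eg d' mult_ac)
      also have "\<dots> = v ^ p" unfolding v_def power_int_mult[of _ "int p ^ d' * u g"] power_int_of_nat by (rule refl)
      finally have "b0 g powi e k g / v ^ p = 1" using U_nonzero[OF v] by simp
      then have "b0 g powi e k g / v ^ p \<in> U (k + 1)" by (simp only: U_one)
      moreover have "b0 g powi e k g \<in> U k" using eU eq by simp
      ultimately have "b0 g powi e k g \<in> {w \<in> U k. \<exists>u\<in>U i. w / u ^ p \<in> U (k + 1)}" using v by blast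
      then show ?thesis using Wk_rho[OF i1] ki by simp
    qed
  qed
  have kI1: "1 \<le> k" "k \<le> ?es" if "k \<in> I" for k using T_star_le[OF IT[OF that]] by auto
  have Sk: "R k \<in> lev k" "(f - 1, k) \<in> lev k" if "k \<in> I" for k
    using SG[OF R(3)[OF that]] R(2)[OF that] special_gen[OF IT[OF that]] by auto
  have x_red: "x k / (\<Prod>g\<in>lev k. b0 g powi e k g) \<in> Wk k" if k: "k \<in> I" for k
  proof -
    have Wg: "mgroup (Wk k)" by (rule Wk_mgroup[OF kI1(1)[OF k]])
    have "(\<Prod>g\<in>?G. b0 g powi e k g) = (\<Prod>g\<in>?G - lev k. b0 g powi e k g) * (\<Prod>g\<in>lev k. b0 g powi e k g)"
      by (rule prod.subset_diff) (use finG in auto)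
    moreover have "(\<Prod>g\<in>lev k. b0 g powi e k g) \<noteq> 0" using L0.b_nz finG by simp
    ultimately have "x k / (\<Prod>g\<in>lev k. b0 g powi e k g) = (\<Prod>g\<in>?G - lev k. b0 g powi e k g) * yy k"
      by (simp add: x_def)
    moreover have "(\<Prod>g\<in>?G - lev k. b0 g powi e k g) \<in> Wk k" by (rule mgroup_prod[OF Wg]) (use elt[OF k] in auto)
    moreover have "yy k \<in> Wk k" using yyU[of k] U_antimono[of "k + 1" "?es + 1"] kI1(2)[OF k] Wk_bounds(1)[of k] by auto
    ultimately show ?thesis using mgroup_mult[OF Wg] by simp
  qed
  have xU: "x k \<in> U k" if k: "k \<in> I" for k
  proof -
    have "x k / (\<Prod>g\<in>lev k. b0 g powi e k g) \<in> U k" using x_red[OF k] Wk_bounds(2) by blast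
    moreover have "(\<Prod>g\<in>lev k. b0 g powi e k g) \<in> U k" by (intro U_prod U_powi) (use b0U in auto)
    ultimately show ?thesis by (rule U_divide_cancel)
  qed
  \<comment> \<open>The new generator takes the special slot \<open>(f - 1, k)\<close>, on which
    \<open>half_rel\<close> is supported; the former occupant moves to the slot of
    \<open>R k\<close>.\<close>
  define b where "b g = (if snd g \<in> I then
      (if g = (f - 1, snd g) then x (snd g) else b0 (Transposition.transpose (R (snd g)) (f - 1, snd g) g)) else b0 g)" for g
  have b: "basis b"
    unfolding basis_def
  proof (intro conjI ballI allI impI)
    fix g assume g: "g \<in> ?G"
    show "b g \<in> U (snd g)"
    proof (cases "snd g \<in> I")
      case True
      have "Transposition.transpose (R (snd g)) (f - 1, snd g) g \<in> lev (snd g)"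
        using Sk[OF True] g by (auto simp: Transposition.transpose_def)
      then have "b0 (Transposition.transpose (R (snd g)) (f - 1, snd g) g) \<in> U (snd g)" using b0U by fastforce
      then show ?thesis using xU[OF True] True by (simp add: b_def)
    qed (use b0U[OF g] in \<open>simp add: b_def\<close>)
  next
    fix k :: nat assume k1: "1 \<le> k"
    have ind0: "indep p (Wk k) (lev k) b0" using b0 k1 by (simp add: basis_def)
    show "indep p (Wk k) (lev k) b"
    proof (cases "k \<in> I")
      case False
      have "(\<Prod>g\<in>lev k. b g powi a g) = (\<Prod>g\<in>lev k. b0 g powi a g)" for a by (rule prod.cong) (use False in \<open>auto simp: b_def\<close>)
      then show ?thesis using ind0 by (simp add: indep_def)
    next
      case True
      have eR: "\<not> int p dvd e k (R k)" using R(3)[OF True] asgR[OF True] zS(2)[OF R(3)[OF True]] by (simp add: e_def \<gamma>_def)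
      have "indep p (Wk k) (lev k) (\<lambda>g. if g = (f - 1, k) then x k else b0 (Transposition.transpose (R k) (f - 1, k) g))"
        by (rule elementary_level.indep_exchange[OF Wk_level[OF k1] _ ind0 _ Sk[OF True] xU[OF True] x_red[OF True] eR])
          (use finG b0U in auto)
      moreover have "(\<Prod>g\<in>lev k. b g powi a g)
          = (\<Prod>g\<in>lev k. (if g = (f - 1, k) then x k else b0 (Transposition.transpose (R k) (f - 1, k) g)) powi a g)" for a
        by (rule prod.cong) (use True in \<open>auto simp: b_def\<close>)
      ultimately show ?thesis by (simp only: indep_def)
    qed
  qed
  have "(\<Prod>g\<in>?G. b g powi half_rel A g) = (\<Prod>g\<in>Pair (f - 1) ` I. b g powi half_rel A g)"
    by (rule prod.mono_neutral_right[OF finG]) (use IT special_gen A(2) in \<open>auto simp: half_rel_def\<close>)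
  also have "\<dots> = (\<Prod>i\<in>I. b (f - 1, i) powi half_rel A (f - 1, i))" by (subst prod.reindex) (auto simp: inj_on_def)
  also have "\<dots> = (\<Prod>i\<in>I. x i ^ (p ^ \<gamma> i))"
  proof (rule prod.cong)
    fix i assume i: "i \<in> I"
    have "half_rel A (f - 1, i) = int (p ^ \<gamma> i)" using i A(2,3) by (simp add: half_rel_def)
    then show "b (f - 1, i) powi half_rel A (f - 1, i) = x i ^ (p ^ \<gamma> i)" using i by (simp only: power_int_of_nat) (simp add: b_def)
  qed simp
  finally have pz: "(\<Prod>g\<in>?G. b g powi half_rel A g) = \<zeta>" using zeta_x by simp
  \<comment> \<open>As \<zeta> has level \<open>e1\<close>, the vector \<open>z\<close> has weight
    at least \<open>e1\<close> in every coordinate, and the order of \<open>z (R i)\<close> is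
    exactly \<open>\<gamma> i\<close>.\<close>
  have "e1 \<le> (\<rho> ^^ (jump_beta A i - 1)) i" if i: "i \<in> jump_I \<rho> A" for i
  proof (rule ccontr)
    assume n: "\<not> ?thesis"
    have iI: "i \<in> I" using i A(2) by simp
    have "dv (snd (R i)) e1 (z (R i))" using z(1) SG[OF R(3)[OF iI]] by (simp add: L0.vFil_def)
    moreover have "(\<rho> ^^ c (R i)) (snd (R i)) < e1" using n A(3)[OF iI] R(2)[OF iI] by (simp add: \<gamma>_def)
    ultimately have "int p ^ (c (R i) + 1) dvd z (R i)" by (simp add: dv_def)
    then have "int p dvd u (R i)" using zS(1)[OF R(3)[OF iI]] p_gt_1 by simp
    then show False using zS(2)[OF R(3)[OF iI]] by blast
  qed
  moreover have "A \<in> Jump_star \<rho>" using A IT by (auto simp: Jump_star_def jump_sets_within_iff)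
  ultimately show ?thesis using b pz by blast
qed

theorem presented_exists: "\<exists>A\<in>Jump_star \<rho>. presented f A"
proof -
  obtain A b where A: "A \<in> Jump_star \<rho>" and b: "basis b" and z: "(\<Prod>g\<in>gens f \<rho>. b g powi half_rel A g) = \<zeta>"
    and we: "\<And>i. i \<in> jump_I \<rho> A \<Longrightarrow> e1 \<le> (\<rho> ^^ (jump_beta A i - 1)) i" using adapted_basis by blast
  have spA: "spaced A" using A by (simp add: Jump_star_def jump_sets_within_iff)
  interpret L0: level_system \<rho> U p "gens f \<rho>" snd b 0 by (rule basis_level_system[OF b])
  have Fz: "L0.F (half_rel A) = \<zeta>" unfolding L0.F_def by (rule z)
  have Fv: "L0.F (\<lambda>g. int p * half_rel A g) = 1" by (simp add: L0.F_nat_scale Fz zeta(3))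
  have "L0.spans n \<and> L0.relations n (\<lambda>g. int p * half_rel A g)" for n
  proof
    interpret L: level_system \<rho> U p "gens f \<rho>" snd b n by (rule basis_level_system[OF b])
    show "L0.spans n" by (rule L.spans_upto) simp
    show "L0.relations n (\<lambda>g. int p * half_rel A g)"
    proof (rule L.relations_upto)
      show "indep p (Wk k) (lev k) b" if "1 \<le> k" for k using b that by (simp add: basis_def)
      show "\<exists>l. L0.vFil i (\<lambda>g. l * half_rel A g) \<and> u / L0.F (\<lambda>g. l * half_rel A g) \<in> U (i + 1)"
        if i: "1 \<le> i" "i < n" and u: "u \<in> U i" "u ^ p \<in> U (\<rho> i + 1)" for i u
      \<comment> \<open>At \<open>e1\<close> the kernel consists of powers of \<zeta>, which is
        \<open>F (half_rel A)\<close>; the weight bound from \<open>adapted_basis\<close> makes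
        these expansions admissible. At other levels there is no kernel.\<close>
      proof (cases "i = e1")
        case True
        obtain l :: nat where l: "u / \<zeta> ^ l \<in> U (e1 + 1)" using kernel_p[of u] u True by blast
        have "L0.vFil e1 (half_rel A)"
          unfolding L0.vFil_def
        proof
          fix g assume "g \<in> gens f \<rho>"
          obtain s j where g: "g = (s, j)" by (cases g)
          have "dv j ((\<rho> ^^ (jump_beta A j - 1)) j) (int p ^ (jump_beta A j - 1))" by (rule dv_pow) simp
          then show "dv (snd g) e1 (half_rel A g)"
            using dv_antimono[OF we] by (auto simp: g half_rel_def dv_zero)
        qed
        then have "L0.vFil i (\<lambda>g. int l * half_rel A g)" unfolding True by (rule L0.vFil_scale)
        moreover have "u / L0.F (\<lambda>g. int l * half_rel A g) \<in> U (i + 1)" using l True by (simp add: L0.F_nat_scale Fz)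
        ultimately show ?thesis by blast
      next
        case False
        then have "u \<in> U (i + 1)" using inj_p[OF i(1) _ u] by simp
        then show ?thesis by (intro exI[of _ 0]) (simp add: L0.F_zero L0.vFil_def dv_zero)
      qed
      show "L0.F (\<lambda>g. int p * half_rel A g) = 1" by (rule Fv)
    qed simp
  qed
  then have "presented f A"
    unfolding presented_def rel_half[OF spA] using L0.gen_system_axioms Fv by blast
  then show ?thesis using A by blast
qed

text \<open>The right-hand side mentions only the filtered group, which gives uniqueness. Up to the
  relation and a vector of high weight, a nontrivial root of unity has exponents
  \<open>m * half_rel A\<close> with \<open>m\<close> prime to \<open>p\<close>. Multiplying by a
  \<open>p^n\<close>-th power changes exponents by multiples of \<open>p^n\<close>, so the
  coordinates of count at most \<open>n\<close> keep their order and bound the level, while all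
  others can be cancelled.\<close>

lemma presented_torsion:
  assumes A: "A \<in> Jump_star \<rho>" and pr: "presented f A"
  shows "tail_bound A n l \<longleftrightarrow> (\<exists>\<xi> y. \<xi> ^ p = 1 \<and> \<xi> \<noteq> 1 \<and> \<xi> \<in> U 0 \<and> y \<in> U 0 \<and> \<xi> * y ^ (p ^ n) \<in> U l)"
proof -
  have spA: "spaced A" and IT: "jump_I \<rho> A \<subseteq> T_star \<rho>" using A by (auto simp: Jump_star_def jump_sets_within_iff)
  obtain F where gs: "gen_system \<rho> U p (gens f \<rho>) snd F"
    and sr: "\<And>n. gen_system.spans \<rho> U p (gens f \<rho>) snd F n \<and> gen_system.relations \<rho> U p (gens f \<rho>) snd F n (rel_vec p f \<rho> A)"
    and Fv: "F (rel_vec p f \<rho> A) = 1" using pr unfolding presented_def by blast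
  interpret S: gen_system \<rho> U p "gens f \<rho>" snd F by (rule gs)
  let ?z = "half_rel A"
  have v: "rel_vec p f \<rho> A = (\<lambda>g. int p * ?z g)" by (rule rel_half[OF spA])
  have spans: "S.spans n" and rel: "S.relations n (\<lambda>g. int p * ?z g)" for n using sr v by auto
  have Fpz: "F (\<lambda>g. int p * ?z g) = 1" using Fv v by simp
  have strip: "S.vFil k a" if "S.vFil (\<rho> k) (\<lambda>g. int p * a g)" for k a
    using that dv_p_iff by (simp add: S.vFil_def)
  \<comment> \<open>If \<open>x\<close> approximates \<xi>, then \<open>p * x\<close> is a relation
    up to level \<open>\<rho> k\<close>, hence a multiple of the given one, and \<open>p\<close> can
    be cancelled. A multiplier divisible by \<open>p\<close> would put \<xi> into
    \<open>U k\<close>.\<close>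
  have root: "\<exists>x m. \<xi> / F x \<in> U (\<rho> k) \<and> S.vFil k (\<lambda>g. x g - m * ?z g) \<and> \<not> int p dvd m"
    if xi: "\<xi> ^ p = 1" "\<xi> \<in> U 0" "\<xi> \<notin> U k" for \<xi> k
  proof -
    obtain x where x: "\<xi> / F x \<in> U (\<rho> k)" using spans[of "\<rho> k"] xi(2) unfolding S.spans_def by blast
    have "(\<xi> / F x) ^ p \<in> U (\<rho> k)" by (rule U_power[OF x])
    then have "1 / F (\<lambda>g. int p * x g) \<in> U (\<rho> k)" using xi(1) by (simp add: power_divide S.F_nat_scale)
    then have "F (\<lambda>g. int p * x g) \<in> U (\<rho> k)" using U_divide_cancel2[OF _ U_one] by blast
    then obtain m where m: "S.vFil (\<rho> k) (\<lambda>g. int p * x g - m * (int p * ?z g))" using rel unfolding S.relations_def by blast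
    have "(\<lambda>g. int p * x g - m * (int p * ?z g)) = (\<lambda>g. int p * (x g - m * ?z g))" by (simp add: algebra_simps)
    then have fm: "S.vFil k (\<lambda>g. x g - m * ?z g)" using strip m by simp
    have "\<not> int p dvd m"
    proof
      assume "int p dvd m"
      then obtain q where q: "m = int p * q" by (elim dvdE)
      have "F (\<lambda>g. x g - m * ?z g) = F x"
      proof -
        have "(\<lambda>g. x g - m * ?z g) = (\<lambda>g. x g - q * (int p * ?z g))" by (simp add: q mult_ac)
        then show ?thesis by (simp only: S.F_diff S.F_scale[of q] Fpz power_int_1_left div_by_1)
      qed
      then have "F x \<in> U k" using S.F_vFil[OF fm] by simp
      moreover have "\<xi> / F x \<in> U k" using x U_antimono[OF rho_ge[of k]] by blast
      ultimately show False using U_divide_cancel xi(3) by blast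
    qed
    then show ?thesis using x fm by blast
  qed
  have not_sep: "\<exists>k. \<xi> \<notin> U k" if "\<xi> \<noteq> 1" for \<xi> using separated that by blast
  have pnz: "int p ^ m \<noteq> 0" for m using p_gt_1 by simp
  show ?thesis
  proof
    assume "\<exists>\<xi> y. \<xi> ^ p = 1 \<and> \<xi> \<noteq> 1 \<and> \<xi> \<in> U 0 \<and> y \<in> U 0 \<and> \<xi> * y ^ (p ^ n) \<in> U l"
    then obtain \<xi> y where xi: "\<xi> ^ p = 1" "\<xi> \<noteq> 1" "\<xi> \<in> U 0" and y: "y \<in> U 0" "\<xi> * y ^ (p ^ n) \<in> U l" by blast
    obtain k0 where "\<xi> \<notin> U k0" using not_sep[OF xi(2)] by blast
    define k where "k = max k0 l"
    have "\<xi> \<notin> U k" using \<open>\<xi> \<notin> U k0\<close> U_antimono[of k0 k] by (auto simp: k_def)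
    from root[OF xi(1,3) this] obtain x m where x: "\<xi> / F x \<in> U (\<rho> k)" "S.vFil k (\<lambda>g. x g - m * ?z g)" "\<not> int p dvd m" by blast
    obtain Y where Y: "y / F Y \<in> U (\<rho> k)" using spans[of "\<rho> k"] y(1) unfolding S.spans_def by blast
    have lk: "l \<le> k" "l \<le> \<rho> k" using rho_ge[of k] by (auto simp: k_def)
    let ?w = "\<lambda>g. x g + int (p ^ n) * Y g"
    have "(\<xi> / F x) * (y / F Y) ^ (p ^ n) \<in> U (\<rho> k)" by (intro U_mult U_power x Y)
    then have "(\<xi> * y ^ (p ^ n)) / F ?w \<in> U (\<rho> k)" by (simp only: S.F_add S.F_nat_scale) (simp add: power_divide)
    then have "(\<xi> * y ^ (p ^ n)) / F ?w \<in> U l" using U_antimono[OF lk(2)] by blast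
    then have "F ?w \<in> U l" using y(2) by (rule U_divide_cancel2)
    then obtain q where q: "S.vFil l (\<lambda>g. ?w g - q * (int p * ?z g))" using rel unfolding S.relations_def by blast
    have "S.vFil l (\<lambda>g. x g - m * ?z g)" using S.vFil_antimono[OF lk(1) x(2)] .
    from S.vFil_diff[OF q this] have d: "S.vFil l (\<lambda>g. ?w g - q * (int p * ?z g) - (x g - m * ?z g))" .
    show "tail_bound A n l"
      unfolding tail_bound_def
    proof (intro ballI impI, rule ccontr)
      fix i assume i: "i \<in> jump_I \<rho> A" "jump_beta A i \<le> n" and nl: "\<not> l \<le> (\<rho> ^^ (jump_beta A i - 1)) i"
      let ?g = "(f - 1, i)" and ?\<beta> = "jump_beta A i"
      have b1: "1 \<le> ?\<beta>" by (rule jump_beta_I_pos[OF spA i(1)])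
      have "?g \<in> gens f \<rho>" using special_gen IT i(1) by blast
      then have "dv i l (?w ?g - q * (int p * ?z ?g) - (x ?g - m * ?z ?g))" using d unfolding S.vFil_def by fastforce
      then have "int p ^ (?\<beta> - 1 + 1) dvd ?w ?g - q * (int p * ?z ?g) - (x ?g - m * ?z ?g)"
        using nl unfolding dv_def by simp
      also have "?w ?g - q * (int p * ?z ?g) - (x ?g - m * ?z ?g) = int p ^ n * Y ?g + (m - q * int p) * int p ^ (?\<beta> - 1)"
        using i(1) by (simp add: half_rel_def algebra_simps)
      finally have "int p ^ ?\<beta> dvd int p ^ n * Y ?g + (m - q * int p) * int p ^ (?\<beta> - 1)" using b1 by simp
      moreover have "int p ^ ?\<beta> dvd int p ^ n * Y ?g" using i(2) by (intro dvd_mult2 le_imp_power_dvd)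
      ultimately have "int p ^ ?\<beta> dvd (m - q * int p) * int p ^ (?\<beta> - 1)" using dvd_add_right_iff by blast
      moreover have "int p ^ ?\<beta> = int p * int p ^ (?\<beta> - 1)" using b1 by (simp flip: power_Suc)
      ultimately have "int p * int p ^ (?\<beta> - 1) dvd (m - q * int p) * int p ^ (?\<beta> - 1)" by (simp only:)
      then have "int p dvd m - q * int p" using dvd_times_right_cancel_iff[OF pnz[of "?\<beta> - 1"]] by blast
      then have "int p dvd (m - q * int p) + q * int p" by (intro dvd_add) simp_all
      then show False using x(3) by simp
    qed
  next
    assume tb: "tail_bound A n l"
    obtain k0 where k0: "\<zeta> \<notin> U k0" using not_sep[OF zeta_not_power] by blast
    have ne: "jump_I \<rho> A \<noteq> {}"
    proof
      assume "jump_I \<rho> A = {}"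
      then have z0: "?z = (\<lambda>g. 0)" by (auto simp: half_rel_def)
      obtain x m where x: "\<zeta> / F x \<in> U (\<rho> k0)" "S.vFil k0 (\<lambda>g. x g - m * ?z g)"
        using root[OF zeta(3) U_in_0[OF zeta(1)] k0] by blast
      then have "F x \<in> U k0" using S.F_vFil[of k0 x] by (simp add: z0)
      moreover have "\<zeta> / F x \<in> U k0" using x(1) U_antimono[OF rho_ge[of k0]] by blast
      ultimately show False using U_divide_cancel k0 by blast
    qed
    \<comment> \<open>A root of unity read off from the presentation at hand; it need not be the
      fixed \<zeta>.\<close>
    define \<xi> where "\<xi> = F ?z"
    have xp: "\<xi> ^ p = 1" using Fpz by (simp add: \<xi>_def S.F_nat_scale)
    have x1: "\<xi> \<noteq> 1"
    proof
      assume one: "\<xi> = 1"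
      obtain i where i: "i \<in> jump_I \<rho> A" using ne by blast
      let ?\<beta> = "jump_beta A i"
      have b1: "1 \<le> ?\<beta>" by (rule jump_beta_I_pos[OF spA i])
      have gi: "(f - 1, i) \<in> gens f \<rho>" using special_gen IT i by blast
      define k where "k = Suc ((\<rho> ^^ (?\<beta> - 1)) i)"
      have "F ?z \<in> U k" using one U_one by (simp add: \<xi>_def)
      then obtain q where "S.vFil k (\<lambda>g. ?z g - q * (int p * ?z g))" using rel unfolding S.relations_def by blast
      then have "dv i k (?z (f - 1, i) - q * (int p * ?z (f - 1, i)))" using gi unfolding S.vFil_def by fastforce
      then have "int p ^ (?\<beta> - 1 + 1) dvd ?z (f - 1, i) - q * (int p * ?z (f - 1, i))" unfolding dv_def k_def by blast
      also have "?z (f - 1, i) - q * (int p * ?z (f - 1, i)) = (1 - q * int p) * int p ^ (?\<beta> - 1)"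
        using i by (simp add: half_rel_def algebra_simps)
      also have "int p ^ (?\<beta> - 1 + 1) = int p * int p ^ (?\<beta> - 1)" by simp
      finally have "int p dvd 1 - q * int p" using dvd_times_right_cancel_iff[OF pnz[of "?\<beta> - 1"]] by blast
      then have "int p dvd (1 - q * int p) + q * int p" by (intro dvd_add) simp_all
      then show False using p_gt_1 by (simp add: zdvd_not_zless)
    qed
    \<comment> \<open>Its \<open>p^n\<close>-th multiple cancels exactly the coordinates whose count
      exceeds \<open>n\<close>.\<close>
    define Y where "Y g = (if n < jump_beta A (snd g) \<and> ?z g \<noteq> 0 then - (int p ^ (jump_beta A (snd g) - 1 - n)) else 0)" for g
    have "S.vFil l (\<lambda>g. ?z g + int (p ^ n) * Y g)"
      unfolding S.vFil_def
    proof
      fix g assume "g \<in> gens f \<rho>"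
      obtain s i where g: "g = (s, i)" by (cases g)
      show "dv (snd g) l (?z g + int (p ^ n) * Y g)"
      proof (cases "?z g = 0")
        case True
        then show ?thesis by (simp add: Y_def dv_zero)
      next
        case False
        then have si: "s = f - 1" "i \<in> jump_I \<rho> A" by (auto simp: g half_rel_def split: if_splits)
        show ?thesis
        proof (cases "n < jump_beta A i")
          case True
          then have "int p ^ n * int p ^ (jump_beta A i - 1 - n) = int p ^ (jump_beta A i - 1)" by (simp flip: power_add)
          then show ?thesis using True False si by (simp add: Y_def g half_rel_def dv_zero)
        next
          case False
          then have "l \<le> (\<rho> ^^ (jump_beta A i - 1)) i" using tb si(2) by (simp add: tail_bound_def)
          moreover have "dv i ((\<rho> ^^ (jump_beta A i - 1)) i) (int p ^ (jump_beta A i - 1))" by (rule dv_pow) simp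
          ultimately have "dv i l (int p ^ (jump_beta A i - 1))" by (rule dv_antimono)
          then show ?thesis using False si by (simp add: Y_def g half_rel_def)
        qed
      qed
    qed
    then have "F (\<lambda>g. ?z g + int (p ^ n) * Y g) \<in> U l" by (rule S.F_vFil)
    then have "\<xi> * F Y ^ (p ^ n) \<in> U l" by (simp only: S.F_add S.F_nat_scale \<xi>_def)
    moreover have "\<xi> \<in> U 0" "F Y \<in> U 0" using S.F_U0 by (auto simp: \<xi>_def)
    ultimately show "\<exists>\<xi> y. \<xi> ^ p = 1 \<and> \<xi> \<noteq> 1 \<and> \<xi> \<in> U 0 \<and> y \<in> U 0 \<and> \<xi> * y ^ (p ^ n) \<in> U l"
      using xp x1 by blast
  qed
qed

theorem presented_unique:
  assumes "A \<in> Jump_star \<rho>" "B \<in> Jump_star \<rho>" "presented f A" "presented f B"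
  shows "A = B"
proof (rule spaced_eq_tail_bound)
  show "spaced A" "spaced B" using assms by (auto simp: Jump_star_def jump_sets_within_iff)
  show "tail_bound A n l \<longleftrightarrow> tail_bound B n l" for n l
    using presented_torsion[OF assms(1,3)] presented_torsion[OF assms(2,4)] by simp
qed

theorem ijumps_presented:
  assumes B: "B \<in> Jump_star \<rho>" and pr: "presented f B"
  shows "{ijumps N h | N h. ichar N h} = {A \<in> Jump_star \<rho>. compatible \<rho> f p A B}"
proof -
  obtain F where gs: "gen_system \<rho> U p (gens f \<rho>) snd F"
    and sr: "\<And>n. gen_system.spans \<rho> U p (gens f \<rho>) snd F n \<and> gen_system.relations \<rho> U p (gens f \<rho>) snd F n (rel_vec p f \<rho> B)"
    and Fv: "F (rel_vec p f \<rho> B) = 1" using pr unfolding presented_def by blast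
  interpret S: gen_system \<rho> U p "gens f \<rho>" snd F by (rule gs)
  have Bs: "spaced B" "jump_I \<rho> B \<subseteq> T_star \<rho>" using B by (auto simp: Jump_star_def jump_sets_within_iff)
  show ?thesis
  proof (intro equalityI subsetI)
    fix A assume "A \<in> {ijumps N h | N h. ichar N h}"
    then obtain N h where h: "ichar N h" "A = ijumps N h" by blast
    have AJ: "A \<in> Jump_star \<rho>" using ijumps_in_Jump[OF h(1)] h(2) e1 e_star by (simp add: Jump_star_def T_star_def)
    then have As: "spaced A" "jump_I \<rho> A \<subseteq> T_star \<rho>" by (auto simp: Jump_star_def jump_sets_within_iff)
    have sp: "S.spans n" for n using sr by blast
    have "compatible \<rho> f p A B"
      by (rule solvable_imp_compatible[OF prime_p f_pos fin_T As Bs, where N = N and y = "\<lambda>g. h (F (unitv g))"])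
        (use S.ichar_necessary[OF sp h] Fv in auto)
    then show "A \<in> {A \<in> Jump_star \<rho>. compatible \<rho> f p A B}" using AJ by blast
  next
    fix A assume "A \<in> {A \<in> Jump_star \<rho>. compatible \<rho> f p A B}"
    then have AJ: "A \<in> Jump_star \<rho>" and comp: "compatible \<rho> f p A B" by auto
    then have As: "spaced A" "jump_I \<rho> A \<subseteq> T_star \<rho>" by (auto simp: Jump_star_def jump_sets_within_iff)
    obtain N y where y: "\<forall>g\<in>gens f \<rho>. int p ^ N dvd int p ^ jump_beta A (snd g) * y g"
      "\<forall>j\<in>jump_I \<rho> A. \<exists>g\<in>gens f \<rho>. snd g = j \<and> \<not> int p ^ N dvd int p ^ (jump_beta A j - 1) * y g"
      "int p ^ N dvd (\<Sum>g\<in>gens f \<rho>. rel_vec p f \<rho> B g * y g)"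
      using compatible_imp_solvable[OF prime_p f_pos fin_T As Bs comp] by blast
    define n where "n = Suc (Max (insert 0 A))"
    have An: "a < n" if "a \<in> A" for a using that As(1) by (auto simp: n_def less_Suc_eq_le spaced_def)
    have "\<exists>h. ichar N h \<and> ijumps N h = A"
      by (rule S.ichar_realization[of n "rel_vec p f \<rho> B", OF _ _ As(1) An]) (use sr y in blast)+
    then show "A \<in> {ijumps N h | N h. ichar N h}" by blast
  qed
qed

end

section \<open>Local fields\<close>

lemma card_image_kernel:
  assumes "\<phi> ` A = B" and "\<And>x y. x \<in> A \<Longrightarrow> y \<in> A \<Longrightarrow> \<alpha> x = \<alpha> y \<longleftrightarrow> \<beta> (\<phi> x) = \<beta> (\<phi> y)"
  shows "card (\<alpha> ` A) = card (\<beta> ` B)"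
proof -
  have ch: "inv_into A \<alpha> (\<alpha> x) \<in> A" "\<alpha> (inv_into A \<alpha> (\<alpha> x)) = \<alpha> x" if "x \<in> A" for x
    using that by (simp_all add: inv_into_into f_inv_into_f)
  have v: "\<beta> (\<phi> (inv_into A \<alpha> (\<alpha> x))) = \<beta> (\<phi> x)" if "x \<in> A" for x
    using assms(2)[OF ch(1)[OF that] that] ch(2)[OF that] by simp
  have "bij_betw (\<lambda>C. \<beta> (\<phi> (inv_into A \<alpha> C))) (\<alpha> ` A) (\<beta> ` B)"
  proof (rule bij_betw_imageI)
    show "inj_on (\<lambda>C. \<beta> (\<phi> (inv_into A \<alpha> C))) (\<alpha> ` A)"
      by (rule inj_onI) (use v assms(2) in auto)
    have "(\<lambda>C. \<beta> (\<phi> (inv_into A \<alpha> C))) ` \<alpha> ` A = (\<lambda>x. \<beta> (\<phi> x)) ` A"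
      unfolding image_image by (rule image_cong) (use v in auto)
    then show "(\<lambda>C. \<beta> (\<phi> (inv_into A \<alpha> C))) ` \<alpha> ` A = \<beta> ` B" using assms(1) by (simp add: image_image[symmetric])
  qed
  then show ?thesis by (rule bij_betw_same_card)
qed

section \<open>Compactness, uniformizer and unit filtration of a local field\<close>

context local_field
begin

lemma absv_1 [simp]: "absv 1 = 1"
  using absv_mult[of 1 1] absv_eq_0_iff[of 1] by simp

lemma absv_0 [simp]: "absv 0 = 0"
  using absv_eq_0_iff by simp

lemma absv_minus [simp]: "absv (- x) = absv x"
proof -
  have "absv (-1) * absv (-1) = 1" using absv_mult[of "-1" "-1"] by simp
  then have "absv (-1) = 1" using absv_nonneg[of "-1"] by (metis abs_of_nonneg abs_mult_self_eq power2_eq_1_iff power2_eq_square abs_1 abs_minus_cancel)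
  then show ?thesis using absv_mult[of "-1" x] by simp
qed

lemma absv_pos_iff [simp]: "0 < absv x \<longleftrightarrow> x \<noteq> 0"
  using absv_nonneg[of x] absv_eq_0_iff[of x] by (auto simp: less_le)

lemma absv_power: "absv (x ^ n) = absv x ^ n"
  by (induction n) (simp_all add: absv_mult)

lemma absv_inverse: "absv (inverse x) = inverse (absv x)"
proof (cases "x = 0")
  case False
  then have "absv x * absv (inverse x) = 1" by (simp flip: absv_mult)
  then show ?thesis by (metis inverse_unique)
qed simp

lemma absv_divide: "absv (x / y) = absv x / absv y"
  by (simp add: divide_inverse absv_mult absv_inverse)

lemma absv_diff: "absv (x - y) \<le> max (absv x) (absv y)"
  using absv_nonarchimedean[of x "-y"] by simp

lemma absv_diff_commute: "absv (x - y) = absv (y - x)"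
  using absv_minus[of "x - y"] by simp

lemma absv_add_le: "absv x \<le> r \<Longrightarrow> absv y \<le> r \<Longrightarrow> absv (x + y) \<le> r"
  using absv_nonarchimedean[of x y] by linarith

lemma absv_diff_le: "absv x \<le> r \<Longrightarrow> absv y \<le> r \<Longrightarrow> absv (x - y) \<le> r"
  using absv_diff[of x y] by linarith

lemma absv_add_eq: "absv y < absv x \<Longrightarrow> absv (x + y) = absv x"
  using absv_nonarchimedean[of x y] absv_diff[of "x + y" y] by simp

lemma absv_sum_le: "(\<And>i. i \<in> S \<Longrightarrow> absv (g i) \<le> r) \<Longrightarrow> 0 \<le> r \<Longrightarrow> absv (sum g S) \<le> r"
  by (induction S rule: infinite_finite_induct) (auto intro: absv_add_le)

lemma absv_of_nat_le: "absv (of_nat n) \<le> 1"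
  by (induction n) (auto intro: absv_add_le)

sublocale M: Metric_space UNIV "\<lambda>x y. absv (x - y)"
proof
  show "absv (x - z) \<le> absv (x - y) + absv (y - z)" for x y z
    using absv_nonarchimedean[of "x - y" "y - z"] absv_nonneg[of "x - y"] absv_nonneg[of "y - z"] by simp
qed (use absv_nonneg absv_diff_commute absv_eq_0_iff in auto)

lemma topology_M: "field_topology absv = M.mtopology"
  by (simp add: field_topology_def)

lemma limitin_iff:
  "limitin (field_topology absv) s l sequentially \<longleftrightarrow> (\<forall>r>0. \<forall>\<^sub>F n in sequentially. absv (s n - l) < r)"
  unfolding topology_M M.limitin_metric by simp

lemma openin_iff: "openin (field_topology absv) S \<longleftrightarrow> (\<forall>x\<in>S. \<exists>r>0. \<forall>y. absv (x - y) < r \<longrightarrow> y \<in> S)"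
  unfolding topology_M M.openin_mtopology by (auto simp: M.mball_def subset_iff)

lemma small_element: "0 < r \<Longrightarrow> \<exists>x. x \<noteq> 0 \<and> absv x < r"
proof (rule ccontr)
  assume r: "0 < r" and n: "\<not> ?thesis"
  have "openin (field_topology absv) S" for S
    unfolding openin_iff
  proof
    fix x assume "x \<in> S"
    have "y \<in> S" if "absv (x - y) < r" for y
    proof -
      have "x - y = 0" using n that by blast
      then show ?thesis using \<open>x \<in> S\<close> by simp
    qed
    then show "\<exists>r>0. \<forall>y. absv (x - y) < r \<longrightarrow> y \<in> S" using r by blast
  qed
  then have "field_topology absv = discrete_topology UNIV" by (simp add: topology_eq)
  then show False using non_discrete by simp
qed

text \<open>A compact neighbourhood of 0 contains a ball; multiplication by a small nonzero
  \<open>c\<close> carries the unit ball into it, and division by \<open>c\<close> brings the limit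
  back.\<close>

lemma sequentially_compact:
  assumes s: "\<And>n::nat. absv (s n) \<le> 1"
  shows "\<exists>l r. strict_mono r \<and> (\<forall>\<epsilon>>0. \<forall>\<^sub>F n in sequentially. absv (s (r n) - l) < \<epsilon>)"
proof -
  obtain W K where WK: "openin (field_topology absv) W" "compactin (field_topology absv) K" "0 \<in> W" "W \<subseteq> K"
    using locally_compact unfolding locally_compact_space_def topology_M by (metis M.topspace_mtopology UNIV_I)
  obtain r0 where r0: "0 < r0" "\<And>y. absv (0 - y) < r0 \<Longrightarrow> y \<in> W" using WK(1,3) unfolding openin_iff by blast
  obtain c where c: "c \<noteq> 0" "absv c < r0" using small_element[OF r0(1)] by blast
  have in_K: "c * s n \<in> K" for n
  proof -
    have "absv (c * s n) \<le> absv c" using s[of n] absv_nonneg[of c] by (simp add: absv_mult mult_left_le)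
    then show ?thesis using r0(2)[of "c * s n"] c(2) WK(4) by auto
  qed
  have all: "\<forall>\<sigma>::nat \<Rightarrow> 'a. range \<sigma> \<subseteq> K \<longrightarrow>
      (\<exists>l r. l \<in> K \<and> strict_mono r \<and> limitin M.mtopology (\<sigma> \<circ> r) l sequentially)"
    using WK(2) unfolding topology_M M.compactin_sequentially by (rule conjunct2)
  have "range (\<lambda>n. c * s n) \<subseteq> K" using in_K by blast
  with all[rule_format, of "\<lambda>n. c * s n"] obtain l r
    where lr: "strict_mono r" "limitin (field_topology absv) ((\<lambda>n. c * s n) \<circ> r) l sequentially"
    unfolding topology_M by blast
  have "\<forall>\<^sub>F n in sequentially. absv (s (r n) - l / c) < \<epsilon>" if "0 < \<epsilon>" for \<epsilon>
  proof -
    have "\<forall>\<^sub>F n in sequentially. absv (c * s (r n) - l) < absv c * \<epsilon>"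
      using lr(2) that c(1) unfolding limitin_iff by simp
    then show ?thesis
    proof eventually_elim
      case (elim n)
      have "c * s (r n) - l = c * (s (r n) - l / c)" using c(1) by (simp add: algebra_simps)
      then show ?case using elim c(1) by (simp add: absv_mult)
    qed
  qed
  then show ?thesis using lr(1) by blast
qed

text \<open>Otherwise there is a sequence in the maximal ideal with strictly increasing absolute
  values. A convergent subsequence has a nonzero limit, and by the ultrametric inequality its
  absolute values are eventually constant.\<close>

lemma uniformizer_exists: "\<exists>\<pi>. uniformizer absv \<pi>"
proof (rule ccontr)
  assume n: "\<not> ?thesis"
  have step: "\<exists>y. (y \<noteq> 0 \<and> absv y < 1) \<and> absv x < absv y" if "x \<noteq> 0" "absv x < 1" for x
    using n that unfolding uniformizer_def maximal_ideal_def by (auto simp: not_le) (metis absv_0 absv_pos_iff less_asym)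
  have "\<exists>s. \<forall>n::nat. (s n \<noteq> 0 \<and> absv (s n) < 1) \<and> absv (s n) < absv (s (Suc n))"
  proof (rule dependent_nat_choice)
    show "\<exists>x. x \<noteq> 0 \<and> absv x < 1" using small_element[of 1] by simp
  qed (use step in blast)
  then obtain s where s: "\<And>n::nat. s n \<noteq> 0" "\<And>n. absv (s n) < 1" "\<And>n. absv (s n) < absv (s (Suc n))" by blast
  have mono: "strict_mono (\<lambda>n. absv (s n))" using s(3) by (simp add: strict_mono_Suc_iff)
  obtain l r where lr: "strict_mono r" "\<And>\<epsilon>. 0 < \<epsilon> \<Longrightarrow> \<forall>\<^sub>F n in sequentially. absv (s (r n) - l) < \<epsilon>"
    using sequentially_compact[of s] s(2) by (metis less_imp_le)
  obtain N where N: "\<And>n. N \<le> n \<Longrightarrow> absv (s (r n) - l) < absv (s 0)"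
    using lr(2)[of "absv (s 0)"] s(1) unfolding eventually_sequentially by auto
  have "absv l = absv (s (r n))" if "N \<le> n" for n
  proof -
    have "absv (s 0) \<le> absv (s (r n))" using strict_mono_less_eq[OF mono] by simp
    then have "absv (l - s (r n)) < absv (s (r n))" using N[OF that] absv_diff_commute[of l] by simp
    then show ?thesis using absv_add_eq[of "l - s (r n)" "s (r n)"] by simp
  qed
  then have "absv (s (r N)) = absv (s (r (Suc N)))" by (metis le_Suc_eq order_refl)
  moreover have "r N < r (Suc N)" using lr(1) by (simp add: strict_mono_less)
  ultimately show False using strict_mono_less[OF mono, of "r N" "r (Suc N)"] by simp
qed

definition unif :: 'a where "unif = (SOME \<pi>. uniformizer absv \<pi>)"
definition q :: real where "q = absv unif"

lemma unif: "uniformizer absv unif"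
  unfolding unif_def by (rule someI_ex[OF uniformizer_exists])

lemma unif_nz: "unif \<noteq> 0" and q_pos: "0 < q" and q_less_1: "q < 1"
  using unif by (auto simp: uniformizer_def maximal_ideal_def q_def)

lemma less_1_iff: "absv x < 1 \<longleftrightarrow> absv x \<le> q"
  using unif q_less_1 by (auto simp: uniformizer_def maximal_ideal_def q_def)

lemma less_q_iff: "absv x < q ^ k \<longleftrightarrow> absv x \<le> q ^ (k + 1)"
proof -
  have "absv (x / unif ^ k) = absv x / q ^ k" by (simp add: absv_divide absv_power q_def)
  then have "absv x / q ^ k < 1 \<longleftrightarrow> absv x / q ^ k \<le> q" using less_1_iff[of "x / unif ^ k"] by simp
  then show ?thesis using q_pos by (simp add: pos_divide_less_eq pos_divide_le_eq)
qed

lemma q_power_mono: "k \<le> l \<Longrightarrow> q ^ l \<le> q ^ k"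
  using q_pos q_less_1 by (intro power_decreasing) auto

lemma q_power_less_iff [simp]: "q ^ k < q ^ l \<longleftrightarrow> l < k"
  using q_pos q_less_1 by (rule power_strict_decreasing_iff)

lemma q_power_le_iff [simp]: "q ^ k \<le> q ^ l \<longleftrightarrow> l \<le> k"
  using q_pos q_less_1 by (rule power_decreasing_iff)

lemma q_power_small: "0 < r \<Longrightarrow> \<exists>k. q ^ k < r"
  using real_arch_pow_inv[of r q] q_less_1 by blast

lemma zero_if_small: "(\<And>k. absv x \<le> q ^ k) \<Longrightarrow> x = 0"
  using q_power_small[of "absv x"] by (metis absv_pos_iff leD)

lemma absv_eq_q_power:
  assumes "x \<noteq> 0" "absv x \<le> 1"
  obtains k where "absv x = q ^ k"
proof -
  have ex: "\<exists>k. \<not> absv x \<le> q ^ k" using zero_if_small assms(1) by blast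
  define k where "k = (LEAST k. \<not> absv x \<le> q ^ k)"
  have 1: "\<not> absv x \<le> q ^ k" unfolding k_def by (rule LeastI_ex[OF ex])
  then have "k \<noteq> 0" using assms(2) by (intro notI) simp
  then obtain j where j: "k = Suc j" by (cases k) auto
  have "absv x \<le> q ^ j" using not_less_Least[of j "\<lambda>k. \<not> absv x \<le> q ^ k"] j k_def by simp
  then have "absv x = q ^ j" using less_q_iff[of x j] 1 j by auto
  then show ?thesis using that by blast
qed

text \<open>Compactness gives the limit of a subsequence; the ultrametric inequality bounds all
  later differences by the first one, so the whole sequence converges at the stated rate.\<close>

lemma complete_q:
  assumes s: "\<And>n. absv (s n) \<le> 1" and g: "mono g" "\<And>n. n \<le> g n"
    and d: "\<And>n. absv (s (Suc n) - s n) \<le> q ^ g n"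
  shows "\<exists>l. \<forall>n. absv (l - s n) \<le> q ^ g n"
proof -
  have d2: "absv (s (n + m) - s n) \<le> q ^ g n" for n m
  proof (induction m)
    case (Suc m)
    have "g n \<le> g (n + m)" using g(1) by (simp add: mono_def)
    then have "absv (s (Suc (n + m)) - s (n + m)) \<le> q ^ g n" using d[of "n + m"] q_power_mono by (meson order_trans)
    from absv_add_le[OF this Suc] show ?case by simp
  qed (use q_pos in simp)
  obtain l r where lr: "strict_mono r" "\<And>\<epsilon>. 0 < \<epsilon> \<Longrightarrow> \<forall>\<^sub>F n in sequentially. absv (s (r n) - l) < \<epsilon>"
    using sequentially_compact[of s] s by metis
  have "absv (l - s n) \<le> q ^ g n" for n
  proof -
    obtain N where N: "\<And>m. N \<le> m \<Longrightarrow> absv (s (r m) - l) < q ^ g n"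
      using lr(2)[of "q ^ g n"] q_pos unfolding eventually_sequentially by auto
    define m where "m = max N n"
    have "n \<le> r m" using seq_suble[OF lr(1), of m] by (simp add: m_def)
    then have "absv (s (r m) - s n) \<le> q ^ g n" using d2[of n "r m - n"] by simp
    moreover have "absv (l - s (r m)) \<le> q ^ g n" using N[of m] absv_diff_commute[of l] by (simp add: m_def)
    ultimately show ?thesis using absv_add_le[of "l - s (r m)" _ "s (r m) - s n"] by simp
  qed
  then show ?thesis by blast
qed

lemma valuation_ring_simps [simp]:
  "carrier (valuation_ring absv) = {x. absv x \<le> 1}" "x \<otimes>\<^bsub>valuation_ring absv\<^esub> y = x * y"
  "\<one>\<^bsub>valuation_ring absv\<^esub> = 1" "\<zero>\<^bsub>valuation_ring absv\<^esub> = 0" "x \<oplus>\<^bsub>valuation_ring absv\<^esub> y = x + y"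
  by (simp_all add: valuation_ring_def)

lemma maximal_ideal_eq: "maximal_ideal absv = {x. absv x \<le> q}"
  using less_1_iff by (auto simp: maximal_ideal_def)

lemma ideal_power: "maximal_ideal absv [^]\<^bsub>ideals_set (valuation_ring absv)\<^esub> k = {x. absv x \<le> q ^ k}"
proof (induction k)
  case 0
  show ?case by (simp add: nat_pow_def ideals_set_def)
next
  case (Suc k)
  let ?R = "valuation_ring absv"
  have "maximal_ideal absv [^]\<^bsub>ideals_set ?R\<^esub> Suc k = ideal_prod ?R {x. absv x \<le> q ^ k} {x. absv x \<le> q}"
    using Suc by (simp add: nat_pow_def ideals_set_def maximal_ideal_eq)
  also have "\<dots> = {x. absv x \<le> q ^ Suc k}"
  proof (intro equalityI subsetI)
    fix x assume "x \<in> ideal_prod ?R {x. absv x \<le> q ^ k} {x. absv x \<le> q}"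
    then show "x \<in> {x. absv x \<le> q ^ Suc k}"
    proof (induction rule: ideal_prod.induct)
      case (prod i j)
      then show ?case using absv_nonneg[of i] absv_nonneg[of j] q_pos by (simp add: absv_mult mult.commute[of q] mult_mono)
    next
      case (sum s1 s2)
      then show ?case by (auto intro: absv_add_le)
    qed
  next
    fix x assume x: "x \<in> {x. absv x \<le> q ^ Suc k}"
    have "absv (x / unif) \<le> q ^ k" using x q_pos by (simp add: absv_divide q_def field_simps)
    then have "(x / unif) \<otimes>\<^bsub>?R\<^esub> unif \<in> ideal_prod ?R {x. absv x \<le> q ^ k} {x. absv x \<le> q}"
      by (intro ideal_prod.prod) (auto simp: q_def)
    then show "x \<in> ideal_prod ?R {x. absv x \<le> q ^ k} {x. absv x \<le> q}" using unif_nz by simp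
  qed
  finally show ?case .
qed

lemma U_iff: "x \<in> U absv k \<longleftrightarrow> absv (x - 1) \<le> q ^ k"
proof -
  have "x = 1 + (x - 1)" by simp
  then show ?thesis unfolding U_def ideal_power by (force simp del: diff_add_cancel)
qed

text \<open>\<open>U absv 0\<close> is the whole valuation ring, which contains 0; index 0 is
  therefore redirected to \<open>U absv 1\<close>, as \<open>unit_filt\<close> demands.\<close>

definition Uf :: "nat \<Rightarrow> 'a set" where "Uf k = U absv (max 1 k)"

lemma Uf_pos: "1 \<le> k \<Longrightarrow> Uf k = U absv k"
  by (simp add: Uf_def max_def)

lemma Uf_iff: "x \<in> Uf k \<longleftrightarrow> absv (x - 1) \<le> q ^ max 1 k"
  by (simp add: Uf_def U_iff)

lemma Uf_absv: "x \<in> Uf k \<Longrightarrow> absv x = 1"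
proof -
  assume "x \<in> Uf k"
  moreover have "q ^ max 1 k < q ^ 0" by (simp only: q_power_less_iff)
  ultimately have "absv (x - 1) < absv 1" by (simp add: Uf_iff)
  then show ?thesis using absv_add_eq[of "x - 1" 1] by simp
qed

lemma Uf_divide_iff: "absv x = 1 \<Longrightarrow> absv y = 1 \<Longrightarrow> x / y \<in> Uf k \<longleftrightarrow> absv (x - y) \<le> q ^ max 1 k"
proof -
  assume a: "absv x = 1" "absv y = 1"
  then have "y \<noteq> 0" by auto
  then have "x / y - 1 = (x - y) / y" by (simp add: field_simps)
  then show ?thesis using a by (simp add: Uf_iff absv_divide)
qed

lemma Uf_mult: "x \<in> Uf k \<Longrightarrow> y \<in> Uf k \<Longrightarrow> x * y \<in> Uf k"
proof -
  assume x: "x \<in> Uf k" and y: "y \<in> Uf k"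
  have "x * y - 1 = x * (y - 1) + (x - 1)" by (simp add: algebra_simps)
  moreover have "absv (x * (y - 1)) \<le> q ^ max 1 k" using y Uf_absv[OF x] by (simp add: absv_mult Uf_iff)
  ultimately show ?thesis using absv_add_le[of "x * (y - 1)" "q ^ max 1 k" "x - 1"] x by (simp only: Uf_iff)
qed

lemma Uf_inverse: "x \<in> Uf k \<Longrightarrow> inverse x \<in> Uf k"
  using Uf_divide_iff[of 1 x k] Uf_absv[of x k] by (simp add: Uf_iff absv_diff_commute divide_inverse)

lemma Uf_antimono: "k \<le> l \<Longrightarrow> Uf l \<subseteq> Uf k"
proof
  fix x assume "k \<le> l" "x \<in> Uf l"
  moreover have "q ^ max 1 l \<le> q ^ max 1 k" using \<open>k \<le> l\<close> by (intro q_power_mono) auto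
  ultimately show "x \<in> Uf k" unfolding Uf_iff by (meson order_trans)
qed

end

section \<open>The residue field and the \<open>p\<close>-th power map on principal units\<close>

locale residual_field = local_field absv for absv :: "'a::field \<Rightarrow> real" +
  fixes p f :: nat
  assumes prime_p: "prime p"
    and res_char: "add_pow (residue_field absv) p \<one>\<^bsub>residue_field absv\<^esub> = \<zero>\<^bsub>residue_field absv\<^esub>"
    and res_card: "card (carrier (residue_field absv)) = p ^ f"
begin

abbreviation "R \<equiv> valuation_ring absv"
abbreviation "m \<equiv> maximal_ideal absv"

lemma coset_eq_iff: "m +>\<^bsub>R\<^esub> a = m +>\<^bsub>R\<^esub> b \<longleftrightarrow> absv (a - b) \<le> q"
proof -
  have c: "m +>\<^bsub>R\<^esub> a = {x. absv (x - a) \<le> q}" for a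
  proof (intro equalityI subsetI)
    fix x assume "x \<in> {x. absv (x - a) \<le> q}"
    then have "x - a \<in> m" "x = (x - a) + a" by (auto simp: maximal_ideal_eq)
    then show "x \<in> m +>\<^bsub>R\<^esub> a" unfolding a_r_coset_def' valuation_ring_simps by blast
  qed (auto simp: a_r_coset_def' maximal_ideal_eq)
  show ?thesis
  proof
    assume "m +>\<^bsub>R\<^esub> a = m +>\<^bsub>R\<^esub> b"
    moreover have "a \<in> {x. absv (x - a) \<le> q}" using q_pos by simp
    ultimately show "absv (a - b) \<le> q" unfolding c by blast
  next
    assume ab: "absv (a - b) \<le> q"
    have "absv (x - a) \<le> q \<longleftrightarrow> absv (x - b) \<le> q" for x
      using absv_add_le[of "x - a" q "a - b"] absv_diff_le[of "x - b" q "a - b"] ab by auto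
    then show "m +>\<^bsub>R\<^esub> a = m +>\<^bsub>R\<^esub> b" unfolding c by blast
  qed
qed

lemma carrier_residue: "carrier (residue_field absv) = (\<lambda>a. m +>\<^bsub>R\<^esub> a) ` {x. absv x \<le> 1}"
  by (auto simp: residue_field_def FactRing_def A_RCOSETS_def')

lemma m_coset: "m = m +>\<^bsub>R\<^esub> 0"
  unfolding a_r_coset_def' by auto

lemma residue_add: "absv a \<le> 1 \<Longrightarrow> absv b \<le> 1 \<Longrightarrow>
    (m +>\<^bsub>R\<^esub> a) \<oplus>\<^bsub>residue_field absv\<^esub> (m +>\<^bsub>R\<^esub> b) = m +>\<^bsub>R\<^esub> (a + b)"
proof (intro equalityI subsetI)
  fix x assume "x \<in> (m +>\<^bsub>R\<^esub> a) \<oplus>\<^bsub>residue_field absv\<^esub> (m +>\<^bsub>R\<^esub> b)"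
  then obtain h k where "h \<in> m" "k \<in> m" "x = (h + a) + (k + b)"
    by (auto simp: residue_field_def FactRing_def set_add_def' a_r_coset_def')
  then have "x = (h + k) + (a + b)" "h + k \<in> m" by (auto simp: maximal_ideal_eq absv_add_le)
  then show "x \<in> m +>\<^bsub>R\<^esub> (a + b)" by (auto simp: a_r_coset_def')
next
  fix x assume "x \<in> m +>\<^bsub>R\<^esub> (a + b)"
  then obtain h where h: "h \<in> m" "x = h + (a + b)" by (auto simp: a_r_coset_def')
  have "h + a \<in> m +>\<^bsub>R\<^esub> a" "0 + b \<in> m +>\<^bsub>R\<^esub> b"
    using h(1) q_pos by (auto simp: maximal_ideal_eq a_r_coset_def' intro!: bexI[of _ 0])
  moreover have "x = (h + a) + (0 + b)" using h(2) by simp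
  ultimately show "x \<in> (m +>\<^bsub>R\<^esub> a) \<oplus>\<^bsub>residue_field absv\<^esub> (m +>\<^bsub>R\<^esub> b)"
    by (simp only: residue_field_def FactRing_def set_add_def' ring.simps valuation_ring_simps) blast
qed

lemma residue_add_pow: "add_pow (residue_field absv) n \<one>\<^bsub>residue_field absv\<^esub> = m +>\<^bsub>R\<^esub> of_nat n"
proof (induction n)
  case 0
  show ?case using m_coset by (simp add: add_pow_def nat_pow_def residue_field_def FactRing_def)
next
  case (Suc n)
  have "add_pow (residue_field absv) (Suc n) \<one>\<^bsub>residue_field absv\<^esub>
      = add_pow (residue_field absv) n \<one>\<^bsub>residue_field absv\<^esub> \<oplus>\<^bsub>residue_field absv\<^esub> \<one>\<^bsub>residue_field absv\<^esub>"
    by (simp add: add_pow_def nat_pow_def)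
  moreover have "\<one>\<^bsub>residue_field absv\<^esub> = m +>\<^bsub>R\<^esub> 1" by (simp add: residue_field_def FactRing_def)
  ultimately show ?case using Suc residue_add[of "of_nat n" 1] absv_of_nat_le by (simp add: add.commute)
qed

lemma absv_p: "absv (of_nat p) < 1"
proof -
  have "m +>\<^bsub>R\<^esub> of_nat p = m +>\<^bsub>R\<^esub> 0"
    using res_char m_coset unfolding residue_add_pow by (simp add: residue_field_def FactRing_def)
  then show ?thesis using coset_eq_iff[of "of_nat p" 0] less_1_iff by simp
qed

text \<open>The map from \<open>a\<close> to \<open>1 + a * unif^k\<close> identifies the residue
  field with \<open>Uf k / Uf (k + 1)\<close>.\<close>

lemma index_Uf:
  assumes k: "1 \<le> k" shows "mindex (Uf k) (Uf (k + 1)) = p ^ f"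
proof -
  have Ug: "mgroup (Uf (k + 1))"
    unfolding mgroup_def using Uf_mult Uf_inverse Uf_absv
    by (auto simp: divide_inverse Uf_iff[of 1] q_pos less_imp_le dest: Uf_absv[of 0])
  have "card ((\<lambda>a. m +>\<^bsub>R\<^esub> a) ` {x. absv x \<le> 1}) = card (mcoset (Uf (k + 1)) ` Uf k)"
  proof (rule card_image_kernel[where \<phi> = "\<lambda>a. 1 + a * unif ^ k"])
    have uk: "absv (unif ^ k) = q ^ k" by (simp add: absv_power q_def)
    have inU: "1 + a * unif ^ k \<in> Uf k" if "absv a \<le> 1" for a
      using that k q_pos by (simp add: Uf_iff absv_mult uk max_def mult_left_le_one_le absv_nonneg)
    show "(\<lambda>a. 1 + a * unif ^ k) ` {x. absv x \<le> 1} = Uf k"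
    proof (intro equalityI subsetI)
      fix x assume x: "x \<in> Uf k"
      have "absv ((x - 1) / unif ^ k) \<le> 1" using x k q_pos by (simp add: absv_divide uk Uf_iff max_def)
      moreover have "x = 1 + ((x - 1) / unif ^ k) * unif ^ k" using unif_nz by simp
      ultimately show "x \<in> (\<lambda>a. 1 + a * unif ^ k) ` {x. absv x \<le> 1}" by blast
    qed (use inU in auto)
    fix a b assume "a \<in> {x. absv x \<le> 1}" "b \<in> {x. absv x \<le> 1}"
    then have ab: "1 + a * unif ^ k \<in> Uf k" "1 + b * unif ^ k \<in> Uf k" using inU by auto
    then have nz: "1 + a * unif ^ k \<noteq> 0" "1 + b * unif ^ k \<noteq> 0" using Uf_absv[of 0 k] by auto
    have "mcoset (Uf (k + 1)) (1 + a * unif ^ k) = mcoset (Uf (k + 1)) (1 + b * unif ^ k)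
        \<longleftrightarrow> (1 + a * unif ^ k) / (1 + b * unif ^ k) \<in> Uf (k + 1)" by (rule mcoset_eq[OF Ug nz])
    also have "\<dots> \<longleftrightarrow> absv ((1 + a * unif ^ k) - (1 + b * unif ^ k)) \<le> q ^ max 1 (k + 1)"
      by (rule Uf_divide_iff[OF Uf_absv[OF ab(1)] Uf_absv[OF ab(2)]])
    also have "max 1 (k + 1) = k + 1" by simp
    also have "(1 + a * unif ^ k) - (1 + b * unif ^ k) = (a - b) * unif ^ k" by (simp add: algebra_simps)
    also have "absv ((a - b) * unif ^ k) \<le> q ^ (k + 1) \<longleftrightarrow> absv (a - b) \<le> q" using q_pos by (simp add: absv_mult uk)
    finally show "m +>\<^bsub>R\<^esub> a = m +>\<^bsub>R\<^esub> b \<longleftrightarrow>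
        mcoset (Uf (k + 1)) (1 + a * unif ^ k) = mcoset (Uf (k + 1)) (1 + b * unif ^ k)"
      using coset_eq_iff by simp
  qed
  then show ?thesis using res_card unfolding carrier_residue mindex_def by simp
qed

lemma f_pos: "1 \<le> f"
proof (rule ccontr)
  assume "\<not> 1 \<le> f"
  then have "card ((\<lambda>a. m +>\<^bsub>R\<^esub> a) ` {x. absv x \<le> 1}) = 1" using res_card carrier_residue by simp
  then obtain C where C: "(\<lambda>a. m +>\<^bsub>R\<^esub> a) ` {x. absv x \<le> 1} = {C}" by (auto simp: card_1_singleton_iff)
  have "m +>\<^bsub>R\<^esub> 0 \<in> {C}" "m +>\<^bsub>R\<^esub> 1 \<in> {C}" unfolding C[symmetric] by auto
  then have "m +>\<^bsub>R\<^esub> 1 = m +>\<^bsub>R\<^esub> 0" by simp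
  then show False using coset_eq_iff[of 1 0] q_less_1 by simp
qed

abbreviation "\<rho> \<equiv> rho_K absv p"

lemma p_ge_2: "2 \<le> p"
  using prime_ge_2_nat[OF prime_p] .

lemma val_p_cases:
  obtains (inf) "(of_nat p :: 'a) = 0" "val_p absv p = \<infinity>"
  | (fin) n where "1 \<le> n" "absv (of_nat p) = q ^ n" "val_p absv p = enat n"
proof (cases "(of_nat p :: 'a) = 0")
  case True
  then show ?thesis using inf by (simp add: val_p_def)
next
  case False
  obtain n where n: "absv (of_nat p) = q ^ n" using absv_eq_q_power[OF False absv_of_nat_le] by blast
  have "1 \<le> n" using n absv_p by (cases n) auto
  have uq: "absv \<pi> = q" if "uniformizer absv \<pi>" for \<pi>
    using that unif unfolding uniformizer_def q_def by (meson order_antisym)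
  have "val absv (of_nat p) = int n"
    unfolding val_def
  proof (rule the_equality)
    show "\<exists>\<pi>. uniformizer absv \<pi> \<and> absv (of_nat p) = absv \<pi> powi int n" using unif n by (intro exI[of _ unif]) (simp add: q_def)
    fix k assume "\<exists>\<pi>. uniformizer absv \<pi> \<and> absv (of_nat p) = absv \<pi> powi k"
    then have e: "q ^ n = q powi k" using uq n by auto
    show "k = int n"
    proof -
      have inj: "a = b" if "q ^ a = q ^ b" for a b
        using q_power_le_iff[of a b] q_power_le_iff[of b a] that by simp
      show ?thesis
      proof (cases "0 \<le> k")
        case True
        then show ?thesis using e inj[of n "nat k"] by (simp add: power_int_def)
      next
        case False
        then have "q ^ n * q ^ nat (- k) = 1" using e q_pos by (simp add: power_int_def field_simps)
        then have "q ^ (n + nat (- k)) = q ^ 0" by (simp add: power_add)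
        then show ?thesis using inj[of "n + nat (- k)" 0] False by simp
      qed
    qed
  qed
  then show ?thesis using fin[OF \<open>1 \<le> n\<close> n] False by (simp add: val_p_def)
qed

lemma rho_le_mult: "\<rho> i \<le> p * i"
  by (simp add: rho_K_def rho_def split: enat.splits)

lemma rho_shift: "shift \<rho>"
proof
  have p2: "2 \<le> p" by (rule p_ge_2)
  show "strict_mono \<rho>"
  proof (rule strict_monoI)
    fix a b :: nat assume "a < b"
    then have "p * a < p * b" using p2 by simp
    have "min (a + n) (p * a) < min (b + n) (p * b)" for n
      using min.strict_coboundedI1[of "a + n" "b + n" "p * a"] min.strict_coboundedI2[OF \<open>p * a < p * b\<close>, of "a + n"] \<open>a < b\<close>
      unfolding min_less_iff_conj by linarith
    then show "\<rho> a < \<rho> b" using \<open>p * a < p * b\<close> by (simp add: rho_K_def rho_def split: enat.splits)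
  qed
  show "\<rho> 0 = 0" by (simp add: rho_K_def rho_def split: enat.splits)
  show "i < \<rho> i" if "1 \<le> i" for i
  proof -
    have "i < p * i" using p2 that by simp
    then show ?thesis by (cases rule: val_p_cases) (auto simp: rho_K_def rho_def)
  qed
qed

lemma absv_p_le: "absv (of_nat p) * q ^ i \<le> q ^ \<rho> i"
proof (cases rule: val_p_cases)
  case inf
  then show ?thesis using q_pos by (simp add: less_imp_le)
next
  case (fin n)
  then have "\<rho> i \<le> n + i" by (simp add: rho_K_def rho_def)
  then have "q ^ (n + i) \<le> q ^ \<rho> i" by (rule q_power_mono)
  then show ?thesis using fin by (simp add: power_add)
qed

text \<open>The inner binomial coefficients are divisible by \<open>p\<close>; \<open>r\<close>
  collects those from \<open>k = 2\<close> on, which leaves \<open>x^p\<close> and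
  \<open>p x\<close> as leading terms.\<close>

lemma binomial_p:
  assumes x: "absv x \<le> 1"
  obtains r where "absv r \<le> 1" "(1 + x) ^ p = 1 + (x ^ p + of_nat p * x * (1 + x * r))"
proof
  define r where "r = (\<Sum>k\<in>{2..<p}. of_nat ((p choose k) div p) * x ^ (k - 2))"
  show "absv r \<le> 1"
    unfolding r_def
  proof (rule absv_sum_le)
    show "absv (of_nat ((p choose k) div p) * x ^ (k - 2)) \<le> 1" for k
      using absv_of_nat_le[of "(p choose k) div p"] x absv_nonneg
      by (simp add: absv_mult absv_power mult_le_one power_le_one)
  qed simp
  have "(1 + x) ^ p = (\<Sum>k\<le>p. of_nat (p choose k) * x ^ k)"
    using binomial_ring[of x 1 p] by (simp add: add.commute)
  also have "{..p} = insert 0 (insert 1 (insert p {2..<p}))" using p_ge_2 by auto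
  also have "(\<Sum>k\<in>insert 0 (insert 1 (insert p {2..<p})). of_nat (p choose k) * x ^ k)
      = 1 + (of_nat p * x + (x ^ p + (\<Sum>k\<in>{2..<p}. of_nat (p choose k) * x ^ k)))"
    using p_ge_2 by simp
  also have "(\<Sum>k\<in>{2..<p}. of_nat (p choose k) * x ^ k) = of_nat p * x * (x * r)"
    unfolding r_def sum_distrib_left
  proof (rule sum.cong)
    fix k assume k: "k \<in> {2..<p}"
    then have "p dvd p choose k" using prime_p by (intro dvd_choose_prime) auto
    then have "(of_nat (p choose k) :: 'a) = of_nat p * of_nat ((p choose k) div p)" by (simp flip: of_nat_mult)
    moreover have "x ^ k = x * x * x ^ (k - 2)" using k by (metis add_diff_inverse_nat atLeastLessThan_iff not_less power_add power2_eq_square)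
    ultimately show "of_nat (p choose k) * x ^ k = of_nat p * x * (x * (of_nat ((p choose k) div p) * x ^ (k - 2)))" by (simp add: mult_ac)
  qed simp
  finally show "(1 + x) ^ p = 1 + (x ^ p + of_nat p * x * (1 + x * r))" by (simp add: algebra_simps)
qed

text \<open>\<open>1 + x r\<close> has absolute value 1, so the sizes of both leading terms are
  known exactly; this decides where they can cancel.\<close>

lemma Uf_p_power:
  assumes "u \<in> Uf k"
  obtains a b where "u ^ p = 1 + (a + b)" "absv a = absv (u - 1) ^ p" "absv b = absv (of_nat p) * absv (u - 1)"
proof -
  define x where "x = u - 1"
  have x: "absv x \<le> q ^ max 1 k" using assms by (simp add: x_def Uf_iff)
  have "q ^ max 1 k < q ^ 0" by (simp only: q_power_less_iff)
  then have x1: "absv x < 1" using x by simp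
  obtain r where r: "absv r \<le> 1" "(1 + x) ^ p = 1 + (x ^ p + of_nat p * x * (1 + x * r))"
    using binomial_p[of x] x1 by auto
  have "absv (x * r) < 1" using r(1) x1 absv_nonneg[of x] absv_nonneg[of r] by (simp add: absv_mult) (metis mult_left_le order_le_less_trans)
  then have "absv (1 + x * r) = 1" using absv_add_eq[of "x * r" 1] by simp
  then show ?thesis using that[of "x ^ p" "of_nat p * x * (1 + x * r)"] r(2) by (simp add: x_def absv_mult absv_power)
qed

lemma Uf_pow_p: "u \<in> Uf k \<Longrightarrow> u ^ p \<in> Uf (\<rho> k)"
proof -
  assume u: "u \<in> Uf k"
  interpret shift \<rho> by (rule rho_shift)
  define j where "j = max 1 k"
  have x: "absv (u - 1) \<le> q ^ j" using u by (simp add: Uf_iff j_def)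
  obtain a b where ab: "u ^ p = 1 + (a + b)" "absv a = absv (u - 1) ^ p" "absv b = absv (of_nat p) * absv (u - 1)"
    using Uf_p_power[OF u] by blast
  have "absv a \<le> (q ^ j) ^ p" unfolding ab(2) using x absv_nonneg by (intro power_mono) auto
  also have "\<dots> = q ^ (p * j)" by (simp flip: power_mult add: mult.commute)
  also have "\<dots> \<le> q ^ \<rho> j" by (intro q_power_mono rho_le_mult)
  finally have a: "absv a \<le> q ^ \<rho> j" .
  have "absv b \<le> absv (of_nat p) * q ^ j" unfolding ab(3) using x absv_nonneg by (intro mult_left_mono) auto
  then have b: "absv b \<le> q ^ \<rho> j" using absv_p_le[of j] by linarith
  have "max 1 (\<rho> k) \<le> \<rho> j" using rho_ge[of j] rho_le_iff[of k j] by (auto simp: j_def max_def)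
  then have "q ^ \<rho> j \<le> q ^ max 1 (\<rho> k)" by (rule q_power_mono)
  then have "absv (a + b) \<le> q ^ max 1 (\<rho> k)" using absv_add_le[OF a b] by (rule order_trans[rotated])
  then show ?thesis unfolding Uf_iff ab(1) by (simp only: add_diff_cancel_left')
qed

text \<open>When the leading terms differ in size the larger one wins, and a unit of exact level
  \<open>i\<close> has a \<open>p\<close>-th power of exact level \<open>\<rho> i\<close>.\<close>

lemma Uf_inj_p:
  assumes i: "1 \<le> i" "\<not> (\<exists>n. val_p absv p = enat n \<and> p * i = i + n)"
    and u: "u \<in> Uf i" "u ^ p \<in> Uf (\<rho> i + 1)"
  shows "u \<in> Uf (i + 1)"
proof (rule ccontr)
  assume n: "u \<notin> Uf (i + 1)"
  have x: "absv (u - 1) = q ^ i" using n u(1) i(1) less_q_iff[of "u - 1" i] by (auto simp: Uf_iff max_def)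
  obtain a b where ab: "u ^ p = 1 + (a + b)" "absv a = absv (u - 1) ^ p" "absv b = absv (of_nat p) * absv (u - 1)"
    using Uf_p_power[OF u(1)] by blast
  have a: "absv a = q ^ (p * i)" unfolding ab(2) x by (simp flip: power_mult add: mult.commute)
  have "absv (a + b) = q ^ \<rho> i"
  proof (cases rule: val_p_cases)
    case inf
    then have "absv b = 0" using ab(3) by simp
    then have "b = 0" using absv_eq_0_iff by simp
    then show ?thesis using a inf by (simp add: rho_K_def rho_def)
  next
    case (fin n)
    then have b: "absv b = q ^ (i + n)" using ab(3) x by (simp add: power_add mult.commute)
    have ne: "p * i \<noteq> i + n" using i(2) fin by blast
    have r: "\<rho> i = min (i + n) (p * i)" using fin by (simp add: rho_K_def rho_def)
    show ?thesis
    proof (cases "p * i < i + n")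
      case True
      then have "absv b < absv a" unfolding a b q_power_less_iff .
      then show ?thesis using absv_add_eq a r True by simp
    next
      case False
      then have "i + n < p * i" using ne by simp
      then have "absv a < absv b" unfolding a b q_power_less_iff .
      then have "absv (b + a) = absv b" by (rule absv_add_eq)
      then show ?thesis using b r False by (simp add: add.commute)
    qed
  qed
  moreover have "absv (a + b) \<le> q ^ (\<rho> i + 1)" using u(2) ab(1) by (simp add: Uf_iff max_def)
  ultimately have "q ^ \<rho> i \<le> q ^ (\<rho> i + 1)" by (simp only:)
  then show False unfolding q_power_le_iff by simp
qed

lemma Uf_complete:
  assumes s: "\<And>n. s n \<in> Uf 0" "\<And>n. s (Suc n) / s n \<in> Uf n"
  shows "\<exists>y. \<forall>n. y / s n \<in> Uf n"
proof -
  have a1: "absv (s n) = 1" for n using Uf_absv[OF s(1)] .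
  have "\<exists>l. \<forall>n. absv (l - s n) \<le> q ^ max 1 n"
  proof (rule complete_q)
    show "absv (s n) \<le> 1" for n using a1 by simp
    show "mono (\<lambda>n::nat. max 1 n)" by (auto simp: mono_def)
    show "n \<le> max 1 n" for n :: nat by simp
    show "absv (s (Suc n) - s n) \<le> q ^ max 1 n" for n using s(2)[of n] Uf_divide_iff[OF a1 a1] by simp
  qed
  then obtain l where l: "\<And>n. absv (l - s n) \<le> q ^ max 1 n" by blast
  have "absv (l - s 0) < absv (s 0)" using l[of 0] q_less_1 a1 by simp
  then have "absv l = 1" using absv_add_eq[of "l - s 0" "s 0"] a1 by simp
  then show ?thesis using Uf_divide_iff[OF _ a1] l by blast
qed

lemma unit_filt_Uf: "unit_filt \<rho> Uf p"
proof -
  interpret shift \<rho> by (rule rho_shift)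
  show ?thesis
  proof unfold_locales
    show "prime p" by (rule prime_p)
    show "x \<noteq> 0" if "x \<in> Uf k" for x k using Uf_absv[OF that] by auto
    show "1 \<in> Uf k" for k using q_pos by (simp add: Uf_iff)
    show "x * y \<in> Uf k" if "x \<in> Uf k" "y \<in> Uf k" for x y k using Uf_mult that .
    show "inverse x \<in> Uf k" if "x \<in> Uf k" for x k using Uf_inverse that .
    show "Uf l \<subseteq> Uf k" if "k \<le> l" for k l using Uf_antimono that .
    show "Uf 0 = Uf 1" by (simp add: Uf_def)
    show "x ^ p \<in> Uf (\<rho> k)" if "x \<in> Uf k" for x k using Uf_pow_p that .
  qed
qed

text \<open>The levels at which \<open>x^p\<close> and \<open>p x\<close> have the same size, that
  is \<open>i = e / (p - 1)\<close>; there are none in characteristic \<open>p\<close>.\<close>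

definition exc :: "nat set" where
  "exc = {i. 1 \<le> i \<and> (\<exists>n. val_p absv p = enat n \<and> p * i = i + n)}"

lemma exc_unique: "i \<in> exc \<Longrightarrow> j \<in> exc \<Longrightarrow> i = j"
proof -
  assume "i \<in> exc" "j \<in> exc"
  then obtain n where "p * i = i + n" "p * j = j + n" by (auto simp: exc_def)
  then have "(p - 1) * i = (p - 1) * j" by (simp add: diff_mult_distrib)
  then show ?thesis using p_ge_2 by simp
qed

lemma Uf_separated: "(\<And>k. x \<in> Uf k) \<Longrightarrow> x = 1"
proof -
  assume x: "\<And>k. x \<in> Uf k"
  have "absv (x - 1) \<le> q ^ k" for k
    using x[of k] q_power_mono[of k "max 1 k"] unfolding Uf_iff by (meson max.cobounded2 order_trans)
  then show ?thesis using zero_if_small[of "x - 1"] by simp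
qed

lemma unit_tower_Uf:
  assumes "\<And>i u. i \<in> exc - X \<Longrightarrow> u \<in> Uf i \<Longrightarrow> u ^ p \<in> Uf (\<rho> i + 1) \<Longrightarrow> u \<in> Uf (i + 1)"
  shows "unit_tower \<rho> Uf p f X"
proof -
  interpret unit_filt \<rho> Uf p by (rule unit_filt_Uf)
  show ?thesis
  proof unfold_locales
    show "1 \<le> f" by (rule f_pos)
    show "mindex (Uf k) (Uf (k + 1)) = p ^ f" if "1 \<le> k" for k by (rule index_Uf[OF that])
    show "x = 1" if "\<And>k. x \<in> Uf k" for x by (rule Uf_separated[OF that])
    show "\<exists>y. \<forall>n. y / xs n \<in> Uf n" if "\<And>n. xs n \<in> Uf 0" "\<And>n. xs (Suc n) / xs n \<in> Uf n" for xs
      by (rule Uf_complete) (fact that)+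
    show "u \<in> Uf (i + 1)" if "1 \<le> i" "i \<notin> X" "u \<in> Uf i" "u ^ p \<in> Uf (\<rho> i + 1)" for i u
      using Uf_inj_p[OF that(1) _ that(3,4)] assms[of i u] that by (auto simp: exc_def)
  qed
qed

lemma exc_tail:
  assumes e: "e1 \<in> exc"
  obtains n where "val_p absv p = enat n" "p * e1 = e1 + n" "1 \<le> e1" "1 \<le> n" "\<And>i. e1 \<le> i \<Longrightarrow> \<rho> i = i + n" "\<And>i. i \<le> e1 \<Longrightarrow> \<rho> i = p * i"
proof -
  obtain n where n: "val_p absv p = enat n" "p * e1 = e1 + n" "1 \<le> e1" using e by (auto simp: exc_def)
  have pe: "(p - 1) * e1 = n" using n(2) by (simp add: diff_mult_distrib)
  have c: "p * i = (p - 1) * i + i" for i using p_ge_2 by (simp add: diff_mult_distrib)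
  have 1: "\<rho> i = i + n" if "e1 \<le> i" for i
  proof -
    have "(p - 1) * e1 \<le> (p - 1) * i" by (rule mult_le_mono2[OF that])
    then have "i + n \<le> p * i" using pe c[of i] by linarith
    then show ?thesis using n(1) by (simp add: rho_K_def rho_def)
  qed
  have 2: "\<rho> i = p * i" if "i \<le> e1" for i
  proof -
    have "(p - 1) * i \<le> (p - 1) * e1" by (rule mult_le_mono2[OF that])
    then have "p * i \<le> i + n" using pe c[of i] by linarith
    then show ?thesis using n(1) by (simp add: rho_K_def rho_def)
  qed
  have "1 \<le> n" using pe n(3) p_ge_2 by (cases n) auto
  then show ?thesis using that n 1 2 by blast
qed

lemma absv_root: "(\<zeta>::'a) ^ p = 1 \<Longrightarrow> absv \<zeta> = 1"
proof -
  assume "\<zeta> ^ p = 1"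
  then have "absv \<zeta> ^ p = 1" by (metis absv_1 absv_power)
  then have "absv \<zeta> ^ p = 1 ^ p" by simp
  then show ?thesis using power_eq_iff_eq_base[of p "absv \<zeta>" 1] absv_nonneg[of \<zeta>] p_ge_2 by simp
qed

text \<open>For \<open>x = \<zeta> - 1\<close> the expansion of \<open>(1 + x)^p = 1\<close> makes
  \<open>x^p\<close> a multiple of \<open>p\<close> in the valuation ring, hence \<open>x\<close>
  lies in the maximal ideal.\<close>

lemma root_in_U1: "(\<zeta>::'a) ^ p = 1 \<Longrightarrow> \<zeta> \<in> Uf 1"
proof -
  assume z: "\<zeta> ^ p = 1"
  define x where "x = \<zeta> - 1"
  have x: "absv x \<le> 1" using absv_diff_le[of \<zeta> 1 1] absv_root[OF z] by (simp add: x_def)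
  obtain r where r: "absv r \<le> 1" "(1 + x) ^ p = 1 + (x ^ p + of_nat p * x * (1 + x * r))" using binomial_p[OF x] by blast
  have "absv (1 + x * r) \<le> 1" using x r(1) by (intro absv_add_le) (auto simp: absv_mult mult_le_one absv_nonneg)
  then have "absv (x * (1 + x * r)) \<le> 1" using x by (simp add: absv_mult mult_le_one absv_nonneg)
  then have "absv (of_nat p) * absv (x * (1 + x * r)) < 1"
    using absv_p absv_nonneg[of "of_nat p"] by (metis mult_left_le order_le_less_trans)
  moreover have "x ^ p = - (of_nat p * (x * (1 + x * r)))" using r(2) z by (simp add: x_def eq_neg_iff_add_eq_0 mult.assoc)
  ultimately have "absv x ^ p < 1" by (metis absv_minus absv_mult absv_power)
  then have "absv x < 1" using one_le_power[of "absv x" p] by (meson not_less)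
  then show ?thesis using less_1_iff by (simp add: Uf_iff x_def)
qed

text \<open>The tower with the exceptional level \<open>i\<close> left out provides
  \<open>p\<close>-th roots above \<open>i\<close>. These show that a kernel element at
  \<open>i\<close> differs from a unit of level \<open>i + 1\<close> by a root of unity, which is
  trivial here.\<close>

lemma mu_trivial_tower:
  assumes mu: "(mu p :: 'a set) = {1}"
  shows "unit_tower \<rho> Uf p f {}"
proof (rule unit_tower_Uf)
  fix i u assume "i \<in> exc - {}" and u: "u \<in> Uf i" "u ^ p \<in> Uf (\<rho> i + 1)"
  then have e: "i \<in> exc" by simp
  obtain n where n: "1 \<le> i" "\<And>j. i \<le> j \<Longrightarrow> \<rho> j = j + n" using exc_tail[OF e] by metis
  interpret unit_tower \<rho> Uf p f "{i}" by (rule unit_tower_Uf) (use exc_unique[OF e] in auto)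
  have "u ^ p \<in> Uf (\<rho> (i + 1))" using u(2) n(2)[of i] n(2)[of "i + 1"] by simp
  then obtain w where w: "w \<in> Uf (i + 1)" "u ^ p = w ^ p"
    using p_th_root_tail[of "i + 1" "u ^ p"] n(2) by (auto simp: add.assoc)
  have wn: "w \<noteq> 0" using U_nonzero[OF w(1)] .
  have "(u / w) ^ p = 1" using w(2) wn by (simp add: power_divide)
  then have "u / w \<in> mu p" by (simp add: mu_def)
  then have "u = w" using mu wn by simp
  then show "u \<in> Uf (i + 1)" using w(1) by simp
qed

text \<open>The exact level of a nontrivial root of unity must be exceptional, because its
  \<open>p\<close>-th power 1 lies in every level.\<close>

lemma mu_nontrivial_tower:
  assumes mu: "(mu p :: 'a set) \<noteq> {1}"
  shows "\<exists>e1 \<zeta>. unit_tower_mu \<rho> Uf p f e1 \<zeta>"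
proof -
  have "(1::'a) \<in> mu p" by (simp add: mu_def)
  then obtain \<zeta> :: 'a where z: "\<zeta> ^ p = 1" "\<zeta> \<noteq> 1" using mu by (auto simp: mu_def)
  have zU: "\<zeta> \<in> Uf 1" by (rule root_in_U1[OF z(1)])
  have "absv (\<zeta> - 1) \<le> 1" using zU q_less_1 by (simp add: Uf_iff)
  then obtain i where i: "absv (\<zeta> - 1) = q ^ i" using absv_eq_q_power[of "\<zeta> - 1"] z(2) by auto
  have i1: "1 \<le> i" using i zU q_less_1 by (cases i) (auto simp: Uf_iff)
  have zi: "\<zeta> \<in> Uf i" "\<zeta> \<notin> Uf (i + 1)" using i i1 by (auto simp: Uf_iff max_def simp del: power_Suc)
  have one: "1 \<in> Uf k" for k using q_pos by (simp add: Uf_iff)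
  have e: "i \<in> exc" using Uf_inj_p[OF i1 _ zi(1)] zi(2) z(1) one i1 by (auto simp: exc_def)
  obtain n where n: "1 \<le> n" "p * i = i + n" "\<And>j. i \<le> j \<Longrightarrow> \<rho> j = j + n" "\<And>j. j \<le> i \<Longrightarrow> \<rho> j = p * j" using exc_tail[OF e] by metis
  interpret unit_tower \<rho> Uf p f "{i}" by (rule unit_tower_Uf) (use exc_unique[OF e] in auto)
  have Tsub: "T \<rho> \<subseteq> {..<i + n}"
  proof
    fix k assume k: "k \<in> T \<rho>"
    show "k \<in> {..<i + n}"
    proof (rule ccontr)
      assume "k \<notin> {..<i + n}"
      then have "k = \<rho> (k - n)" "1 \<le> k - n" using n(3)[of "k - n"] i1 by auto
      then show False using k by (auto simp: T_def)
    qed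
  qed
  \<comment> \<open>\<open>i + n - 1\<close> equals \<open>p * i - 1\<close> and is no multiple of
    \<open>p\<close>, while \<open>\<rho>\<close> takes only multiples of \<open>p\<close> below
    \<open>i\<close>. Thus the largest element of \<open>T \<rho>\<close> is
    \<open>\<rho> i - 1\<close>.\<close>
  have top: "i + n - 1 \<in> T \<rho>"
    unfolding T_def
  proof (intro DiffI notI)
    show "i + n - 1 \<in> {1..}" using i1 n(1) by simp
    assume "i + n - 1 \<in> \<rho> ` {1..}"
    then obtain j where j: "i + n - 1 = \<rho> j" by blast
    have "\<rho> i = i + n" using n(3) by simp
    then have "\<rho> j < \<rho> i" using j i1 by simp
    then have "j < i" by simp
    then have "p * i - 1 = p * j" using j n(2,4) by simp
    moreover have "p * (j + 1) \<le> p * i" using \<open>j < i\<close> by (intro mult_left_mono) auto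
    ultimately show False using p_ge_2 by simp
  qed
  have finT: "finite (T \<rho>)" using Tsub finite_subset by blast
  have "Max (T \<rho>) = i + n - 1" using Tsub top finT by (intro Max_eqI) auto
  then have es: "e_star \<rho> = \<rho> i" using n(3)[of i] i1 by (simp add: e_star_def)
  have zn: "\<zeta> \<noteq> 0" by (rule U_nonzero[OF zU])
  \<comment> \<open>The first \<open>p\<close> powers of \<zeta> are distinct, and a polynomial of
    degree at most \<open>p\<close> has no further roots.\<close>
  have roots: "\<exists>l::nat. x = \<zeta> ^ l" if x: "x ^ p = 1" for x :: 'a
  proof (rule ccontr)
    assume nx: "\<nexists>l. x = \<zeta> ^ l"
    have inj: "inj_on (\<lambda>l. \<zeta> ^ l) {..<p}"
    proof (rule linorder_inj_onI')
      fix a b assume ab: "a \<in> {..<p}" "b \<in> {..<p}" "a < b"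
      show "\<zeta> ^ a \<noteq> \<zeta> ^ b"
      proof
        assume "\<zeta> ^ a = \<zeta> ^ b"
        also have "\<zeta> ^ b = \<zeta> ^ a * \<zeta> ^ (b - a)" using ab by (simp flip: power_add)
        finally have d: "\<zeta> ^ (b - a) = 1" using zn by simp
        have "\<not> p dvd b - a" using ab by (auto dest: dvd_imp_le)
        then have "coprime p (b - a)" by (rule prime_imp_coprime[OF prime_p])
        then have "coprime (int (b - a)) (int p)" by (simp only: coprime_int_iff coprime_commute)
        moreover obtain s t where "s * int (b - a) + t * int p = gcd (int (b - a)) (int p)" using bezout_int by blast
        ultimately have "int (b - a) * s + int p * t = 1" by (simp add: mult.commute)
        moreover have "\<zeta> powi (int (b - a) * s + int p * t) = 1"
          using zn d z(1) by (simp add: power_int_add power_int_mult del: of_nat_diff)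
        ultimately show False using z(2) by simp
      qed
    qed
    define P where "P = monom (1::'a) p - 1"
    have cP: "coeff P p = 1" using p_ge_2 by (simp add: P_def coeff_pCons split: nat.splits)
    then have P0: "P \<noteq> 0" by auto
    have dP: "degree P \<le> p" unfolding P_def by (rule degree_diff_le) (auto intro: degree_monom_le)
    have rt: "{x. poly P x = 0} = {x. x ^ p = 1}" by (simp add: P_def poly_monom)
    have "insert x ((\<lambda>l. \<zeta> ^ l) ` {..<p}) \<subseteq> {x. poly P x = 0}"
    proof -
      have "(\<zeta> ^ l) ^ p = (\<zeta> ^ p) ^ l" for l by (simp only: power_mult[symmetric] mult.commute)
      then show ?thesis unfolding rt using x z(1) by auto
    qed
    then have "card (insert x ((\<lambda>l. \<zeta> ^ l) ` {..<p})) \<le> card {x. poly P x = 0}"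
      by (intro card_mono poly_roots_finite P0)
    also have "\<dots> \<le> degree P" by (rule card_poly_roots_bound[OF P0])
    finally have "card (insert x ((\<lambda>l. \<zeta> ^ l) ` {..<p})) \<le> p" using dP by simp
    moreover have "x \<notin> (\<lambda>l. \<zeta> ^ l) ` {..<p}" using nx by blast
    ultimately show False using card_image[OF inj] by simp
  qed
  have "unit_tower_mu \<rho> Uf p f i \<zeta>"
  proof unfold_locales
    show "1 \<le> i" "\<zeta> \<in> Uf i" "\<zeta> \<notin> Uf (i + 1)" "\<zeta> ^ p = 1" "finite (T \<rho>)" "e_star \<rho> = \<rho> i"
      using i1 zi z finT es by auto
    show "\<rho> (j + 1) = \<rho> j + 1" if "i \<le> j" for j using n(3)[of j] n(3)[of "j + 1"] that by simp
  qed (use roots in blast)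
  then show ?thesis by blast
qed

end

section \<open>Characters with values in the p-adic numbers modulo the p-adic integers\<close>

context
  fixes p :: nat
  assumes prime_p: "prime p"
begin

private abbreviation (input) "Z \<equiv> Zp p"

section \<open>Arithmetic of \<open>p\<close>-adic integers as coherent sequences\<close>

lemma p_int_pos: "0 < int p" "1 < int p" "0 < int p ^ n" "int p ^ n \<noteq> 0"
  using prime_gt_1_nat[OF prime_p] by auto

lemma Zp_simps [simp]:
  "(x \<otimes>\<^bsub>Z\<^esub> y) = (\<lambda>n. x n * y n mod int p ^ n)" "(x \<oplus>\<^bsub>Z\<^esub> y) = (\<lambda>n. (x n + y n) mod int p ^ n)"
  "\<one>\<^bsub>Z\<^esub> = (\<lambda>n. 1 mod int p ^ n)" "\<zero>\<^bsub>Z\<^esub> = (\<lambda>n. 0)"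
  by (simp_all add: Zp_def)

lemma Zp_iff: "x \<in> carrier Z \<longleftrightarrow> (\<forall>n. x n \<in> {0..<int p ^ n} \<and> x (Suc n) mod int p ^ n = x n)"
  by (simp add: Zp_def)

lemma Zp_range: "x \<in> carrier Z \<Longrightarrow> 0 \<le> x n \<and> x n < int p ^ n"
  by (simp add: Zp_iff)

lemma Zp_mod_self: "x \<in> carrier Z \<Longrightarrow> x n mod int p ^ n = x n"
  using Zp_range by simp

lemma mod_mod_pow: "m \<le> n \<Longrightarrow> a mod int p ^ n mod int p ^ m = a mod int p ^ m"
  by (simp add: le_imp_power_dvd mod_mod_cancel)

lemma Zp_coherent: "x \<in> carrier Z \<Longrightarrow> m \<le> n \<Longrightarrow> x n mod int p ^ m = x m"
proof -
  assume x: "x \<in> carrier Z" and "m \<le> n"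
  from this(2) show ?thesis
  proof (induction n rule: dec_induct)
    case base
    show ?case by (rule Zp_mod_self[OF x])
  next
    case (step n)
    have "x (Suc n) mod int p ^ m = x (Suc n) mod int p ^ n mod int p ^ m" using step.hyps by (simp add: mod_mod_pow)
    also have "\<dots> = x m" using step x by (simp add: Zp_iff)
    finally show ?case .
  qed
qed

lemma ZpI: "(\<And>n. 0 \<le> x n) \<Longrightarrow> (\<And>n. x n < int p ^ n) \<Longrightarrow> (\<And>n. x (Suc n) mod int p ^ n = x n) \<Longrightarrow> x \<in> carrier Z"
  by (simp add: Zp_iff)

lemma ZpI_mod: "(\<And>n. y (Suc n) mod int p ^ n = y n mod int p ^ n) \<Longrightarrow> (\<lambda>n. y n mod int p ^ n) \<in> carrier Z"
  using p_int_pos by (intro ZpI) (auto simp: mod_mod_pow simp del: power_Suc)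

lemma Zp_Suc_mod: "x \<in> carrier Z \<Longrightarrow> x (Suc n) mod int p ^ n = x n mod int p ^ n"
  using Zp_coherent[of x n "Suc n"] by (simp add: Zp_mod_self)

lemma Zp_mult_closed: "x \<in> carrier Z \<Longrightarrow> y \<in> carrier Z \<Longrightarrow> x \<otimes>\<^bsub>Z\<^esub> y \<in> carrier Z"
  unfolding Zp_simps by (rule ZpI_mod) (metis Zp_Suc_mod mod_mult_eq)

lemma Zp_add_closed: "x \<in> carrier Z \<Longrightarrow> y \<in> carrier Z \<Longrightarrow> x \<oplus>\<^bsub>Z\<^esub> y \<in> carrier Z"
  unfolding Zp_simps by (rule ZpI_mod) (metis Zp_Suc_mod mod_add_eq)

definition zi :: "int \<Rightarrow> padic" where "zi k = (\<lambda>n. k mod int p ^ n)"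

lemma zi_closed: "zi k \<in> carrier Z"
  unfolding zi_def by (rule ZpI_mod) simp

lemma zi_add: "zi a \<oplus>\<^bsub>Z\<^esub> zi b = zi (a + b)" and zi_mult: "zi a \<otimes>\<^bsub>Z\<^esub> zi b = zi (a * b)"
  and zi_0: "\<zero>\<^bsub>Z\<^esub> = zi 0" and zi_1: "\<one>\<^bsub>Z\<^esub> = zi 1"
  by (auto simp: zi_def mod_simps)

definition zneg :: "padic \<Rightarrow> padic" where "zneg x = (\<lambda>n. (- x n) mod int p ^ n)"

lemma zneg_closed: "x \<in> carrier Z \<Longrightarrow> zneg x \<in> carrier Z"
  unfolding zneg_def by (rule ZpI_mod) (metis Zp_Suc_mod mod_minus_eq)

lemma Zp_eqI: "x \<in> carrier Z \<Longrightarrow> y \<in> carrier Z \<Longrightarrow> (\<And>n. int p ^ n dvd x n - y n) \<Longrightarrow> x = y"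
  by (rule ext) (metis Zp_mod_self mod_eq_dvd_iff)

lemma Zp_zero_closed: "(\<lambda>n. 0) \<in> carrier Z"
  using zi_closed[of 0] by (simp add: zi_def)

lemma prime_power_dvd_mult:
  "int p ^ (a + b) dvd x * y \<Longrightarrow> int p ^ a dvd x \<or> int p ^ b dvd y" for x y :: int
proof (cases "x = 0")
  case False
  assume d: "int p ^ (a + b) dvd x * y"
  have "\<not> is_unit (int p)" using p_int_pos by simp
  then obtain u where u: "x = int p ^ multiplicity (int p) x * u" "\<not> int p dvd u"
    using multiplicity_decompose'[OF False] by blast
  define c where "c = multiplicity (int p) x"
  have u': "x = int p ^ c * u" using u(1) c_def by simp
  show ?thesis
  proof (cases "a \<le> c")
    case True
    then have "int p ^ a dvd x" unfolding u' by (intro dvd_mult2 le_imp_power_dvd)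
    then show ?thesis ..
  next
    case ac: False
    have "int p ^ (a + b) = int p ^ c * int p ^ (a + b - c)" using ac by (simp flip: power_add)
    then have "int p ^ c * int p ^ (a + b - c) dvd int p ^ c * (u * y)" using d unfolding u' by (simp add: mult.assoc)
    then have "int p ^ (a + b - c) dvd u * y" using p_int_pos(4) by (simp only: dvd_mult_cancel_left) simp
    moreover have "coprime (int p ^ (a + b - c)) u" using u(2) prime_p prime_imp_coprime[of "int p" u] by simp
    ultimately have "int p ^ (a + b - c) dvd y" by (simp add: coprime_dvd_mult_right_iff)
    moreover have "int p ^ b dvd int p ^ (a + b - c)" using ac by (intro le_imp_power_dvd) simp
    ultimately show ?thesis using dvd_trans by blast
  qed
qed simp

text \<open>If \<open>p^t\<close> does not divide \<open>d\<close>, dividing by \<open>d\<close>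
  loses fewer than \<open>t\<close> powers of \<open>p\<close>; comparing the products modulo
  \<open>p^(n + t)\<close> therefore settles the factors modulo \<open>p^n\<close>.\<close>

lemma Zp_cancel:
  assumes x: "x \<in> carrier Z" and y: "y \<in> carrier Z" and d: "d \<in> carrier Z" "d \<noteq> (\<lambda>n. 0)"
    and e: "x \<otimes>\<^bsub>Z\<^esub> d = y \<otimes>\<^bsub>Z\<^esub> d"
  shows "x = y"
proof (rule Zp_eqI[OF x y])
  fix n
  obtain t where t: "d t \<noteq> 0" using d(2) by auto
  let ?N = "n + t"
  have "x ?N * d ?N mod int p ^ ?N = y ?N * d ?N mod int p ^ ?N" using fun_cong[OF e, of ?N] by simp
  then have "int p ^ ?N dvd (x ?N - y ?N) * d ?N" by (simp add: mod_eq_dvd_iff left_diff_distrib)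
  moreover have "\<not> int p ^ t dvd d ?N" using Zp_coherent[OF d(1), of t ?N] t by (simp add: dvd_eq_mod_eq_0)
  ultimately have "int p ^ n dvd x ?N - y ?N" using prime_power_dvd_mult by blast
  then have "x ?N mod int p ^ n = y ?N mod int p ^ n" by (simp add: mod_eq_dvd_iff)
  then show "int p ^ n dvd x n - y n" using Zp_coherent[OF x, of n ?N] Zp_coherent[OF y, of n ?N] by simp
qed

lemma Zp_mult_nonzero:
  assumes "x \<in> carrier Z" "y \<in> carrier Z" "x \<noteq> (\<lambda>n. 0)" "y \<noteq> (\<lambda>n. 0)"
  shows "x \<otimes>\<^bsub>Z\<^esub> y \<noteq> (\<lambda>n. 0)"
proof
  assume "x \<otimes>\<^bsub>Z\<^esub> y = (\<lambda>n. 0)"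
  then have "x \<otimes>\<^bsub>Z\<^esub> y = (\<lambda>n. 0) \<otimes>\<^bsub>Z\<^esub> y" by simp
  then show False using Zp_cancel[OF assms(1) Zp_zero_closed assms(2,4)] assms(3) by blast
qed

lemma zi_power_nonzero: "zi (int p ^ N) \<noteq> (\<lambda>n. 0)"
proof
  assume "zi (int p ^ N) = (\<lambda>n. 0)"
  from fun_cong[OF this, of "Suc N"] have "int p ^ N mod int p ^ Suc N = 0" by (simp add: zi_def)
  moreover have "int p ^ N < int p ^ Suc N" using p_int_pos by simp
  ultimately show False using p_int_pos by simp
qed

text \<open>\<open>b\<close> is \<open>p^n\<close> times a unit; the unit is inverted modulo each
  \<open>p^m\<close> by Bezout, and uniqueness of inverses makes the results coherent.\<close>

lemma Zp_divides_power:
  assumes b: "b \<in> carrier Z" "b \<noteq> (\<lambda>n. 0)"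
  obtains M b' where "b' \<in> carrier Z" "b \<otimes>\<^bsub>Z\<^esub> b' = zi (int p ^ M)"
proof -
  have ex: "\<exists>n. b n \<noteq> 0" using b(2) by auto
  define n1 where "n1 = (LEAST n. b n \<noteq> 0)"
  have n1: "b n1 \<noteq> 0" unfolding n1_def by (rule LeastI_ex[OF ex])
  have "n1 \<noteq> 0" using n1 Zp_range[OF b(1), of 0] by (intro notI) simp
  then obtain n where n: "n1 = Suc n" by (cases n1) auto
  have bn: "b n = 0" using not_less_Least[of n "\<lambda>n. b n \<noteq> 0"] n n1_def by simp
  define u where "u m = b (n + m) div int p ^ n" for m
  have bu: "b (n + m) = int p ^ n * u m" for m
  proof -
    have "b (n + m) mod int p ^ n = 0" using Zp_coherent[OF b(1), of n "n + m"] bn by simp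
    then show ?thesis using mult_div_mod_eq[of "int p ^ n" "b (n + m)"] by (simp add: u_def)
  qed
  have "\<exists>v. int p ^ m dvd u m * v - 1" for m
  proof (cases m)
    case (Suc k)
    have "\<not> int p dvd u m"
    proof
      assume "int p dvd u m"
      then have "int p ^ n * int p dvd b (n + m)" unfolding bu by simp
      then have "int p ^ Suc n dvd b (n + m)" by (simp add: mult.commute)
      then have "b (n + m) mod int p ^ Suc n = 0" by (rule dvd_imp_mod_0)
      then show False using Zp_coherent[OF b(1), of "Suc n" "n + m"] n1 n Suc by simp
    qed
    then have "coprime (u m) (int p ^ m)" using prime_p prime_imp_coprime[of "int p" "u m"] by (simp add: coprime_commute)
    moreover obtain s t where "s * u m + t * int p ^ m = gcd (u m) (int p ^ m)" using bezout_int by blast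
    ultimately have "u m * s - 1 = int p ^ m * (- t)" by (simp add: algebra_simps)
    then show ?thesis by (intro exI[of _ s]) (simp only: dvd_triv_left)
  qed simp
  then obtain v where v: "\<And>m. int p ^ m dvd u m * v m - 1" by metis
  have uS: "int p ^ m dvd u (Suc m) - u m" for m
  proof -
    have "b (n + Suc m) mod int p ^ (n + m) = b (n + m) mod int p ^ (n + m)"
      using Zp_Suc_mod[OF b(1), of "n + m"] by simp
    then have "int p ^ (n + m) dvd int p ^ n * (u (Suc m) - u m)" unfolding mod_eq_dvd_iff bu by (simp add: right_diff_distrib)
    then show ?thesis unfolding power_add using p_int_pos(4) by (simp only: dvd_mult_cancel_left) simp
  qed
  define b' where "b' m = v m mod int p ^ m" for m
  have "b' \<in> carrier Z"
    unfolding b'_def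
  proof (rule ZpI_mod)
    fix m
    have 1: "int p ^ m dvd u (Suc m) * v (Suc m) - 1"
      using v[of "Suc m"] dvd_trans[of "int p ^ m" "int p ^ Suc m"] by (simp add: le_imp_power_dvd)
    have "int p ^ m dvd v m * (u (Suc m) * v (Suc m) - 1) - v (Suc m) * (u m * v m - 1) - v m * v (Suc m) * (u (Suc m) - u m)"
      by (rule dvd_diff[OF dvd_diff[OF dvd_mult[OF 1] dvd_mult[OF v]] dvd_mult[OF uS]])
    then have "int p ^ m dvd v (Suc m) - v m" by (simp add: algebra_simps)
    then show "v (Suc m) mod int p ^ m = v m mod int p ^ m" by (simp add: mod_eq_dvd_iff)
  qed
  moreover have "b \<otimes>\<^bsub>Z\<^esub> b' = zi (int p ^ n)"
  proof
    fix m
    have "b m * b' m mod int p ^ m = b (n + m) * v m mod int p ^ m"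
      using Zp_coherent[OF b(1), of m "n + m"] by (simp add: b'_def mod_mult_right_eq) (metis le_add2 mod_mult_left_eq)
    also have "\<dots> = int p ^ n mod int p ^ m"
    proof -
      have "b (n + m) * v m - int p ^ n = int p ^ n * (u m * v m - 1)" unfolding bu by (simp add: algebra_simps)
      then show ?thesis using v[of m] by (simp add: mod_eq_dvd_iff)
    qed
    finally show "(b \<otimes>\<^bsub>Z\<^esub> b') m = zi (int p ^ n) m" by (simp add: zi_def)
  qed
  ultimately show ?thesis using that by blast
qed

lemma Zp_split:
  assumes c: "c \<in> carrier Z"
  obtains y where "y \<in> carrier Z" "c = y \<otimes>\<^bsub>Z\<^esub> zi (int p ^ M) \<oplus>\<^bsub>Z\<^esub> zi (c M)"
proof
  define y where "y n = c (M + n) div int p ^ M" for n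
  have e: "c (M + n) = c M + int p ^ M * y n" for n
    using Zp_coherent[OF c, of M "M + n"] mult_div_mod_eq[of "int p ^ M" "c (M + n)"] by (simp add: y_def)
  show "y \<in> carrier Z"
  proof (rule ZpI)
    fix n
    show "0 \<le> y n" using Zp_range[OF c] p_int_pos by (simp add: y_def pos_imp_zdiv_nonneg_iff)
    have "int p ^ M * y n < int p ^ M * int p ^ n"
      using Zp_range[OF c, of "M + n"] Zp_range[OF c, of M] e[of n] by (simp add: power_add)
    then show yn: "y n < int p ^ n" using p_int_pos(3)[of M] by simp
    have "c (M + Suc n) mod int p ^ (M + n) = c (M + n) mod int p ^ (M + n)" using Zp_Suc_mod[OF c, of "M + n"] by simp
    then have "int p ^ M * int p ^ n dvd int p ^ M * (y (Suc n) - y n)"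
      unfolding mod_eq_dvd_iff e power_add by (simp add: right_diff_distrib)
    then have "int p ^ n dvd y (Suc n) - y n" using p_int_pos(4) by (simp only: dvd_mult_cancel_left) simp
    then have "y (Suc n) mod int p ^ n = y n mod int p ^ n" by (simp add: mod_eq_dvd_iff)
    also have "\<dots> = y n" using yn \<open>0 \<le> y n\<close> by simp
    finally show "y (Suc n) mod int p ^ n = y n" .
  qed
  show "c = y \<otimes>\<^bsub>Z\<^esub> zi (int p ^ M) \<oplus>\<^bsub>Z\<^esub> zi (c M)"
  proof
    fix n
    have "c n = c (M + n) mod int p ^ n" using Zp_coherent[OF c, of n "M + n"] by simp
    then show "c n = (y \<otimes>\<^bsub>Z\<^esub> zi (int p ^ M) \<oplus>\<^bsub>Z\<^esub> zi (c M)) n" by (simp add: e zi_def mod_simps algebra_simps)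
  qed
qed

section \<open>The group of \<open>p\<close>-adic numbers as fractions, and its quotient by the
  integers\<close>

definition fracs :: "(padic \<times> padic) set" where
  "fracs = carrier Z \<times> (carrier Z - {\<lambda>n. 0})"

definition cl :: "padic \<Rightarrow> padic \<Rightarrow> (padic \<times> padic) set" where
  "cl a b = frac_rel p `` {(a, b)}"

lemma frac_rel_iff: "((a, b), (c, d)) \<in> frac_rel p \<longleftrightarrow>
    (a, b) \<in> fracs \<and> (c, d) \<in> fracs \<and> a \<otimes>\<^bsub>Z\<^esub> d = c \<otimes>\<^bsub>Z\<^esub> b"
  by (auto simp: frac_rel_def fracs_def)

lemma equiv_frac: "equiv fracs (frac_rel p)"
proof (rule equivI)
  show "frac_rel p \<subseteq> fracs \<times> fracs" by (auto simp: frac_rel_def fracs_def)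
  show "refl_on fracs (frac_rel p)" by (auto simp: refl_on_def frac_rel_def fracs_def)
  show "sym (frac_rel p)" by (auto simp: sym_def frac_rel_iff)
  show "trans (frac_rel p)"
  proof (rule transI)
    fix X Y W assume "(X, Y) \<in> frac_rel p" "(Y, W) \<in> frac_rel p"
    moreover obtain a b c d e f where eqs: "X = (a, b)" "Y = (c, d)" "W = (e, f)" by (metis surj_pair)
    ultimately have in_fr: "(a, b) \<in> fracs" "(c, d) \<in> fracs" "(e, f) \<in> fracs"
      and 1: "a \<otimes>\<^bsub>Z\<^esub> d = c \<otimes>\<^bsub>Z\<^esub> b" and 2: "c \<otimes>\<^bsub>Z\<^esub> f = e \<otimes>\<^bsub>Z\<^esub> d" by (auto simp only: frac_rel_iff)
    have "(a \<otimes>\<^bsub>Z\<^esub> f) \<otimes>\<^bsub>Z\<^esub> d = (a \<otimes>\<^bsub>Z\<^esub> d) \<otimes>\<^bsub>Z\<^esub> f" by (simp add: mod_simps ac_simps)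
    also have "\<dots> = (c \<otimes>\<^bsub>Z\<^esub> f) \<otimes>\<^bsub>Z\<^esub> b" unfolding 1 by (simp add: mod_simps ac_simps)
    also have "\<dots> = (e \<otimes>\<^bsub>Z\<^esub> b) \<otimes>\<^bsub>Z\<^esub> d" unfolding 2 by (simp add: mod_simps ac_simps)
    finally have "a \<otimes>\<^bsub>Z\<^esub> f = e \<otimes>\<^bsub>Z\<^esub> b"
      using in_fr by (intro Zp_cancel[of "a \<otimes>\<^bsub>Z\<^esub> f" "e \<otimes>\<^bsub>Z\<^esub> b" d] Zp_mult_closed) (auto simp only: fracs_def)
    then show "(X, W) \<in> frac_rel p" using in_fr eqs by (simp only: frac_rel_iff)
  qed
qed

lemma cl_eq_iff: "(a, b) \<in> fracs \<Longrightarrow> (c, d) \<in> fracs \<Longrightarrow> cl a b = cl c d \<longleftrightarrow> a \<otimes>\<^bsub>Z\<^esub> d = c \<otimes>\<^bsub>Z\<^esub> b"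
  unfolding cl_def using eq_equiv_class_iff[OF equiv_frac, of "(a, b)" "(c, d)"] frac_rel_iff[of a b c d] by blast

lemma Qp_carrier: "carrier (Qp_add p) = fracs // frac_rel p"
  by (simp add: Qp_add_def fracs_def)

lemma cl_closed: "(a, b) \<in> fracs \<Longrightarrow> cl a b \<in> carrier (Qp_add p)"
  unfolding Qp_carrier cl_def by (rule quotientI)

lemma Qp_cases:
  assumes "X \<in> carrier (Qp_add p)"
  obtains a b where "(a, b) \<in> fracs" "X = cl a b"
  using assms unfolding Qp_carrier cl_def by (metis quotientE surj_pair)

lemma fracs_D: "(a, b) \<in> fracs \<Longrightarrow> a \<in> carrier Z" "(a, b) \<in> fracs \<Longrightarrow> b \<in> carrier Z" "(a, b) \<in> fracs \<Longrightarrow> b \<noteq> (\<lambda>n. 0)"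
  by (auto simp: fracs_def)

lemma fracs_add: "(a, b) \<in> fracs \<Longrightarrow> (c, d) \<in> fracs \<Longrightarrow> (a \<otimes>\<^bsub>Z\<^esub> d \<oplus>\<^bsub>Z\<^esub> c \<otimes>\<^bsub>Z\<^esub> b, b \<otimes>\<^bsub>Z\<^esub> d) \<in> fracs"
  using Zp_mult_nonzero[of b d] by (auto simp only: fracs_def intro!: Zp_add_closed Zp_mult_closed)

lemma cl_add:
  assumes 1: "(a, b) \<in> fracs" and 2: "(c, d) \<in> fracs"
  shows "cl a b \<otimes>\<^bsub>Qp_add p\<^esub> cl c d = cl (a \<otimes>\<^bsub>Z\<^esub> d \<oplus>\<^bsub>Z\<^esub> c \<otimes>\<^bsub>Z\<^esub> b) (b \<otimes>\<^bsub>Z\<^esub> d)"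
proof -
  let ?f = "\<lambda>(a, b) (c, d). frac_rel p `` {(a \<otimes>\<^bsub>Z\<^esub> d \<oplus>\<^bsub>Z\<^esub> c \<otimes>\<^bsub>Z\<^esub> b, b \<otimes>\<^bsub>Z\<^esub> d)}"
  have "congruent2 (frac_rel p) (frac_rel p) ?f"
  proof (rule congruent2I')
    fix X X' Y Y' assume "(X, X') \<in> frac_rel p" "(Y, Y') \<in> frac_rel p"
    moreover obtain a b a' b' c d c' d' where eqs: "X = (a, b)" "X' = (a', b')" "Y = (c, d)" "Y' = (c', d')" by (metis surj_pair)
    ultimately have fr: "(a, b) \<in> fracs" "(a', b') \<in> fracs" "(c, d) \<in> fracs" "(c', d') \<in> fracs"
      and e1: "a \<otimes>\<^bsub>Z\<^esub> b' = a' \<otimes>\<^bsub>Z\<^esub> b" and e2: "c \<otimes>\<^bsub>Z\<^esub> d' = c' \<otimes>\<^bsub>Z\<^esub> d" by (auto simp only: frac_rel_iff)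
    have "(a \<otimes>\<^bsub>Z\<^esub> d \<oplus>\<^bsub>Z\<^esub> c \<otimes>\<^bsub>Z\<^esub> b) \<otimes>\<^bsub>Z\<^esub> (b' \<otimes>\<^bsub>Z\<^esub> d')
        = (a \<otimes>\<^bsub>Z\<^esub> b') \<otimes>\<^bsub>Z\<^esub> (d \<otimes>\<^bsub>Z\<^esub> d') \<oplus>\<^bsub>Z\<^esub> (c \<otimes>\<^bsub>Z\<^esub> d') \<otimes>\<^bsub>Z\<^esub> (b \<otimes>\<^bsub>Z\<^esub> b')"
      by (rule ext) (simp only: Zp_simps mod_simps, simp add: algebra_simps)
    also have "\<dots> = (a' \<otimes>\<^bsub>Z\<^esub> d' \<oplus>\<^bsub>Z\<^esub> c' \<otimes>\<^bsub>Z\<^esub> b') \<otimes>\<^bsub>Z\<^esub> (b \<otimes>\<^bsub>Z\<^esub> d)"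
      unfolding e1 e2 by (rule ext) (simp only: Zp_simps mod_simps, simp add: algebra_simps)
    finally have "cl (a \<otimes>\<^bsub>Z\<^esub> d \<oplus>\<^bsub>Z\<^esub> c \<otimes>\<^bsub>Z\<^esub> b) (b \<otimes>\<^bsub>Z\<^esub> d) = cl (a' \<otimes>\<^bsub>Z\<^esub> d' \<oplus>\<^bsub>Z\<^esub> c' \<otimes>\<^bsub>Z\<^esub> b') (b' \<otimes>\<^bsub>Z\<^esub> d')"
      using cl_eq_iff[OF fracs_add[OF fr(1,3)] fracs_add[OF fr(2,4)]] by blast
    then show "?f X Y = ?f X' Y'" unfolding eqs cl_def prod.case .
  qed
  from UN_equiv_class2[OF equiv_frac equiv_frac this 1 2] show ?thesis
    unfolding cl_def Qp_add_def by (simp add: case_prod_beta' del: Zp_simps)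
qed

lemma fracs_one: "a \<in> carrier Z \<Longrightarrow> (a, zi 1) \<in> fracs"
  using zi_closed[of 1] zi_power_nonzero[of 0] by (auto simp: fracs_def)

lemma Qp_one: "\<one>\<^bsub>Qp_add p\<^esub> = cl (zi 0) (zi 1)"
  unfolding cl_def zi_0[symmetric] zi_1[symmetric] by (simp add: Qp_add_def del: Zp_simps)

lemma Qp_comm_group: "comm_group (Qp_add p)"
proof (rule comm_groupI)
  fix X Y assume "X \<in> carrier (Qp_add p)" "Y \<in> carrier (Qp_add p)"
  then obtain a b c d where r: "(a, b) \<in> fracs" "X = cl a b" "(c, d) \<in> fracs" "Y = cl c d" using Qp_cases by metis
  show "X \<otimes>\<^bsub>Qp_add p\<^esub> Y \<in> carrier (Qp_add p)" unfolding r cl_add[OF r(1,3)] by (rule cl_closed[OF fracs_add[OF r(1,3)]])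
  have "a \<otimes>\<^bsub>Z\<^esub> d \<oplus>\<^bsub>Z\<^esub> c \<otimes>\<^bsub>Z\<^esub> b = c \<otimes>\<^bsub>Z\<^esub> b \<oplus>\<^bsub>Z\<^esub> a \<otimes>\<^bsub>Z\<^esub> d" "b \<otimes>\<^bsub>Z\<^esub> d = d \<otimes>\<^bsub>Z\<^esub> b" by (simp_all add: ac_simps)
  then show "X \<otimes>\<^bsub>Qp_add p\<^esub> Y = Y \<otimes>\<^bsub>Qp_add p\<^esub> X" unfolding r cl_add[OF r(1,3)] cl_add[OF r(3,1)] by (simp only:)
next
  fix X Y W assume "X \<in> carrier (Qp_add p)" "Y \<in> carrier (Qp_add p)" "W \<in> carrier (Qp_add p)"
  then obtain a b c d e f where r: "(a, b) \<in> fracs" "X = cl a b" "(c, d) \<in> fracs" "Y = cl c d" "(e, f) \<in> fracs" "W = cl e f"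
    using Qp_cases by metis
  have 1: "(a \<otimes>\<^bsub>Z\<^esub> d \<oplus>\<^bsub>Z\<^esub> c \<otimes>\<^bsub>Z\<^esub> b) \<otimes>\<^bsub>Z\<^esub> f \<oplus>\<^bsub>Z\<^esub> e \<otimes>\<^bsub>Z\<^esub> (b \<otimes>\<^bsub>Z\<^esub> d) = a \<otimes>\<^bsub>Z\<^esub> (d \<otimes>\<^bsub>Z\<^esub> f) \<oplus>\<^bsub>Z\<^esub> (c \<otimes>\<^bsub>Z\<^esub> f \<oplus>\<^bsub>Z\<^esub> e \<otimes>\<^bsub>Z\<^esub> d) \<otimes>\<^bsub>Z\<^esub> b"
    "b \<otimes>\<^bsub>Z\<^esub> d \<otimes>\<^bsub>Z\<^esub> f = b \<otimes>\<^bsub>Z\<^esub> (d \<otimes>\<^bsub>Z\<^esub> f)"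
    by (rule ext, simp only: Zp_simps mod_simps, simp add: algebra_simps)+
  show "X \<otimes>\<^bsub>Qp_add p\<^esub> Y \<otimes>\<^bsub>Qp_add p\<^esub> W = X \<otimes>\<^bsub>Qp_add p\<^esub> (Y \<otimes>\<^bsub>Qp_add p\<^esub> W)"
    unfolding r cl_add[OF r(1,3)] cl_add[OF r(3,5)] cl_add[OF fracs_add[OF r(1,3)] r(5)] cl_add[OF r(1) fracs_add[OF r(3,5)]] 1 by (rule refl)
next
  show "\<one>\<^bsub>Qp_add p\<^esub> \<in> carrier (Qp_add p)" unfolding Qp_one by (rule cl_closed[OF fracs_one[OF zi_closed]])
next
  fix X assume "X \<in> carrier (Qp_add p)"
  then obtain a b where r: "(a, b) \<in> fracs" "X = cl a b" using Qp_cases by metis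
  have e: "zi 0 \<otimes>\<^bsub>Z\<^esub> b \<oplus>\<^bsub>Z\<^esub> a \<otimes>\<^bsub>Z\<^esub> zi 1 = a" "zi 1 \<otimes>\<^bsub>Z\<^esub> b = b"
    using Zp_mod_self[OF fracs_D(1)[OF r(1)]] Zp_mod_self[OF fracs_D(2)[OF r(1)]] by (auto simp: zi_def mod_simps)
  show "\<one>\<^bsub>Qp_add p\<^esub> \<otimes>\<^bsub>Qp_add p\<^esub> X = X" unfolding Qp_one r cl_add[OF fracs_one[OF zi_closed] r(1)] e by (rule refl)
  have n: "(zneg a, b) \<in> fracs" using r(1) zneg_closed by (auto simp: fracs_def)
  have z: "zneg a \<otimes>\<^bsub>Z\<^esub> b \<oplus>\<^bsub>Z\<^esub> a \<otimes>\<^bsub>Z\<^esub> b = zi 0" by (auto simp: zi_def zneg_def mod_simps)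
  have "cl (zneg a) b \<otimes>\<^bsub>Qp_add p\<^esub> X = \<one>\<^bsub>Qp_add p\<^esub>"
    unfolding Qp_one r cl_add[OF n r(1)] z
    using cl_eq_iff[of "zi 0" "b \<otimes>\<^bsub>Z\<^esub> b" "zi 0" "zi 1"] fracs_add[OF n r(1)] fracs_one[OF zi_closed[of 0]] z
    by (simp add: zi_def)
  then show "\<exists>Y\<in>carrier (Qp_add p). Y \<otimes>\<^bsub>Qp_add p\<^esub> X = \<one>\<^bsub>Qp_add p\<^esub>" using cl_closed[OF n] by blast
qed

definition Hz :: "(padic \<times> padic) set set" where
  "Hz = (\<lambda>a. cl a (zi 1)) ` carrier Z"

lemma Qp_mod_Zp_eq: "Qp_mod_Zp p = Qp_add p Mod Hz"
  unfolding Qp_mod_Zp_def Hz_def cl_def zi_1[symmetric] by (rule refl)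

lemma cl_add_int:
  assumes "a \<in> carrier Z" "c \<in> carrier Z"
  shows "cl a (zi 1) \<otimes>\<^bsub>Qp_add p\<^esub> cl c (zi 1) = cl (a \<oplus>\<^bsub>Z\<^esub> c) (zi 1)"
proof -
  have "a \<otimes>\<^bsub>Z\<^esub> zi 1 \<oplus>\<^bsub>Z\<^esub> c \<otimes>\<^bsub>Z\<^esub> zi 1 = a \<oplus>\<^bsub>Z\<^esub> c" "zi 1 \<otimes>\<^bsub>Z\<^esub> zi 1 = zi 1" by (auto simp: zi_def mod_simps)
  then show ?thesis unfolding cl_add[OF fracs_one[OF assms(1)] fracs_one[OF assms(2)]] by (simp only:)
qed

lemma Hz_normal: "Hz \<lhd> Qp_add p"
proof -
  interpret comm_group "Qp_add p" by (rule Qp_comm_group)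
  have "subgroup Hz (Qp_add p)"
  proof (rule subgroupI)
    show "Hz \<subseteq> carrier (Qp_add p)" unfolding Hz_def using cl_closed[OF fracs_one] by blast
    show "Hz \<noteq> {}" unfolding Hz_def using zi_closed by blast
    fix X assume "X \<in> Hz"
    then obtain a where a: "a \<in> carrier Z" "X = cl a (zi 1)" by (auto simp: Hz_def)
    have "zneg a \<oplus>\<^bsub>Z\<^esub> a = zi 0" by (auto simp: zi_def zneg_def mod_simps)
    then have "cl (zneg a) (zi 1) \<otimes>\<^bsub>Qp_add p\<^esub> X = \<one>\<^bsub>Qp_add p\<^esub>"
      unfolding a(2) cl_add_int[OF zneg_closed[OF a(1)] a(1)] Qp_one by (simp only:)
    then have "inv\<^bsub>Qp_add p\<^esub> X = cl (zneg a) (zi 1)"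
      using inv_equality cl_closed[OF fracs_one[OF zneg_closed[OF a(1)]]] cl_closed[OF fracs_one[OF a(1)]] a(2) by blast
    then show "inv\<^bsub>Qp_add p\<^esub> X \<in> Hz" using zneg_closed[OF a(1)] by (simp add: Hz_def)
  next
    fix X Y assume "X \<in> Hz" "Y \<in> Hz"
    then obtain a c where a: "a \<in> carrier Z" "X = cl a (zi 1)" "c \<in> carrier Z" "Y = cl c (zi 1)" by (auto simp: Hz_def)
    show "X \<otimes>\<^bsub>Qp_add p\<^esub> Y \<in> Hz"
      unfolding a cl_add_int[OF a(1,3)] Hz_def by (rule imageI[OF Zp_add_closed[OF a(1,3)]])
  qed
  then show ?thesis by (rule subgroup_imp_normal)
qed

text \<open>\<open>emb N k\<close> is the class of \<open>k/p\<^sup>N\<close> in \<open>Q\<^sub>p/Z\<^sub>p\<close>.\<close>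

definition emb :: "nat \<Rightarrow> int \<Rightarrow> (padic \<times> padic) set set" where
  "emb N k = Hz #>\<^bsub>Qp_add p\<^esub> cl (zi k) (zi (int p ^ N))"

lemma fracs_pow: "a \<in> carrier Z \<Longrightarrow> (a, zi (int p ^ N)) \<in> fracs"
  using zi_closed zi_power_nonzero[of N] by (auto simp: fracs_def)

lemma cl_add_pow: "cl (zi a) (zi (int p ^ N)) \<otimes>\<^bsub>Qp_add p\<^esub> cl (zi b) (zi (int p ^ N)) = cl (zi (a + b)) (zi (int p ^ N))"
  unfolding cl_add[OF fracs_pow[OF zi_closed] fracs_pow[OF zi_closed]] zi_mult zi_add
  using cl_eq_iff[of "zi (a * int p ^ N + b * int p ^ N)" "zi (int p ^ N * int p ^ N)" "zi (a + b)" "zi (int p ^ N)"]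
    fracs_pow[OF zi_closed] fracs_pow[OF zi_closed, of _ "N + N"] zi_mult
  by (simp add: power_add algebra_simps del: Zp_simps)

lemma emb_carrier: "emb N k \<in> carrier (Qp_mod_Zp p)"
  using cl_closed[OF fracs_pow[OF zi_closed]] by (auto simp: Qp_mod_Zp_eq FactGroup_def RCOSETS_def emb_def)

lemma emb_add: "emb N k \<otimes>\<^bsub>Qp_mod_Zp p\<^esub> emb N l = emb N (k + l)"
proof -
  have "emb N k \<otimes>\<^bsub>Qp_mod_Zp p\<^esub> emb N l = Hz #>\<^bsub>Qp_add p\<^esub> (cl (zi k) (zi (int p ^ N)) \<otimes>\<^bsub>Qp_add p\<^esub> cl (zi l) (zi (int p ^ N)))"
    unfolding emb_def Qp_mod_Zp_eq FactGroup_def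
    using normal.rcos_sum[OF Hz_normal cl_closed[OF fracs_pow[OF zi_closed]] cl_closed[OF fracs_pow[OF zi_closed]]] by simp
  then show ?thesis unfolding cl_add_pow emb_def .
qed

lemma cl_pow_in_Hz: "cl (zi k) (zi (int p ^ N)) \<in> Hz \<longleftrightarrow> int p ^ N dvd k"
proof
  assume "cl (zi k) (zi (int p ^ N)) \<in> Hz"
  then obtain y where y: "y \<in> carrier Z" "cl (zi k) (zi (int p ^ N)) = cl y (zi 1)" by (auto simp: Hz_def)
  then have "zi k \<otimes>\<^bsub>Z\<^esub> zi 1 = y \<otimes>\<^bsub>Z\<^esub> zi (int p ^ N)"
    using cl_eq_iff[OF fracs_pow[OF zi_closed] fracs_one[OF y(1)]] by blast
  from fun_cong[OF this, of N] show "int p ^ N dvd k" by (simp add: zi_def mod_simps dvd_eq_mod_eq_0)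
next
  assume "int p ^ N dvd k"
  then obtain c where c: "k = int p ^ N * c" by (elim dvdE)
  have "zi k \<otimes>\<^bsub>Z\<^esub> zi 1 = zi c \<otimes>\<^bsub>Z\<^esub> zi (int p ^ N)" unfolding zi_mult c by (simp add: mult.commute)
  then have "cl (zi k) (zi (int p ^ N)) = cl (zi c) (zi 1)"
    using cl_eq_iff[OF fracs_pow[OF zi_closed] fracs_one[OF zi_closed]] by blast
  then show "cl (zi k) (zi (int p ^ N)) \<in> Hz" unfolding Hz_def using zi_closed by blast
qed

lemma emb_eq_iff: "emb N k = emb N l \<longleftrightarrow> int p ^ N dvd k - l"
proof -
  interpret comm_group "Qp_add p" by (rule Qp_comm_group)
  interpret N: normal Hz "Qp_add p" by (rule Hz_normal)
  let ?c = "\<lambda>k. cl (zi k) (zi (int p ^ N))"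
  have cc: "?c k \<in> carrier (Qp_add p)" for k by (rule cl_closed[OF fracs_pow[OF zi_closed]])
  have kl: "?c k = ?c (k - l) \<otimes>\<^bsub>Qp_add p\<^esub> ?c l" unfolding cl_add_pow by simp
  show ?thesis
  proof
    assume "emb N k = emb N l"
    then have "?c k \<in> Hz #>\<^bsub>Qp_add p\<^esub> ?c l" unfolding emb_def using rcos_self[OF cc N.subgroup_axioms] by metis
    then obtain x where x: "x \<in> Hz" "?c k = x \<otimes>\<^bsub>Qp_add p\<^esub> ?c l" by (auto simp: r_coset_def)
    have "x \<in> carrier (Qp_add p)" using x(1) N.subset by blast
    then have "?c (k - l) = x" using kl x(2) cc right_cancel by metis
    then show "int p ^ N dvd k - l" using x(1) cl_pow_in_Hz by blast
  next
    assume "int p ^ N dvd k - l"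
    then have "?c (k - l) \<in> Hz" using cl_pow_in_Hz by blast
    then have "?c k \<in> Hz #>\<^bsub>Qp_add p\<^esub> ?c l" unfolding kl r_coset_def by blast
    then show "emb N k = emb N l" unfolding emb_def using repr_independence[OF _ cc N.subgroup_axioms] by metis
  qed
qed

lemma emb_scale: "emb (M + d) (int p ^ d * k) = emb M k"
proof -
  have "cl (zi (int p ^ d * k)) (zi (int p ^ (M + d))) = cl (zi k) (zi (int p ^ M))"
    unfolding cl_eq_iff[OF fracs_pow[OF zi_closed] fracs_pow[OF zi_closed]] zi_mult by (simp add: power_add ac_simps del: Zp_simps)
  then show ?thesis by (simp add: emb_def)
qed

text \<open>The denominator is extended to a power \<open>p^M\<close>; then the numerator is
  replaced by its residue modulo \<open>p^M\<close>, which changes the fraction by a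
  \<open>p\<close>-adic integer.\<close>

lemma emb_surj: "X \<in> carrier (Qp_mod_Zp p) \<Longrightarrow> \<exists>M k. X = emb M k"
proof -
  assume "X \<in> carrier (Qp_mod_Zp p)"
  then obtain Y where Y: "Y \<in> carrier (Qp_add p)" "X = Hz #>\<^bsub>Qp_add p\<^esub> Y" by (auto simp: Qp_mod_Zp_eq FactGroup_def RCOSETS_def)
  obtain a b where ab: "(a, b) \<in> fracs" "Y = cl a b" using Qp_cases[OF Y(1)] by blast
  obtain M b' where b': "b' \<in> carrier Z" "b \<otimes>\<^bsub>Z\<^esub> b' = zi (int p ^ M)" using Zp_divides_power[OF fracs_D(2,3)[OF ab(1)]] by blast
  define c where "c = a \<otimes>\<^bsub>Z\<^esub> b'"
  have c: "c \<in> carrier Z" unfolding c_def by (rule Zp_mult_closed[OF fracs_D(1)[OF ab(1)] b'(1)])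
  have "a \<otimes>\<^bsub>Z\<^esub> zi (int p ^ M) = c \<otimes>\<^bsub>Z\<^esub> b" unfolding c_def b'(2)[symmetric] by (simp add: mod_simps ac_simps)
  then have Yc: "Y = cl c (zi (int p ^ M))" using cl_eq_iff[OF ab(1) fracs_pow[OF c]] ab(2) by blast
  obtain y where y: "y \<in> carrier Z" "c = y \<otimes>\<^bsub>Z\<^esub> zi (int p ^ M) \<oplus>\<^bsub>Z\<^esub> zi (c M)" using Zp_split[OF c] by blast
  let ?k = "cl (zi (c M)) (zi (int p ^ M))"
  have "y \<otimes>\<^bsub>Z\<^esub> zi (int p ^ M) \<oplus>\<^bsub>Z\<^esub> zi (c M) \<otimes>\<^bsub>Z\<^esub> zi 1 = c"
    unfolding zi_mult mult_1_right by (rule y(2)[symmetric])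
  moreover have "zi 1 \<otimes>\<^bsub>Z\<^esub> zi (int p ^ M) = zi (int p ^ M)" unfolding zi_mult by simp
  ultimately have "cl y (zi 1) \<otimes>\<^bsub>Qp_add p\<^esub> ?k = Y"
    unfolding cl_add[OF fracs_one[OF y(1)] fracs_pow[OF zi_closed]] Yc by (simp only:)
  then have "Y \<in> Hz #>\<^bsub>Qp_add p\<^esub> ?k" unfolding r_coset_def Hz_def using y(1) by blast
  moreover interpret comm_group "Qp_add p" by (rule Qp_comm_group)
  interpret N: normal Hz "Qp_add p" by (rule Hz_normal)
  have "?k \<in> carrier (Qp_add p)" by (rule cl_closed[OF fracs_pow[OF zi_closed]])
  ultimately have "Hz #>\<^bsub>Qp_add p\<^esub> ?k = Hz #>\<^bsub>Qp_add p\<^esub> Y" using repr_independence N.subgroup_axioms by blast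
  then show ?thesis unfolding Y(2) emb_def by metis
qed

end

section \<open>Characters as integer functions modulo a power of \<open>p\<close>\<close>

context residual_field
begin

sublocale UF: unit_filt \<rho> Uf p
  by (rule unit_filt_Uf)

lemma U1: "U absv 1 = Uf 0" "U absv (Suc 0) = Uf 0"
  by (simp_all add: Uf_def)

text \<open>The target is discrete, so continuity at 1 means that \<theta> is constant on some
  \<open>Uf n\<close>; translation carries this to every point.\<close>

lemma character_continuous_iff:
  assumes hom: "\<theta> \<in> hom (U1_group absv) (Qp_mod_Zp p)"
  shows "continuous_map (subtopology (field_topology absv) (U absv 1)) (discrete_topology (carrier (Qp_mod_Zp p))) \<theta>
    \<longleftrightarrow> (\<exists>n. \<forall>x\<in>Uf n. \<theta> x = \<theta> 1)"
proof -
  have c: "\<theta> x \<in> carrier (Qp_mod_Zp p)" if "x \<in> Uf 0" for x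
    using hom that by (auto simp: hom_def U1_group_def U1)
  have m: "\<theta> (x * y) = \<theta> x \<otimes>\<^bsub>Qp_mod_Zp p\<^esub> \<theta> y" if "x \<in> Uf 0" "y \<in> Uf 0" for x y
    using hom that by (auto simp: hom_def U1_group_def U1)
  have top: "topspace (field_topology absv) = UNIV" by (simp add: topology_M)
  show ?thesis
  proof
    assume cont: "continuous_map (subtopology (field_topology absv) (U absv 1)) (discrete_topology (carrier (Qp_mod_Zp p))) \<theta>"
    have "\<forall>S. openin (discrete_topology (carrier (Qp_mod_Zp p))) S \<longrightarrow>
        openin (subtopology (field_topology absv) (U absv 1)) {x \<in> topspace (subtopology (field_topology absv) (U absv 1)). \<theta> x \<in> S}"
      using cont unfolding continuous_map_def by blast
    from this[rule_format, of "{\<theta> 1}"]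
    have "openin (subtopology (field_topology absv) (Uf 0)) {x \<in> Uf 0. \<theta> x \<in> {\<theta> 1}}"
      using c[OF UF.U_one] unfolding U1 topspace_subtopology top by simp
    then obtain S where S: "openin (field_topology absv) S" "{x \<in> Uf 0. \<theta> x \<in> {\<theta> 1}} = S \<inter> Uf 0"
      unfolding openin_subtopology by blast
    have "1 \<in> S" using S(2) UF.U_one[of 0] by blast
    then obtain r where r: "0 < r" "\<And>y. absv (1 - y) < r \<Longrightarrow> y \<in> S" using S(1) unfolding openin_iff by blast
    obtain n where n: "q ^ n < r" using q_power_small[OF r(1)] by blast
    have "\<theta> x = \<theta> 1" if "x \<in> Uf n" for x
    proof -
      have "absv (x - 1) \<le> q ^ n" using that q_power_mono[of n "max 1 n"] unfolding Uf_iff by (meson max.cobounded2 order_trans)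
      then have "x \<in> S" using r(2)[of x] n absv_diff_commute[of x 1] by simp
      then have "x \<in> S \<inter> Uf 0" using UF.U_in_0[OF that] by blast
      then show ?thesis unfolding S(2)[symmetric] by simp
    qed
    then show "\<exists>n. \<forall>x\<in>Uf n. \<theta> x = \<theta> 1" by blast
  next
    assume "\<exists>n. \<forall>x\<in>Uf n. \<theta> x = \<theta> 1"
    then obtain n where n: "\<And>x. x \<in> Uf n \<Longrightarrow> \<theta> x = \<theta> 1" by blast
    have op: "openin (field_topology absv) {x \<in> Uf 0. \<theta> x \<in> S}" for S
      unfolding openin_iff
    proof
      fix x assume x: "x \<in> {x \<in> Uf 0. \<theta> x \<in> S}"
      have "y \<in> {x \<in> Uf 0. \<theta> x \<in> S}" if xy: "absv (x - y) < q ^ max 1 n" for y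
      proof -
        have ax: "absv x = 1" using x Uf_absv by blast
        have "q ^ max 1 n < q ^ 0" by (simp only: q_power_less_iff)
        then have "absv (y - x) < absv x" using xy ax absv_diff_commute[of x y] by simp
        then have ay: "absv y = 1" using absv_add_eq[of "y - x" x] ax by simp
        have yx: "y / x \<in> Uf n" using Uf_divide_iff[OF ay ax] xy absv_diff_commute[of x y] by simp
        then have y0: "y \<in> Uf 0" using UF.U_divide_cancel[of y x 0] UF.U_in_0[OF yx] x by blast
        have "\<theta> y = \<theta> (y / x * x)" using ax by auto
        also have "\<dots> = \<theta> (y / x) \<otimes>\<^bsub>Qp_mod_Zp p\<^esub> \<theta> x" by (rule m[OF UF.U_in_0[OF yx]]) (use x in blast)
        also have "\<dots> = \<theta> 1 \<otimes>\<^bsub>Qp_mod_Zp p\<^esub> \<theta> x" using n[OF yx] by simp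
        also have "\<dots> = \<theta> x" using m[OF UF.U_one, of x] x by simp
        finally show ?thesis using y0 x by simp
      qed
      then show "\<exists>r>0. \<forall>y. absv (x - y) < r \<longrightarrow> y \<in> {x \<in> Uf 0. \<theta> x \<in> S}" using q_pos by (intro exI[of _ "q ^ max 1 n"]) auto
    qed
    then show "continuous_map (subtopology (field_topology absv) (U absv 1)) (discrete_topology (carrier (Qp_mod_Zp p))) \<theta>"
      unfolding continuous_map_def
    proof (intro conjI allI impI)
      fix S
      have "{x \<in> topspace (subtopology (field_topology absv) (U absv 1)). \<theta> x \<in> S} = {x \<in> Uf 0. \<theta> x \<in> S} \<inter> U absv 1"
        unfolding U1 topspace_subtopology top by auto
      then show "openin (subtopology (field_topology absv) (U absv 1)) {x \<in> topspace (subtopology (field_topology absv) (U absv 1)). \<theta> x \<in> S}"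
        unfolding openin_subtopology using op[of S] by blast
    qed (use c in \<open>simp add: top U1\<close>)
  qed
qed

text \<open>The image of \<open>Uf k\<close> is the full subgroup of elements killed by
  \<open>p^t\<close>, with \<open>t\<close> the rank, so equal ranks mean equal images.\<close>

lemma char_jumps_emb:
  assumes h: "UF.ichar N h" and \<theta>: "\<And>x. x \<in> Uf 0 \<Longrightarrow> \<theta> x = emb p N (h x)"
  shows "char_jumps absv \<theta> = UF.ijumps N h"
proof -
  have eq: "\<theta> x = \<theta> y \<longleftrightarrow> int p ^ N dvd h x - h y" if "x \<in> Uf 0" "y \<in> Uf 0" for x y
    using \<theta> that emb_eq_iff[OF prime_p] by simp
  have "\<theta> ` Uf k = \<theta> ` Uf (k + 1) \<longleftrightarrow> UF.rank N h k = UF.rank N h (k + 1)" for k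
  proof
    assume e: "\<theta> ` Uf k = \<theta> ` Uf (k + 1)"
    have "UF.rank N h k \<le> UF.rank N h (k + 1)"
      unfolding UF.rank_le_iff
    proof
      fix x assume x: "x \<in> Uf k"
      then obtain y where y: "y \<in> Uf (k + 1)" "\<theta> x = \<theta> y" using e by blast
      then have "int p ^ N dvd h x - h y" using eq UF.U_in_0 x by blast
      then show "int p ^ N dvd int p ^ UF.rank N h (k + 1) * h x"
        using UF.dvd_cong UF.rank_le_iff[of N h "k + 1" "UF.rank N h (k + 1)"] y(1) by blast
    qed
    then show "UF.rank N h k = UF.rank N h (k + 1)" using UF.rank_antimono[of k "k + 1" N h] by simp
  next
    assume r: "UF.rank N h k = UF.rank N h (k + 1)"
    define t where "t = UF.rank N h k"
    have tk: "int p ^ N dvd int p ^ t * h x" if "x \<in> Uf k" for x using UF.rank_le_iff[of N h k t] that t_def by blast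
    have tN: "t \<le> N" unfolding t_def UF.rank_le_iff by simp
    have "\<exists>y\<in>Uf (k + 1). \<theta> x = \<theta> y" if x: "x \<in> Uf k" for x
    proof (cases t)
      case 0
      then have "int p ^ N dvd h x" using tk[OF x] by simp
      then have "int p ^ N dvd h x - h 1" using UF.ichar_one[OF h] by simp
      then show ?thesis using eq[OF UF.U_in_0[OF x] UF.U_one] UF.U_one by blast
    next
      case (Suc s)
      then have "\<not> UF.rank N h (k + 1) \<le> s" using r t_def by simp
      \<comment> \<open>\<open>w\<close> has exact order \<open>p^t\<close> under the character, so
        \<open>h w\<close> is \<open>p^(N - t)\<close> times an integer \<open>a\<close> prime to
        \<open>p\<close>; an inverse of \<open>a\<close> modulo \<open>p^t\<close> yields the power
        of \<open>w\<close> that matches \<open>x\<close>.\<close>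
      then obtain w where w: "w \<in> Uf (k + 1)" "\<not> int p ^ N dvd int p ^ s * h w" unfolding UF.rank_le_iff by blast
      have wk: "w \<in> Uf k" using w(1) Uf_antimono[of k "k + 1"] by auto
      have pN: "int p ^ N = int p ^ t * int p ^ (N - t)" using tN by (simp flip: power_add)
      have pt: "int p ^ t \<noteq> 0" using p_ge_2 by simp
      have "int p ^ (N - t) dvd h w" "int p ^ (N - t) dvd h x"
        using tk[OF wk] tk[OF x] pt unfolding pN by (simp_all only: dvd_mult_cancel_left) simp_all
      then obtain a b where ab: "h w = int p ^ (N - t) * a" "h x = int p ^ (N - t) * b" by (auto elim!: dvdE)
      have "\<not> int p dvd a"
      proof
        assume "int p dvd a"
        then obtain a' where "a = int p * a'" by (elim dvdE)
        then have "int p ^ s * h w = int p ^ (s + Suc (N - t)) * a'" by (simp add: ab power_add)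
        moreover have "s + Suc (N - t) = N" using Suc tN by simp
        ultimately have "int p ^ s * h w = int p ^ N * a'" by (simp only:)
        then show False using w(2) by simp
      qed
      then have "coprime a (int p ^ t)" using prime_p prime_imp_coprime[of "int p" a] by (simp add: coprime_commute)
      moreover obtain c d where "c * a + d * int p ^ t = gcd a (int p ^ t)" using bezout_int by blast
      ultimately have cd: "c * a + d * int p ^ t = 1" by simp
      define j where "j = nat ((c * b) mod int p ^ t)"
      have jj: "int j = (c * b) mod int p ^ t" using p_ge_2 by (simp add: j_def)
      have "int p ^ t dvd b - int j * a"
      proof -
        have "int p ^ t dvd c * b - int j" unfolding jj by (simp add: minus_mod_eq_mult_div)
        then have "int p ^ t dvd a * (c * b - int j) + int p ^ t * (d * b)" by (rule dvd_add[OF dvd_mult dvd_triv_left])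
        also have "a * (c * b - int j) + int p ^ t * (d * b) = (c * a + d * int p ^ t) * b - int j * a" by (simp add: algebra_simps)
        finally show ?thesis by (simp add: cd)
      qed
      then have "int p ^ (N - t) * int p ^ t dvd int p ^ (N - t) * (b - int j * a)" by (rule mult_dvd_mono[OF dvd_refl])
      then have 1: "int p ^ N dvd h x - int j * h w" unfolding pN by (simp add: ab algebra_simps)
      have "int p ^ N dvd (h x - int j * h w) - (h (w ^ j) - int j * h w)"
        by (rule dvd_diff[OF 1 UF.ichar_power[OF h UF.U_in_0[OF w(1)]]])
      then have "int p ^ N dvd h x - h (w ^ j)" by simp
      moreover have "w ^ j \<in> Uf (k + 1)" by (rule UF.U_power[OF w(1)])
      ultimately show ?thesis using eq[OF UF.U_in_0[OF x] UF.U_in_0] by blast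
    qed
    then show "\<theta> ` Uf k = \<theta> ` Uf (k + 1)" using Uf_antimono[of k "k + 1"] unfolding image_def by auto
  qed
  note rank_iff = this
  have "1 \<le> i \<and> \<theta> ` U absv i \<noteq> \<theta> ` U absv (i + 1) \<longleftrightarrow> 1 \<le> i \<and> UF.rank N h i \<noteq> UF.rank N h (i + 1)" for i
  proof (cases "1 \<le> i")
    case True
    then show ?thesis using rank_iff[of i] unfolding Uf_pos[OF True] Uf_pos[OF trans_le_add1[OF True]] by simp
  qed simp
  then show ?thesis unfolding char_jumps_def UF.ijumps_def by (simp only:)
qed

text \<open>A character trivial on \<open>Uf n\<close> has common denominator \<open>p^n\<close>, so
  choosing numerators gives an integer function; conversely \<open>emb\<close> turns such a function
  into a character.\<close>

lemma jump_sets_eq: "jump_sets_of_field absv p = {UF.ijumps N h | N h. UF.ichar N h}"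
proof (intro equalityI subsetI)
  fix J assume "J \<in> jump_sets_of_field absv p"
  then obtain \<theta> where th: "\<theta> \<in> hom (U1_group absv) (Qp_mod_Zp p)"
    "continuous_map (subtopology (field_topology absv) (U absv 1)) (discrete_topology (carrier (Qp_mod_Zp p))) \<theta>"
    "J = char_jumps absv \<theta>" by (auto simp: jump_sets_of_field_def characters_def)
  obtain n where n: "\<And>x. x \<in> Uf n \<Longrightarrow> \<theta> x = \<theta> 1" using character_continuous_iff[OF th(1)] th(2) by blast
  have c: "\<theta> x \<in> carrier (Qp_mod_Zp p)" if "x \<in> Uf 0" for x
    using th(1) that by (auto simp: hom_def U1_group_def U1)
  have m: "\<theta> (x * y) = \<theta> x \<otimes>\<^bsub>Qp_mod_Zp p\<^esub> \<theta> y" if "x \<in> Uf 0" "y \<in> Uf 0" for x y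
    using th(1) that by (auto simp: hom_def U1_group_def U1)
  have one: "\<theta> 1 = emb p M 0" for M
  proof -
    obtain M' k where k: "\<theta> 1 = emb p M' k" using emb_surj[OF prime_p c[OF UF.U_one]] by blast
    have "emb p M' k = emb p M' (k + k)" using m[OF UF.U_one UF.U_one] emb_add[OF prime_p, of M' k k] k by simp
    then have "int p ^ M' dvd k" using emb_eq_iff[OF prime_p, of M' k "k + k"] by simp
    then obtain k' where "k = int p ^ M' * k'" by (elim dvdE)
    then have "\<theta> 1 = emb p 0 k'" using k emb_scale[OF prime_p, of 0 M' k'] by simp
    also have "\<dots> = emb p 0 0" using emb_eq_iff[OF prime_p] by simp
    also have "\<dots> = emb p M 0" using emb_scale[OF prime_p, of 0 M 0] by simp
    finally show ?thesis .
  qed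
  \<comment> \<open>Each \<open>p\<close>-th power raises the level by at least one, so
    \<open>x^(p^n)\<close> lies in \<open>Uf n\<close> and \<open>p^n\<close> kills the value at
    \<open>x\<close>.\<close>
  have ex: "\<exists>k. \<theta> x = emb p n k" if x: "x \<in> Uf 0" for x
  proof -
    obtain M k where k: "\<theta> x = emb p M k" using emb_surj[OF prime_p c[OF x]] by blast
    have pw: "\<theta> (x ^ j) = emb p M (int j * k)" for j
    proof (induction j)
      case (Suc j)
      then show ?case using m[OF x UF.U_power[OF x, of j]] emb_add[OF prime_p, of M k "int j * k"] k by (simp add: algebra_simps)
    qed (simp add: one)
    have "x ^ (p ^ n) \<in> Uf ((\<rho> ^^ n) 1)" using UF.U_pow_pow[of x 1 n] x UF.U_0 by simp
    moreover have "n \<le> (\<rho> ^^ n) 1" using UF.pow_ge_add[of 1 n] by simp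
    ultimately have "x ^ (p ^ n) \<in> Uf n" using Uf_antimono[of n "(\<rho> ^^ n) 1"] by blast
    then have "\<theta> (x ^ (p ^ n)) = \<theta> 1" by (rule n)
    then have "emb p M (int (p ^ n) * k) = emb p M 0" unfolding pw one[of M] .
    then have d: "int p ^ M dvd int p ^ n * k" using emb_eq_iff[OF prime_p] by simp
    show ?thesis
    proof (cases "M \<le> n")
      case True
      then have "\<theta> x = emb p n (int p ^ (n - M) * k)" using k emb_scale[OF prime_p, of M "n - M" k] by simp
      then show ?thesis by blast
    next
      case False
      have "int p ^ M = int p ^ n * int p ^ (M - n)" using False by (simp flip: power_add)
      then have "int p ^ (M - n) dvd k" using d p_ge_2 by simp
      then obtain k' where "k = int p ^ (M - n) * k'" by (elim dvdE)
      then have "\<theta> x = emb p n k'" using k emb_scale[OF prime_p, of n "M - n" k'] False by simp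
      then show ?thesis by blast
    qed
  qed
  define h where "h x = (SOME k. \<theta> x = emb p n k)" for x
  have h: "\<theta> x = emb p n (h x)" if "x \<in> Uf 0" for x unfolding h_def by (rule someI_ex[OF ex[OF that]])
  have "UF.ichar n h"
    unfolding UF.ichar_def
  proof (intro conjI ballI exI)
    fix x y assume x: "x \<in> Uf 0" and y: "y \<in> Uf 0"
    have "emb p n (h (x * y)) = emb p n (h x + h y)"
      using m[OF x y] h[OF x] h[OF y] h[OF UF.U_mult[OF x y]] emb_add[OF prime_p] by simp
    then show "int p ^ n dvd h (x * y) - h x - h y" using emb_eq_iff[OF prime_p] by (simp add: diff_diff_eq)
  next
    fix x assume x: "x \<in> Uf n"
    have "emb p n (h x) = emb p n 0" using n[OF x] h[OF UF.U_in_0[OF x]] one by simp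
    then show "int p ^ n dvd h x" using emb_eq_iff[OF prime_p] by simp
  qed
  then show "J \<in> {UF.ijumps N h | N h. UF.ichar N h}" using char_jumps_emb[of n h \<theta>] h th(3) by blast
next
  fix J assume "J \<in> {UF.ijumps N h | N h. UF.ichar N h}"
  then obtain N h where h: "UF.ichar N h" "J = UF.ijumps N h" by blast
  define \<theta> where "\<theta> x = emb p N (h x)" for x
  have hom: "\<theta> \<in> hom (U1_group absv) (Qp_mod_Zp p)"
    unfolding hom_def
  proof (intro CollectI conjI ballI)
    show "\<theta> \<in> carrier (U1_group absv) \<rightarrow> carrier (Qp_mod_Zp p)" using emb_carrier[OF prime_p] by (simp add: \<theta>_def)
    fix x y assume "x \<in> carrier (U1_group absv)" "y \<in> carrier (U1_group absv)"
    then have "int p ^ N dvd h (x * y) - (h x + h y)" using UF.ichar_mult[OF h(1), of x y] by (simp add: U1_group_def U1 diff_diff_eq)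
    then show "\<theta> (x \<otimes>\<^bsub>U1_group absv\<^esub> y) = \<theta> x \<otimes>\<^bsub>Qp_mod_Zp p\<^esub> \<theta> y"
      using emb_eq_iff[OF prime_p] emb_add[OF prime_p] by (simp add: \<theta>_def U1_group_def)
  qed
  obtain n where n: "\<And>x. x \<in> Uf n \<Longrightarrow> int p ^ N dvd h x" using h(1) by (auto simp: UF.ichar_def)
  have "\<theta> x = \<theta> 1" if "x \<in> Uf n" for x
    unfolding \<theta>_def emb_eq_iff[OF prime_p] using n[OF that] UF.ichar_one[OF h(1)] by (rule dvd_diff)
  then have "\<theta> \<in> characters absv p" unfolding characters_def using character_continuous_iff[OF hom] hom by blast
  moreover have "char_jumps absv \<theta> = J" using char_jumps_emb[OF h(1)] h(2) by (simp add: \<theta>_def)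
  ultimately show "J \<in> jump_sets_of_field absv p" by (auto simp: jump_sets_of_field_def)
qed

end

section \<open>Presentations and isomorphisms of filtered modules\<close>

context residual_field
begin

lemma unit_pow_eqI:
  assumes u: "u \<in> Uf 0" and y: "\<And>n. y / u ^ nat (c n) \<in> Uf n"
  shows "unit_pow absv c u = y"
proof -
  have ua: "absv (u ^ n) = 1" for n using Uf_absv[OF u] by (simp add: absv_power)
  have "y \<in> Uf 0" using UF.U_divide_cancel[OF y[of 0] UF.U_power[OF u]] .
  then have ya: "absv y = 1" by (rule Uf_absv)
  have lim: "limitin (field_topology absv) (\<lambda>n. u ^ nat (c n)) y sequentially"
    unfolding limitin_iff
  proof (intro allI impI)
    fix r :: real assume "0 < r"
    then obtain k where k: "q ^ k < r" using q_power_small by blast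
    have "absv (u ^ nat (c n) - y) < r" if "k \<le> n" for n
    proof -
      have "absv (u ^ nat (c n) - y) \<le> q ^ max 1 n"
        using y[of n] Uf_divide_iff[OF ya ua] absv_diff_commute[of y] by simp
      also have "\<dots> \<le> q ^ k" using that by (intro q_power_mono) simp
      finally show ?thesis using k by simp
    qed
    then show "\<forall>\<^sub>F n in sequentially. absv (u ^ nat (c n) - y) < r" unfolding eventually_sequentially by blast
  qed
  show ?thesis
    unfolding unit_pow_def
  proof (rule the_equality)
    show "limitin (field_topology absv) (\<lambda>n. u ^ nat (c n)) y sequentially" by (rule lim)
  next
    fix y' assume "limitin (field_topology absv) (\<lambda>n. u ^ nat (c n)) y' sequentially"
    then show "y' = y" using lim unfolding topology_M by (rule M.limitin_metric_unique) simp
  qed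
qed

abbreviation (input) "Z \<equiv> Zp p"

text \<open>\<open>x (c + 1) = 0\<close> says that \<open>p^(c + 1)\<close> divides
  \<open>x\<close>, so this is the \<open>p\<close>-adic counterpart of \<open>dv\<close>.\<close>

lemma weight_ge_iff:
  assumes x: "x \<in> carrier Z" and i: "1 \<le> i"
  shows "enat k \<le> weight \<rho> i x \<longleftrightarrow> (\<forall>c. (\<rho> ^^ c) i < k \<longrightarrow> x (c + 1) = 0)"
proof (cases "x = (\<lambda>n. 0)")
  case False
  then have ex0: "\<exists>n. x n \<noteq> 0" by auto
  have "x 0 = 0" using Zp_range[OF prime_p x, of 0] by simp
  then have ex: "\<exists>n. x (Suc n) \<noteq> 0" using ex0 by (metis not0_implies_Suc)
  have o1: "x (Suc (ord_p x)) \<noteq> 0" unfolding ord_p_def by (rule LeastI_ex[OF ex])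
  have o2: "x (Suc c) = 0" if "c < ord_p x" for c using not_less_Least[OF that[unfolded ord_p_def]] by simp
  have "enat k \<le> weight \<rho> i x \<longleftrightarrow> k \<le> (\<rho> ^^ ord_p x) i" using False by (simp add: weight_def)
  also have "\<dots> \<longleftrightarrow> (\<forall>c. (\<rho> ^^ c) i < k \<longrightarrow> x (c + 1) = 0)"
  proof
    assume k: "k \<le> (\<rho> ^^ ord_p x) i"
    show "\<forall>c. (\<rho> ^^ c) i < k \<longrightarrow> x (c + 1) = 0"
    proof (intro allI impI)
      fix c assume "(\<rho> ^^ c) i < k"
      then have "(\<rho> ^^ c) i < (\<rho> ^^ ord_p x) i" using k by simp
      then have "c < ord_p x" using UF.pow_mono_exp[of "ord_p x" c i] by (meson leD not_le_imp_less)
      then show "x (c + 1) = 0" using o2 by simp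
    qed
  next
    assume "\<forall>c. (\<rho> ^^ c) i < k \<longrightarrow> x (c + 1) = 0"
    then have "\<not> (\<rho> ^^ ord_p x) i < k" using o1 by auto
    then show "k \<le> (\<rho> ^^ ord_p x) i" by simp
  qed
  finally show ?thesis .
qed (simp add: weight_def)

lemma Zp_dvd_iff: "x \<in> carrier Z \<Longrightarrow> c \<le> n \<Longrightarrow> int p ^ c dvd x n \<longleftrightarrow> x c = 0"
  using Zp_coherent[OF prime_p, of x c n] by (simp add: dvd_eq_mod_eq_0)

lemma add_pow_zi: "add_pow Z n \<one>\<^bsub>Z\<^esub> = zi p (int n)"
proof (induction n)
  case 0
  show ?case using zi_0[OF prime_p] by (simp add: add_pow_def nat_pow_def)
next
  case (Suc n)
  have "add_pow Z (Suc n) \<one>\<^bsub>Z\<^esub> = add_pow Z n \<one>\<^bsub>Z\<^esub> \<oplus>\<^bsub>Z\<^esub> \<one>\<^bsub>Z\<^esub>" by (simp add: add_pow_def nat_pow_def)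
  also have "\<dots> = zi p (int n + 1)" unfolding Suc unfolding zi_1[OF prime_p] zi_add[OF prime_p] by (rule refl)
  finally show ?case by (simp add: add.commute)
qed

section \<open>The quotient module in coordinates\<close>

context
  fixes A :: "nat set"
  assumes finT: "finite (T \<rho>)" and IT: "jump_I \<rho> A \<subseteq> T_star \<rho>"
begin

abbreviation (input) "G \<equiv> gens f \<rho>"
abbreviation (input) "rv \<equiv> rel_vec p f \<rho> A"
abbreviation (input) "Mst \<equiv> M_rho_star p \<rho>"
abbreviation (input) "vv \<equiv> v_vec p \<rho> A"
abbreviation (input) "Nv \<equiv> (\<lambda>a. a \<odot>\<^bsub>Mst\<^esub> vv) ` carrier Z"
abbreviation (input) "Pm \<equiv> filt_prod {..<f - 1} (\<lambda>_. M_rho p \<rho>)"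
abbreviation (input) "Qm \<equiv> filt_sum Pm (filt_quot Mst Nv)"

lemma T_star_pos: "i \<in> T_star \<rho> \<Longrightarrow> 1 \<le> i"
  by (auto simp: T_star_def T_def e_star_def)

lemma G_pos: "g \<in> G \<Longrightarrow> 1 \<le> snd g"
  using T_star_pos by (auto simp: gens_def T_star_def)

lemma finG: "finite G"
  by (rule finite_gens[OF finT])

text \<open>Vectors on the whole index type with coordinates restricted on
  \<open>gens f \<rho>\<close> only; equality of vectors is accordingly tested there.\<close>

definition ZV :: "(nat \<times> nat \<Rightarrow> padic) set" where
  "ZV = {X. \<forall>g\<in>G. X g \<in> carrier Z}"

definition zFil :: "nat \<Rightarrow> (nat \<times> nat \<Rightarrow> padic) \<Rightarrow> bool" where
  "zFil k X \<longleftrightarrow> X \<in> ZV \<and> (\<forall>g\<in>G. \<forall>c. (\<rho> ^^ c) (snd g) < k \<longrightarrow> X g (c + 1) = 0)"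

definition vadd :: "(nat \<times> nat \<Rightarrow> padic) \<Rightarrow> (nat \<times> nat \<Rightarrow> padic) \<Rightarrow> nat \<times> nat \<Rightarrow> padic" where
  "vadd X Y g = X g \<oplus>\<^bsub>Z\<^esub> Y g"

definition vsmult :: "padic \<Rightarrow> (nat \<times> nat \<Rightarrow> padic) \<Rightarrow> nat \<times> nat \<Rightarrow> padic" where
  "vsmult a X g = a \<otimes>\<^bsub>Z\<^esub> X g"

definition zvec :: "(nat \<times> nat \<Rightarrow> int) \<Rightarrow> nat \<times> nat \<Rightarrow> padic" where
  "zvec a g = zi p (a g)"

definition cls :: "(nat \<times> nat \<Rightarrow> padic) \<Rightarrow> (nat \<Rightarrow> nat \<Rightarrow> padic) \<times> (nat \<Rightarrow> padic) set" where
  "cls X = ((\<lambda>s\<in>{..<f - 1}. \<lambda>i\<in>T \<rho>. X (s, i)), Nv +>\<^bsub>Mst\<^esub> (\<lambda>i\<in>T_star \<rho>. X (f - 1, i)))"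

lemma ZV_closed:
  "X \<in> ZV \<Longrightarrow> Y \<in> ZV \<Longrightarrow> vadd X Y \<in> ZV" "a \<in> carrier Z \<Longrightarrow> X \<in> ZV \<Longrightarrow> vsmult a X \<in> ZV" "zvec b \<in> ZV"
  using Zp_add_closed[OF prime_p] Zp_mult_closed[OF prime_p] zi_closed[OF prime_p]
  by (auto simp only: ZV_def vadd_def vsmult_def zvec_def mem_Collect_eq)

lemma M_simps:
  "carrier Mst = PiE (T_star \<rho>) (\<lambda>_. carrier Z)" "(x \<oplus>\<^bsub>Mst\<^esub> y) = (\<lambda>i\<in>T_star \<rho>. x i \<oplus>\<^bsub>Z\<^esub> y i)"
  "(a \<odot>\<^bsub>Mst\<^esub> x) = (\<lambda>i\<in>T_star \<rho>. a \<otimes>\<^bsub>Z\<^esub> x i)"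
  "Fil Mst k = PiE (T_star \<rho>) (\<lambda>i. {x \<in> carrier Z. enat k \<le> weight \<rho> i x})"
  by (simp_all add: M_rho_star_def filt_prod_def S_mod_def)

lemma P_simps:
  "carrier Pm = PiE {..<f - 1} (\<lambda>_. PiE (T \<rho>) (\<lambda>_. carrier Z))"
  "(x \<oplus>\<^bsub>Pm\<^esub> y) = (\<lambda>s\<in>{..<f - 1}. \<lambda>i\<in>T \<rho>. x s i \<oplus>\<^bsub>Z\<^esub> y s i)"
  "(a \<odot>\<^bsub>Pm\<^esub> x) = (\<lambda>s\<in>{..<f - 1}. \<lambda>i\<in>T \<rho>. a \<otimes>\<^bsub>Z\<^esub> x s i)"
  "Fil Pm k = PiE {..<f - 1} (\<lambda>_. PiE (T \<rho>) (\<lambda>i. {x \<in> carrier Z. enat k \<le> weight \<rho> i x}))"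
  by (simp_all add: M_rho_def filt_prod_def S_mod_def cong: restrict_cong)

lemma Q_simps:
  "carrier Qm = carrier Pm \<times> (a_rcosets\<^bsub>Mst\<^esub> Nv)"
  "((x, C) \<oplus>\<^bsub>Qm\<^esub> (y, D)) = (x \<oplus>\<^bsub>Pm\<^esub> y, C <+>\<^bsub>Mst\<^esub> D)"
  "(a \<odot>\<^bsub>Qm\<^esub> (x, C)) = (a \<odot>\<^bsub>Pm\<^esub> x, Nv <+>\<^bsub>Mst\<^esub> ((\<lambda>x. a \<odot>\<^bsub>Mst\<^esub> x) ` C))"
  "Fil Qm k = Fil Pm k \<times> ((\<lambda>x. Nv +>\<^bsub>Mst\<^esub> x) ` Fil Mst k)"
  by (simp_all add: filt_sum_def filt_quot_def)

lemma vv_eq: "i \<in> T_star \<rho> \<Longrightarrow> vv i = zi p (rv (f - 1, i))"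
  using add_pow_zi zi_0[OF prime_p] by (simp add: v_vec_def rel_vec_def del: Zp_simps)

definition relation_shift :: "padic \<Rightarrow> (nat \<Rightarrow> padic) \<Rightarrow> nat \<Rightarrow> padic" where
  "relation_shift l y = (\<lambda>i\<in>T_star \<rho>. (l \<otimes>\<^bsub>Z\<^esub> vv i) \<oplus>\<^bsub>Z\<^esub> y i)"

lemma coset_eq: "Nv +>\<^bsub>Mst\<^esub> y = {relation_shift l y | l. l \<in> carrier Z}"
proof -
  have "(a \<odot>\<^bsub>Mst\<^esub> vv) \<oplus>\<^bsub>Mst\<^esub> y = relation_shift a y" for a
    unfolding M_simps relation_shift_def by (rule restrict_ext) simp
  then show ?thesis unfolding a_r_coset_def' by blast
qed

lemma relation_shift_add: "relation_shift l (relation_shift r y) = relation_shift (l \<oplus>\<^bsub>Z\<^esub> r) y"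
proof -
  have "(l \<otimes>\<^bsub>Z\<^esub> vv i) \<oplus>\<^bsub>Z\<^esub> ((r \<otimes>\<^bsub>Z\<^esub> vv i) \<oplus>\<^bsub>Z\<^esub> y i) = ((l \<oplus>\<^bsub>Z\<^esub> r) \<otimes>\<^bsub>Z\<^esub> vv i) \<oplus>\<^bsub>Z\<^esub> y i" for i
    by (rule ext) (simp only: Zp_simps[OF prime_p] mod_simps, simp add: algebra_simps)
  then show ?thesis unfolding relation_shift_def by (intro restrict_ext) simp
qed

lemma relation_shift_zero: "y \<in> carrier Mst \<Longrightarrow> relation_shift (zi p 0) y = y"
proof -
  assume y: "y \<in> carrier Mst"
  have "(zi p 0 \<otimes>\<^bsub>Z\<^esub> vv i) \<oplus>\<^bsub>Z\<^esub> y i = y i" if "i \<in> T_star \<rho>" for i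
  proof
    fix n
    have "y i \<in> carrier Z" using y that unfolding M_simps by auto
    then show "((zi p 0 \<otimes>\<^bsub>Z\<^esub> vv i) \<oplus>\<^bsub>Z\<^esub> y i) n = y i n"
      using Zp_mod_self[OF prime_p, of "y i" n] by (simp add: Zp_simps[OF prime_p] zi_def[OF prime_p])
  qed
  then have "relation_shift (zi p 0) y = restrict y (T_star \<rho>)" unfolding relation_shift_def by (intro restrict_ext) simp
  then show ?thesis using y unfolding M_simps by (simp add: PiE_restrict)
qed

lemma coset_eq_iff_shift:
  assumes y: "y \<in> carrier Mst" and z: "z \<in> carrier Mst"
  shows "Nv +>\<^bsub>Mst\<^esub> y = Nv +>\<^bsub>Mst\<^esub> z \<longleftrightarrow> (\<exists>l\<in>carrier Z. y = relation_shift l z)"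
proof
  assume "Nv +>\<^bsub>Mst\<^esub> y = Nv +>\<^bsub>Mst\<^esub> z"
  moreover have "y \<in> Nv +>\<^bsub>Mst\<^esub> y" unfolding coset_eq using relation_shift_zero[OF y] zi_closed[OF prime_p, of 0] by (metis (mono_tags, lifting) mem_Collect_eq)
  ultimately show "\<exists>l\<in>carrier Z. y = relation_shift l z" unfolding coset_eq by blast
next
  assume "\<exists>l\<in>carrier Z. y = relation_shift l z"
  then obtain l where l: "l \<in> carrier Z" "y = relation_shift l z" by blast
  have n: "zneg p l \<in> carrier Z" by (rule zneg_closed[OF prime_p l(1)])
  have "zneg p l \<oplus>\<^bsub>Z\<^esub> l = zi p 0" by (rule ext) (simp add: Zp_simps[OF prime_p] zneg_def[OF prime_p] zi_def[OF prime_p] mod_simps)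
  then have zy: "z = relation_shift (zneg p l) y" using relation_shift_add[of "zneg p l" l z] relation_shift_zero[OF z] l(2) by simp
  show "Nv +>\<^bsub>Mst\<^esub> y = Nv +>\<^bsub>Mst\<^esub> z"
  proof (intro equalityI subsetI)
    fix w assume "w \<in> Nv +>\<^bsub>Mst\<^esub> y"
    then obtain r where "r \<in> carrier Z" "w = relation_shift r y" unfolding coset_eq by blast
    then show "w \<in> Nv +>\<^bsub>Mst\<^esub> z" unfolding coset_eq l(2) relation_shift_add using Zp_add_closed[OF prime_p _ l(1), of r] by blast
  next
    fix w assume "w \<in> Nv +>\<^bsub>Mst\<^esub> z"
    then obtain r where r: "r \<in> carrier Z" "w = relation_shift r z" unfolding coset_eq by blast
    then have "w = relation_shift (r \<oplus>\<^bsub>Z\<^esub> zneg p l) y" using relation_shift_add[of r "zneg p l" y] zy by simp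
    then show "w \<in> Nv +>\<^bsub>Mst\<^esub> y" unfolding coset_eq using Zp_add_closed[OF prime_p r(1) n] by blast
  qed
qed

lemma part_closed: "X \<in> ZV \<Longrightarrow> (\<lambda>i\<in>T_star \<rho>. X (f - 1, i)) \<in> carrier Mst"
  "X \<in> ZV \<Longrightarrow> (\<lambda>s\<in>{..<f - 1}. \<lambda>i\<in>T \<rho>. X (s, i)) \<in> carrier Pm"
  unfolding M_simps P_simps by (auto simp: ZV_def gens_def)

lemma cls_closed: "X \<in> ZV \<Longrightarrow> cls X \<in> carrier Qm"
  unfolding Q_simps cls_def A_RCOSETS_def' using part_closed by blast

text \<open>The relation vanishes on the first \<open>f - 1\<close> copies, so the equality of
  coordinates there and the coset condition on the last copy merge into one formula.\<close>

lemma cls_eq_iff: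
  assumes X: "X \<in> ZV" and Y: "Y \<in> ZV"
  shows "cls X = cls Y \<longleftrightarrow> (\<exists>l\<in>carrier Z. \<forall>g\<in>G. X g = vadd (vsmult l (zvec rv)) Y g)"
proof -
  have z0: "l \<otimes>\<^bsub>Z\<^esub> zi p 0 \<oplus>\<^bsub>Z\<^esub> y = y" if "y \<in> carrier Z" for l y
    by (rule ext) (use Zp_mod_self[OF prime_p that] in \<open>simp add: Zp_simps[OF prime_p] zi_def[OF prime_p]\<close>)
  have "cls X = cls Y \<longleftrightarrow> (\<lambda>s\<in>{..<f - 1}. \<lambda>i\<in>T \<rho>. X (s, i)) = (\<lambda>s\<in>{..<f - 1}. \<lambda>i\<in>T \<rho>. Y (s, i))
      \<and> (\<exists>l\<in>carrier Z. (\<lambda>i\<in>T_star \<rho>. X (f - 1, i)) = relation_shift l (\<lambda>i\<in>T_star \<rho>. Y (f - 1, i)))"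
    unfolding cls_def prod.inject coset_eq_iff_shift[OF part_closed(1)[OF X] part_closed(1)[OF Y]] by (rule refl)
  also have "(\<lambda>s\<in>{..<f - 1}. \<lambda>i\<in>T \<rho>. X (s, i)) = (\<lambda>s\<in>{..<f - 1}. \<lambda>i\<in>T \<rho>. Y (s, i))
      \<longleftrightarrow> (\<forall>s<f - 1. \<forall>i\<in>T \<rho>. X (s, i) = Y (s, i))"
    by (auto simp: fun_eq_iff restrict_def split: if_splits)
  also have "(\<exists>l\<in>carrier Z. (\<lambda>i\<in>T_star \<rho>. X (f - 1, i)) = relation_shift l (\<lambda>i\<in>T_star \<rho>. Y (f - 1, i)))
      \<longleftrightarrow> (\<exists>l\<in>carrier Z. \<forall>i\<in>T_star \<rho>. X (f - 1, i) = (l \<otimes>\<^bsub>Z\<^esub> zi p (rv (f - 1, i))) \<oplus>\<^bsub>Z\<^esub> Y (f - 1, i))"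
  proof (intro bex_cong refl)
    fix l
    show "(\<lambda>i\<in>T_star \<rho>. X (f - 1, i)) = relation_shift l (\<lambda>i\<in>T_star \<rho>. Y (f - 1, i))
      \<longleftrightarrow> (\<forall>i\<in>T_star \<rho>. X (f - 1, i) = (l \<otimes>\<^bsub>Z\<^esub> zi p (rv (f - 1, i))) \<oplus>\<^bsub>Z\<^esub> Y (f - 1, i))"
    proof
      assume e: "(\<lambda>i\<in>T_star \<rho>. X (f - 1, i)) = relation_shift l (\<lambda>i\<in>T_star \<rho>. Y (f - 1, i))"
      show "\<forall>i\<in>T_star \<rho>. X (f - 1, i) = (l \<otimes>\<^bsub>Z\<^esub> zi p (rv (f - 1, i))) \<oplus>\<^bsub>Z\<^esub> Y (f - 1, i)"
      proof
        fix i assume i: "i \<in> T_star \<rho>"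
        from fun_cong[OF e, of i] show "X (f - 1, i) = (l \<otimes>\<^bsub>Z\<^esub> zi p (rv (f - 1, i))) \<oplus>\<^bsub>Z\<^esub> Y (f - 1, i)"
          using i unfolding relation_shift_def vv_eq[OF i, symmetric] by (simp only: restrict_apply if_True)
      qed
    next
      assume "\<forall>i\<in>T_star \<rho>. X (f - 1, i) = (l \<otimes>\<^bsub>Z\<^esub> zi p (rv (f - 1, i))) \<oplus>\<^bsub>Z\<^esub> Y (f - 1, i)"
      then show "(\<lambda>i\<in>T_star \<rho>. X (f - 1, i)) = relation_shift l (\<lambda>i\<in>T_star \<rho>. Y (f - 1, i))"
        unfolding relation_shift_def by (intro restrict_ext) (simp only: vv_eq restrict_apply if_True)
    qed
  qed
  also have "(\<forall>s<f - 1. \<forall>i\<in>T \<rho>. X (s, i) = Y (s, i)) \<and>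
      (\<exists>l\<in>carrier Z. \<forall>i\<in>T_star \<rho>. X (f - 1, i) = (l \<otimes>\<^bsub>Z\<^esub> zi p (rv (f - 1, i))) \<oplus>\<^bsub>Z\<^esub> Y (f - 1, i))
    \<longleftrightarrow> (\<exists>l\<in>carrier Z. \<forall>g\<in>G. X g = (l \<otimes>\<^bsub>Z\<^esub> zi p (rv g)) \<oplus>\<^bsub>Z\<^esub> Y g)"
  proof -
    have "X (s, i) = (l \<otimes>\<^bsub>Z\<^esub> zi p (rv (s, i))) \<oplus>\<^bsub>Z\<^esub> Y (s, i) \<longleftrightarrow> X (s, i) = Y (s, i)" if "s < f - 1" "i \<in> T \<rho>" for s i l
    proof -
      have "rv (s, i) = 0" using that by (simp add: rel_vec_def)
      moreover have "Y (s, i) \<in> carrier Z" using Y that by (simp add: ZV_def gens_def)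
      ultimately show ?thesis using z0 by simp
    qed
    note low = this
    have "(\<forall>g\<in>G. X g = (l \<otimes>\<^bsub>Z\<^esub> zi p (rv g)) \<oplus>\<^bsub>Z\<^esub> Y g) \<longleftrightarrow>
      (\<forall>s<f - 1. \<forall>i\<in>T \<rho>. X (s, i) = (l \<otimes>\<^bsub>Z\<^esub> zi p (rv (s, i))) \<oplus>\<^bsub>Z\<^esub> Y (s, i)) \<and>
      (\<forall>i\<in>T_star \<rho>. X (f - 1, i) = (l \<otimes>\<^bsub>Z\<^esub> zi p (rv (f - 1, i))) \<oplus>\<^bsub>Z\<^esub> Y (f - 1, i))" for l
      unfolding gens_def by blast
    then show ?thesis using low by blast
  qed
  finally show ?thesis by (simp only: vadd_def vsmult_def zvec_def)
qed

lemma cls_add: "X \<in> ZV \<Longrightarrow> Y \<in> ZV \<Longrightarrow> cls (vadd X Y) = cls X \<oplus>\<^bsub>Qm\<^esub> cls Y"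
proof -
  assume X: "X \<in> ZV" and Y: "Y \<in> ZV"
  let ?x = "\<lambda>i\<in>T_star \<rho>. X (f - 1, i)" and ?y = "\<lambda>i\<in>T_star \<rho>. Y (f - 1, i)" and ?w = "\<lambda>i\<in>T_star \<rho>. vadd X Y (f - 1, i)"
  have t: "relation_shift l ?x \<oplus>\<^bsub>Mst\<^esub> relation_shift r ?y = relation_shift (l \<oplus>\<^bsub>Z\<^esub> r) ?w" for l r
  proof -
    have "((l \<otimes>\<^bsub>Z\<^esub> vv i) \<oplus>\<^bsub>Z\<^esub> X (f - 1, i)) \<oplus>\<^bsub>Z\<^esub> ((r \<otimes>\<^bsub>Z\<^esub> vv i) \<oplus>\<^bsub>Z\<^esub> Y (f - 1, i))
      = ((l \<oplus>\<^bsub>Z\<^esub> r) \<otimes>\<^bsub>Z\<^esub> vv i) \<oplus>\<^bsub>Z\<^esub> (X (f - 1, i) \<oplus>\<^bsub>Z\<^esub> Y (f - 1, i))" for i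
      by (rule ext) (simp only: Zp_simps[OF prime_p] mod_simps, simp add: algebra_simps)
    then show ?thesis unfolding M_simps relation_shift_def vadd_def by (intro restrict_ext) (simp only: restrict_apply if_True)
  qed
  have "Nv +>\<^bsub>Mst\<^esub> ?w = (Nv +>\<^bsub>Mst\<^esub> ?x) <+>\<^bsub>Mst\<^esub> (Nv +>\<^bsub>Mst\<^esub> ?y)"
  proof (intro equalityI subsetI)
    fix u assume "u \<in> Nv +>\<^bsub>Mst\<^esub> ?w"
    then obtain l where l: "l \<in> carrier Z" "u = relation_shift l ?w" unfolding coset_eq by blast
    have "l \<oplus>\<^bsub>Z\<^esub> zi p 0 = l" by (rule ext) (use Zp_mod_self[OF prime_p l(1)] in \<open>simp add: Zp_simps[OF prime_p] zi_def[OF prime_p]\<close>)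
    then have "u = relation_shift l ?x \<oplus>\<^bsub>Mst\<^esub> relation_shift (zi p 0) ?y" unfolding t l(2) by (simp only:)
    then show "u \<in> (Nv +>\<^bsub>Mst\<^esub> ?x) <+>\<^bsub>Mst\<^esub> (Nv +>\<^bsub>Mst\<^esub> ?y)"
      unfolding set_add_def' coset_eq using l(1) zi_closed[OF prime_p, of 0] by blast
  next
    fix u assume "u \<in> (Nv +>\<^bsub>Mst\<^esub> ?x) <+>\<^bsub>Mst\<^esub> (Nv +>\<^bsub>Mst\<^esub> ?y)"
    then obtain l r where lm: "l \<in> carrier Z" "r \<in> carrier Z" "u = relation_shift l ?x \<oplus>\<^bsub>Mst\<^esub> relation_shift r ?y"
      unfolding set_add_def' coset_eq by blast
    then show "u \<in> Nv +>\<^bsub>Mst\<^esub> ?w" unfolding t coset_eq using Zp_add_closed[OF prime_p lm(1,2)] by blast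
  qed
  moreover have "(\<lambda>s\<in>{..<f - 1}. \<lambda>i\<in>T \<rho>. vadd X Y (s, i))
      = (\<lambda>s\<in>{..<f - 1}. \<lambda>i\<in>T \<rho>. X (s, i)) \<oplus>\<^bsub>Pm\<^esub> (\<lambda>s\<in>{..<f - 1}. \<lambda>i\<in>T \<rho>. Y (s, i))"
    unfolding P_simps vadd_def by (intro restrict_ext) (simp only: restrict_apply if_True)
  ultimately show ?thesis unfolding cls_def Q_simps by (simp only:)
qed

lemma cls_smult: "a \<in> carrier Z \<Longrightarrow> X \<in> ZV \<Longrightarrow> cls (vsmult a X) = a \<odot>\<^bsub>Qm\<^esub> cls X"
proof -
  assume a: "a \<in> carrier Z" and X: "X \<in> ZV"
  let ?x = "\<lambda>i\<in>T_star \<rho>. X (f - 1, i)" and ?w = "\<lambda>i\<in>T_star \<rho>. vsmult a X (f - 1, i)"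
  have t: "(r \<odot>\<^bsub>Mst\<^esub> vv) \<oplus>\<^bsub>Mst\<^esub> (a \<odot>\<^bsub>Mst\<^esub> relation_shift l ?x) = relation_shift (r \<oplus>\<^bsub>Z\<^esub> a \<otimes>\<^bsub>Z\<^esub> l) ?w" for l r
  proof -
    have "(r \<otimes>\<^bsub>Z\<^esub> vv i) \<oplus>\<^bsub>Z\<^esub> (a \<otimes>\<^bsub>Z\<^esub> ((l \<otimes>\<^bsub>Z\<^esub> vv i) \<oplus>\<^bsub>Z\<^esub> X (f - 1, i)))
      = ((r \<oplus>\<^bsub>Z\<^esub> a \<otimes>\<^bsub>Z\<^esub> l) \<otimes>\<^bsub>Z\<^esub> vv i) \<oplus>\<^bsub>Z\<^esub> (a \<otimes>\<^bsub>Z\<^esub> X (f - 1, i))" for i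
      by (rule ext) (simp only: Zp_simps[OF prime_p] mod_simps, simp add: algebra_simps)
    then show ?thesis unfolding M_simps relation_shift_def vsmult_def by (intro restrict_ext) (simp only: restrict_apply if_True)
  qed
  have "Nv +>\<^bsub>Mst\<^esub> ?w = Nv <+>\<^bsub>Mst\<^esub> ((\<lambda>x. a \<odot>\<^bsub>Mst\<^esub> x) ` (Nv +>\<^bsub>Mst\<^esub> ?x))"
  proof (intro equalityI subsetI)
    fix u assume "u \<in> Nv +>\<^bsub>Mst\<^esub> ?w"
    then obtain l where l: "l \<in> carrier Z" "u = relation_shift l ?w" unfolding coset_eq by blast
    have "l \<oplus>\<^bsub>Z\<^esub> a \<otimes>\<^bsub>Z\<^esub> zi p 0 = l" by (rule ext) (use Zp_mod_self[OF prime_p l(1)] in \<open>simp add: Zp_simps[OF prime_p] zi_def[OF prime_p]\<close>)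
    then have "u = (l \<odot>\<^bsub>Mst\<^esub> vv) \<oplus>\<^bsub>Mst\<^esub> (a \<odot>\<^bsub>Mst\<^esub> relation_shift (zi p 0) ?x)" unfolding t l(2) by (simp only:)
    then show "u \<in> Nv <+>\<^bsub>Mst\<^esub> ((\<lambda>x. a \<odot>\<^bsub>Mst\<^esub> x) ` (Nv +>\<^bsub>Mst\<^esub> ?x))"
      unfolding set_add_def' coset_eq using l(1) zi_closed[OF prime_p, of 0] by blast
  next
    fix u assume "u \<in> Nv <+>\<^bsub>Mst\<^esub> ((\<lambda>x. a \<odot>\<^bsub>Mst\<^esub> x) ` (Nv +>\<^bsub>Mst\<^esub> ?x))"
    then obtain l r where lm: "l \<in> carrier Z" "r \<in> carrier Z" "u = (r \<odot>\<^bsub>Mst\<^esub> vv) \<oplus>\<^bsub>Mst\<^esub> (a \<odot>\<^bsub>Mst\<^esub> relation_shift l ?x)"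
      unfolding set_add_def' coset_eq by blast
    then show "u \<in> Nv +>\<^bsub>Mst\<^esub> ?w"
      unfolding t coset_eq using Zp_add_closed[OF prime_p lm(2) Zp_mult_closed[OF prime_p a lm(1)]] by blast
  qed
  moreover have "(\<lambda>s\<in>{..<f - 1}. \<lambda>i\<in>T \<rho>. vsmult a X (s, i)) = a \<odot>\<^bsub>Pm\<^esub> (\<lambda>s\<in>{..<f - 1}. \<lambda>i\<in>T \<rho>. X (s, i))"
    unfolding P_simps vsmult_def by (intro restrict_ext) (simp only: restrict_apply if_True)
  ultimately show ?thesis unfolding cls_def Q_simps by (simp only:)
qed

lemma cls_Fil: "w \<in> Fil Qm k \<longleftrightarrow> (\<exists>X. zFil k X \<and> w = cls X)"
proof
  assume "w \<in> Fil Qm k"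
  then obtain x y where xy: "x \<in> Fil Pm k" "y \<in> Fil Mst k" "w = (x, Nv +>\<^bsub>Mst\<^esub> y)" unfolding Q_simps by blast
  define X where "X = (\<lambda>(s, i). if s = f - 1 then y i else x s i)"
  have xF: "x s i \<in> carrier Z \<and> enat k \<le> weight \<rho> i (x s i)" if "s < f - 1" "i \<in> T \<rho>" for s i
    using xy(1) that unfolding P_simps by (fastforce simp: PiE_iff)
  have yF: "y i \<in> carrier Z \<and> enat k \<le> weight \<rho> i (y i)" if "i \<in> T_star \<rho>" for i
    using xy(2) that unfolding M_simps by (auto simp: PiE_iff)
  have XF: "X g \<in> carrier Z \<and> enat k \<le> weight \<rho> (snd g) (X g)" if "g \<in> G" for g
    using xF yF that by (auto simp: gens_def X_def)
  then have "zFil k X" unfolding zFil_def ZV_def using weight_ge_iff[OF _ G_pos] by blast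
  moreover have "w = cls X"
  proof -
    have "(\<lambda>i\<in>T_star \<rho>. X (f - 1, i)) = restrict y (T_star \<rho>)" by (simp add: X_def)
    also have "\<dots> = y" using xy(2) unfolding M_simps by (simp add: PiE_restrict)
    finally have 1: "(\<lambda>i\<in>T_star \<rho>. X (f - 1, i)) = y" .
    have "(\<lambda>i\<in>T \<rho>. X (s, i)) = x s" if "s < f - 1" for s
    proof -
      have "x s \<in> PiE (T \<rho>) (\<lambda>i. {x \<in> carrier Z. enat k \<le> weight \<rho> i x})" using xy(1) that unfolding P_simps by auto
      then have "restrict (x s) (T \<rho>) = x s" by (rule PiE_restrict)
      then show ?thesis using that by (simp add: X_def)
    qed
    then have "(\<lambda>s\<in>{..<f - 1}. \<lambda>i\<in>T \<rho>. X (s, i)) = restrict x {..<f - 1}" by (intro restrict_ext) simp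
    also have "\<dots> = x" using xy(1) unfolding P_simps by (simp add: PiE_restrict)
    finally show ?thesis using 1 xy(3) by (simp add: cls_def)
  qed
  ultimately show "\<exists>X. zFil k X \<and> w = cls X" by blast
next
  assume "\<exists>X. zFil k X \<and> w = cls X"
  then obtain X where X: "zFil k X" "w = cls X" by blast
  have XF: "X g \<in> carrier Z \<and> enat k \<le> weight \<rho> (snd g) (X g)" if "g \<in> G" for g
    using X(1) that weight_ge_iff[OF _ G_pos[OF that]] unfolding zFil_def ZV_def by blast
  have "(\<lambda>i\<in>T_star \<rho>. X (f - 1, i)) \<in> Fil Mst k" "(\<lambda>s\<in>{..<f - 1}. \<lambda>i\<in>T \<rho>. X (s, i)) \<in> Fil Pm k"
    unfolding M_simps P_simps using XF by (fastforce simp: gens_def)+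
  then show "w \<in> Fil Qm k" unfolding X(2) cls_def Q_simps by blast
qed

lemma Fil_1: "Fil Qm 1 = carrier Qm" and zFil_1: "zFil (Suc 0) X \<longleftrightarrow> X \<in> ZV"
proof -
  have no: "\<not> (\<rho> ^^ c) i < 1" if "1 \<le> i" for c i using UF.pow_ge[of i c] that by simp
  show "zFil (Suc 0) X \<longleftrightarrow> X \<in> ZV" unfolding zFil_def using no G_pos by (metis One_nat_def)
  have "{x \<in> carrier Z. enat 1 \<le> weight \<rho> i x} = carrier Z" if "1 \<le> i" for i
    using weight_ge_iff[OF _ that, of _ 1] no[OF that] by blast
  then have e: "i \<in> T_star \<rho> \<Longrightarrow> {x \<in> carrier Z. enat 1 \<le> weight \<rho> i x} = carrier Z" "i \<in> T \<rho> \<Longrightarrow> {x \<in> carrier Z. enat 1 \<le> weight \<rho> i x} = carrier Z" for i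
    using T_star_pos by (auto simp: T_star_def)
  have "Fil Mst 1 = carrier Mst" unfolding M_simps by (rule PiE_cong) (rule e)
  moreover have "Fil Pm 1 = carrier Pm" unfolding P_simps by (intro PiE_cong e)
  ultimately show "Fil Qm 1 = carrier Qm" unfolding Q_simps A_RCOSETS_def' by auto
qed

lemma cls_surj: "w \<in> carrier Qm \<Longrightarrow> \<exists>X\<in>ZV. w = cls X"
  using cls_Fil[of w 1] Fil_1 zFil_1 by auto

text \<open>Integer exponents approximating \<open>p\<close>-adic ones: the error is divisible by
  \<open>p^n\<close> and disappears modulo \<open>Uf n\<close>.\<close>

definition trunc :: "nat \<Rightarrow> (nat \<times> nat \<Rightarrow> padic) \<Rightarrow> nat \<times> nat \<Rightarrow> int" where
  "trunc n X g = X g n"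

lemma trunc_dv: "zFil k X \<Longrightarrow> k \<le> n \<Longrightarrow> g \<in> G \<Longrightarrow> UF.dv (snd g) k (trunc n X g)"
  unfolding UF.dv_def
proof (intro allI impI)
  fix c assume X: "zFil k X" and k: "k \<le> n" and g: "g \<in> G" and c: "(\<rho> ^^ c) (snd g) < k"
  have "c + 1 \<le> n" using UF.pow_ge_add[OF G_pos[OF g], of c] G_pos[OF g] c k by linarith
  then show "int p ^ (c + 1) dvd trunc n X g"
    using X g c Zp_dvd_iff[of "X g" "c + 1" n] by (simp add: zFil_def ZV_def trunc_def)
qed

text \<open>The inverse isomorphism is restricted to integer vectors. These approximate all
  \<open>p\<close>-adic vectors, which gives generation; a relation modulo \<open>Uf n\<close>
  becomes an equality of classes with a vector of weight \<open>n\<close>.\<close>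

lemma presented_of_iso:
  assumes "filt_isomorphic Z (U_mod absv) Qm"
  shows "UF.presented f A"
proof -
  obtain \<phi> \<psi> where \<phi>: "\<phi> \<in> filt_hom Z (U_mod absv) Qm" and \<psi>: "\<psi> \<in> filt_hom Z Qm (U_mod absv)"
    and inv: "\<And>x. x \<in> Uf 0 \<Longrightarrow> \<psi> (\<phi> x) = x" "\<And>y. y \<in> carrier Qm \<Longrightarrow> \<phi> (\<psi> y) = y"
    using assms unfolding filt_isomorphic_def by (auto simp: U_mod_def U1)
  have \<phi>Fil: "\<phi> x \<in> Fil Qm k" if "x \<in> Uf k" "1 \<le> k" for x k
    
  proof -
    have "\<phi> ` Fil (U_mod absv) k \<subseteq> Fil Qm k" using \<phi> that(2) unfolding filt_hom_def by blast
    then show ?thesis using that(1) Uf_pos[OF that(2)] by (auto simp: U_mod_def)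
  qed
  have \<psi>Fil: "\<psi> y \<in> Uf k" if "y \<in> Fil Qm k" "1 \<le> k" for y k
    
  proof -
    have "\<psi> ` Fil Qm k \<subseteq> Fil (U_mod absv) k" using \<psi> that(2) unfolding filt_hom_def by blast
    then show ?thesis using that(1) Uf_pos[OF that(2)] by (auto simp: U_mod_def)
  qed
  have \<psi>add: "\<psi> (x \<oplus>\<^bsub>Qm\<^esub> y) = \<psi> x * \<psi> y" if "x \<in> carrier Qm" "y \<in> carrier Qm" for x y
    using \<psi> that by (auto simp: filt_hom_def U_mod_def)
  define F where "F a = \<psi> (cls (zvec a))" for a
  have zadd: "zvec (\<lambda>g. a g + b g) = vadd (zvec a) (zvec b)" for a b
    by (rule ext) (simp only: vadd_def zvec_def zi_add[OF prime_p])
  have Fadd: "F (\<lambda>g. a g + b g) = F a * F b" for a b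
    unfolding F_def zadd cls_add[OF ZV_closed(3) ZV_closed(3)] by (rule \<psi>add[OF cls_closed[OF ZV_closed(3)] cls_closed[OF ZV_closed(3)]])
  have Ffil: "F a \<in> Uf k" if d: "\<And>g. g \<in> G \<Longrightarrow> UF.dv (snd g) k (a g)" for a k
  proof -
    have "zFil k (zvec a)" unfolding zFil_def
    proof (intro conjI ballI allI impI ZV_closed)
      fix g c assume "g \<in> G" "(\<rho> ^^ c) (snd g) < k"
      then have "int p ^ (c + 1) dvd a g" using d unfolding UF.dv_def by blast
      then show "zvec a g (c + 1) = 0" by (simp add: Zp_simps[OF prime_p] zvec_def zi_def[OF prime_p])
    qed
    then have "F a \<in> Uf k" if "1 \<le> k" unfolding F_def using \<psi>Fil cls_Fil that by blast
    moreover have "F a \<in> Uf 1" 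
      unfolding F_def by (rule \<psi>Fil) (simp_all only: Fil_1 cls_closed[OF ZV_closed(3)] order_refl)
    ultimately show ?thesis using UF.U_0 by (cases k) auto
  qed
  interpret S: gen_system \<rho> Uf p G snd F
    by unfold_locales (use finG G_pos Fadd Ffil in auto)
  have spans: "S.spans n" for n
    unfolding S.spans_def
  proof (intro allI ballI)
    fix k x assume x: "x \<in> Uf k"
    define k' where "k' = max 1 k"
    have "x \<in> Uf k'" using x by (simp add: k'_def Uf_def max_def)
    then have "\<phi> x \<in> Fil Qm k'" by (rule \<phi>Fil) (simp add: k'_def)
    then obtain X where X: "zFil k' X" "\<phi> x = cls X" using cls_Fil by blast
    \<comment> \<open>Truncation at \<open>N\<close> must preserve weight \<open>k'\<close> and
      leave an error of level at least \<open>n\<close>.\<close>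
    define N where "N = max k' n"
    define a where "a = trunc N X"
    have XZ: "X \<in> ZV" using X(1) by (simp add: zFil_def)
    have va: "S.vFil k' a" unfolding S.vFil_def a_def using trunc_dv[OF X(1), of N] by (simp add: N_def)
    define RR where "RR g = X g \<oplus>\<^bsub>Z\<^esub> zneg p (zi p (a g))" for g
    have RZ: "RR \<in> ZV" using XZ Zp_add_closed[OF prime_p] zneg_closed[OF prime_p] zi_closed[OF prime_p] by (simp only: ZV_def RR_def mem_Collect_eq) blast
    have Xsum: "\<forall>g\<in>G. X g = vadd (zvec a) RR g"
    proof
      fix g assume "g \<in> G"
      then have "X g n mod int p ^ n = X g n" for n using XZ Zp_mod_self[OF prime_p, of "X g"] by (simp add: ZV_def)
      then show "X g = vadd (zvec a) RR g"
        by (intro ext) (simp add: Zp_simps[OF prime_p] vadd_def zvec_def RR_def zi_def[OF prime_p] zneg_def[OF prime_p] mod_simps)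
    qed
    have "zFil (N + 1) RR"
      unfolding zFil_def
    proof (intro conjI ballI allI impI RZ)
      fix g c assume g: "g \<in> G" and c: "(\<rho> ^^ c) (snd g) < N + 1"
      have "c + 1 \<le> N" using UF.pow_ge_add[OF G_pos[OF g], of c] G_pos[OF g] c by linarith
      then have "X g N mod int p ^ (c + 1) = X g (c + 1)" using XZ g Zp_coherent[OF prime_p, of "X g" "c + 1" N] by (simp add: ZV_def)
      then have "(X g (c + 1) - X g N) mod int p ^ (c + 1) = 0" by (simp add: mod_eq_0_iff_dvd mod_eq_dvd_iff[symmetric]) (metis mod_mod_trivial)
      then show "RR g (c + 1) = 0"
        by (simp add: Zp_simps[OF prime_p] RR_def zi_def[OF prime_p] zneg_def[OF prime_p] a_def trunc_def mod_simps del: power_Suc)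
    qed
    then have "cls RR \<in> Fil Qm (N + 1)" unfolding cls_Fil by blast
    then have RU: "\<psi> (cls RR) \<in> Uf (N + 1)" by (rule \<psi>Fil) simp
    have vz: "vadd (zvec a) RR \<in> ZV" by (rule ZV_closed(1)[OF ZV_closed(3) RZ])
    have "cls X = cls (vadd (zvec a) RR)"
      using Xsum by (simp only: cls_def) (intro arg_cong2[of _ _ _ _ Pair] arg_cong[of _ _ "\<lambda>y. Nv +>\<^bsub>Mst\<^esub> y"] restrict_ext, auto simp: gens_def)
    then have "x = F a * \<psi> (cls RR)"
      using inv(1)[OF UF.U_in_0[OF x]] X(2) cls_add[OF ZV_closed(3) RZ] \<psi>add[OF cls_closed[OF ZV_closed(3)] cls_closed[OF RZ]] by (simp add: F_def)
    then have "x / F a = \<psi> (cls RR)" using S.F_nz[of a] by simp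
    then have "x / F a \<in> Uf n" using subsetD[OF Uf_antimono RU, of n] by (simp only:) (simp add: N_def)
    moreover have "S.vFil k a" using S.vFil_antimono[OF _ va] by (simp add: k'_def)
    ultimately show "\<exists>a. S.vFil k a \<and> x / F a \<in> Uf n" by blast
  qed
  have cls_rv: "cls (zvec rv) = cls (zvec (\<lambda>g. 0))"
    unfolding cls_eq_iff[OF ZV_closed(3) ZV_closed(3)]
  proof (rule bexI[OF _ zi_closed[OF prime_p, of 1]], intro ballI ext)
    show "zvec rv g n = vadd (vsmult (zi p 1) (zvec rv)) (zvec (\<lambda>g. 0)) g n" for g n
      by (simp add: Zp_simps[OF prime_p] vadd_def vsmult_def zvec_def zi_def[OF prime_p] mod_simps)
  qed
  have rel: "S.relations n rv" for n
    unfolding S.relations_def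
  proof (intro allI impI)
    fix a assume a: "F a \<in> Uf n"
    show "\<exists>l. S.vFil n (\<lambda>g. a g - l * rv g)"
    proof (cases "1 \<le> n")
      case False
      then show ?thesis using S.vFil_0 by (intro exI[of _ 0]) (simp add: not_le)
    next
      case True
      have "cls (zvec a) = \<phi> (F a)" using inv(2)[OF cls_closed[OF ZV_closed(3)]] by (simp add: F_def)
      then have "cls (zvec a) \<in> Fil Qm n" using \<phi>Fil[OF a True] by simp
      then obtain X where X: "zFil n X" "cls (zvec a) = cls X" using cls_Fil by blast
      have XZ: "X \<in> ZV" using X(1) by (simp add: zFil_def)
      obtain l where l: "l \<in> carrier Z" "\<forall>g\<in>G. zvec a g = vadd (vsmult l (zvec rv)) X g"
        using X(2) cls_eq_iff[OF ZV_closed(3) XZ] by blast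
      \<comment> \<open>The \<open>p\<close>-adic multiplier is replaced by its residue modulo
        \<open>p^n\<close>; a weight condition up to \<open>n\<close> involves no higher power of
        \<open>p\<close>.\<close>
      have "S.vFil n (\<lambda>g. a g - l n * rv g)"
        unfolding S.vFil_def
      proof
        fix g assume g: "g \<in> G"
        have "zvec a g n = vadd (vsmult l (zvec rv)) X g n" using l(2) g by simp
        then have "a g mod int p ^ n = (l n * rv g + X g n) mod int p ^ n"
          by (simp add: Zp_simps[OF prime_p] vadd_def vsmult_def zvec_def zi_def[OF prime_p] mod_simps)
        then have e: "int p ^ n dvd (a g - l n * rv g) - trunc n X g" by (simp add: mod_eq_dvd_iff trunc_def diff_diff_eq)
        show "UF.dv (snd g) n (a g - l n * rv g)"
          unfolding UF.dv_def
        proof (intro allI impI)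
          fix c assume c: "(\<rho> ^^ c) (snd g) < n"
          have "c + 1 \<le> n" using UF.pow_ge_add[OF G_pos[OF g], of c] G_pos[OF g] c by linarith
          then have "int p ^ (c + 1) dvd int p ^ n" by (rule le_imp_power_dvd)
          then have "int p ^ (c + 1) dvd (a g - l n * rv g) - trunc n X g" using e by (rule dvd_trans)
          moreover have "int p ^ (c + 1) dvd trunc n X g" using trunc_dv[OF X(1) order_refl g] c unfolding UF.dv_def by blast
          ultimately have "int p ^ (c + 1) dvd ((a g - l n * rv g) - trunc n X g) + trunc n X g" by (rule dvd_add)
          then show "int p ^ (c + 1) dvd a g - l n * rv g" by simp
        qed
      qed
      then show ?thesis by blast
    qed
  qed
  have "F rv = F (\<lambda>g. 0)" by (simp only: F_def cls_rv)
  then have "F rv = 1" using S.F_zero by simp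
  then show ?thesis unfolding UF.presented_def using S.gen_system_axioms spans rel by blast
qed

text \<open>\<open>F\<close> is extended to \<open>p\<close>-adic exponents by completeness.
  Generation modulo every \<open>Uf n\<close> makes the extension surjective on each filtration
  step, and the description of relations makes its kernel the \<open>p\<close>-adic multiples of
  \<open>rv\<close>; it therefore factors through the quotient in both directions.\<close>

lemma iso_of_presented:
  assumes "UF.presented f A"
  shows "filt_isomorphic Z (U_mod absv) Qm"
proof -
  obtain F where gs: "gen_system \<rho> Uf p G snd F" and
    sr: "\<forall>n. gen_system.spans \<rho> Uf p G snd F n \<and> gen_system.relations \<rho> Uf p G snd F n rv" and Frv: "F rv = 1"
    using assms unfolding UF.presented_def by blast
  interpret S: gen_system \<rho> Uf p G snd F by (rule gs)
  have sp: "S.spans n" and rel: "S.relations n rv" for n using sr by blast+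
  have Fdvd: "F a / F b \<in> Uf n" if d: "\<And>g. g \<in> G \<Longrightarrow> int p ^ n dvd a g - b g" for a b n
    unfolding S.F_diff[symmetric]
  proof (rule S.F_fil)
    fix g assume g: "g \<in> G"
    have "n \<le> (\<rho> ^^ n) (snd g)" using UF.pow_ge_add[OF G_pos[OF g], of n] by linarith
    then show "UF.dv (snd g) n (a g - b g)" by (rule UF.dv_antimono[OF _ UF.dv_pow[OF d[OF g]]])
  qed
  have tdvd: "int p ^ n dvd X g k - X g n" if "X \<in> ZV" "g \<in> G" "n \<le> k" for X n k g
  proof -
    have x: "X g \<in> carrier Z" using that by (simp add: ZV_def)
    show ?thesis using Zp_coherent[OF prime_p x that(3)] Zp_mod_self[OF prime_p x, of n] by (simp add: mod_eq_dvd_iff[symmetric])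
  qed
  \<comment> \<open>The limit of the values of \<open>F\<close> at the truncations; it is unique
    because the filtration is separated.\<close>
  define \<Phi> where "\<Phi> X = (SOME y. \<forall>n. y / F (trunc n X) \<in> Uf n)" for X
  have \<Phi>: "\<Phi> X / F (trunc n X) \<in> Uf n" if X: "X \<in> ZV" for X n
  proof -
    have "\<exists>y. \<forall>n. y / F (trunc n X) \<in> Uf n"
      by (rule Uf_complete[OF S.F_U0 Fdvd]) (use tdvd[OF X] in \<open>auto simp: trunc_def\<close>)
    then have "\<forall>n. \<Phi> X / F (trunc n X) \<in> Uf n" unfolding \<Phi>_def by (rule someI_ex)
    then show ?thesis by blast
  qed
  have \<Phi>_U0: "\<Phi> X \<in> Uf 0" if "X \<in> ZV" for X
    by (rule UF.U_divide_cancel[OF \<Phi>[OF that] S.F_U0])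
  have \<Phi>_eqI: "\<Phi> X = y" if X: "X \<in> ZV" and a: "\<And>n g. g \<in> G \<Longrightarrow> int p ^ n dvd a n g - X g n"
    and y: "\<And>n. y / F (a n) \<in> Uf n" for X y and a :: "nat \<Rightarrow> nat \<times> nat \<Rightarrow> int"
  proof -
    have "F (a n) / F (trunc n X) \<in> Uf n" for n by (rule Fdvd) (simp add: trunc_def a)
    then have "y / F (trunc n X) \<in> Uf n" for n using UF.U_divide_trans[OF y] by blast
    then have "\<Phi> X / y \<in> Uf n" for n using UF.U_divide_trans[OF \<Phi>[OF X] UF.U_divide_sym] by blast
    then have "\<Phi> X / y = 1" by (rule Uf_separated)
    then show ?thesis by (metis div_0 divide_eq_1_iff zero_neq_one)
  qed
  have \<Phi>_add: "\<Phi> (vadd X Y) = \<Phi> X * \<Phi> Y" if X: "X \<in> ZV" and Y: "Y \<in> ZV" for X Y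
  proof (rule \<Phi>_eqI[OF ZV_closed(1)[OF X Y]])
    show "int p ^ n dvd (trunc n X g + trunc n Y g) - vadd X Y g n" for n g
      by (simp add: trunc_def vadd_def Zp_simps[OF prime_p] mod_eq_dvd_iff[symmetric])
    show "\<Phi> X * \<Phi> Y / F (\<lambda>g. trunc n X g + trunc n Y g) \<in> Uf n" for n
      using UF.U_mult[OF \<Phi>[OF X] \<Phi>[OF Y], of n] by (simp add: S.F_add)
  qed
  have \<Phi>_smult: "unit_pow absv c (\<Phi> X) = \<Phi> (vsmult c X)" if c: "c \<in> carrier Z" and X: "X \<in> ZV" for c X
  proof (rule unit_pow_eqI[OF \<Phi>_U0[OF X]])
    fix n
    have 1: "\<Phi> (vsmult c X) / F (trunc n (vsmult c X)) \<in> Uf n" by (rule \<Phi>[OF ZV_closed(2)[OF c X]])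
    have 2: "F (trunc n (vsmult c X)) / F (\<lambda>g. c n * trunc n X g) \<in> Uf n"
      by (rule Fdvd) (simp add: trunc_def vsmult_def Zp_simps[OF prime_p] mod_eq_dvd_iff[symmetric])
    have "F (\<lambda>g. c n * trunc n X g) = F (trunc n X) ^ nat (c n)"
      using S.F_nat_scale[of "nat (c n)" "trunc n X"] Zp_range[OF prime_p c, of n] by simp
    then have "F (\<lambda>g. c n * trunc n X g) / \<Phi> X ^ nat (c n) \<in> Uf n"
      using UF.U_power[OF UF.U_divide_sym[OF \<Phi>[OF X]], of n "nat (c n)"] by (simp add: power_divide)
    then show "\<Phi> (vsmult c X) / \<Phi> X ^ nat (c n) \<in> Uf n" by (rule UF.U_divide_trans[OF UF.U_divide_trans[OF 1 2]])
  qed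
  have \<Phi>_Fil: "\<Phi> X \<in> Uf k" if X: "zFil k X" for X k
  proof -
    have "F (trunc k X) \<in> Uf k" by (rule S.F_fil) (rule trunc_dv[OF X order_refl])
    moreover have "\<Phi> X / F (trunc k X) \<in> Uf k" using X by (intro \<Phi>) (simp add: zFil_def)
    ultimately show ?thesis by (rule UF.U_divide_cancel[rotated])
  qed
  \<comment> \<open>Weight at least \<open>NN r\<close> forces divisibility by \<open>p^r\<close> in
    every coordinate of \<open>gens f \<rho>\<close>; finiteness of this set gives a common
    bound.\<close>
  define NN where "NN r = Max (insert r ((\<lambda>g. Suc ((\<rho> ^^ r) (snd g))) ` G))" for r
  have NN: "r \<le> NN r" and NN': "g \<in> G \<Longrightarrow> (\<rho> ^^ r) (snd g) < NN r" for r g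
    unfolding NN_def using finG by (auto simp: less_eq_Suc_le intro!: Max_ge)
  have vFil_dvd: "int p ^ r dvd a g" if "S.vFil k a" "g \<in> G" "NN r \<le> k" for k a g r
  proof -
    have "UF.dv (snd g) k (a g)" using that by (simp add: S.vFil_def)
    moreover have "(\<rho> ^^ r) (snd g) < k" using NN'[OF that(2), of r] that(3) by linarith
    ultimately have "int p ^ (r + 1) dvd a g" unfolding UF.dv_def by blast
    then show ?thesis by (rule power_le_dvd) simp
  qed
  have \<Phi>_surj: "\<exists>X. zFil k X \<and> \<Phi> X = u" if u: "u \<in> Uf k" for u k
  proof -
    have "\<exists>a. \<forall>n. (S.vFil k (a n) \<and> u / F (a n) \<in> Uf (k + n)) \<and> S.vFil (k + n) (\<lambda>g. a (Suc n) g - a n g)"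
    proof (rule dependent_nat_choice)
      show "\<exists>a. S.vFil k a \<and> u / F a \<in> Uf (k + 0)" using sp[of "k + 0"] u unfolding S.spans_def by blast
    next
      fix a n assume a: "S.vFil k a \<and> u / F a \<in> Uf (k + n)"
      obtain d where d: "S.vFil (k + n) d" "u / F a / F d \<in> Uf (k + Suc n)"
        using sp[of "k + Suc n"] a unfolding S.spans_def by blast
      have "S.vFil k (\<lambda>g. a g + d g)" using a S.vFil_antimono[OF _ d(1), of k] by (intro S.vFil_add) auto
      moreover have "u / F (\<lambda>g. a g + d g) \<in> Uf (k + Suc n)" using d(2) by (simp add: S.F_add)
      moreover have "S.vFil (k + n) (\<lambda>g. (a g + d g) - a g)" using d(1) by simp
      ultimately show "\<exists>b. (S.vFil k b \<and> u / F b \<in> Uf (k + Suc n)) \<and> S.vFil (k + n) (\<lambda>g. b g - a g)" by blast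
    qed
    then obtain a where va: "\<And>n. S.vFil k (a n)" and ua: "\<And>n. u / F (a n) \<in> Uf (k + n)"
      and ad: "\<And>n. S.vFil (k + n) (\<lambda>g. a (Suc n) g - a n g)" by blast
    have stab: "int p ^ r dvd a n g - a (NN r) g" if "NN r \<le> n" "g \<in> G" for r n g
      using that(1)
    proof (induction n rule: dec_induct)
      case (step n)
      have "int p ^ r dvd a (Suc n) g - a n g" by (rule vFil_dvd[OF ad that(2)]) (use step in simp)
      from dvd_add[OF this step(3)] show ?case by simp
    qed simp
    define X where "X g r = a (NN r) g mod int p ^ r" for g r
    have "X g \<in> carrier Z" if g: "g \<in> G" for g
    proof -
      have "a (NN (Suc r)) g mod int p ^ r = a (NN r) g mod int p ^ r" for r
      proof -
        define K where "K = max (NN r) (NN (Suc r))"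
        have 1: "int p ^ r dvd a K g - a (NN r) g" by (rule stab[OF _ g]) (simp add: K_def)
        have "int p ^ Suc r dvd a K g - a (NN (Suc r)) g" by (rule stab[OF _ g]) (simp add: K_def)
        then have "int p ^ r dvd a K g - a (NN (Suc r)) g" by (rule power_le_dvd) simp
        from dvd_diff[OF 1 this] show ?thesis by (simp add: mod_eq_dvd_iff)
      qed
      then show ?thesis unfolding X_def by (rule ZpI_mod[OF prime_p])
    qed
    then have XZ: "X \<in> ZV" by (simp add: ZV_def)
    have "zFil k X"
      unfolding zFil_def
    proof (intro conjI ballI allI impI XZ)
      fix g c assume "g \<in> G" "(\<rho> ^^ c) (snd g) < k"
      then have "int p ^ (c + 1) dvd a (NN (c + 1)) g" using va[of "NN (c + 1)"] unfolding S.vFil_def UF.dv_def by blast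
      then show "X g (c + 1) = 0" unfolding X_def by (rule dvd_imp_mod_0)
    qed
    moreover have "\<Phi> X = u"
    proof (rule \<Phi>_eqI[OF XZ, of "\<lambda>n. a (NN n)"])
      show "int p ^ n dvd a (NN n) g - X g n" for n g by (simp add: X_def mod_eq_dvd_iff[symmetric])
      show "u / F (a (NN n)) \<in> Uf n" for n
        using ua[of "NN n"] Uf_antimono[of n "k + NN n"] NN[of n] by (auto intro: trans_le_add2)
    qed
    ultimately show ?thesis by blast
  qed
  have \<Phi>_kernel: "\<exists>l\<in>carrier Z. \<forall>g\<in>G. X g = vsmult l (zvec rv) g" if X: "X \<in> ZV" and X1: "\<Phi> X = 1" for X
  proof -
    have "\<exists>l. \<forall>g\<in>G. int p ^ r dvd X g r - l * rv g" for r
    proof -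
      have "F (trunc (NN r) X) \<in> Uf (NN r)" using UF.U_inverse[OF \<Phi>[OF X, of "NN r"]] X1 by simp
      then obtain l where l: "S.vFil (NN r) (\<lambda>g. trunc (NN r) X g - l * rv g)" using rel unfolding S.relations_def by blast
      have "int p ^ r dvd X g r - l * rv g" if g: "g \<in> G" for g
      proof -
        have "int p ^ r dvd X g (NN r) - l * rv g" using vFil_dvd[OF l g order_refl] by (simp add: trunc_def)
        from dvd_diff[OF this tdvd[OF X g NN]] show ?thesis by simp
      qed
      then show ?thesis by blast
    qed
    then obtain L where L: "\<And>r g. g \<in> G \<Longrightarrow> int p ^ r dvd X g r - L r * rv g" by metis
    \<comment> \<open>The relation determines its multiplier only after division by its coefficient
      \<open>p^b\<close> at one chosen weight, so the residue modulo \<open>p^r\<close> is taken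
      from \<open>L (b + r)\<close>. If there is no coefficient the relation is zero and the
      multiplier 0 serves.\<close>
    define b where "b = (if jump_I \<rho> A = {} then 0 else jump_beta A (SOME i. i \<in> jump_I \<rho> A))"
    define l where "l r = (if jump_I \<rho> A = {} then 0 else L (b + r)) mod int p ^ r" for r
    have lZ: "l \<in> carrier Z"
      unfolding l_def
    proof (rule ZpI_mod[OF prime_p])
      fix r
      show "(if jump_I \<rho> A = {} then 0 else L (b + Suc r)) mod int p ^ r = (if jump_I \<rho> A = {} then 0 else L (b + r)) mod int p ^ r"
      proof (cases "jump_I \<rho> A = {}")
        case False
        define i where "i = (SOME i. i \<in> jump_I \<rho> A)"
        have i: "i \<in> jump_I \<rho> A" unfolding i_def using False by (simp add: some_in_eq)
        then have g: "(f - 1, i) \<in> G" using IT by (auto simp: gens_def)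
        have rvi: "rv (f - 1, i) = int p ^ b" using i False by (simp add: rel_vec_def b_def i_def)
        have "int p ^ (b + Suc r) dvd X (f - 1, i) (b + Suc r) - L (b + Suc r) * int p ^ b" using L[OF g] unfolding rvi .
        then have 1: "int p ^ (b + r) dvd X (f - 1, i) (b + Suc r) - L (b + Suc r) * int p ^ b" by (rule power_le_dvd) simp
        have 2: "int p ^ (b + r) dvd X (f - 1, i) (b + r) - L (b + r) * int p ^ b" using L[OF g] unfolding rvi .
        have 3: "int p ^ (b + r) dvd X (f - 1, i) (b + Suc r) - X (f - 1, i) (b + r)" by (rule tdvd[OF X g]) simp
        have "int p ^ (b + r) dvd (X (f - 1, i) (b + Suc r) - X (f - 1, i) (b + r)) - (X (f - 1, i) (b + Suc r) - L (b + Suc r) * int p ^ b)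
           + (X (f - 1, i) (b + r) - L (b + r) * int p ^ b)"
          by (rule dvd_add[OF dvd_diff[OF 3 1] 2])
        then have "int p ^ b * int p ^ r dvd int p ^ b * (L (b + Suc r) - L (b + r))" by (simp add: power_add algebra_simps)
        then have "int p ^ r dvd L (b + Suc r) - L (b + r)" using prime_gt_0_nat[OF prime_p] by simp
        then show ?thesis using False by (simp add: mod_eq_dvd_iff)
      qed simp
    qed
    have "X g = vsmult l (zvec rv) g" if g: "g \<in> G" for g
    proof
      fix r
      have Xg: "X g \<in> carrier Z" using X g by (simp add: ZV_def)
      have "int p ^ (b + r) dvd X g (b + r) - L (b + r) * rv g" by (rule L[OF g])
      then have "int p ^ r dvd X g (b + r) - L (b + r) * rv g" by (rule power_le_dvd) simp
      then have "X g (b + r) mod int p ^ r = L (b + r) * rv g mod int p ^ r" by (simp add: mod_eq_dvd_iff)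
      moreover have "X g (b + r) mod int p ^ r = X g r" by (rule Zp_coherent[OF prime_p Xg]) simp
      moreover have "jump_I \<rho> A = {} \<Longrightarrow> rv g = 0" by (simp add: rel_vec_def split_beta)
      ultimately show "X g r = vsmult l (zvec rv) g r"
        by (simp add: vsmult_def zvec_def Zp_simps[OF prime_p] zi_def[OF prime_p] l_def mod_simps)
    qed
    then show ?thesis using lZ by blast
  qed
  have \<Phi>_rel: "\<Phi> (vsmult l (zvec rv)) = 1" if l: "l \<in> carrier Z" for l
  proof (rule \<Phi>_eqI[OF ZV_closed(2)[OF l ZV_closed(3)]])
    show "int p ^ n dvd l n * rv g - vsmult l (zvec rv) g n" for n g
      by (simp add: vsmult_def zvec_def Zp_simps[OF prime_p] zi_def[OF prime_p] mod_eq_dvd_iff[symmetric] mod_simps)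
    show "1 / F (\<lambda>g. l n * rv g) \<in> Uf n" for n unfolding S.F_scale Frv by (simp add: UF.U_one)
  qed
  have \<Phi>_cong: "\<Phi> X = \<Phi> Y" if X: "X \<in> ZV" and Y: "Y \<in> ZV" and e: "\<And>g. g \<in> G \<Longrightarrow> X g = Y g" for X Y
    by (rule \<Phi>_eqI[OF X _ \<Phi>[OF Y]]) (simp add: trunc_def e)
  have \<Phi>_cls: "\<Phi> X = \<Phi> Y \<longleftrightarrow> cls X = cls Y" if X: "X \<in> ZV" and Y: "Y \<in> ZV" for X Y
  proof
    assume e: "\<Phi> X = \<Phi> Y"
    define W where "W g = X g \<oplus>\<^bsub>Z\<^esub> zneg p (Y g)" for g
    have W: "W \<in> ZV" using X Y Zp_add_closed[OF prime_p] zneg_closed[OF prime_p] by (simp only: ZV_def W_def mem_Collect_eq) blast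
    have XW: "X g = vadd W Y g" if "g \<in> G" for g
    proof
      fix n
      have "X g n mod int p ^ n = X g n" using X that Zp_mod_self[OF prime_p, of "X g"] by (simp add: ZV_def)
      then show "X g n = vadd W Y g n" by (simp add: W_def vadd_def Zp_simps[OF prime_p] zneg_def[OF prime_p] mod_simps)
    qed
    have "\<Phi> X = \<Phi> W * \<Phi> Y" using \<Phi>_cong[OF X ZV_closed(1)[OF W Y] XW] \<Phi>_add[OF W Y] by simp
    then have "\<Phi> W = 1" using e UF.U_nonzero[OF \<Phi>_U0[OF Y]] by simp
    then obtain l where l: "l \<in> carrier Z" "\<forall>g\<in>G. W g = vsmult l (zvec rv) g" using \<Phi>_kernel[OF W] by blast
    have "X g = vadd (vsmult l (zvec rv)) Y g" if "g \<in> G" for g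
      unfolding XW[OF that] using l(2) that by (simp only: vadd_def)
    then show "cls X = cls Y" unfolding cls_eq_iff[OF X Y] using l(1) by blast
  next
    assume "cls X = cls Y"
    then obtain l where l: "l \<in> carrier Z" "\<forall>g\<in>G. X g = vadd (vsmult l (zvec rv)) Y g" unfolding cls_eq_iff[OF X Y] by blast
    have V: "vsmult l (zvec rv) \<in> ZV" by (rule ZV_closed(2)[OF l(1) ZV_closed(3)])
    show "\<Phi> X = \<Phi> Y" using \<Phi>_cong[OF X ZV_closed(1)[OF V Y]] l(2) \<Phi>_add[OF V Y] \<Phi>_rel[OF l(1)] by simp
  qed
  define \<phi> where "\<phi> u = cls (SOME X. X \<in> ZV \<and> \<Phi> X = u)" for u
  define \<psi> where "\<psi> w = \<Phi> (SOME X. X \<in> ZV \<and> cls X = w)" for w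
  have \<phi>: "\<phi> (\<Phi> X) = cls X" if X: "X \<in> ZV" for X
  proof -
    have "(SOME Y. Y \<in> ZV \<and> \<Phi> Y = \<Phi> X) \<in> ZV \<and> \<Phi> (SOME Y. Y \<in> ZV \<and> \<Phi> Y = \<Phi> X) = \<Phi> X"
      by (rule someI[of "\<lambda>Y. Y \<in> ZV \<and> \<Phi> Y = \<Phi> X" X]) (simp add: X)
    then show ?thesis unfolding \<phi>_def using \<Phi>_cls[OF _ X] by blast
  qed
  have \<psi>: "\<psi> (cls X) = \<Phi> X" if X: "X \<in> ZV" for X
  proof -
    have "(SOME Y. Y \<in> ZV \<and> cls Y = cls X) \<in> ZV \<and> cls (SOME Y. Y \<in> ZV \<and> cls Y = cls X) = cls X"
      by (rule someI[of "\<lambda>Y. Y \<in> ZV \<and> cls Y = cls X" X]) (simp add: X)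
    then show ?thesis unfolding \<psi>_def using \<Phi>_cls[OF _ X] by blast
  qed
  have U: "carrier (U_mod absv) = Uf 1" "x \<oplus>\<^bsub>U_mod absv\<^esub> y = x * y" "c \<odot>\<^bsub>U_mod absv\<^esub> x = unit_pow absv c x"
    "1 \<le> k \<Longrightarrow> Fil (U_mod absv) k = Uf k" for x y c k
    by (simp_all add: U_mod_def Uf_pos)
  have exU: "\<exists>X\<in>ZV. u = \<Phi> X" if "u \<in> Uf 1" for u using \<Phi>_surj[OF that] zFil_1 by auto
  have zZ: "zFil k X \<Longrightarrow> X \<in> ZV" for k X by (simp add: zFil_def)
  have U1: "X \<in> ZV \<Longrightarrow> \<Phi> X \<in> Uf 1" for X using \<Phi>_Fil[of 1 X] zFil_1 by simp
  have h\<phi>: "\<phi> \<in> filt_hom Z (U_mod absv) Qm"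
    unfolding filt_hom_def mem_Collect_eq
  proof (intro conjI ballI allI impI subsetI Pi_I; (unfold U(1-3))?)
    fix u assume "u \<in> Uf 1"
    then obtain X where X: "X \<in> ZV" "u = \<Phi> X" using exU by blast
    show "\<phi> u \<in> carrier Qm" unfolding X(2) \<phi>[OF X(1)] by (rule cls_closed[OF X(1)])
  next
    fix u v assume "u \<in> Uf 1" "v \<in> Uf 1"
    then obtain X Y where X: "X \<in> ZV" "u = \<Phi> X" and Y: "Y \<in> ZV" "v = \<Phi> Y" using exU by meson
    show "\<phi> (u * v) = \<phi> u \<oplus>\<^bsub>Qm\<^esub> \<phi> v"
      unfolding X(2) Y(2) \<Phi>_add[OF X(1) Y(1), symmetric] \<phi>[OF X(1)] \<phi>[OF Y(1)] \<phi>[OF ZV_closed(1)[OF X(1) Y(1)]] by (rule cls_add[OF X(1) Y(1)])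
  next
    fix c u assume c: "c \<in> carrier Z" and "u \<in> Uf 1"
    then obtain X where X: "X \<in> ZV" "u = \<Phi> X" using exU by blast
    show "\<phi> (unit_pow absv c u) = c \<odot>\<^bsub>Qm\<^esub> \<phi> u"
      unfolding X(2) \<Phi>_smult[OF c X(1)] \<phi>[OF X(1)] \<phi>[OF ZV_closed(2)[OF c X(1)]] by (rule cls_smult[OF c X(1)])
  next
    fix k w assume k: "1 \<le> k" and "w \<in> \<phi> ` Fil (U_mod absv) k"
    then obtain u where "u \<in> Uf k" "w = \<phi> u" using U(4) by blast
    then obtain X where X: "zFil k X" "w = \<phi> (\<Phi> X)" using \<Phi>_surj by blast
    show "w \<in> Fil Qm k" unfolding X(2) \<phi>[OF zZ[OF X(1)]] cls_Fil using X(1) by blast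
  qed
  have h\<psi>: "\<psi> \<in> filt_hom Z Qm (U_mod absv)"
    unfolding filt_hom_def mem_Collect_eq
  proof (intro conjI ballI allI impI subsetI Pi_I; (unfold U(1-3))?)
    fix w assume "w \<in> carrier Qm"
    then obtain X where X: "X \<in> ZV" "w = cls X" using cls_surj by blast
    show "\<psi> w \<in> Uf 1" unfolding X(2) \<psi>[OF X(1)] by (rule U1[OF X(1)])
  next
    fix u v assume "u \<in> carrier Qm" "v \<in> carrier Qm"
    then obtain X Y where X: "X \<in> ZV" "u = cls X" and Y: "Y \<in> ZV" "v = cls Y" using cls_surj by meson
    show "\<psi> (u \<oplus>\<^bsub>Qm\<^esub> v) = \<psi> u * \<psi> v"
      unfolding X(2) Y(2) cls_add[OF X(1) Y(1), symmetric] \<psi>[OF X(1)] \<psi>[OF Y(1)] \<psi>[OF ZV_closed(1)[OF X(1) Y(1)]] by (rule \<Phi>_add[OF X(1) Y(1)])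
  next
    fix c u assume c: "c \<in> carrier Z" and "u \<in> carrier Qm"
    then obtain X where X: "X \<in> ZV" "u = cls X" using cls_surj by blast
    show "\<psi> (c \<odot>\<^bsub>Qm\<^esub> u) = unit_pow absv c (\<psi> u)"
      unfolding X(2) cls_smult[OF c X(1), symmetric] \<psi>[OF X(1)] \<psi>[OF ZV_closed(2)[OF c X(1)]] by (rule \<Phi>_smult[OF c X(1), symmetric])
  next
    fix k u assume k: "1 \<le> k" and "u \<in> \<psi> ` Fil Qm k"
    then obtain w where w: "w \<in> Fil Qm k" "u = \<psi> w" by blast
    then obtain X where X: "zFil k X" "u = \<psi> (cls X)" using iffD1[OF cls_Fil w(1)] by blast
    show "u \<in> Fil (U_mod absv) k" unfolding X(2) \<psi>[OF zZ[OF X(1)]] U(4)[OF k] by (rule \<Phi>_Fil[OF X(1)])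
  qed
  have "\<psi> (\<phi> u) = u" if u: "u \<in> carrier (U_mod absv)" for u
  proof -
    obtain X where X: "X \<in> ZV" "u = \<Phi> X" using exU u unfolding U(1) by blast
    show ?thesis unfolding X(2) \<phi>[OF X(1)] by (rule \<psi>[OF X(1)])
  qed
  moreover have "\<phi> (\<psi> w) = w" if w: "w \<in> carrier Qm" for w
  proof -
    obtain X where X: "X \<in> ZV" "w = cls X" using cls_surj[OF w] by blast
    show ?thesis unfolding X(2) \<psi>[OF X(1)] by (rule \<phi>[OF X(1)])
  qed
  ultimately show ?thesis unfolding filt_isomorphic_def using h\<phi> h\<psi> by blast
qed

end

end

theorem theorem6p2:
  fixes absv :: "'a::field \<Rightarrow> real" and p f :: nat
  assumes "local_field absv"
    and "prime p"
    and "add_pow (residue_field absv) p \<one>\<^bsub>residue_field absv\<^esub> = \<zero>\<^bsub>residue_field absv\<^esub>"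
    and "card (carrier (residue_field absv)) = p ^ f"
  shows "((mu p :: 'a set) = {1} \<longrightarrow> jump_sets_of_field absv p = Jump (rho_K absv p)) \<and>
         ((mu p :: 'a set) \<noteq> {1} \<longrightarrow>
            jump_sets_of_field absv p =
              {A \<in> Jump_star (rho_K absv p).
                 compatible (rho_K absv p) f p A (jump_set_K absv p f)})"
proof -
  interpret residual_field absv p f
    by (intro residual_field.intro residual_field_axioms.intro assms)
  show ?thesis
  proof (intro conjI impI)
    assume "(mu p :: 'a set) = {1}"
    then interpret W: unit_tower "rho_K absv p" Uf p f "{}" by (rule mu_trivial_tower)
    show "jump_sets_of_field absv p = Jump (rho_K absv p)"
      unfolding jump_sets_eq by (rule W.ijumps_trivial[OF refl])
  next
    assume "(mu p :: 'a set) \<noteq> {1}"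
    then obtain e1 \<zeta> where "unit_tower_mu (rho_K absv p) Uf p f e1 \<zeta>" using mu_nontrivial_tower by blast
    then interpret W: unit_tower_mu "rho_K absv p" Uf p f e1 \<zeta> .
    let ?iso = "\<lambda>A. filt_isomorphic (Zp p) (U_mod absv)
          (filt_sum
            (filt_prod {..<f - 1} (\<lambda>_. M_rho p (rho_K absv p)))
            (filt_quot (M_rho_star p (rho_K absv p))
              ((\<lambda>a. a \<odot>\<^bsub>M_rho_star p (rho_K absv p)\<^esub> v_vec p (rho_K absv p) A) ` carrier (Zp p))))"
    have iso_iff: "?iso A \<longleftrightarrow> UF.presented f A" if A: "A \<in> Jump_star (rho_K absv p)" for A
    proof -
      have "jump_I (rho_K absv p) A \<subseteq> T_star (rho_K absv p)"
        using A by (simp add: Jump_star_def jump_sets_within_def jump_I_def)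
      then show ?thesis using presented_of_iso[OF W.fin_T] iso_of_presented[OF W.fin_T] by blast
    qed
    \<comment> \<open>Unique existence is what gives the definite description in
      \<open>jump_set_K\<close> its intended value.\<close>
    have "\<exists>!A. A \<in> Jump_star (rho_K absv p) \<and> ?iso A"
      using W.presented_exists W.presented_unique iso_iff by blast
    then have K: "jump_set_K absv p f \<in> Jump_star (rho_K absv p) \<and> ?iso (jump_set_K absv p f)"
      unfolding jump_set_K_def by (rule theI')
    then have "UF.presented f (jump_set_K absv p f)" using iso_iff by blast
    with K show "jump_sets_of_field absv p =
              {A \<in> Jump_star (rho_K absv p). compatible (rho_K absv p) f p A (jump_set_K absv p f)}"
      unfolding jump_sets_eq by (intro W.ijumps_presented) auto
  qed
qed

end
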